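(* Let $M$ be a complete degenerate space-like stationary surface in $\mathbb{R}^{3,1}$ which is not an affine plane, and let $(\psi_1,\psi_2)$ be the Gauss map of $M$. Assume $\psi_i$ omits exactly $q_i$ points of $\mathbb{C}^*=\mathbb{C}\cup\{\infty\}$ ($i=1,2$). Then: \begin{itemize} \item If $M$ is $2$-degenerate, then $q_i\in\{1,2\}$ for the nonconstant $\psi_i$. \item If $M$ is a nonflat degenerate stationary surface of hyperbolic type, then $q_1=q_2=2$. \item If $M$ is a minimal surface in $\mathbb{R}^3$ or a degenerate stationary surface of elliptic type, then $q_1=q_2\in\{0,1,2,3,4\}$. \item If $M$ is a degenerate stationary surface of parabolic type, then $q_1=q_2\in\{1,2,3\}$. \end{itemize}
   Context: $\mathbb{R}^{3,1}$ is $\mathbb{R}^4$ with the Minkowski inner product $\langle u,v\rangle=u_1v_1+u_2v_2+u_3v_3-u_4v_4$, extended complex-bilinearly to $\mathbb{C}^4$. A space-like surface is a connected oriented surface with an immersion $\mathbf{x}:M\to\mathbb{R}^{3,1}$ whose induced metric is positive definite; it is stationary if its mean curvature vector field vanishes identically, complete if the induced metric is complete, nonflat if its Gauss curvature is not identically $0$. Let $Q_{1,1}=\{[z]\in\mathbb{CP}^3:\langle z,z\rangle=0\}$, $Q_{1,1}^+=\{[z]\in Q_{1,1}:\langle z,\bar z\rangle>0\}$, $\mathbb{C}^*=\mathbb{C}\cup\{\infty\}$ (with $\overline{\infty}=\infty$). There is a biholomorphism $\Psi:Q_{1,1}\to\mathbb{C}^*\times\mathbb{C}^*$ whose inverse is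 $(w_1,w_2)\mapsto[(w_1+w_2,-i(w_1-w_2),1-w_1w_2,1+w_1w_2)]$ for $w_1,w_2\in\mathbb{C}$, $(w_1,\infty)\mapsto[(1,i,-w_1,w_1)]$, $(\infty,w_2)\mapsto[(1,-i,-w_2,w_2)]$, $(\infty,\infty)\mapsto[(0,0,-1,1)]$; it maps $Q_{1,1}^+$ onto $\{w_2\neq\bar w_1\}$. For a space-like stationary surface with local complex coordinate $z=u+iv$ from oriented isothermal parameters, the Gauss map sends $p$ to $[\mathbf{x}_z]\in Q_{1,1}^+$, and $(\psi_1,\psi_2):=\Psi([\mathbf{x}_z])$; both are holomorphic maps $M\to\mathbb{C}^*$. For $[A]\in\mathbb{CP}^3$, the hyperplane $H_A$ is $\{[z]\in Q_{1,1}:\langle A,z\rangle=0\}$. A space-like stationary surface is degenerate if its Gauss image lies in some $H_A$, and $2$-degenerate if its Gauss image lies in the intersection of two distinct hyperplanes. $[A]$ is totally real if $[A]=[\mathbf{u}_0]$ for a real vector $\mathbf{u}_0$; otherwise $\mathrm{Re}\,A,\mathrm{Im}\,A$ span a real $2$-plane $P_A$, and $[A]$ is of hyperbolic, elliptic, parabolic type according to whether $P_A$ is space-like (induced inner product positive definite), time-like (induced inner product Lorentzian), or light-like (induced inner product degenerate). $M$ is a degenerate stationary surface of hyperbolic (elliptic, parabolic) type if its Gauss image lies in $H_A$ with $[A]$ of that type. A minimal surface in $\mathbb{R}^3$ is regarded as a stationary surface of $\mathbb{R}^{3,1}$ via $\mathbb{R}^3=\{x_4=0\}$ (up to congruence in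 $\mathbb{R}^{3,1}$). *)

theory Defs
  imports "HOL-Analysis.Analysis" "HOL-Library.Extended_Nat"
begin

subsection \<open>Minkowski space and the quadric\<close>

definition mink :: "real^4 \<Rightarrow> real^4 \<Rightarrow> real" where
  "mink u v = u$1 * v$1 + u$2 * v$2 + u$3 * v$3 - u$4 * v$4"

definition cmink :: "complex^4 \<Rightarrow> complex^4 \<Rightarrow> complex" where
  "cmink u v = u$1 * v$1 + u$2 * v$2 + u$3 * v$3 - u$4 * v$4"

definition cvec :: "real^4 \<Rightarrow> complex^4" where
  "cvec u = (\<chi> k. complex_of_real (u$k))"

definition re_vec :: "complex^4 \<Rightarrow> real^4" where
  "re_vec A = (\<chi> k. Re (A$k))"

definition im_vec :: "complex^4 \<Rightarrow> real^4" where
  "im_vec A = (\<chi> k. Im (A$k))"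

text \<open>The point \<open>[z]\<close> of complex projective 3-space is the punctured complex line through
  \<open>z \<noteq> 0\<close>.\<close>

type_synonym cp3 = "(complex^4) set"

definition proj_pt :: "complex^4 \<Rightarrow> cp3" where
  "proj_pt z = {c *s z | c. c \<noteq> 0}"

definition quadric :: "cp3 set" where
  "quadric = {proj_pt z | z. z \<noteq> 0 \<and> cmink z z = 0}"

definition hyperplane :: "complex^4 \<Rightarrow> cp3 set" where
  "hyperplane A = {L \<in> quadric. \<forall>z\<in>L. cmink A z = 0}"

definition vec4 :: "complex \<Rightarrow> complex \<Rightarrow> complex \<Rightarrow> complex \<Rightarrow> complex^4" where
  "vec4 a b c d = (\<chi> k. if k = 1 then a else if k = 2 then b else if k = 3 then c else d)"

text \<open>The extended plane is \<^typ>\<open>complex option\<close>, with \<^const>\<open>None\<close> as the point at infinity.\<close>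

type_synonym csphere = "complex option"

fun Psi_rep :: "csphere \<times> csphere \<Rightarrow> complex^4" where
  "Psi_rep (Some w1, Some w2) = vec4 (w1 + w2) (- \<i> * (w1 - w2)) (1 - w1 * w2) (1 + w1 * w2)"
| "Psi_rep (Some w1, None) = vec4 1 \<i> (- w1) w1"
| "Psi_rep (None, Some w2) = vec4 1 (- \<i>) (- w2) w2"
| "Psi_rep (None, None) = vec4 0 0 (- 1) 1"

definition Psi_inv :: "csphere \<times> csphere \<Rightarrow> cp3" where
  "Psi_inv w = proj_pt (Psi_rep w)"

definition Psi :: "cp3 \<Rightarrow> csphere \<times> csphere" where
  "Psi = inv Psi_inv"

subsection \<open>Types of hyperplanes\<close>

definition totally_real :: "complex^4 \<Rightarrow> bool" where
  "totally_real A \<longleftrightarrow> (\<exists>u. u \<noteq> 0 \<and> proj_pt A = proj_pt (cvec u))"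

definition plane_of :: "complex^4 \<Rightarrow> (real^4) set" where
  "plane_of A = span {re_vec A, im_vec A}"

definition hyperbolic_type :: "complex^4 \<Rightarrow> bool" where
  "hyperbolic_type A \<longleftrightarrow> A \<noteq> 0 \<and> \<not> totally_real A \<and> (\<forall>v\<in>plane_of A. v \<noteq> 0 \<longrightarrow> mink v v > 0)"

definition elliptic_type :: "complex^4 \<Rightarrow> bool" where
  "elliptic_type A \<longleftrightarrow> A \<noteq> 0 \<and> \<not> totally_real A \<and>
     (\<exists>a b. plane_of A = span {a, b} \<and> mink a a = 1 \<and> mink b b = -1 \<and> mink a b = 0)"

definition parabolic_type :: "complex^4 \<Rightarrow> bool" where
  "parabolic_type A \<longleftrightarrow> A \<noteq> 0 \<and> \<not> totally_real A \<and>
     (\<exists>v\<in>plane_of A. v \<noteq> 0 \<and> (\<forall>w\<in>plane_of A. mink v w = 0))"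

subsection \<open>Smooth functions of two real parameters\<close>

text \<open>The parameter plane is \<^typ>\<open>complex\<close> with \<open>z = u + \<i>v\<close>; the indices \<open>1\<close> and \<open>2\<close> of
  \<^typ>\<open>2\<close> refer to \<open>u\<close> and \<open>v\<close>.\<close>

definition pd :: "2 \<Rightarrow> (complex \<Rightarrow> 'b::real_normed_vector) \<Rightarrow> complex \<Rightarrow> 'b" where
  "pd i f z = frechet_derivative f (at z) (if i = 1 then 1 else \<i>)"

primrec Ck_on :: "nat \<Rightarrow> (complex \<Rightarrow> 'b::real_normed_vector) \<Rightarrow> complex set \<Rightarrow> bool" where
  "Ck_on 0 f S \<longleftrightarrow> continuous_on S f"
| "Ck_on (Suc k) f S \<longleftrightarrow> (\<forall>z\<in>S. f differentiable (at z)) \<and> (\<forall>i. Ck_on k (pd i f) S)"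

definition smooth_on :: "(complex \<Rightarrow> 'b::real_normed_vector) \<Rightarrow> complex set \<Rightarrow> bool" where
  "smooth_on f S \<longleftrightarrow> (\<forall>k. Ck_on k f S)"

definition jacobian :: "(complex \<Rightarrow> complex) \<Rightarrow> complex \<Rightarrow> real" where
  "jacobian f z = Re (pd 1 f z) * Im (pd 2 f z) - Re (pd 2 f z) * Im (pd 1 f z)"

subsection \<open>Oriented surfaces\<close>

type_synonym 'a chart = "'a set \<times> ('a \<Rightarrow> complex)"

definition is_chart :: "'a topology \<Rightarrow> 'a chart \<Rightarrow> bool" where
  "is_chart T = (\<lambda>(U, f). openin T U \<and> open (f ` U) \<and>
     homeomorphic_map (subtopology T U) (top_of_set (f ` U)) f)"

definition oriented_transition :: "'a chart \<Rightarrow> 'a chart \<Rightarrow> bool" where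
  "oriented_transition = (\<lambda>(U, f) (V, g).
     smooth_on (g \<circ> inv_into U f) (f ` (U \<inter> V)) \<and>
     (\<forall>z\<in>f ` (U \<inter> V). jacobian (g \<circ> inv_into U f) z > 0))"

definition oriented_surface :: "'a topology \<Rightarrow> 'a chart set \<Rightarrow> bool" where
  "oriented_surface T \<A> \<longleftrightarrow>
     topspace T \<noteq> {} \<and> connected_space T \<and> Hausdorff_space T \<and> second_countable T \<and>
     (\<forall>c\<in>\<A>. is_chart T c) \<and> (\<Union>c\<in>\<A>. fst c) = topspace T \<and>
     (\<forall>c\<in>\<A>. \<forall>c'\<in>\<A>. oriented_transition c c')"

text \<open>The charts of the maximal oriented atlas generated by \<open>\<A>\<close>.\<close>

definition oriented_chart :: "'a topology \<Rightarrow> 'a chart set \<Rightarrow> 'a chart \<Rightarrow> bool" where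
  "oriented_chart T \<A> c \<longleftrightarrow>
     is_chart T c \<and> (\<forall>c'\<in>\<A>. oriented_transition c c' \<and> oriented_transition c' c)"

subsection \<open>Local geometry of a parametrized surface\<close>

definition in_chart :: "('a \<Rightarrow> 'b) \<Rightarrow> 'a chart \<Rightarrow> complex \<Rightarrow> 'b" where
  "in_chart x c = x \<circ> inv_into (fst c) (snd c)"

definition first_form :: "(complex \<Rightarrow> real^4) \<Rightarrow> complex \<Rightarrow> real^2^2" where
  "first_form X z = (\<chi> i j. mink (pd i X z) (pd j X z))"

definition normal_part :: "(complex \<Rightarrow> real^4) \<Rightarrow> complex \<Rightarrow> real^4 \<Rightarrow> real^4" where
  "normal_part X z w =
     w - (\<Sum>i\<in>UNIV. \<Sum>j\<in>UNIV. (matrix_inv (first_form X z) $ i $ j * mink w (pd j X z)) *\<^sub>R pd i X z)"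

definition second_form :: "(complex \<Rightarrow> real^4) \<Rightarrow> 2 \<Rightarrow> 2 \<Rightarrow> complex \<Rightarrow> real^4" where
  "second_form X i j z = normal_part X z (pd i (pd j X) z)"

definition mean_curvature :: "(complex \<Rightarrow> real^4) \<Rightarrow> complex \<Rightarrow> real^4" where
  "mean_curvature X z =
     (1/2) *\<^sub>R (\<Sum>i\<in>UNIV. \<Sum>j\<in>UNIV. matrix_inv (first_form X z) $ i $ j *\<^sub>R second_form X i j z)"

definition christoffel :: "(complex \<Rightarrow> real^2^2) \<Rightarrow> 2 \<Rightarrow> 2 \<Rightarrow> 2 \<Rightarrow> complex \<Rightarrow> real" where
  "christoffel g k i j z = (1/2) * (\<Sum>l\<in>UNIV. matrix_inv (g z) $ k $ l *
     (pd i (\<lambda>w. g w $ j $ l) z + pd j (\<lambda>w. g w $ i $ l) z - pd l (\<lambda>w. g w $ i $ j) z))"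

text \<open>The coefficient of \<open>\<partial>\<^sub>l\<close> in \<open>R(\<partial>\<^sub>i, \<partial>\<^sub>j)\<partial>\<^sub>k = \<nabla>\<^sub>i\<nabla>\<^sub>j\<partial>\<^sub>k - \<nabla>\<^sub>j\<nabla>\<^sub>i\<partial>\<^sub>k\<close>; with this sign convention
  the Gauss curvature below is positive on round spheres.\<close>

definition riemann :: "(complex \<Rightarrow> real^2^2) \<Rightarrow> 2 \<Rightarrow> 2 \<Rightarrow> 2 \<Rightarrow> 2 \<Rightarrow> complex \<Rightarrow> real" where
  "riemann g l k i j z =
     pd i (christoffel g l j k) z - pd j (christoffel g l i k) z +
     (\<Sum>m\<in>UNIV. christoffel g l i m z * christoffel g m j k z
              - christoffel g l j m z * christoffel g m i k z)"

definition gauss_curvature :: "(complex \<Rightarrow> real^2^2) \<Rightarrow> complex \<Rightarrow> real" where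
  "gauss_curvature g z = (\<Sum>l\<in>UNIV. g z $ 1 $ l * riemann g l 2 1 2 z) / det (g z)"

subsection \<open>Space-like stationary surfaces\<close>

definition spacelike_surface :: "'a topology \<Rightarrow> 'a chart set \<Rightarrow> ('a \<Rightarrow> real^4) \<Rightarrow> bool" where
  "spacelike_surface T \<A> x \<longleftrightarrow> oriented_surface T \<A> \<and>
     (\<forall>c\<in>\<A>. smooth_on (in_chart x c) (snd c ` fst c) \<and>
       (\<forall>z\<in>snd c ` fst c.
          inj (frechet_derivative (in_chart x c) (at z)) \<and>
          (\<forall>\<xi>. \<xi> \<noteq> 0 \<longrightarrow> \<xi> \<bullet> (first_form (in_chart x c) z *v \<xi>) > 0)))"

definition stationary_surface :: "'a topology \<Rightarrow> 'a chart set \<Rightarrow> ('a \<Rightarrow> real^4) \<Rightarrow> bool" where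
  "stationary_surface T \<A> x \<longleftrightarrow> spacelike_surface T \<A> x \<and>
     (\<forall>c\<in>\<A>. \<forall>z\<in>snd c ` fst c. mean_curvature (in_chart x c) z = 0)"

definition nonflat :: "'a chart set \<Rightarrow> ('a \<Rightarrow> real^4) \<Rightarrow> bool" where
  "nonflat \<A> x \<longleftrightarrow>
     (\<exists>c\<in>\<A>. \<exists>z\<in>snd c ` fst c. gauss_curvature (first_form (in_chart x c)) z \<noteq> 0)"

definition pw_C1_curve :: "'a topology \<Rightarrow> 'a chart set \<Rightarrow> 'a \<Rightarrow> 'a \<Rightarrow> (real \<Rightarrow> 'a) \<Rightarrow> bool" where
  "pw_C1_curve T \<A> p q \<gamma> \<longleftrightarrow> pathin T \<gamma> \<and> \<gamma> 0 = p \<and> \<gamma> 1 = q \<and>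
     (\<exists>S. finite S \<and> (\<forall>(U, f)\<in>\<A>. (f \<circ> \<gamma>) C1_differentiable_on {t\<in>{0<..<1} - S. \<gamma> t \<in> U}))"

text \<open>The length of \<open>\<gamma>'\<close> in the induced metric is the Minkowski length of \<open>(x \<circ> \<gamma>)'\<close>. As in
  \<^const>\<open>C1_differentiable_on\<close> with finitely many exceptions, one-sided limits of \<open>\<gamma>'\<close> at the
  exceptional parameters are not required, so the length may be infinite.\<close>

definition curve_length :: "('a \<Rightarrow> real^4) \<Rightarrow> (real \<Rightarrow> 'a) \<Rightarrow> ennreal" where
  "curve_length x \<gamma> = (\<integral>\<^sup>+ t \<in> {0..1}.
     ennreal (sqrt (mink (vector_derivative (x \<circ> \<gamma>) (at t)) (vector_derivative (x \<circ> \<gamma>) (at t))))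
     \<partial>lborel)"

definition induced_dist :: "'a topology \<Rightarrow> 'a chart set \<Rightarrow> ('a \<Rightarrow> real^4) \<Rightarrow> 'a \<Rightarrow> 'a \<Rightarrow> real" where
  "induced_dist T \<A> x p q = enn2real (INF \<gamma>\<in>{\<gamma>. pw_C1_curve T \<A> p q \<gamma>}. curve_length x \<gamma>)"

definition complete_surface :: "'a topology \<Rightarrow> 'a chart set \<Rightarrow> ('a \<Rightarrow> real^4) \<Rightarrow> bool" where
  "complete_surface T \<A> x \<longleftrightarrow> Metric_space.mcomplete (topspace T) (induced_dist T \<A> x)"

definition affine_plane :: "'a topology \<Rightarrow> ('a \<Rightarrow> real^4) \<Rightarrow> bool" where
  "affine_plane T x \<longleftrightarrow> affine (x ` topspace T) \<and> aff_dim (x ` topspace T) = 2"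

definition mink_congruence :: "(real^4 \<Rightarrow> real^4) \<Rightarrow> bool" where
  "mink_congruence F \<longleftrightarrow> (\<exists>L b. linear L \<and> (\<forall>u v. mink (L u) (L v) = mink u v) \<and> F = (\<lambda>v. L v + b))"

text \<open>For a stationary surface contained in the totally geodesic hyperplane \<open>x\<^sub>4 = 0\<close>, the mean
  curvature vector of \<open>\<real>\<^sup>3\<close> is that of the ambient Minkowski space, so such a surface is minimal.\<close>

definition in_euclidean_3space :: "'a topology \<Rightarrow> ('a \<Rightarrow> real^4) \<Rightarrow> bool" where
  "in_euclidean_3space T x \<longleftrightarrow> (\<exists>F. mink_congruence F \<and> (\<forall>p\<in>topspace T. F (x p) $ 4 = 0))"

definition minimal_surface_in_R3 :: "'a topology \<Rightarrow> 'a chart set \<Rightarrow> ('a \<Rightarrow> real^4) \<Rightarrow> bool" where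
  "minimal_surface_in_R3 T \<A> x \<longleftrightarrow> stationary_surface T \<A> x \<and> in_euclidean_3space T x"

subsection \<open>The Gauss map\<close>

definition isothermal_chart :: "'a topology \<Rightarrow> 'a chart set \<Rightarrow> ('a \<Rightarrow> real^4) \<Rightarrow> 'a chart \<Rightarrow> bool" where
  "isothermal_chart T \<A> x c \<longleftrightarrow> oriented_chart T \<A> c \<and>
     (\<forall>z\<in>snd c ` fst c. let g = first_form (in_chart x c) z in g $ 1 $ 1 = g $ 2 $ 2 \<and> g $ 1 $ 2 = 0)"

definition dz :: "(complex \<Rightarrow> real^4) \<Rightarrow> complex \<Rightarrow> complex^4" where
  "dz X z = (\<chi> k. (complex_of_real (pd 1 X z $ k) - \<i> * complex_of_real (pd 2 X z $ k)) / 2)"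

text \<open>Isothermal charts differ by holomorphic changes of coordinate, which rescale \<open>x\<^sub>z\<close> by a
  nonzero factor, so the description below is unambiguous wherever an isothermal chart exists.\<close>

definition gauss_map :: "'a topology \<Rightarrow> 'a chart set \<Rightarrow> ('a \<Rightarrow> real^4) \<Rightarrow> 'a \<Rightarrow> cp3" where
  "gauss_map T \<A> x p = (THE L. \<exists>c. isothermal_chart T \<A> x c \<and> p \<in> fst c \<and>
     L = proj_pt (dz (in_chart x c) (snd c p)))"

definition psi1 :: "'a topology \<Rightarrow> 'a chart set \<Rightarrow> ('a \<Rightarrow> real^4) \<Rightarrow> 'a \<Rightarrow> csphere" where
  "psi1 T \<A> x p = fst (Psi (gauss_map T \<A> x p))"

definition psi2 :: "'a topology \<Rightarrow> 'a chart set \<Rightarrow> ('a \<Rightarrow> real^4) \<Rightarrow> 'a \<Rightarrow> csphere" where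
  "psi2 T \<A> x p = snd (Psi (gauss_map T \<A> x p))"

definition gauss_image :: "'a topology \<Rightarrow> 'a chart set \<Rightarrow> ('a \<Rightarrow> real^4) \<Rightarrow> cp3 set" where
  "gauss_image T \<A> x = gauss_map T \<A> x ` topspace T"

definition degenerate :: "'a topology \<Rightarrow> 'a chart set \<Rightarrow> ('a \<Rightarrow> real^4) \<Rightarrow> bool" where
  "degenerate T \<A> x \<longleftrightarrow> (\<exists>A. A \<noteq> 0 \<and> gauss_image T \<A> x \<subseteq> hyperplane A)"

definition two_degenerate :: "'a topology \<Rightarrow> 'a chart set \<Rightarrow> ('a \<Rightarrow> real^4) \<Rightarrow> bool" where
  "two_degenerate T \<A> x \<longleftrightarrow> (\<exists>A B. A \<noteq> 0 \<and> B \<noteq> 0 \<and> hyperplane A \<noteq> hyperplane B \<and>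
     gauss_image T \<A> x \<subseteq> hyperplane A \<inter> hyperplane B)"

definition degenerate_of_type ::
  "(complex^4 \<Rightarrow> bool) \<Rightarrow> 'a topology \<Rightarrow> 'a chart set \<Rightarrow> ('a \<Rightarrow> real^4) \<Rightarrow> bool" where
  "degenerate_of_type P T \<A> x \<longleftrightarrow> (\<exists>A. P A \<and> gauss_image T \<A> x \<subseteq> hyperplane A)"

text \<open>The number of omitted points of the extended plane, infinite e.g. for a constant map.\<close>

definition omitted_count :: "('a \<Rightarrow> csphere) \<Rightarrow> 'a set \<Rightarrow> enat" where
  "omitted_count f S = (if finite (- f ` S) then enat (card (- f ` S)) else \<infinity>)"

subsection \<open>\<open>\<Psi>\<close> is the inverse of a bijection onto the quadric\<close>

lemma proj_pt_eq_iff: "proj_pt y = proj_pt z \<longleftrightarrow> (\<exists>c. c \<noteq> 0 \<and> y = c *s z)"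
proof
  assume "proj_pt y = proj_pt z"
  moreover have "y \<in> proj_pt y"
    unfolding proj_pt_def by (rule CollectI, rule exI[of _ 1]) (simp add: vec_eq_iff)
  ultimately show "\<exists>c. c \<noteq> 0 \<and> y = c *s z"
    unfolding proj_pt_def by auto
next
  assume "\<exists>c. c \<noteq> 0 \<and> y = c *s z"
  then obtain c where c: "c \<noteq> 0" "y = c *s z" by blast
  have "d *s z = (d / c) *s (c *s z)" for d
    using c by (simp add: vec_eq_iff)
  moreover have "d \<noteq> 0 \<Longrightarrow> d / c \<noteq> 0" for d using c by simp
  ultimately have "proj_pt z \<subseteq> proj_pt y"
    unfolding proj_pt_def c by blast
  moreover have "d *s (c *s z) = (d * c) *s z" for d
    by (simp add: vec_eq_iff)
  hence "proj_pt y \<subseteq> proj_pt z"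
    unfolding proj_pt_def c using c(1) by fastforce
  ultimately show "proj_pt y = proj_pt z" by blast
qed

lemma vec4_nth [simp]:
  "vec4 a b c d $ 1 = a" "vec4 a b c d $ 2 = b" "vec4 a b c d $ 3 = c" "vec4 a b c d $ 4 = d"
  by (simp_all add: vec4_def)

definition Psi_coord :: "complex^4 \<Rightarrow> csphere \<times> csphere" where
  "Psi_coord z =
     (if z$3 + z$4 \<noteq> 0 then (Some ((z$1 + \<i> * z$2) / (z$3 + z$4)), Some ((z$1 - \<i> * z$2) / (z$3 + z$4)))
      else if z$1 = 0 \<and> z$2 = 0 then (None, None)
      else if z$1 + \<i> * z$2 = 0 then (Some (- z$3 / z$1), None)
      else (None, Some (- z$3 / z$1)))"

lemma Psi_coord_scale:
  assumes "c \<noteq> 0" shows "Psi_coord (c *s z) = Psi_coord z"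
proof -
  have 1: "c * z$3 + c * z$4 = c * (z$3 + z$4)"
    and 2: "c * z$1 + \<i> * (c * z$2) = c * (z$1 + \<i> * z$2)"
    and 3: "c * z$1 - \<i> * (c * z$2) = c * (z$1 - \<i> * z$2)"
    by (simp_all add: algebra_simps)
  show ?thesis
    unfolding Psi_coord_def vector_smult_component 1 2 3 using assms by simp
qed

lemma Psi_coord_rep: "Psi_coord (Psi_rep w) = w"
  by (cases w rule: Psi_rep.cases) (auto simp: Psi_coord_def algebra_simps)

lemma inj_Psi_inv: "inj Psi_inv"
  by (rule injI) (metis Psi_inv_def Psi_coord_rep Psi_coord_scale proj_pt_eq_iff)

lemma Psi_inv_in_quadric: "Psi_inv w \<in> quadric"
proof -
  have "cmink (Psi_rep w) (Psi_rep w) = 0"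
    by (cases w rule: Psi_rep.cases) (auto simp: cmink_def algebra_simps)
  moreover have "Psi_rep w $ 3 + Psi_rep w $ 4 \<noteq> 0 \<or> Psi_rep w $ 1 \<noteq> 0 \<or> Psi_rep w $ 4 \<noteq> 0"
    by (cases w rule: Psi_rep.cases) auto
  then have "Psi_rep w \<noteq> 0" by (auto simp del: Psi_rep.simps)
  ultimately show ?thesis by (auto simp: quadric_def Psi_inv_def)
qed

lemma Psi_inv_coord:
  assumes "z \<noteq> 0" "cmink z z = 0"
  shows "Psi_inv (Psi_coord z) = proj_pt z"
proof -
  obtain a b c d where z: "z$1 = a" "z$2 = b" "z$3 = c" "z$4 = d" by blast
  have q: "(a + \<i> * b) * (a - \<i> * b) = (d - c) * (c + d)"
    using assms(2) by (simp add: cmink_def z algebra_simps)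
  have nz: "a \<noteq> 0 \<or> b \<noteq> 0 \<or> c \<noteq> 0 \<or> d \<noteq> 0"
    using assms(1) by (auto simp: vec_eq_iff forall_4 z)
  have "\<exists>k. k \<noteq> 0 \<and> Psi_rep (Psi_coord z) = k *s z"
  proof (cases "c + d = 0")
    case False
    have "(a + \<i> * b) / (c + d) * ((a - \<i> * b) / (c + d)) = (d - c) / (c + d)"
      unfolding times_divide_times_eq q using False by simp
    moreover have "1 - (d - c) / (c + d) = 2 / (c + d) * c" "1 + (d - c) / (c + d) = 2 / (c + d) * d"
      "(a + \<i> * b) / (c + d) + (a - \<i> * b) / (c + d) = 2 / (c + d) * a"
      "- \<i> * ((a + \<i> * b) / (c + d) - (a - \<i> * b) / (c + d)) = 2 / (c + d) * b"
      using False by (simp_all add: divide_simps)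
    ultimately have "Psi_rep (Psi_coord z) = (2 / (c + d)) *s z"
      using False
      by (simp only: Psi_coord_def z if_True not_False_eq_True Psi_rep.simps vec_eq_iff forall_4 vec4_nth
          vector_smult_component)
    then show ?thesis using False by (intro exI[of _ "2 / (c + d)"]) simp
  next
    case True
    then have d: "d = - c" by algebra
    show ?thesis
    proof (cases "a = 0 \<and> b = 0")
      case True
      then have "Psi_rep (Psi_coord z) = (- 1 / c) *s z" "c \<noteq> 0"
        using d nz by (auto simp: Psi_coord_def z vec_eq_iff forall_4)
      then show ?thesis by (intro exI[of _ "- 1 / c"]) simp
    next
      case False
      have ab: "a + \<i> * b = 0 \<or> a - \<i> * b = 0" using q d by simp
      have a: "a \<noteq> 0" using ab False by auto
      have "Psi_rep (Psi_coord z) = (1 / a) *s z"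
      proof (cases "a + \<i> * b = 0")
        case True
        moreover have "\<i> * (a + \<i> * b) = \<i> * a - b" by (simp add: algebra_simps)
        ultimately have "b = \<i> * a" by simp
        then show ?thesis using a d by (simp add: Psi_coord_def z vec_eq_iff forall_4)
      next
        case F: False
        moreover have "\<i> * (a - \<i> * b) = \<i> * a + b" by (simp add: algebra_simps)
        ultimately have "b = - \<i> * a" using ab by (simp add: eq_neg_iff_add_eq_0 add.commute)
        then show ?thesis using a d F by (simp add: Psi_coord_def z vec_eq_iff forall_4)
      qed
      then show ?thesis using a by (intro exI[of _ "1 / a"]) simp
    qed
  qed
  then show ?thesis by (simp add: Psi_inv_def proj_pt_eq_iff)
qed

lemma bij_betw_Psi_inv: "bij_betw Psi_inv UNIV quadric"
proof -
  have "L \<in> range Psi_inv" if "L \<in> quadric" for L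
    using that Psi_inv_coord unfolding quadric_def by (smt (verit) mem_Collect_eq rangeI)
  then show ?thesis
    using inj_Psi_inv Psi_inv_in_quadric by (auto simp: bij_betw_def)
qed

end

theory Submission
  imports Defs "HOL-Complex_Analysis.Complex_Analysis"
begin

text \<open>The conformal immersion is \<open>x = Re \<integral> 2\<phi> dz\<close> with \<open>\<phi> = x\<^sub>z\<close> isotropic and holomorphic in isothermal
  coordinates; these exist because \<open>x\<close> has a local conjugate \<open>y\<close> (the Hodge star of \<open>dx\<close> is closed when
  the mean curvature vanishes) and a component of \<open>x + \<i>y\<close> is a conformal coordinate.

  If the Gauss image lies in \<open>H\<^sub>A\<close> with \<open>\<langle>A,A\<rangle> \<noteq> 0\<close>, then \<open>H\<^sub>A\<close> is a conic that both projections \<open>\<psi>\<^sub>i\<close> map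
  bijectively to the extended plane, so \<open>q\<^sub>1 = q\<^sub>2\<close> is the number of points of the conic omitted by the Gauss map.
  Let \<open>[l]\<close> be an omitted point and \<open>l, l', n\<close> a basis of \<open>A\<^sup>\<bottom>\<close> with \<open>l, l'\<close> isotropic and \<open>n\<close> a unit vector orthogonal
  to both; then \<open>\<phi> = h (l' + g n - g\<^sup>2/2 l)\<close> with \<open>h\<close> nowhere zero. The metric is bounded by
  \<open>|h|\<^sup>2(1 + |g|)\<^bsup>2m\<^esup>|dz|\<^sup>2\<close> up to a constant, where \<open>m = 2\<close> in general and \<open>m = 1\<close> if \<open>l\<close> is real; if \<open>l\<close> and \<open>l'\<close>
  are both real, it is bounded by \<open>|h g|\<^sup>2|dz|\<^sup>2\<close>, the case \<open>m = 0\<close> for the function \<open>1/g\<close>. By Fujimoto's argument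
  the function is constant if it omits \<open>m + 2\<close> finite values, and a complete surface with constant Gauss map is
  a plane. Real points of the conic are always omitted: one exists for the parabolic type, two for the
  hyperbolic type.

  If \<open>\<langle>A,A\<rangle> = 0\<close>, then \<open>\<psi>\<^sub>1\<close> or \<open>\<psi>\<^sub>2\<close> is constant by the identity theorem. The surface is then flat, and the
  other \<open>\<psi>\<^sub>i\<close> falls under the case \<open>m = 0\<close>. A pencil of hyperplanes always contains such an \<open>A\<close>.

  Fujimoto's flat metric enters through its dual holomorphic vector field: completeness and a Landau-type
  estimate give an integral curve in complex time defined on the whole plane, to which Picard's theorem applies.\<close>

text \<open>Fujimoto's metric is singular at the critical points of \<open>g\<close> and has to be
  developed on a covering surface. For the dual field \<open>v\<close> these points are mere zeros,
  which no integral curve reaches in finite time, and curves on discs through one base point replace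
  the covering. On a largest disc of finite radius R the speed would be at most a multiple of (R -
  |w|)^(-\<kappa>) with \<kappa> < 1; this is integrable along radii, so completeness continues the
  curve past every boundary point.

  The hyperbolic metric of a punctured plane contains logarithms, from which no holomorphic
  \<open>v\<close> can be formed; hence estimates with exponent 1 - 1/N at each finite puncture and
  1 + 1/N at infinity. For m + 2 omitted finite values the exponents balance if N = m + 3 + m/s, as
  in (m, s, N) = (1, 1, 5) and (2, 2, 6); for m = 0 the choice s = 0, N = 3 leaves
  \<open>v = 1/h\<close>. For m + 1 values they never balance.

  Isothermal charts need not belong to the atlas in whose charts the curves defining completeness
  are tested, so curves are treated by a pointwise condition that any compatible chart can
  verify.\<close>

no_notation fps_nth (infixl "$" 75)

subsection \<open>Functions omitting finitely many values\<close>

text \<open>Schottky's theorem bounds the normalized function on a smaller disc by its value at the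
  centre, and Cauchy's inequality makes this a bound of the derivative there. \<open>C\<close>
  depends only on the omitted values and on \<open>r\<close>, so one constant serves all functions
  and all discs.\<close>

lemma landau_bound:
  fixes c1 c2 :: complex and r :: real
  assumes "c1 \<noteq> c2"
  obtains C where "C > 0"
    "\<And>f w \<rho>. \<lbrakk>\<rho> > 0; f holomorphic_on ball w \<rho>; \<And>z. z \<in> ball w \<rho> \<Longrightarrow> f z \<noteq> c1 \<and> f z \<noteq> c2;
       norm (f w) \<le> r\<rbrakk> \<Longrightarrow> norm (deriv f w) * \<rho> \<le> C"
proof -
  define r' where "r' = (r + norm c1) / norm (c2 - c1)"
  \<comment> \<open>The constant of Schottky's theorem on the disc of radius 1/2, for functions that
    omit 0 and 1 and have modulus at most \<open>r'\<close> at the centre.\<close>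
  define K where "K = exp (pi * exp (pi * (2 + 2 * r' + 12 * (1/2) / (1 - 1/2))))"
  have K: "K > 0" by (simp add: K_def)
  show ?thesis
  proof (rule that)
    show "4 * K * norm (c2 - c1) > 0" using K assms by simp
  next
    fix f w \<rho> assume \<rho>: "(\<rho>::real) > 0" and hol: "f holomorphic_on ball w \<rho>"
      and om: "\<And>z. z \<in> ball w \<rho> \<Longrightarrow> f z \<noteq> c1 \<and> f z \<noteq> c2" and fr: "norm (f w) \<le> r"
    \<comment> \<open>Half of the radius is given away so that \<open>h\<close> lives on the closed
      unit disc; with Cauchy's inequality on radius 1/2 this accounts for the factor 4.\<close>
    define h where "h z = (f (w + of_real (\<rho>/2) * z) - c1) / (c2 - c1)" for z
    have inb: "w + of_real (\<rho>/2) * z \<in> ball w \<rho>" if "norm z \<le> 1" for z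
    proof -
      have "\<rho> * norm z \<le> \<rho>" using that \<rho> by (simp add: mult_left_le)
      then show ?thesis using \<rho> by (simp add: dist_norm norm_mult)
    qed
    have hh: "h holomorphic_on cball 0 1"
      unfolding h_def
      by (intro holomorphic_intros holomorphic_on_compose_gen[OF _ hol, unfolded o_def])
         (use assms inb in auto)
    have h01: "\<not> (h z = 0 \<or> h z = 1)" if "z \<in> cball 0 1" for z
      using om[OF inb[of z]] that assms by (simp add: h_def)
    have h0: "norm (h 0) \<le> r'"
      using norm_triangle_ineq4[of "f w" c1] fr assms
      by (simp add: h_def r'_def norm_divide divide_right_mono)
    have Kb: "norm (h z) \<le> K" if "norm z \<le> 1/2" for z
      using Schottky[OF hh h0 h01, of "1/2" z] that unfolding K_def by simp
    have "norm ((deriv ^^ 1) h 0) \<le> fact 1 * K / (1/2)^1"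
    proof (rule Cauchy_inequality)
      show "h holomorphic_on ball 0 (1/2)" by (rule holomorphic_on_subset[OF hh]) auto
      show "continuous_on (cball 0 (1/2)) h"
        by (rule continuous_on_subset[OF holomorphic_on_imp_continuous_on[OF hh]]) auto
    qed (use Kb in auto)
    moreover have "(h has_field_derivative (deriv f w * of_real (\<rho>/2) / (c2 - c1))) (at 0)"
    proof -
      have "(f has_field_derivative deriv f w) (at (w + of_real (\<rho>/2) * 0))"
        using hol \<rho> by (auto intro: holomorphic_derivI)
      moreover have "((\<lambda>z. w + of_real (\<rho>/2) * z) has_field_derivative of_real (\<rho>/2)) (at 0)"
        by (auto intro!: derivative_eq_intros)
      ultimately have "((\<lambda>z. f (w + of_real (\<rho>/2) * z)) has_field_derivative deriv f w * of_real (\<rho>/2)) (at 0)"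
        by (rule DERIV_chain2)
      then have "((\<lambda>z. (f (w + of_real (\<rho>/2) * z) - c1) / (c2 - c1)) has_field_derivative
          (deriv f w * of_real (\<rho>/2) - 0) / (c2 - c1)) (at 0)"
        by (intro DERIV_cdivide DERIV_diff DERIV_const)
      then show ?thesis by (simp add: h_def[abs_def])
    qed
    ultimately have "norm (deriv f w * of_real (\<rho>/2) / (c2 - c1)) \<le> 2 * K"
      by (simp add: DERIV_imp_deriv)
    then have "norm (deriv f w) * (\<rho>/2) / norm (c2 - c1) \<le> 2 * K"
      using \<rho> by (simp only: norm_mult norm_divide norm_of_real abs_of_pos half_gt_zero)
    then show "norm (deriv f w) * \<rho> \<le> 4 * K * norm (c2 - c1)"
      using assms by (simp add: field_simps)
  qed
qed

text \<open>An \<open>N\<close>-th root \<open>G\<close> of \<open>f - a\<close> omits every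
  \<open>N\<close>-th root of \<open>b - a\<close>, hence two values as soon as N is at least 2, and
  \<open>landau_bound\<close> applies to it. Since f' = N G^(N-1) G', the bound for G' gains the
  factor |f - a|^(1 - 1/N); taking \<open>N\<close>-th powers avoids roots in the statement.\<close>

lemma root_bound:
  fixes a b :: complex and r :: real and N :: nat
  assumes ab: "a \<noteq> b" and N: "N \<ge> 2"
  obtains C where "C > 0"
    "\<And>f w \<rho>. \<lbrakk>\<rho> > 0; f holomorphic_on ball w \<rho>; \<And>z. z \<in> ball w \<rho> \<Longrightarrow> f z \<noteq> a \<and> f z \<noteq> b;
       norm (f w) \<le> r\<rbrakk> \<Longrightarrow> (norm (deriv f w) * \<rho>) ^ N \<le> C * norm (f w - a) ^ (N - 1)"
proof -
  define c1 where "c1 = exp (Ln (b - a) / of_nat N)"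
  define c2 where "c2 = c1 * exp (2 * of_real pi * \<i> / of_nat N)"
  have N0: "N \<noteq> 0" using N by simp
  have c1: "c1 ^ N = b - a"
    using ab N0 by (simp add: c1_def exp_of_nat_mult[symmetric] )
  have "exp (2 * of_real pi * \<i> / of_nat N) ^ N = 1"
    using N0 by (simp add: exp_of_nat_mult[symmetric])
  then have c2: "c2 ^ N = b - a" by (simp add: c2_def power_mult_distrib c1)
  have "c1 \<noteq> c2"
  proof
    assume "c1 = c2"
    then have "exp (2 * of_real pi * \<i> / of_nat N) = 1" unfolding c2_def by (simp add: c1_def)
    then obtain k :: int where "2 * pi / N = of_int (2 * k) * pi"
      by (auto simp: exp_eq_1 )
    then have "of_int k * real N = 1" using N0 by (simp add: field_simps)
    then have "k * int N = 1" by (metis of_int_eq_1_iff of_int_mult of_int_of_nat_eq)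
    then show False using N by (simp add: zmult_eq_1_iff)
  qed
  then obtain C where C: "C > 0" and
    CC: "\<And>f w \<rho>. \<lbrakk>\<rho> > 0; f holomorphic_on ball w \<rho>; \<And>z. z \<in> ball w \<rho> \<Longrightarrow> f z \<noteq> c1 \<and> f z \<noteq> c2;
       norm (f w) \<le> 1 + r + norm a\<rbrakk> \<Longrightarrow> norm (deriv f w) * \<rho> \<le> C"
    using landau_bound[of c1 c2 "1 + r + norm a"] by metis
  show ?thesis
  proof (rule that)
    show "(real N * C) ^ N > 0" using C N0 by simp
  next
    fix f w \<rho> assume \<rho>: "(\<rho>::real) > 0" and hol: "f holomorphic_on ball w \<rho>"
      and om: "\<And>z. z \<in> ball w \<rho> \<Longrightarrow> f z \<noteq> a \<and> f z \<noteq> b" and fr: "norm (f w) \<le> r"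
    obtain g where g: "g holomorphic_on ball w \<rho>" and fg: "\<And>z. z \<in> ball w \<rho> \<Longrightarrow> f z - a = exp (g z)"
    proof (rule contractible_imp_holomorphic_log[of "\<lambda>z. f z - a" "ball w \<rho>"])
      show "(\<lambda>z. f z - a) holomorphic_on ball w \<rho>" by (intro holomorphic_intros hol)
      show "contractible (ball w \<rho>)" by (intro convex_imp_contractible convex_ball)
    qed (use om in auto)
    define G where "G z = exp (g z / of_nat N)" for z
    have GN: "G z ^ N = f z - a" if "z \<in> ball w \<rho>" for z
      using fg[OF that] N0 by (simp add: G_def exp_of_nat_mult[symmetric])
    have hG: "G holomorphic_on ball w \<rho>"
      unfolding G_def by (intro holomorphic_intros g) (use N0 in auto)
    have w: "w \<in> ball w \<rho>" using \<rho> by simp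
    have Gw: "norm (G w) ^ N = norm (f w - a)" using GN[OF w] by (metis norm_power)
    \<comment> \<open>Either |G| is at most 1, or |G| is at most |G|^N = |f - a|; the bound covers
      both.\<close>
    have Gr: "norm (G w) \<le> 1 + r + norm a"
    proof (cases "norm (G w) \<le> 1")
      case True then show ?thesis using fr norm_ge_zero[of "f w"] norm_ge_zero[of a] by linarith
    next
      case False
      then have "norm (G w) \<le> norm (G w) ^ N" using N0 by (simp add: self_le_power)
      then show ?thesis using Gw norm_triangle_ineq4[of "f w" a] fr by linarith
    qed
    have Gom: "G z \<noteq> c1 \<and> G z \<noteq> c2" if "z \<in> ball w \<rho>" for z
      using GN[OF that] om[OF that] c1 c2 by auto
    have dG: "norm (deriv G w) * \<rho> \<le> C" by (rule CC[OF \<rho> hG Gom Gr])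
    have "((\<lambda>z. G z ^ N + a) has_field_derivative (of_nat N * G w ^ (N - 1) * deriv G w)) (at w)"
      by (auto intro!: derivative_eq_intros holomorphic_derivI[OF hG _ w])
    then have "(f has_field_derivative (of_nat N * G w ^ (N - 1) * deriv G w)) (at w)"
      by (rule has_field_derivative_transform_within_open[OF _ open_ball w]) (simp add: GN)
    then have "deriv f w = of_nat N * G w ^ (N - 1) * deriv G w" by (rule DERIV_imp_deriv)
    then have "norm (deriv f w) * \<rho> = real N * norm (G w) ^ (N - 1) * (norm (deriv G w) * \<rho>)"
      by (simp add: norm_mult norm_power)
    also have "\<dots> \<le> real N * norm (G w) ^ (N - 1) * C"
      using dG by (intro mult_left_mono) auto
    finally have "(norm (deriv f w) * \<rho>) ^ N \<le> (real N * norm (G w) ^ (N - 1) * C) ^ N"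
      using \<rho> by (intro power_mono) auto
    also have "\<dots> = (real N * C) ^ N * (norm (G w) ^ N) ^ (N - 1)"
      by (simp add: power_mult_distrib power_mult[symmetric] mult.commute)
    finally show "(norm (deriv f w) * \<rho>) ^ N \<le> (real N * C) ^ N * norm (f w - a) ^ (N - 1)"
      by (simp add: Gw)
  qed
qed

text \<open>Being holomorphic, \<open>f\<close> also omits \<infinity>, so 1/(f - a) omits 0 and
  1/(b - a), and \<open>root_bound\<close> applies with 0 as the puncture. The exponent
  \<open>N + 1\<close> is 2N - (N - 1), where 2N comes from the derivative of the inversion.\<close>

lemma root_bound_at_infinity:
  fixes a b :: complex and N :: nat
  assumes ab: "a \<noteq> b" and N: "N \<ge> 2"
  obtains C where "C > 0"
    "\<And>f w \<rho>. \<lbrakk>\<rho> > 0; f holomorphic_on ball w \<rho>; \<And>z. z \<in> ball w \<rho> \<Longrightarrow> f z \<noteq> a \<and> f z \<noteq> b;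
       norm (f w - a) \<ge> 1\<rbrakk> \<Longrightarrow> (norm (deriv f w) * \<rho>) ^ N \<le> C * norm (f w - a) ^ (N + 1)"
proof -
  have "(0::complex) \<noteq> 1 / (b - a)" using ab by simp
  then obtain C where C: "C > 0" and
    CC: "\<And>f w \<rho>. \<lbrakk>\<rho> > 0; f holomorphic_on ball w \<rho>; \<And>z. z \<in> ball w \<rho> \<Longrightarrow> f z \<noteq> 0 \<and> f z \<noteq> 1/(b-a);
       norm (f w) \<le> 1\<rbrakk> \<Longrightarrow> (norm (deriv f w) * \<rho>) ^ N \<le> C * norm (f w - 0) ^ (N - 1)"
    using root_bound[OF _ N, of 0 "1/(b-a)" 1] by metis
  show ?thesis
  proof (rule that[OF C])
    fix f w \<rho> assume \<rho>: "(\<rho>::real) > 0" and hol: "f holomorphic_on ball w \<rho>"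
      and om: "\<And>z. z \<in> ball w \<rho> \<Longrightarrow> f z \<noteq> a \<and> f z \<noteq> b" and fr: "norm (f w - a) \<ge> 1"
    define u where "u z = 1 / (f z - a)" for z
    have w: "w \<in> ball w \<rho>" using \<rho> by simp
    have hu: "u holomorphic_on ball w \<rho>"
      unfolding u_def by (intro holomorphic_intros hol) (use om in auto)
    have fa: "f w - a \<noteq> 0" using fr by auto
    have 1: "(norm (deriv u w) * \<rho>) ^ N \<le> C * norm (u w - 0) ^ (N - 1)"
    proof (rule CC[OF \<rho> hu])
      show "u z \<noteq> 0 \<and> u z \<noteq> 1 / (b - a)" if "z \<in> ball w \<rho>" for z
        using om[OF that] ab by (auto simp: u_def)
      show "norm (u w) \<le> 1" using fr fa by (simp add: u_def norm_divide)
    qed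
    have "(u has_field_derivative (- deriv f w / (f w - a)^2)) (at w)"
      unfolding u_def
      by (rule derivative_eq_intros refl holomorphic_derivI[OF hol _ w] | use fa in \<open>simp add: power2_eq_square\<close>)+
    then have "deriv u w = - deriv f w / (f w - a)^2" by (rule DERIV_imp_deriv)
    then have "norm (deriv f w) * \<rho> = (norm (deriv u w) * \<rho>) * norm (f w - a)^2"
      using fa by (simp add: norm_divide norm_power)
    then have "(norm (deriv f w) * \<rho>) ^ N = (norm (deriv u w) * \<rho>)^N * (norm (f w - a)^2)^N"
      by (simp only: power_mult_distrib)
    also have "\<dots> \<le> C * norm (u w - 0) ^ (N - 1) * (norm (f w - a)^2)^N"
      using 1 by (intro mult_right_mono) auto
    also have "\<dots> = C * norm (f w - a) ^ (N + 1)"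
    proof -
      have "(norm (f w - a)^2)^N = norm (f w - a) ^ (N - 1) * norm (f w - a) ^ (N + 1)"
      proof -
        have "2 * N = (N - 1) + (N + 1)" using N by simp
        then show ?thesis by (metis power_mult power_add)
      qed
      then show ?thesis using fa by (simp add: u_def norm_divide power_divide)
    qed
    finally show "(norm (deriv f w) * \<rho>) ^ N \<le> C * norm (f w - a) ^ (N + 1)" .
  qed
qed

text \<open>A substitute for the hyperbolic metric of the plane punctured at \<open>A\<close>: near a puncture an
  \<open>N\<close>-th root of \<open>f - a\<close> still omits two values away from \<open>0\<close>, which trades the logarithm of the
  hyperbolic metric for the exponent \<open>1 - 1/N\<close>.\<close>

lemma punctured_plane_bound:
  fixes A :: "complex set" and N k :: nat
  assumes fin: "finite A" and cA: "card A \<ge> 2" and N: "N \<ge> 2"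
    and k: "card A * (N - 1) = N + 1 + k"
  obtains C where "C > 0"
    "\<And>f w \<rho>. \<lbrakk>\<rho> > 0; f holomorphic_on ball w \<rho>; \<And>z. z \<in> ball w \<rho> \<Longrightarrow> f z \<notin> A\<rbrakk>
       \<Longrightarrow> (norm (deriv f w) * \<rho>) ^ N * (1 + norm (f w)) ^ k \<le> C * (\<Prod>a\<in>A. norm (f w - a)) ^ (N - 1)"
proof -
  have "\<exists>B. \<forall>a\<in>A. norm a \<le> B" using finite_imp_bounded[OF fin] by (simp add: bounded_iff)
  then obtain r1 where r1: "\<And>a. a \<in> A \<Longrightarrow> norm a \<le> r1" by blast
  define r0 where "r0 = max 1 r1"
  have r0: "r0 \<ge> 1" "\<And>a. a \<in> A \<Longrightarrow> norm a \<le> r0" using r1 by (auto simp: r0_def le_max_iff_disj)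
  obtain \<delta> where \<delta>: "\<delta> > 0" "\<And>a b. a \<in> A \<Longrightarrow> b \<in> A \<Longrightarrow> a \<noteq> b \<Longrightarrow> \<delta> \<le> norm (a - b)"
  proof -
    define D where "D = (\<lambda>(a,b). norm (a - b)) ` {(a,b). a \<in> A \<and> b \<in> A \<and> a \<noteq> b}"
    have "finite D" unfolding D_def
      by (rule finite_imageI, rule finite_subset[of _ "A \<times> A"]) (use fin in auto)
    show ?thesis
    proof (rule that[of "Min (insert 1 D)"])
      show "Min (insert 1 D) > 0" using \<open>finite D\<close> by (auto simp: D_def)
      show "Min (insert 1 D) \<le> norm (a - b)" if "a \<in> A" "b \<in> A" "a \<noteq> b" for a b
        by (rule Min_le) (use \<open>finite D\<close> that in \<open>auto simp: D_def\<close>)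
    qed
  qed
  define P where "P f w \<rho> \<longleftrightarrow> \<rho> > 0 \<and> f holomorphic_on ball w \<rho> \<and> (\<forall>z\<in>ball w \<rho>. f z \<notin> A)"
    for f :: "complex \<Rightarrow> complex" and w :: complex and \<rho> :: real
  have other: "\<exists>b\<in>A. b \<noteq> a" for a
  proof (rule ccontr)
    assume "\<not> ?thesis" then have "A \<subseteq> {a}" by auto
    then have "card A \<le> 1" using card_mono[of "{a}" A] by simp
    then show False using cA by simp
  qed
  have "\<exists>C>0. \<forall>f w \<rho>. P f w \<rho> \<and> norm (f w) \<le> 2*r0+2 \<longrightarrow>
      (norm (deriv f w) * \<rho>) ^ N \<le> C * norm (f w - a) ^ (N - 1)" if "a \<in> A" for a
  proof -
    obtain b where b: "b \<in> A" "a \<noteq> b" using other by metis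
    obtain C where "C > 0" and C: "\<And>f w \<rho>. \<lbrakk>\<rho> > 0; f holomorphic_on ball w \<rho>;
        \<And>z. z \<in> ball w \<rho> \<Longrightarrow> f z \<noteq> a \<and> f z \<noteq> b; norm (f w) \<le> 2*r0+2\<rbrakk>
        \<Longrightarrow> (norm (deriv f w) * \<rho>) ^ N \<le> C * norm (f w - a) ^ (N - 1)"
      using root_bound[OF b(2) N, of "2*r0+2"] by blast
    show ?thesis
    proof (intro exI[of _ C] conjI allI impI; (elim conjE)?)
      fix f w \<rho> assume "P f w \<rho>" "norm (f w) \<le> 2*r0+2"
      then show "(norm (deriv f w) * \<rho>) ^ N \<le> C * norm (f w - a) ^ (N - 1)"
        by (intro C) (use that b in \<open>auto simp: P_def\<close>)
    qed (rule \<open>C > 0\<close>)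
  qed
  then obtain C1 where C1: "\<And>a. a \<in> A \<Longrightarrow> C1 a > 0" "\<And>a f w \<rho>. a \<in> A \<Longrightarrow> P f w \<rho> \<Longrightarrow> norm (f w) \<le> 2*r0+2 \<Longrightarrow>
      (norm (deriv f w) * \<rho>) ^ N \<le> C1 a * norm (f w - a) ^ (N - 1)" by metis
  obtain a0 where a0: "a0 \<in> A" using cA by (metis card.empty ex_in_conv not_numeral_le_zero)
  obtain b0 where b0: "b0 \<in> A" "a0 \<noteq> b0" using other by metis
  obtain C2 where C2: "C2 > 0" "\<And>f w \<rho>. P f w \<rho> \<Longrightarrow> norm (f w - a0) \<ge> 1 \<Longrightarrow>
      (norm (deriv f w) * \<rho>) ^ N \<le> C2 * norm (f w - a0) ^ (N + 1)"
  proof -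
    obtain C where "C > 0" and C: "\<And>f w \<rho>. \<lbrakk>\<rho> > 0; f holomorphic_on ball w \<rho>;
        \<And>z. z \<in> ball w \<rho> \<Longrightarrow> f z \<noteq> a0 \<and> f z \<noteq> b0; norm (f w - a0) \<ge> 1\<rbrakk>
        \<Longrightarrow> (norm (deriv f w) * \<rho>) ^ N \<le> C * norm (f w - a0) ^ (N + 1)"
      using root_bound_at_infinity[OF b0(2) N] by blast
    show ?thesis
    proof (rule that[OF \<open>C > 0\<close>])
      fix f w \<rho> assume "P f w \<rho>" "norm (f w - a0) \<ge> 1"
      then show "(norm (deriv f w) * \<rho>) ^ N \<le> C * norm (f w - a0) ^ (N + 1)"
        by (intro C) (use a0 b0 in \<open>auto simp: P_def\<close>)
    qed
  qed
  define d where "d = (\<delta>/2) ^ (N-1)"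
  have d: "d > 0" using \<delta> by (simp add: d_def)
  define S where "S = (\<Sum>a\<in>A. C1 a)"
  have S: "C1 a \<le> S" "S > 0" if "a \<in> A" for a
  proof -
    show "C1 a \<le> S" unfolding S_def by (rule member_le_sum) (use that C1(1) fin in \<open>auto intro: less_imp_le\<close>)
    then show "S > 0" using C1(1)[OF that] by linarith
  qed
  define K1 where "K1 = S * (3 + 2*r0)^k / d ^ (card A - 1)"
  define K2 where "K2 = C2 * 4 ^ (card A * (N - 1))"
  have K: "K1 > 0" "K2 > 0" using S(2)[OF a0] d C2 r0 by (auto simp: K1_def K2_def)
  show ?thesis
  proof (rule that)
    show "K1 + K2 > 0" using K by simp
  next
    fix f w \<rho> assume \<rho>: "(\<rho>::real) > 0" and hol: "f holomorphic_on ball w \<rho>"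
      and om: "\<And>z. z \<in> ball w \<rho> \<Longrightarrow> f z \<notin> A"
    have P: "P f w \<rho>" using \<rho> hol om by (auto simp: P_def)
    define y where "y = norm (f w)"
    define D where "D = norm (deriv f w) * \<rho>"
    have D0: "D \<ge> 0" using \<rho> by (simp add: D_def)
    have prod0: "(\<Prod>a\<in>A. norm (f w - a)) ^ (N-1) \<ge> 0" by (simp add: prod_nonneg)
    have "D ^ N * (1 + y) ^ k \<le> (K1 + K2) * (\<Prod>a\<in>A. norm (f w - a)) ^ (N - 1)"
    proof (cases "y \<le> 2*r0+2")
      \<comment> \<open>For bounded values only the puncture nearest to \<open>f w\<close> matters,
        since the others stay at distance at least \<delta>/2; at the nearest one
        \<open>root_bound\<close> was applied with an arbitrary second puncture.\<close>
      case True
      have "\<exists>a\<in>A. \<forall>b\<in>A. norm (f w - a) \<le> norm (f w - b)"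
        using ex_min_if_finite[of "(\<lambda>a. norm (f w - a)) ` A"] fin a0
        by (metis (mono_tags, lifting) arg_min_if_finite(1) arg_min_least empty_iff)
      then obtain a where a: "a \<in> A" "\<And>b. b \<in> A \<Longrightarrow> norm (f w - a) \<le> norm (f w - b)" by blast
      have far: "norm (f w - b) \<ge> \<delta>/2" if "b \<in> A - {a}" for b
      proof -
        have "\<delta> \<le> norm (a - b)" using \<delta>(2) a(1) that by auto
        also have "\<dots> \<le> norm (f w - a) + norm (f w - b)"
          using norm_triangle_ineq4[of "f w - b" "f w - a"] by simp
        finally show ?thesis using a(2)[of b] that by auto
      qed
      have "(\<Prod>b\<in>A. norm (f w - b)) = norm (f w - a) * (\<Prod>b\<in>A - {a}. norm (f w - b))"
        using fin a(1) by (rule prod.remove)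
      moreover have "(\<Prod>b\<in>A - {a}. norm (f w - b)) \<ge> (\<Prod>b\<in>A - {a}. \<delta>/2)"
        by (rule prod_mono) (use far \<delta> in auto)
      then have "(\<Prod>b\<in>A - {a}. norm (f w - b)) \<ge> (\<delta>/2) ^ (card A - 1)"
        using a(1) by simp
      ultimately have "(\<Prod>b\<in>A. norm (f w - b)) \<ge> norm (f w - a) * (\<delta>/2) ^ (card A - 1)"
        by (simp add: mult_left_mono)
      then have "(\<Prod>b\<in>A. norm (f w - b)) ^ (N-1) \<ge> (norm (f w - a) * (\<delta>/2) ^ (card A - 1)) ^ (N-1)"
        using \<delta> by (intro power_mono) auto
      then have prod: "(\<Prod>b\<in>A. norm (f w - b)) ^ (N-1) \<ge> norm (f w - a) ^ (N-1) * d ^ (card A - 1)"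
        by (simp add: power_mult_distrib d_def power_mult[symmetric] mult.commute)
      have "D ^ N \<le> C1 a * norm (f w - a) ^ (N - 1)"
        unfolding D_def using C1(2)[OF a(1) P] True by (simp add: y_def)
      also have "\<dots> \<le> S * norm (f w - a) ^ (N - 1)"
        using S(1)[OF a(1)] by (intro mult_right_mono) auto
      finally have "D ^ N * (1+y)^k \<le> (S * norm (f w - a) ^ (N - 1)) * (3 + 2*r0)^k"
        using True D0 S[OF a(1)] by (intro mult_mono power_mono) (auto simp: y_def)
      also have "\<dots> = K1 * (norm (f w - a) ^ (N-1) * d ^ (card A - 1))"
        using d by (simp add: K1_def)
      also have "\<dots> \<le> K1 * (\<Prod>b\<in>A. norm (f w - b)) ^ (N-1)"
        using prod K by (intro mult_left_mono) auto
      also have "\<dots> \<le> (K1 + K2) * (\<Prod>b\<in>A. norm (f w - b)) ^ (N-1)"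
        using prod0 K by (intro mult_right_mono) auto
      finally show ?thesis .
    next
      case False
      \<comment> \<open>Far out all \<open>norm (f w - a)\<close> are comparable to
        \<open>y\<close>, and by the hypothesis on \<open>k\<close> both sides have degree
        \<open>card A * (N - 1)\<close> in \<open>y\<close>.\<close>
      have big: "norm (f w - a) \<ge> y/2" "norm (f w - a) \<ge> 1" "norm (f w - a) \<le> 2*y" if "a \<in> A" for a
        using False r0(1) r0(2)[OF that] norm_triangle_ineq2[of "f w" a] norm_triangle_ineq4[of "f w" a]
        unfolding y_def by linarith+
      have y: "y \<ge> 1" using False r0 by linarith
      have "D ^ N \<le> C2 * norm (f w - a0) ^ (N + 1)"
        unfolding D_def using C2(2)[OF P] big(2)[OF a0] by simp
      also have "\<dots> \<le> C2 * (2*y) ^ (N+1)"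
        using C2 big(3)[OF a0] by (intro mult_left_mono power_mono) auto
      finally have "D ^ N * (1+y)^k \<le> (C2 * (2*y) ^ (N+1)) * (2*y)^k"
        using y D0 C2 by (intro mult_mono power_mono) auto
      also have "\<dots> = C2 * (2*y) ^ (card A * (N-1))"
        using k by (simp add: power_add)
      also have "2 * y = 4 * (y/2)" by simp
      also have "C2 * (4 * (y/2)) ^ (card A * (N-1)) = K2 * (y/2) ^ (card A * (N-1))"
        by (simp only: power_mult_distrib K2_def mult.assoc)
      also have "(y/2) ^ (card A * (N-1)) = (\<Prod>a\<in>A. y/2) ^ (N-1)"
        by (simp add: power_mult)
      also have "K2 * (\<Prod>a\<in>A. y/2) ^ (N-1) \<le> K2 * (\<Prod>a\<in>A. norm (f w - a)) ^ (N-1)"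
        using K y big by (intro mult_left_mono power_mono prod_mono prod_nonneg) auto
      also have "\<dots> \<le> (K1 + K2) * (\<Prod>a\<in>A. norm (f w - a)) ^ (N-1)"
        using prod0 K by (intro mult_right_mono) auto
      finally show ?thesis .
    qed
    then show "(norm (deriv f w) * \<rho>) ^ N * (1 + norm (f w)) ^ k
        \<le> (K1 + K2) * (\<Prod>a\<in>A. norm (f w - a)) ^ (N - 1)"
      by (simp add: D_def y_def)
  qed
qed

subsection \<open>Integral curves of holomorphic vector fields\<close>

lemma is_chartD:
  assumes "is_chart T c"
  shows "openin T (fst c)" "open (snd c ` fst c)" "inj_on (snd c) (fst c)" "fst c \<subseteq> topspace T"
    "\<And>V. openin T V \<Longrightarrow> V \<subseteq> fst c \<Longrightarrow> open (snd c ` V)"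
    "\<And>W. open W \<Longrightarrow> openin T {p \<in> fst c. snd c p \<in> W}"
proof -
  obtain U f where c: "c = (U, f)" by (cases c)
  have U: "openin T U" "open (f ` U)"
    and hom: "homeomorphic_map (subtopology T U) (top_of_set (f ` U)) f"
    using assms by (auto simp: c is_chart_def)
  have UT: "U \<subseteq> topspace T" using U(1) by (rule openin_subset)
  show "openin T (fst c)" "open (snd c ` fst c)" "fst c \<subseteq> topspace T" using U UT c by auto
  show "inj_on (snd c) (fst c)" using homeomorphic_imp_injective_map[OF hom] UT by (simp add: c Int_absorb1)
  show "open (snd c ` V)" if "openin T V" "V \<subseteq> fst c" for V
  proof -
    have "openin (subtopology T U) V" using that U c by (simp add: openin_open_subtopology)
    then have "openin (top_of_set (f ` U)) (f ` V)"
      using homeomorphic_imp_open_map[OF hom] by (auto simp: open_map_def)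
    then show ?thesis using U(2) c by (auto simp: openin_open_eq)
  qed
  show "openin T {p \<in> fst c. snd c p \<in> W}" if "open W" for W
  proof -
    have "continuous_map (subtopology T U) (top_of_set (f ` U)) f"
      using hom by (rule homeomorphic_imp_continuous_map)
    moreover have "openin (top_of_set (f ` U)) (f ` U \<inter> W)" using that by (simp add: openin_open_Int)
    ultimately have "openin (subtopology T U) {x \<in> topspace (subtopology T U). f x \<in> f ` U \<inter> W}"
      by (rule openin_continuous_map_preimage)
    moreover have "{x \<in> topspace (subtopology T U). f x \<in> f ` U \<inter> W} = {p \<in> fst c. snd c p \<in> W}"
      using UT c by auto
    ultimately show ?thesis using U(1) openin_open_subtopology by metis
  qed
qed

lemma has_field_derivative_cong_eventually:
  assumes "(f has_field_derivative D) (at x)" "\<forall>\<^sub>F y in nhds x. f y = g y"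
  shows "(g has_field_derivative D) (at x)"
  using DERIV_cong_ev[OF refl assms(2) refl] assms(1) by blast

lemma isCont_tendsto_nhds: "isCont f x \<Longrightarrow> (f \<longlongrightarrow> f x) (nhds x)"
  by (simp add: continuous_at tendsto_at_iff_tendsto_nhds)

abbreviation chart_inv :: "'a chart \<Rightarrow> complex \<Rightarrow> 'a" where
  "chart_inv c \<equiv> inv_into (fst c) (snd c)"

abbreviation img :: "'a chart \<Rightarrow> complex set" where
  "img c \<equiv> snd c ` fst c"

abbreviation change :: "'a chart \<Rightarrow> 'a chart \<Rightarrow> complex \<Rightarrow> complex" where
  "change c c' \<equiv> snd c' \<circ> chart_inv c"

text \<open>A nonzero complex derivative at every point of every overlap is all that holomorphy of
  the transition maps amounts to.\<close>

locale riemann_surface =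
  fixes T :: "'a topology" and Ch :: "'a chart set"
  assumes hausdorff: "Hausdorff_space T" and connected: "connected_space T"
    and charts: "c \<in> Ch \<Longrightarrow> is_chart T c"
    and cover: "p \<in> topspace T \<Longrightarrow> \<exists>c\<in>Ch. p \<in> fst c"
    and transition: "\<lbrakk>c \<in> Ch; c' \<in> Ch; p \<in> fst c; p \<in> fst c'\<rbrakk>
      \<Longrightarrow> \<exists>d. d \<noteq> 0 \<and> (change c c' has_field_derivative d) (at (snd c p))"
begin

lemmas chart_open = is_chartD(1)[OF charts] and chart_open_range = is_chartD(2)[OF charts]
  and chart_inj = is_chartD(3)[OF charts] and chart_subset = is_chartD(4)[OF charts]
  and chart_open_image = is_chartD(5)[OF charts] and chart_open_vimage = is_chartD(6)[OF charts]

lemma chart_inv_in: "z \<in> img c \<Longrightarrow> chart_inv c z \<in> fst c"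
  by (rule inv_into_into)

lemma chart_chart_inv: "z \<in> img c \<Longrightarrow> snd c (chart_inv c z) = z"
  by (rule f_inv_into_f)

lemma chart_inv_chart: "c \<in> Ch \<Longrightarrow> p \<in> fst c \<Longrightarrow> chart_inv c (snd c p) = p"
  by (rule inv_into_f_f[OF chart_inj])

lemma chart_nhd:
  assumes "c \<in> Ch" "p \<in> fst c" "openin T V" "p \<in> V"
  obtains r where "r > 0" "\<And>z. z \<in> ball (snd c p) r \<Longrightarrow> chart_inv c z \<in> fst c \<inter> V"
proof -
  have "open (snd c ` (fst c \<inter> V))" using assms by (intro chart_open_image openin_Int chart_open) auto
  then obtain r where r: "r > 0" "ball (snd c p) r \<subseteq> snd c ` (fst c \<inter> V)"
    using assms open_contains_ball by blast
  have "chart_inv c z \<in> fst c \<inter> V" if "z \<in> ball (snd c p) r" for z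
    using r(2) that chart_inv_chart[OF assms(1)] by fastforce
  then show ?thesis using that r by blast
qed

end

text \<open>\<open>v c\<close> is the coefficient of the field in the chart \<open>c\<close>; the
  second assumption is the transformation law of vector fields.\<close>

locale holomorphic_vector_field = riemann_surface T Ch
  for T :: "'a topology" and Ch :: "'a chart set" +
  fixes v :: "'a chart \<Rightarrow> 'a \<Rightarrow> complex"
  assumes v_holomorphic: "c \<in> Ch \<Longrightarrow> (\<lambda>z. v c (chart_inv c z)) holomorphic_on img c"
    and v_transition: "\<lbrakk>c \<in> Ch; c' \<in> Ch; p \<in> fst c; p \<in> fst c';
      (change c c' has_field_derivative d) (at (snd c p))\<rbrakk> \<Longrightarrow> v c' p = d * v c p"
begin

text \<open>A complex-time integral curve of \<open>v\<close> through nonzero points of \<open>v\<close>; equivalently, a local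
  isometry from the plane to the flat metric for which \<open>v\<close> is a unit parallel field.\<close>

definition sol :: "(complex \<Rightarrow> 'a) \<Rightarrow> complex set \<Rightarrow> bool" where
  "sol \<Phi> \<Omega> \<longleftrightarrow> (\<forall>w\<in>\<Omega>. \<Phi> w \<in> topspace T \<and> (\<forall>c\<in>Ch. \<Phi> w \<in> fst c \<longrightarrow>
     (\<forall>\<^sub>F w' in nhds w. \<Phi> w' \<in> fst c) \<and>
     ((snd c \<circ> \<Phi>) has_field_derivative v c (\<Phi> w)) (at w) \<and> v c (\<Phi> w) \<noteq> 0))"

lemma solD:
  assumes "sol \<Phi> \<Omega>" "w \<in> \<Omega>"
  shows "\<Phi> w \<in> topspace T"
    "\<And>c. c \<in> Ch \<Longrightarrow> \<Phi> w \<in> fst c \<Longrightarrow> (\<forall>\<^sub>F w' in nhds w. \<Phi> w' \<in> fst c)"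
    "\<And>c. c \<in> Ch \<Longrightarrow> \<Phi> w \<in> fst c \<Longrightarrow> ((snd c \<circ> \<Phi>) has_field_derivative v c (\<Phi> w)) (at w)"
    "\<And>c. c \<in> Ch \<Longrightarrow> \<Phi> w \<in> fst c \<Longrightarrow> v c (\<Phi> w) \<noteq> 0"
  using assms by (auto simp: sol_def)

lemma sol_subset: "sol \<Phi> \<Omega> \<Longrightarrow> \<Omega>' \<subseteq> \<Omega> \<Longrightarrow> sol \<Phi> \<Omega>'"
  by (auto simp: sol_def)

text \<open>\<open>sol\<close> quantifies over all charts so that a solution can be examined in any
  of them; by the transformation law of \<open>v\<close> one chart is enough to establish
  it.\<close>

lemma sol_one_chart:
  assumes "c \<in> Ch" "\<Phi> w \<in> fst c" "\<forall>\<^sub>F w' in nhds w. \<Phi> w' \<in> fst c"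
    "((snd c \<circ> \<Phi>) has_field_derivative v c (\<Phi> w)) (at w)" "v c (\<Phi> w) \<noteq> 0"
  shows "sol \<Phi> {w}"
proof -
  have lim: "((snd c \<circ> \<Phi>) \<longlongrightarrow> (snd c \<circ> \<Phi>) w) (nhds w)"
    by (rule isCont_tendsto_nhds[OF DERIV_isCont[OF assms(4)]])
  have "(\<forall>\<^sub>F w' in nhds w. \<Phi> w' \<in> fst c') \<and>
     ((snd c' \<circ> \<Phi>) has_field_derivative v c' (\<Phi> w)) (at w) \<and> v c' (\<Phi> w) \<noteq> 0"
    if c': "c' \<in> Ch" "\<Phi> w \<in> fst c'" for c'
  proof -
    obtain r where r: "r > 0" "\<And>z. z \<in> ball (snd c (\<Phi> w)) r \<Longrightarrow> chart_inv c z \<in> fst c \<inter> fst c'"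
      using chart_nhd[OF assms(1,2) chart_open[OF c'(1)] c'(2)] by metis
    have "\<forall>\<^sub>F w' in nhds w. snd c (\<Phi> w') \<in> ball (snd c (\<Phi> w)) r"
      using topological_tendstoD[OF lim open_ball, of "snd c (\<Phi> w)" r] r(1) by simp
    then have ev: "\<forall>\<^sub>F w' in nhds w. \<Phi> w' \<in> fst c'"
      using assms(3)
    proof eventually_elim
      case (elim w')
      then show ?case using r(2)[OF elim(1)] chart_inv_chart[OF assms(1) elim(2)] by simp
    qed
    obtain d where d: "d \<noteq> 0" "(change c c' has_field_derivative d) (at (snd c (\<Phi> w)))"
      using transition[OF assms(1) c'(1) assms(2) c'(2)] by blast
    have "(change c c' \<circ> (snd c \<circ> \<Phi>) has_field_derivative d * v c (\<Phi> w)) (at w)"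
      by (rule DERIV_chain) (use d assms(4) in auto)
    moreover have "\<forall>\<^sub>F w' in nhds w. (change c c' \<circ> (snd c \<circ> \<Phi>)) w' = (snd c' \<circ> \<Phi>) w'"
      using assms(3) by eventually_elim (simp add: chart_inv_chart[OF assms(1)])
    ultimately have "((snd c' \<circ> \<Phi>) has_field_derivative d * v c (\<Phi> w)) (at w)"
      by (rule has_field_derivative_cong_eventually)
    then show ?thesis using v_transition[OF assms(1) c'(1) assms(2) c'(2) d(2)] ev d(1) assms(5) by simp
  qed
  then show ?thesis using assms(2) chart_subset[OF assms(1)] unfolding sol_def by blast
qed

lemma sol_pointwise: "(\<And>w. w \<in> \<Omega> \<Longrightarrow> sol \<Phi> {w}) \<Longrightarrow> sol \<Phi> \<Omega>"
  unfolding sol_def by blast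

lemma sol_cong:
  assumes "sol \<Phi> \<Omega>" "open \<Omega>" "\<And>w. w \<in> \<Omega> \<Longrightarrow> \<Psi> w = \<Phi> w"
  shows "sol \<Psi> \<Omega>"
proof (rule sol_pointwise)
  fix w assume w: "w \<in> \<Omega>"
  note D = solD[OF assms(1) w]
  have ev: "\<forall>\<^sub>F w' in nhds w. \<Psi> w' = \<Phi> w'"
    using eventually_nhds_in_open[OF assms(2) w] by eventually_elim (rule assms(3))
  obtain c where c: "c \<in> Ch" "\<Phi> w \<in> fst c" using cover D(1) by blast
  show "sol \<Psi> {w}"
  proof (rule sol_one_chart[OF c(1)])
    show "\<Psi> w \<in> fst c" "v c (\<Psi> w) \<noteq> 0" using c D(4)[OF c] assms(3)[OF w] by auto
    show "\<forall>\<^sub>F w' in nhds w. \<Psi> w' \<in> fst c"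
      using D(2)[OF c] ev by eventually_elim simp
    have "\<forall>\<^sub>F w' in nhds w. (snd c \<circ> \<Phi>) w' = (snd c \<circ> \<Psi>) w'"
      using ev by eventually_elim simp
    then show "((snd c \<circ> \<Psi>) has_field_derivative v c (\<Psi> w)) (at w)"
      unfolding assms(3)[OF w] by (rule has_field_derivative_cong_eventually[OF D(3)[OF c]])
  qed
qed

lemma sol_shift:
  assumes "sol \<Phi> \<Omega>"
  shows "sol (\<lambda>w. \<Phi> (w - b)) ((\<lambda>w. w + b) ` \<Omega>)"
proof (rule sol_pointwise)
  fix w assume "w \<in> (\<lambda>w. w + b) ` \<Omega>"
  then have w: "w - b \<in> \<Omega>" by auto
  note D = solD[OF assms(1) w]
  obtain c where c: "c \<in> Ch" "\<Phi> (w - b) \<in> fst c" using cover D(1) by blast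
  have lim: "filterlim (\<lambda>w. w - b) (nhds (w - b)) (nhds w)"
    by (intro tendsto_intros filterlim_ident)
  show "sol (\<lambda>w. \<Phi> (w - b)) {w}"
  proof (rule sol_one_chart[of c "\<lambda>w. \<Phi> (w - b)", OF c])
    show "\<forall>\<^sub>F w' in nhds w. \<Phi> (w' - b) \<in> fst c"
      using eventually_compose_filterlim[OF D(2)[OF c] lim] .
    have "(((snd c \<circ> \<Phi>) \<circ> (\<lambda>w. w - b)) has_field_derivative v c (\<Phi> (w - b)) * 1) (at w)"
      by (rule DERIV_chain) (use D(3)[OF c] in \<open>auto intro!: derivative_eq_intros\<close>)
    then show "((snd c \<circ> (\<lambda>w. \<Phi> (w - b))) has_field_derivative v c (\<Phi> (w - b))) (at w)"
      by (simp add: o_def)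
  qed (rule D(4)[OF c])
qed

lemma sol_eventually:
  assumes "sol \<Phi> \<Omega>" "w \<in> \<Omega>" "openin T V" "\<Phi> w \<in> V"
  shows "\<forall>\<^sub>F w' in nhds w. \<Phi> w' \<in> V"
proof -
  note D = solD[OF assms(1,2)]
  obtain c where c: "c \<in> Ch" "\<Phi> w \<in> fst c" using cover D(1) by blast
  have lim: "((snd c \<circ> \<Phi>) \<longlongrightarrow> (snd c \<circ> \<Phi>) w) (nhds w)"
    by (rule isCont_tendsto_nhds[OF DERIV_isCont[OF D(3)[OF c]]])
  obtain r where r: "r > 0" "\<And>z. z \<in> ball (snd c (\<Phi> w)) r \<Longrightarrow> chart_inv c z \<in> fst c \<inter> V"
    using chart_nhd[OF c assms(3,4)] by metis
  have "\<forall>\<^sub>F w' in nhds w. snd c (\<Phi> w') \<in> ball (snd c (\<Phi> w)) r"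
    using topological_tendstoD[OF lim open_ball, of "snd c (\<Phi> w)" r] r(1) by simp
  then show ?thesis
    using D(2)[OF c]
  proof eventually_elim
    case (elim w')
    then show ?case using r(2)[OF elim(1)] chart_inv_chart[OF c(1) elim(2)] by simp
  qed
qed

text \<open>A primitive \<open>W\<close> of 1/v straightens the field to the constant 1, so that
  integral curves become translations in the coordinate \<open>W\<close>.\<close>

lemma flow_box:
  assumes c: "c \<in> Ch" "q \<in> fst c" and vq: "v c q \<noteq> 0"
  obtains r W where "r > 0" "ball (snd c q) r \<subseteq> img c" "inj_on W (ball (snd c q) r)"
    "\<And>z. z \<in> ball (snd c q) r \<Longrightarrow> v c (chart_inv c z) \<noteq> 0"
    "\<And>z. z \<in> ball (snd c q) r \<Longrightarrow> (W has_field_derivative 1 / v c (chart_inv c z)) (at z)"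
proof -
  define V where "V z = v c (chart_inv c z)" for z
  have hV: "V holomorphic_on img c" unfolding V_def[abs_def] by (rule v_holomorphic[OF c(1)])
  have z0: "snd c q \<in> img c" using c by simp
  have "open {z \<in> img c. V z \<in> - {0}}"
    using continuous_open_preimage[OF holomorphic_on_imp_continuous_on[OF hV] chart_open_range[OF c(1)], of "- {0}"]
    unfolding vimage_def by (rule back_subst[where P="open"]) auto
  moreover have "snd c q \<in> {z \<in> img c. V z \<in> - {0}}"
    using z0 vq chart_inv_chart[OF c] by (simp add: V_def)
  ultimately obtain r1 where r1: "r1 > 0" "ball (snd c q) r1 \<subseteq> {z \<in> img c. V z \<in> - {0}}"
    using open_contains_ball by blast
  have hk: "(\<lambda>z. 1 / V z) holomorphic_on ball (snd c q) r1"
    by (intro holomorphic_intros holomorphic_on_subset[OF hV]) (use r1 in auto)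
  obtain W where W: "\<And>z. z \<in> ball (snd c q) r1 \<Longrightarrow> (W has_field_derivative 1 / V z) (at z within ball (snd c q) r1)"
    using holomorphic_convex_primitive'[OF convex_ball open_ball hk] by blast
  have W': "(W has_field_derivative 1 / V z) (at z)" if "z \<in> ball (snd c q) r1" for z
    using W[OF that] unfolding at_within_open[OF that open_ball] .
  have hW: "W holomorphic_on ball (snd c q) r1"
    using W' holomorphic_on_open[OF open_ball] by blast
  have "deriv W (snd c q) \<noteq> 0"
    using DERIV_imp_deriv[OF W'[of "snd c q"]] r1 subsetD[OF r1(2), of "snd c q"] by simp
  then obtain r where r: "r > 0" "ball (snd c q) r \<subseteq> ball (snd c q) r1" "inj_on W (ball (snd c q) r)"
    using has_complex_derivative_locally_injective[OF hW _ open_ball] r1(1) by (metis centre_in_ball)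
  show ?thesis
  proof (rule that[OF r(1) _ r(3)])
    show "ball (snd c q) r \<subseteq> img c" using r(2) r1(2) by blast
    show "v c (chart_inv c z) \<noteq> 0" "(W has_field_derivative 1 / v c (chart_inv c z)) (at z)"
      if "z \<in> ball (snd c q) r" for z
      using W' r(2) r1(2) that unfolding V_def by blast+
  qed
qed

text \<open>The point is that the existence time is uniform near \<open>q\<close>:
  \<open>sol_extend\<close> can then start slightly before a limit point and still run past
  it.\<close>

lemma local_sol:
  assumes c: "c \<in> Ch" "q \<in> fst c" and vq: "v c q \<noteq> 0"
  obtains \<epsilon> V where "\<epsilon> > 0" "openin T V" "q \<in> V"
    "\<And>q'. q' \<in> V \<Longrightarrow> \<exists>\<Phi>. sol \<Phi> (ball 0 \<epsilon>) \<and> \<Phi> 0 = q'"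
proof -
  obtain r W where r: "r > 0" "ball (snd c q) r \<subseteq> img c" "inj_on W (ball (snd c q) r)"
    and vz: "\<And>z. z \<in> ball (snd c q) r \<Longrightarrow> v c (chart_inv c z) \<noteq> 0"
    and W: "\<And>z. z \<in> ball (snd c q) r \<Longrightarrow> (W has_field_derivative 1 / v c (chart_inv c z)) (at z)"
    using flow_box[OF assms] by blast
  let ?B = "ball (snd c q) r"
  have hW: "W holomorphic_on ?B" using W holomorphic_on_open[OF open_ball] by blast
  obtain H where H: "H holomorphic_on (W ` ?B)" "\<And>z. z \<in> ?B \<Longrightarrow> deriv W z * deriv H (W z) = 1"
    "\<And>z. z \<in> ?B \<Longrightarrow> H (W z) = z"
    using holomorphic_has_inverse[OF hW open_ball r(3)] by blast
  have oW: "open (W ` ?B)" by (rule open_mapping_thm3[OF hW open_ball r(3)])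
  then obtain e where e: "e > 0" "ball (W (snd c q)) e \<subseteq> W ` ?B"
    using r(1) open_contains_ball by (metis centre_in_ball imageI)
  \<comment> \<open>Starting points are taken from half of the disc, so that times up to
    \<open>e/2\<close> keep the coordinate \<open>W\<close> inside the disc.\<close>
  define D where "D = {z \<in> ?B. W z \<in> ball (W (snd c q)) (e/2)}"
  have oD: "open D"
    using continuous_open_preimage[OF holomorphic_on_imp_continuous_on[OF hW] open_ball open_ball, of "W (snd c q)" "e/2"]
    unfolding D_def vimage_def by (rule back_subst[where P="open"]) auto
  show ?thesis
  proof (rule that[of "e/2" "{p \<in> fst c. snd c p \<in> D}"])
    show "e/2 > 0" using e by simp
    show "openin T {p \<in> fst c. snd c p \<in> D}" by (rule chart_open_vimage[OF c(1) oD])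
    show "q \<in> {p \<in> fst c. snd c p \<in> D}" using c e r by (simp add: D_def)
  next
    fix q' assume "q' \<in> {p \<in> fst c. snd c p \<in> D}"
    then have q': "q' \<in> fst c" "snd c q' \<in> ?B" "dist (W (snd c q)) (W (snd c q')) < e/2"
      by (auto simp: D_def)
    define y where "y w = H (W (snd c q') + w)" for w
    have in_e: "W (snd c q') + w \<in> W ` ?B" if "w \<in> ball 0 (e/2)" for w
    proof -
      have "dist (W (snd c q)) (W (snd c q') + w) \<le> dist (W (snd c q)) (W (snd c q')) + norm w"
        using dist_triangle[of "W (snd c q)" "W (snd c q') + w" "W (snd c q')"] by (simp add: dist_norm)
      then show ?thesis using q'(3) that e(2) by auto
    qed
    have yB: "y w \<in> ?B" if "w \<in> ball 0 (e/2)" for w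
      using in_e[OF that] H(3) unfolding y_def by auto
    have y': "(y has_field_derivative v c (chart_inv c (y w))) (at w)" if w: "w \<in> ball 0 (e/2)" for w
    proof -
      obtain z where z: "z \<in> ?B" "W (snd c q') + w = W z" using in_e[OF w] by auto
      have dW: "deriv W z = 1 / v c (chart_inv c z)" using W[OF z(1)] by (rule DERIV_imp_deriv)
      have dH: "deriv H (W z) = v c (chart_inv c z)"
        using H(2)[OF z(1)] vz[OF z(1)] unfolding dW by (simp add: field_simps)
      have "(H has_field_derivative v c (chart_inv c z)) (at (W (snd c q') + w))"
        unfolding z(2) using holomorphic_derivI[OF H(1) oW] z(1) dH by (metis imageI)
      then have "((\<lambda>w. H (W (snd c q') + w)) has_field_derivative v c (chart_inv c z) * 1) (at w)"
        by (rule DERIV_chain2) (auto intro!: derivative_eq_intros)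
      moreover have "y w = z" unfolding y_def z(2) by (rule H(3)[OF z(1)])
      ultimately show ?thesis by (simp add: y_def[abs_def])
    qed
    define \<Phi> where "\<Phi> w = chart_inv c (y w)" for w
    have yU: "y w \<in> img c" if "w \<in> ball 0 (e/2)" for w using yB[OF that] r(2) by blast
    have \<Phi>c: "\<Phi> w \<in> fst c" "snd c (\<Phi> w) = y w" if "w \<in> ball 0 (e/2)" for w
      using chart_inv_in[OF yU[OF that]] chart_chart_inv[OF yU[OF that]] by (auto simp: \<Phi>_def)
    have "sol \<Phi> (ball 0 (e/2))"
    proof (rule sol_pointwise)
      fix w :: complex assume w: "w \<in> ball 0 (e/2)"
      have ev: "\<forall>\<^sub>F w' in nhds w. w' \<in> ball 0 (e/2)" by (rule eventually_nhds_in_open[OF open_ball w])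
      show "sol \<Phi> {w}"
      proof (rule sol_one_chart[where \<Phi>=\<Phi> and w=w, OF c(1) \<Phi>c(1)[OF w]])
        show "\<forall>\<^sub>F w' in nhds w. \<Phi> w' \<in> fst c" using ev by eventually_elim (rule \<Phi>c)
        have "\<forall>\<^sub>F w' in nhds w. y w' = (snd c \<circ> \<Phi>) w'" using ev by eventually_elim (simp add: \<Phi>c)
        then show "((snd c \<circ> \<Phi>) has_field_derivative v c (\<Phi> w)) (at w)"
          using has_field_derivative_cong_eventually[OF y'[OF w]] by (simp only: \<Phi>_def)
        show "v c (\<Phi> w) \<noteq> 0" unfolding \<Phi>_def by (rule vz[OF yB[OF w]])
      qed
    qed
    moreover have "\<Phi> 0 = q'"
      unfolding \<Phi>_def y_def using H(3)[OF q'(2)] chart_inv_chart[OF c(1) q'(1)] by simp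
    ultimately show "\<exists>\<Phi>. sol \<Phi> (ball 0 (e/2)) \<and> \<Phi> 0 = q'" by blast
  qed
qed

text \<open>In a flow box both curves have derivative 1 in the coordinate \<open>W\<close>, so
  agreement at a point spreads to a disc; disagreement is open because the surface is Hausdorff.
  Connectedness leaves only one of the two.\<close>

lemma sol_unique:
  assumes sol1: "sol \<Phi>1 \<Omega>" and sol2: "sol \<Phi>2 \<Omega>" and \<Omega>: "open \<Omega>" "connected \<Omega>"
    and w0: "w0 \<in> \<Omega>" "\<Phi>1 w0 = \<Phi>2 w0" and w: "w \<in> \<Omega>"
  shows "\<Phi>1 w = \<Phi>2 w"
proof (rule ccontr)
  assume ne: "\<Phi>1 w \<noteq> \<Phi>2 w"
  define E where "E = {w \<in> \<Omega>. \<Phi>1 w = \<Phi>2 w}"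
  define F where "F = {w \<in> \<Omega>. \<Phi>1 w \<noteq> \<Phi>2 w}"
  have oE: "open E"
    unfolding open_subopen[of E]
  proof
    fix w assume "w \<in> E"
    then have w: "w \<in> \<Omega>" "\<Phi>1 w = \<Phi>2 w" by (auto simp: E_def)
    obtain c where c: "c \<in> Ch" "\<Phi>1 w \<in> fst c" using cover solD(1)[OF sol1 w(1)] by blast
    obtain r W where r: "r > 0" "ball (snd c (\<Phi>1 w)) r \<subseteq> img c" "inj_on W (ball (snd c (\<Phi>1 w)) r)"
      and vz: "\<And>z. z \<in> ball (snd c (\<Phi>1 w)) r \<Longrightarrow> v c (chart_inv c z) \<noteq> 0"
      and W: "\<And>z. z \<in> ball (snd c (\<Phi>1 w)) r \<Longrightarrow> (W has_field_derivative 1 / v c (chart_inv c z)) (at z)"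
      using flow_box[OF c solD(4)[OF sol1 w(1) c]] by blast
    define V where "V = {p \<in> fst c. snd c p \<in> ball (snd c (\<Phi>1 w)) r}"
    have V: "openin T V" "\<Phi>1 w \<in> V" using chart_open_vimage[OF c(1) open_ball] c r(1) by (auto simp: V_def)
    have "\<forall>\<^sub>F w' in nhds w. \<Phi>1 w' \<in> V \<and> \<Phi>2 w' \<in> V \<and> w' \<in> \<Omega>"
      using sol_eventually[OF sol1 w(1) V] sol_eventually[OF sol2 w(1) V(1)] V(2) w(2)
        eventually_nhds_in_open[OF \<Omega>(1) w(1)] by (simp add: eventually_conj_iff)
    then obtain d where d: "d > 0" "\<And>w'. w' \<in> ball w d \<Longrightarrow> \<Phi>1 w' \<in> V \<and> \<Phi>2 w' \<in> V \<and> w' \<in> \<Omega>"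
      unfolding eventually_nhds_metric by (auto simp: dist_commute)
    have der: "((\<lambda>w. W (snd c (\<Phi> w))) has_field_derivative 1) (at w')"
      if "sol \<Phi> \<Omega>" "\<Phi> w' \<in> V" "w' \<in> \<Omega>" for \<Phi> w'
    proof -
      have U: "\<Phi> w' \<in> fst c" "snd c (\<Phi> w') \<in> ball (snd c (\<Phi>1 w)) r" using that by (auto simp: V_def)
      have "(W has_field_derivative 1 / v c (chart_inv c (snd c (\<Phi> w')))) (at ((snd c \<circ> \<Phi>) w'))"
        using W[OF U(2)] by simp
      from DERIV_chain2[OF this solD(3)[OF that(1,3) c(1) U(1)]]
      show ?thesis using solD(4)[OF that(1,3) c(1) U(1)] chart_inv_chart[OF c(1) U(1)] by simp
    qed
    have "\<Phi>1 w' = \<Phi>2 w'" if w': "w' \<in> ball w d" for w'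
    proof -
      have "\<exists>k. \<forall>w'\<in>ball w d. W (snd c (\<Phi>1 w')) - W (snd c (\<Phi>2 w')) = k"
      proof (rule has_field_derivative_zero_constant[OF convex_ball])
        fix w' assume "w' \<in> ball w d"
        note w' = d(2)[OF this]
        have "((\<lambda>w. W (snd c (\<Phi>1 w)) - W (snd c (\<Phi>2 w))) has_field_derivative 1 - 1) (at w')"
          using w' by (intro DERIV_diff der sol1 sol2) auto
        then show "((\<lambda>w. W (snd c (\<Phi>1 w)) - W (snd c (\<Phi>2 w))) has_field_derivative 0) (at w' within ball w d)"
          by (simp add: has_field_derivative_at_within)
      qed
      then have "W (snd c (\<Phi>1 w')) = W (snd c (\<Phi>2 w'))"
        using w' d(1) w(2) by (metis centre_in_ball right_minus_eq)
      moreover have "snd c (\<Phi>1 w') \<in> ball (snd c (\<Phi>1 w)) r" "snd c (\<Phi>2 w') \<in> ball (snd c (\<Phi>1 w)) r"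
        "\<Phi>1 w' \<in> fst c" "\<Phi>2 w' \<in> fst c"
        using d(2)[OF w'] by (auto simp: V_def)
      ultimately show ?thesis using r(3) chart_inj[OF c(1)] by (meson inj_onD)
    qed
    then have "ball w d \<subseteq> E" using d by (auto simp: E_def)
    then show "\<exists>T. open T \<and> w \<in> T \<and> T \<subseteq> E" using d(1) by (intro exI[of _ "ball w d"]) auto
  qed
  have oF: "open F"
    unfolding open_subopen[of F]
  proof
    fix w assume "w \<in> F"
    then have w: "w \<in> \<Omega>" "\<Phi>1 w \<noteq> \<Phi>2 w" by (auto simp: F_def)
    obtain U V where UV: "openin T U" "openin T V" "\<Phi>1 w \<in> U" "\<Phi>2 w \<in> V" "disjnt U V"
      using hausdorff w solD(1)[OF sol1 w(1)] solD(1)[OF sol2 w(1)] unfolding Hausdorff_space_def by metis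
    have "\<forall>\<^sub>F w' in nhds w. w' \<in> F"
      using sol_eventually[OF sol1 w(1) UV(1,3)] sol_eventually[OF sol2 w(1) UV(2,4)]
        eventually_nhds_in_open[OF \<Omega>(1) w(1)]
    proof eventually_elim
      case (elim w')
      then have "\<Phi>1 w' \<noteq> \<Phi>2 w'" using UV(5) by (auto simp: disjnt_def)
      then show ?case using elim(3) by (simp add: F_def)
    qed
    then show "\<exists>T. open T \<and> w \<in> T \<and> T \<subseteq> F"
      unfolding eventually_nhds by blast
  qed
  have "E \<inter> F \<inter> \<Omega> = {}" "\<Omega> \<subseteq> E \<union> F" unfolding E_def F_def by blast+
  from connectedD[OF \<Omega>(2) oE oF this]
  show False using w0 ne w unfolding E_def F_def by blast
qed

text \<open>Near a zero the field is at most linear in the distance, so a curve approaches the zero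
  at most exponentially and cannot arrive in finite time. A curve that already sits at the zero is
  excluded by the definition of \<open>sol\<close>.\<close>

lemma sol_limit_nonzero:
  assumes sol: "sol \<Phi> (ball 0 R)" and a: "norm a = R" and R: "R > 0"
    and lim: "limitin T (\<lambda>t. \<Phi> (of_real t * a)) q (at_left 1)"
    and c: "c \<in> Ch" "q \<in> fst c"
  shows "v c q \<noteq> 0"
proof
  assume v0: "v c q = 0"
  define z0 where "z0 = snd c q"
  define V where "V z = v c (chart_inv c z)" for z
  have hV: "V holomorphic_on img c" unfolding V_def[abs_def] by (rule v_holomorphic[OF c(1)])
  note oU = chart_open_range[OF c(1)]
  have "z0 \<in> img c" using c by (simp add: z0_def)
  then obtain r where r: "r > 0" "cball z0 r \<subseteq> img c" using oU open_contains_cball by blast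
  have "compact (deriv V ` cball z0 r)"
    by (intro compact_continuous_image compact_cball continuous_on_subset[OF holomorphic_on_imp_continuous_on[OF holomorphic_deriv[OF hV oU]] r(2)])
  then obtain B where "\<forall>y \<in> deriv V ` cball z0 r. norm y \<le> B"
    using compact_imp_bounded bounded_iff by metis
  then have B: "\<And>z. z \<in> cball z0 r \<Longrightarrow> norm (deriv V z) \<le> B" by simp
  have Vz0: "V z0 = 0" using v0 chart_inv_chart[OF c] by (simp add: V_def z0_def)
  have Vb: "norm (V z) \<le> B * norm (z - z0)" if "z \<in> ball z0 r" for z
  proof -
    have "norm (V z - V z0) \<le> B * norm (z - z0)"
    proof (rule field_differentiable_bound[OF convex_cball, of z0 r])
      show "(V has_field_derivative deriv V z) (at z within cball z0 r)" if "z \<in> cball z0 r" for z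
        using holomorphic_derivI[OF hV oU] that r(2) by blast
    qed (use B r that in auto)
    then show ?thesis by (simp add: Vz0)
  qed
  define z where "z t = snd c (\<Phi> (of_real t * a))" for t :: real
  have ev: "\<forall>\<^sub>F t in at_left 1. \<Phi> (of_real t * a) \<in> fst c \<and> z t \<in> ball z0 e" if "e > 0" for e
  proof -
    have "openin T {p \<in> fst c. snd c p \<in> ball z0 e}" by (rule chart_open_vimage[OF c(1) open_ball])
    moreover have "q \<in> {p \<in> fst c. snd c p \<in> ball z0 e}" using c that by (simp add: z0_def)
    ultimately show ?thesis using lim unfolding limitin_def z_def by fastforce
  qed
  have zlim: "(z \<longlongrightarrow> z0) (at_left 1)"
    by (rule tendstoI, rule eventually_mono[OF ev]) (auto simp: dist_commute)
  obtain t0 where t0: "t0 < 1" "\<And>t. t0 < t \<Longrightarrow> t < 1 \<Longrightarrow> \<Phi> (of_real t * a) \<in> fst c \<and> z t \<in> ball z0 r"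
    using ev[OF r(1)] unfolding eventually_at_left_field by blast
  define t1 where "t1 = max t0 0"
  have t1: "t1 < 1" "\<And>t. t1 < t \<Longrightarrow> t < 1 \<Longrightarrow> \<Phi> (of_real t * a) \<in> fst c \<and> z t \<in> ball z0 r \<and> of_real t * a \<in> ball 0 R"
    using t0 a R by (auto simp: t1_def norm_mult)
  \<comment> \<open>Gronwall's weight: as |V| is at most B |z - z0| and |a| = R, the function
    \<open>u\<close> cannot decrease. Since it tends to 0 at 1, it vanishes at earlier parameters
    too.\<close>
  define u where "u t = (z t - z0) \<bullet> (z t - z0) * exp (2 * B * R * t)" for t
  have u': "\<exists>y. (u has_real_derivative y) (at t) \<and> 0 \<le> y" if t: "t1 < t" "t < 1" for t
  proof -
    note T = t1(2)[OF t]
    have "(snd c \<circ> \<Phi> has_field_derivative v c (\<Phi> (of_real t * a))) (at (of_real t * a))"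
      using solD(3)[OF sol _ c(1)] T by blast
    moreover have "((\<lambda>t. of_real t * a) has_vector_derivative a) (at t)"
      by (auto intro!: derivative_eq_intros)
    ultimately have "(snd c \<circ> \<Phi> \<circ> (\<lambda>t. of_real t * a) has_vector_derivative a * v c (\<Phi> (of_real t * a))) (at t)"
      by (intro field_vector_diff_chain_at)
    moreover have "v c (\<Phi> (of_real t * a)) = V (z t)"
      using T chart_inv_chart[OF c(1)] by (simp add: V_def z_def)
    ultimately have z': "(z has_vector_derivative a * V (z t)) (at t)" by (simp add: z_def[abs_def] o_def)
    have "((\<lambda>t. (z t - z0) \<bullet> (z t - z0)) has_vector_derivative (z t - z0) \<bullet> (a * V (z t)) + (a * V (z t)) \<bullet> (z t - z0)) (at t)"
      by (rule bounded_bilinear.has_vector_derivative[OF bounded_bilinear_inner])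
         (auto intro!: derivative_eq_intros z')
    then have i': "((\<lambda>t. (z t - z0) \<bullet> (z t - z0)) has_real_derivative 2 * ((z t - z0) \<bullet> (a * V (z t)))) (at t)"
      by (simp add: has_real_derivative_iff_has_vector_derivative inner_commute)
    have "(u has_real_derivative 2 * ((z t - z0) \<bullet> (a * V (z t))) * exp (2*B*R*t)
        + (z t - z0) \<bullet> (z t - z0) * (exp (2*B*R*t) * (2*B*R))) (at t)"
      unfolding u_def[abs_def] by (auto intro!: derivative_eq_intros i')
    moreover have "- ((z t - z0) \<bullet> (a * V (z t))) \<le> B * R * ((z t - z0) \<bullet> (z t - z0))"
    proof -
      have "- ((z t - z0) \<bullet> (a * V (z t))) \<le> norm (z t - z0) * norm (a * V (z t))"
        using Cauchy_Schwarz_ineq2[of "z t - z0" "a * V (z t)"] by linarith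
      also have "\<dots> \<le> norm (z t - z0) * (R * (B * norm (z t - z0)))"
        using Vb[of "z t"] T a R by (intro mult_left_mono) (auto simp: norm_mult intro!: mult_left_mono)
      also have "\<dots> = B * R * ((z t - z0) \<bullet> (z t - z0))" by (simp add: dot_square_norm power2_eq_square)
      finally show ?thesis .
    qed
    then have "0 \<le> (2 * ((z t - z0) \<bullet> (a * V (z t))) + 2 * (B * R * ((z t - z0) \<bullet> (z t - z0)))) * exp (2*B*R*t)"
      by (intro mult_nonneg_nonneg) auto
    ultimately show ?thesis by (intro exI conjI) (assumption, simp add: algebra_simps)
  qed
  define s where "s = (t1 + 1) / 2"
  have s: "t1 < s" "s < 1" using t1(1) by (auto simp: s_def)
  have "(u \<longlongrightarrow> (z0 - z0) \<bullet> (z0 - z0) * exp (2*B*R*1)) (at_left 1)"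
    unfolding u_def[abs_def] by (intro tendsto_intros zlim)
  moreover have "\<forall>\<^sub>F t in at_left 1. u s \<le> u t"
    unfolding eventually_at_left_field
  proof (intro exI[of _ s] conjI allI impI)
    fix t assume t: "s < t" "t < 1"
    show "u s \<le> u t"
      by (rule DERIV_nonneg_imp_nondecreasing) (use t s u' in auto)
  qed (rule s)
  ultimately have "u s \<le> 0" using tendsto_lowerbound by fastforce
  then have "(z s - z0) \<bullet> (z s - z0) \<le> 0" by (simp add: u_def mult_le_0_iff)
  then have "z s = z0" using inner_ge_zero[of "z s - z0"] by (metis antisym eq_iff_diff_eq_0 inner_eq_zero_iff)
  note T = t1(2)[OF s]
  have "\<Phi> (of_real s * a) = q"
    using \<open>z s = z0\<close> T c chart_inj[OF c(1)] unfolding z_def z0_def by (meson inj_onD)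
  then show False using solD(4)[OF sol _ c(1), of "of_real s * a"] T v0 by simp
qed

text \<open>Every boundary point gets a disc on which the curve continues. Two such discs that meet
  also meet inside the old disc, so the pieces agree, and compactness of the closed disc yields a
  larger radius.\<close>

lemma sol_extend:
  assumes sol: "sol \<Phi> (ball 0 R)" and R: "R > 0"
    and lim: "\<And>a. norm a = R \<Longrightarrow> \<exists>q. limitin T (\<lambda>t. \<Phi> (of_real t * a)) q (at_left 1)"
  shows "\<exists>R'>R. \<exists>\<Psi>. sol \<Psi> (ball 0 R') \<and> \<Psi> 0 = \<Phi> 0"
proof -
  have "\<exists>\<delta> \<Psi>. \<delta> > 0 \<and> sol \<Psi> (ball a \<delta>) \<and> (\<forall>w\<in>ball a \<delta> \<inter> ball 0 R. \<Psi> w = \<Phi> w)" if a: "norm a = R" for a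
  proof -
    obtain q where q: "limitin T (\<lambda>t. \<Phi> (of_real t * a)) q (at_left 1)" using lim[OF a] by blast
    have "q \<in> topspace T" using q by (simp add: limitin_def)
    then obtain c where c: "c \<in> Ch" "q \<in> fst c" using cover by blast
    obtain \<epsilon> V where \<epsilon>: "\<epsilon> > 0" "openin T V" "q \<in> V"
      and \<Phi>V: "\<And>q'. q' \<in> V \<Longrightarrow> \<exists>\<Phi>. sol \<Phi> (ball 0 \<epsilon>) \<and> \<Phi> 0 = q'"
      using local_sol[OF c sol_limit_nonzero[OF sol a R q c]] by blast
    have "\<forall>\<^sub>F t in at_left 1. \<Phi> (of_real t * a) \<in> V" using q \<epsilon> by (simp add: limitin_def)
    then obtain t0 where t0: "t0 < 1" "\<And>t. t0 < t \<Longrightarrow> t < 1 \<Longrightarrow> \<Phi> (of_real t * a) \<in> V"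
      unfolding eventually_at_left_field by blast
    \<comment> \<open>For \<open>t\<close> beyond \<open>m\<close> the point \<open>b\<close> is
      closer than \<epsilon>/2 to \<open>a\<close>, so a run of time \<epsilon> from
      \<open>b\<close> covers the disc of radius \<epsilon>/2 around \<open>a\<close>.\<close>
    define m where "m = max (max t0 0) (1 - \<epsilon> / (2*R))"
    have "m < 1" using t0 \<epsilon> R by (simp add: m_def)
    then obtain t where t: "m < t" "t < 1" using dense by blast
    have tt: "t0 < t" "0 < t" "(1 - t) * R < \<epsilon>/2" using t R by (auto simp: m_def field_simps)
    define b where "b = of_real t * a"
    have bR: "b \<in> ball 0 R" using t tt a R by (simp add: b_def norm_mult)
    have ba: "dist b a < \<epsilon>/2"
    proof -
      have "b - a = of_real (t - 1) * a" by (simp add: b_def algebra_simps)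
      then have "dist b a = \<bar>t - 1\<bar> * R" by (simp add: dist_norm norm_mult a del: of_real_diff)
      then show ?thesis using tt(3) t by simp
    qed
    obtain \<Phi>0 where \<Phi>0: "sol \<Phi>0 (ball 0 \<epsilon>)" "\<Phi>0 0 = \<Phi> b" using \<Phi>V[of "\<Phi> b"] t0(2)[of t] tt t by (auto simp: b_def)
    have "(\<lambda>w. w + b) ` ball 0 \<epsilon> = ball b \<epsilon>" by (auto simp: dist_norm image_iff intro!: bexI[of _ "_ - b"] simp: norm_minus_commute)
    then have s0: "sol (\<lambda>w. \<Phi>0 (w - b)) (ball b \<epsilon>)" using sol_shift[OF \<Phi>0(1), of b] by simp
    have sub: "ball a (\<epsilon>/2) \<subseteq> ball b \<epsilon>" 
    proof
      fix w assume "w \<in> ball a (\<epsilon>/2)"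
      then show "w \<in> ball b \<epsilon>" using ba dist_triangle[of b w a] by simp
    qed
    have agree: "\<Phi>0 (w - b) = \<Phi> w" if "w \<in> ball b \<epsilon> \<inter> ball 0 R" for w
    proof (rule sol_unique[where ?\<Phi>1.0="\<lambda>w. \<Phi>0 (w - b)" and ?w0.0=b and \<Omega>="ball b \<epsilon> \<inter> ball 0 R"])
      show "sol (\<lambda>w. \<Phi>0 (w - b)) (ball b \<epsilon> \<inter> ball 0 R)" using s0 by (rule sol_subset) auto
      show "sol \<Phi> (ball b \<epsilon> \<inter> ball 0 R)" using sol by (rule sol_subset) auto
      show "connected (ball b \<epsilon> \<inter> ball 0 R)" by (intro convex_connected convex_Int convex_ball)
      show "b \<in> ball b \<epsilon> \<inter> ball 0 R" using \<epsilon>(1) bR by simp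
    qed (use \<Phi>0(2) that in auto)
    show ?thesis
    proof (intro exI conjI ballI)
      show "\<epsilon>/2 > 0" using \<epsilon> by simp
      show "sol (\<lambda>w. \<Phi>0 (w - b)) (ball a (\<epsilon>/2))" by (rule sol_subset[OF s0 sub])
      show "\<Phi>0 (w - b) = \<Phi> w" if "w \<in> ball a (\<epsilon>/2) \<inter> ball 0 R" for w using that sub by (intro agree) auto
    qed
  qed
  then obtain \<delta> \<Psi> where \<delta>: "\<And>a. norm a = R \<Longrightarrow> \<delta> a > 0" and sol\<Psi>: "\<And>a. norm a = R \<Longrightarrow> sol (\<Psi> a) (ball a (\<delta> a))"
    and \<Psi>\<Phi>: "\<And>a w. norm a = R \<Longrightarrow> w \<in> ball a (\<delta> a) \<Longrightarrow> w \<in> ball 0 R \<Longrightarrow> \<Psi> a w = \<Phi> w"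
    by (metis IntI)
  have \<Psi>\<Psi>: "\<Psi> a w = \<Psi> b w" if ab: "norm a = R" "norm b = R" and w: "w \<in> ball a (\<delta> a) \<inter> ball b (\<delta> b)" for a b w
  proof -
    \<comment> \<open>The projection to the closed disc is 1-Lipschitz and fixes \<open>a\<close>
      and \<open>b\<close>, so it moves \<open>w\<close> to a point of the closed disc that still
      lies in both balls; openness of the balls then provides a point of the open disc.\<close>
    define w1 where "w1 = closest_point (cball 0 R) w"
    have "closest_point (cball 0 R) a = a" "closest_point (cball 0 R) b = b"
      using ab by (auto intro!: closest_point_self)
    moreover have "cball (0::complex) R \<noteq> {}" using R by simp
    ultimately have "dist a w1 \<le> dist a w" "dist b w1 \<le> dist b w"
      using closest_point_lipschitz[OF convex_cball closed_cball, of 0 R a w]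
        closest_point_lipschitz[OF convex_cball closed_cball, of 0 R b w] by (simp_all add: w1_def)
    then have w1: "w1 \<in> ball a (\<delta> a) \<inter> ball b (\<delta> b)" using w by auto
    have "w1 \<in> cball 0 R" unfolding w1_def using R by (intro closest_point_in_set) auto
    then have "w1 \<in> closure (ball 0 R)" using R by simp
    then obtain w2 where w2: "w2 \<in> ball a (\<delta> a) \<inter> ball b (\<delta> b)" "w2 \<in> ball 0 R"
      using w1 open_Int_closure_eq_empty[of "ball a (\<delta> a) \<inter> ball b (\<delta> b)" "ball 0 R"] by blast
    show ?thesis
    proof (rule sol_unique[where \<Omega>="ball a (\<delta> a) \<inter> ball b (\<delta> b)" and ?w0.0=w2])
      show "sol (\<Psi> a) (ball a (\<delta> a) \<inter> ball b (\<delta> b))" "sol (\<Psi> b) (ball a (\<delta> a) \<inter> ball b (\<delta> b))"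
        using sol_subset[OF sol\<Psi>] ab by blast+
      show "connected (ball a (\<delta> a) \<inter> ball b (\<delta> b))" by (intro convex_connected convex_Int convex_ball)
      show "\<Psi> a w2 = \<Psi> b w2" using \<Psi>\<Phi>[OF ab(1) _ w2(2)] \<Psi>\<Phi>[OF ab(2) _ w2(2)] w2(1) by simp
    qed (use w w2 in auto)
  qed
  \<comment> \<open>The choice of the boundary point is immaterial by
    \<open>\<Psi>\<Psi>\<close>.\<close>
  define X where "X w = (if w \<in> ball 0 R then \<Phi> w else \<Psi> (SOME a. norm a = R \<and> w \<in> ball a (\<delta> a)) w)" for w
  have X\<Psi>: "X w = \<Psi> a w" if "norm a = R" "w \<in> ball a (\<delta> a)" for a w
  proof (cases "w \<in> ball 0 R")
    case True then show ?thesis using \<Psi>\<Phi>[OF that] by (simp add: X_def)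
  next
    case False
    define b where "b = (SOME a. norm a = R \<and> w \<in> ball a (\<delta> a))"
    have "norm b = R \<and> w \<in> ball b (\<delta> b)"
      unfolding b_def using that by (intro someI[of "\<lambda>a. norm a = R \<and> w \<in> ball a (\<delta> a)" a] conjI)
    then have "\<Psi> b w = \<Psi> a w" using \<Psi>\<Psi>[of b a w] that by blast
    then show ?thesis using False by (simp add: X_def b_def)
  qed
  define \<Omega> where "\<Omega> = ball 0 R \<union> (\<Union>a\<in>sphere 0 R. ball a (\<delta> a))"
  have "sol X \<Omega>"
  proof (rule sol_pointwise)
    fix w assume "w \<in> \<Omega>"
    then consider "w \<in> ball 0 R" | a where "norm a = R" "w \<in> ball a (\<delta> a)" by (auto simp: \<Omega>_def)
    then show "sol X {w}"
    proof cases
      case 1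
      have "sol X (ball 0 R)" by (rule sol_cong[OF sol]) (auto simp: X_def)
      then show ?thesis by (rule sol_subset) (use 1 in auto)
    next
      case 2
      have "sol X (ball a (\<delta> a))" by (rule sol_cong[OF sol\<Psi>[OF 2(1)]]) (use X\<Psi>[OF 2(1)] in auto)
      then show ?thesis by (rule sol_subset) (use 2 in auto)
    qed
  qed
  moreover have "cball 0 R \<subseteq> \<Omega>"
  proof
    fix w :: complex assume w: "w \<in> cball 0 R"
    show "w \<in> \<Omega>"
    proof (cases "norm w = R")
      case True
      then have "w \<in> ball w (\<delta> w)" using \<delta> by simp
      then show ?thesis using True unfolding \<Omega>_def by force
    qed (use w in \<open>auto simp: \<Omega>_def\<close>)
  qed
  moreover have "open \<Omega>" unfolding \<Omega>_def by auto
  ultimately obtain e where e: "e > 0" "(\<Union>x\<in>cball 0 R. ball x e) \<subseteq> \<Omega>"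
    using compact_subset_open_imp_ball_epsilon_subset[of "cball 0 R" \<Omega>] by auto
  have "ball 0 (R + e/2) \<subseteq> \<Omega>"
  proof
    fix w :: complex assume w: "w \<in> ball 0 (R + e/2)"
    show "w \<in> \<Omega>"
    proof (cases "norm w \<le> R")
      case True then show ?thesis using \<open>cball 0 R \<subseteq> \<Omega>\<close> by auto
    next
      case False
      have "of_real (R / norm w) * w \<in> cball 0 R" using False R by (simp add: norm_mult norm_divide)
      moreover have "w \<in> ball (of_real (R / norm w) * w) e"
      proof -
        have "w \<noteq> 0" using False R by auto
        have "of_real (R / norm w) * w - w = of_real (R / norm w - 1) * w" by (simp add: algebra_simps)
        then have "dist (of_real (R / norm w) * w) w = \<bar>R / norm w - 1\<bar> * norm w"
          by (simp add: dist_norm norm_mult del: of_real_diff of_real_divide)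
        also have "\<dots> = norm w - R" using False R \<open>w \<noteq> 0\<close> by (simp add: abs_if field_simps)
        also have "\<dots> < e" using w e(1) by simp
        finally show ?thesis by simp
      qed
      ultimately show ?thesis using e(2) by blast
    qed
  qed
  with \<open>sol X \<Omega>\<close> have "sol X (ball 0 (R + e/2))" by (rule sol_subset)
  moreover have "X 0 = \<Phi> 0" using R by (simp add: X_def)
  ultimately show ?thesis using e(1) by (intro exI[of _ "R + e/2"]) auto
qed

text \<open>If the radii of existence were bounded, gluing would give a solution on the disc whose
  radius is their supremum, and \<open>sol_extend\<close> would exceed it. Completeness will enter
  through \<open>lim\<close>.\<close>

theorem entire_sol:
  assumes p: "p \<in> topspace T" "c \<in> Ch" "p \<in> fst c" "v c p \<noteq> 0"
    and lim: "\<And>R \<Phi> a. \<lbrakk>R > 0; sol \<Phi> (ball 0 R); \<Phi> 0 = p; norm a = R\<rbrakk>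
      \<Longrightarrow> \<exists>q. limitin T (\<lambda>t. \<Phi> (of_real t * a)) q (at_left 1)"
  obtains \<Phi> where "sol \<Phi> UNIV" "\<Phi> 0 = p"
proof -
  define S where "S = {r. r > 0 \<and> (\<exists>\<Phi>. sol \<Phi> (ball 0 r) \<and> \<Phi> 0 = p)}"
  obtain \<epsilon> V where "\<epsilon> > 0" "openin T V" "p \<in> V" "\<And>q'. q' \<in> V \<Longrightarrow> \<exists>\<Phi>. sol \<Phi> (ball 0 \<epsilon>) \<and> \<Phi> 0 = q'"
    using local_sol[OF p(2-4)] by blast
  then have S0: "\<epsilon> \<in> S" by (auto simp: S_def)
  have "\<forall>r\<in>S. \<exists>\<Phi>. sol \<Phi> (ball 0 r) \<and> \<Phi> 0 = p" by (simp add: S_def)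
  then obtain F where F: "\<And>r. r \<in> S \<Longrightarrow> sol (F r) (ball 0 r) \<and> F r 0 = p"
    by (auto dest!: bchoice)
  have Spos: "r > 0" if "r \<in> S" for r using that by (simp add: S_def)
  have FF: "F r w = F s w" if "r \<in> S" "s \<in> S" "norm w < r" "norm w < s" for r s w
  proof (rule sol_unique[where \<Omega>="ball 0 r \<inter> ball 0 s" and ?w0.0=0])
    show "sol (F r) (ball 0 r \<inter> ball 0 s)" "sol (F s) (ball 0 r \<inter> ball 0 s)"
      using sol_subset F that by blast+
    show "connected (ball (0::complex) r \<inter> ball 0 s)" by (intro convex_connected convex_Int convex_ball)
  qed (use that F Spos in auto)
  \<comment> \<open>By uniqueness the solutions on the various discs agree, so any admissible radius
    above |w| may be used.\<close>
  define G where "G w = F (SOME r. r \<in> S \<and> norm w < r) w" for w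
  have GF: "G w = F r w" if "r \<in> S" "norm w < r" for r w
  proof -
    have "(SOME r. r \<in> S \<and> norm w < r) \<in> S \<and> norm w < (SOME r. r \<in> S \<and> norm w < r)"
      by (rule someI[of "\<lambda>r. r \<in> S \<and> norm w < r" r]) (use that in auto)
    then show ?thesis using that unfolding G_def by (intro FF) auto
  qed
  have solG: "sol G (ball 0 r)" if "r \<in> S" for r
    by (rule sol_cong[of "F r"]) (use F[OF that] GF[OF that] in auto)
  have G0: "G 0 = p" using GF[OF S0] Spos[OF S0] F[OF S0] by simp
  show ?thesis
  proof (cases "bdd_above S")
    case False
    have "sol G UNIV"
    proof (rule sol_pointwise)
      fix w :: complex obtain r where "r \<in> S" "norm w < r" using False by (meson bdd_above.I not_le)
      then show "sol G {w}" using sol_subset[OF solG, of r "{w}"] by simp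
    qed
    then show ?thesis using G0 that by blast
  next
    case True
    define R where "R = Sup S"
    have le: "r \<le> R" if "r \<in> S" for r unfolding R_def using that True by (rule cSup_upper)
    have R0: "R > 0" using le[OF S0] Spos[OF S0] by simp
    have sG: "sol G (ball 0 R)"
    proof (rule sol_pointwise)
      fix w :: complex assume "w \<in> ball 0 R"
      then have "norm w < Sup S" by (simp add: R_def)
      then obtain r where "r \<in> S" "norm w < r" using less_cSupE S0 by (metis empty_iff)
      then show "sol G {w}" using sol_subset[OF solG, of r "{w}"] by simp
    qed
    have "\<exists>q. limitin T (\<lambda>t. G (of_real t * a)) q (at_left 1)" if "norm a = R" for a
      by (rule lim[where \<Phi>=G, OF R0 sG G0 that])
    then obtain R' \<Psi> where "R' > R" "sol \<Psi> (ball 0 R')" "\<Psi> 0 = G 0"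
      using sol_extend[OF sG R0] by blast
    then have "R' \<in> S" using G0 R0 by (auto simp: S_def)
    then show ?thesis using le \<open>R' > R\<close> by force
  qed
qed

end

subsection \<open>Calculus of smooth functions\<close>

lemma two_neq_one [simp]: "(2::2) \<noteq> 1" by simp

lemma pd_eq: "(f has_derivative D) (at z) \<Longrightarrow> pd i f z = D (if i = 1 then 1 else \<i>)"
  by (simp add: pd_def frechet_derivative_at[symmetric])

lemma linear_complex_split:
  assumes "linear (D :: complex \<Rightarrow> 'b::real_vector)"
  shows "D h = Re h *\<^sub>R D 1 + Im h *\<^sub>R D \<i>"
proof -
  have "h = Re h *\<^sub>R 1 + Im h *\<^sub>R \<i>" by (simp add: complex_eq_iff)
  then have "D h = D (Re h *\<^sub>R 1 + Im h *\<^sub>R \<i>)" by simp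
  then show ?thesis using linear_add[OF assms] linear_scale[OF assms] by simp
qed

lemma has_derivative_pd:
  assumes "f differentiable (at z)"
  shows "(f has_derivative (\<lambda>h. Re h *\<^sub>R pd 1 f z + Im h *\<^sub>R pd 2 f z)) (at z)"
proof -
  obtain D where D: "(f has_derivative D) (at z)" using assms by (auto simp: differentiable_def)
  have "D = (\<lambda>h. Re h *\<^sub>R pd 1 f z + Im h *\<^sub>R pd 2 f z)"
  proof
    show "D h = Re h *\<^sub>R pd 1 f z + Im h *\<^sub>R pd 2 f z" for h
      using linear_complex_split[OF has_derivative_linear[OF D], of h] pd_eq[OF D] by simp
  qed
  then show ?thesis using D by simp
qed

lemma two_cases: "(i::2) = 1 \<or> i = 2" using exhaust_2[of i] .

lemma pd_cong:
  assumes "open S" "z \<in> S" "\<And>z. z \<in> S \<Longrightarrow> f z = g z"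
  shows "pd i f z = pd i g z"
proof -
  have "(f has_derivative D) (at z) \<longleftrightarrow> (g has_derivative D) (at z)" for D
    using has_derivative_transform_within_open[OF _ assms(1,2), of f D UNIV g]
      has_derivative_transform_within_open[OF _ assms(1,2), of g D UNIV f] assms(3) by auto
  then show ?thesis by (simp add: pd_def frechet_derivative_def)
qed

lemma differentiable_cong_open:
  assumes "open S" "z \<in> S" "\<And>z. z \<in> S \<Longrightarrow> f z = g z" "f differentiable (at z)"
  shows "g differentiable (at z)"
  using assms has_derivative_transform_within_open[OF _ assms(1,2), of f _ UNIV g]
  unfolding differentiable_def by blast

lemma Ck_on_cong:
  assumes "open S" "\<And>z. z \<in> S \<Longrightarrow> f z = g z" "Ck_on k f S"
  shows "Ck_on k g S"
  using assms(2,3)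
proof (induction k arbitrary: f g)
  case 0 then show ?case using continuous_on_cong[of S S f g] by simp
next
  case (Suc k)
  have "Ck_on k (pd i g) S" for i
  proof (rule Suc.IH[of "pd i f"])
    show "pd i f z = pd i g z" if "z \<in> S" for z using pd_cong[OF assms(1) that Suc.prems(1)] .
  qed (use Suc.prems in auto)
  moreover have "\<forall>z\<in>S. g differentiable (at z)"
  proof
    fix z assume "z \<in> S"
    show "g differentiable (at z)"
      by (rule differentiable_cong_open[OF assms(1) \<open>z \<in> S\<close> Suc.prems(1)]) (use Suc.prems \<open>z \<in> S\<close> in auto)
  qed
  ultimately show ?case by simp
qed

lemma Ck_on_subset: "Ck_on k f S \<Longrightarrow> S' \<subseteq> S \<Longrightarrow> Ck_on k f S'"
  by (induction k arbitrary: f) (auto intro: continuous_on_subset)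

lemma Ck_on_Suc_D: "Ck_on (Suc k) f S \<Longrightarrow> Ck_on k f S"
proof (induction k arbitrary: f)
  case 0
  then have "\<forall>z\<in>S. isCont f z" by (auto intro: differentiable_imp_continuous_within)
  then show ?case by (simp add: continuous_at_imp_continuous_on)
qed auto

lemma Ck_on_local:
  assumes "\<And>z. z \<in> S \<Longrightarrow> \<exists>N. open N \<and> z \<in> N \<and> Ck_on k f N"
  shows "Ck_on k f S"
  using assms
proof (induction k arbitrary: f)
  case 0
  show ?case unfolding Ck_on.simps
  proof (rule continuous_at_imp_continuous_on, rule ballI)
    fix z assume "z \<in> S"
    then obtain N where "open N" "z \<in> N" "continuous_on N f" using 0 by auto
    then show "isCont f z" by (simp add: continuous_on_eq_continuous_at)
  qed
next
  case (Suc k)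
  have "Ck_on k (pd i f) S" for i
    by (rule Suc.IH) (use Suc.prems in fastforce)
  moreover have "\<forall>z\<in>S. f differentiable (at z)" using Suc.prems by fastforce
  ultimately show ?case by simp
qed

lemma pd_const [simp]: "pd i (\<lambda>z. c) = (\<lambda>z. 0)"
  by (rule ext) (simp add: pd_eq[OF has_derivative_const])

lemma Ck_on_const: "Ck_on k (\<lambda>z. c) S"
  by (induction k arbitrary: c) auto

lemma pd_linear:
  assumes "bounded_linear L" "f differentiable (at z)"
  shows "pd i (\<lambda>z. L (f z)) z = L (pd i f z)"
  using pd_eq[OF bounded_linear.has_derivative[OF assms(1) has_derivative_pd[OF assms(2)]]]
    two_cases[of i] by auto

lemma Ck_on_linear:
  assumes "open S" "bounded_linear L" "Ck_on k f S"
  shows "Ck_on k (\<lambda>z. L (f z)) S"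
  using assms(3)
proof (induction k arbitrary: f)
  case 0 then show ?case using bounded_linear.continuous_on[OF assms(2)] by simp
next
  case (Suc k)
  have "Ck_on k (pd i (\<lambda>z. L (f z))) S" for i
    by (rule Ck_on_cong[OF assms(1), of "\<lambda>z. L (pd i f z)"])
       (use Suc pd_linear[OF assms(2)] in auto)
  moreover have "\<forall>z\<in>S. (\<lambda>z. L (f z)) differentiable (at z)"
    using Suc.prems bounded_linear.has_derivative[OF assms(2)] unfolding Ck_on.simps differentiable_def by blast
  ultimately show ?case by simp
qed

lemma pd_add:
  assumes "f differentiable (at z)" "g differentiable (at z)"
  shows "pd i (\<lambda>z. f z + g z) z = pd i f z + pd i g z"
  using pd_eq[OF has_derivative_add[OF has_derivative_pd[OF assms(1)] has_derivative_pd[OF assms(2)]]]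
    two_cases[of i] by auto

lemma Ck_on_add:
  assumes "open S" "Ck_on k f S" "Ck_on k g S"
  shows "Ck_on k (\<lambda>z. f z + g z) S"
  using assms(2,3)
proof (induction k arbitrary: f g)
  case 0 then show ?case by (auto intro: continuous_intros)
next
  case (Suc k)
  have "Ck_on k (pd i (\<lambda>z. f z + g z)) S" for i
    by (rule Ck_on_cong[OF assms(1), of "\<lambda>z. pd i f z + pd i g z"])
       (use Suc in \<open>auto intro!: pd_add[symmetric]\<close>)
  then show ?case using Suc.prems by (auto intro: differentiable_add)
qed

lemma pd_bilinear:
  assumes "bounded_bilinear B" "f differentiable (at z)" "g differentiable (at z)"
  shows "pd i (\<lambda>z. B (f z) (g z)) z = B (f z) (pd i g z) + B (pd i f z) (g z)"
  using pd_eq[OF bounded_bilinear.FDERIV[OF assms(1) has_derivative_pd[OF assms(2)] has_derivative_pd[OF assms(3)]]]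
    two_cases[of i] by auto

text \<open>Covers products, scalar multiples and the Minkowski product at once.\<close>

lemma Ck_on_bilinear:
  assumes "open S" "bounded_bilinear B" "Ck_on k f S" "Ck_on k g S"
  shows "Ck_on k (\<lambda>z. B (f z) (g z)) S"
  using assms(3,4)
proof (induction k arbitrary: f g)
  case 0 then show ?case using bounded_bilinear.continuous_on[OF assms(2)] by auto
next
  case (Suc k)
  have "Ck_on k (pd i (\<lambda>z. B (f z) (g z))) S" for i
    by (rule Ck_on_cong[OF assms(1), of "\<lambda>z. B (f z) (pd i g z) + B (pd i f z) (g z)"])
       (use Suc.prems pd_bilinear[OF assms(2)] in \<open>auto intro!: Ck_on_add assms(1) Suc.IH intro: Ck_on_Suc_D\<close>)
  moreover have "\<forall>z\<in>S. (\<lambda>z. B (f z) (g z)) differentiable (at z)"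
    using Suc.prems bounded_bilinear.FDERIV[OF assms(2)] unfolding Ck_on.simps differentiable_def by blast
  ultimately show ?case by simp
qed

lemma pd_inverse:
  fixes f :: "complex \<Rightarrow> real"
  assumes "f differentiable (at z)" "f z \<noteq> 0"
  shows "pd i (\<lambda>z. inverse (f z)) z = - (inverse (f z) * (inverse (f z) * pd i f z))"
  using pd_eq[OF Deriv.has_derivative_inverse[OF assms(2) has_derivative_pd[OF assms(1)]]]
    two_cases[of i] by auto

lemma Ck_on_inverse:
  fixes f :: "complex \<Rightarrow> real"
  assumes "open S" "\<And>z. z \<in> S \<Longrightarrow> f z \<noteq> 0" "Ck_on k f S"
  shows "Ck_on k (\<lambda>z. inverse (f z)) S"
  using assms(3)
proof (induction k)
  case 0 then show ?case using assms(2) by (auto intro: continuous_intros)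
next
  case (Suc k)
  have "Ck_on k (\<lambda>z. inverse (f z)) S" using Suc Ck_on_Suc_D by blast
  then have "Ck_on k (\<lambda>z. - (inverse (f z) * (inverse (f z) * pd i f z))) S" for i
    using Suc.prems by (intro Ck_on_linear[OF assms(1) bounded_linear_minus[OF bounded_linear_ident]]
        Ck_on_bilinear[OF assms(1) bounded_bilinear_mult]) auto
  then have "Ck_on k (pd i (\<lambda>z. inverse (f z))) S" for i
    by (rule Ck_on_cong[OF assms(1), where f="(\<lambda>z. - (inverse (f z) * (inverse (f z) * pd i f z)))", rotated]) (use Suc.prems assms(2) in \<open>auto intro!: pd_inverse[symmetric]\<close>)
  moreover have "\<forall>z\<in>S. (\<lambda>z. inverse (f z)) differentiable (at z)"
    using Suc.prems assms(2) by (auto intro!: differentiable_inverse)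
  ultimately show ?case by simp
qed

lemma has_derivative_sqrt_comp:
  fixes f :: "complex \<Rightarrow> real"
  assumes "f differentiable (at z)" "f z > 0"
  shows "((\<lambda>z. sqrt (f z)) has_derivative (\<lambda>h. (Re h *\<^sub>R pd 1 f z + Im h *\<^sub>R pd 2 f z) * (inverse (sqrt (f z)) / 2))) (at z)"
  using has_derivative_real_sqrt[OF assms(2) has_derivative_pd[OF assms(1)]] by (simp add: field_simps)

lemma pd_sqrt:
  fixes f :: "complex \<Rightarrow> real"
  assumes "f differentiable (at z)" "f z > 0"
  shows "pd i (\<lambda>z. sqrt (f z)) z = inverse (2 * sqrt (f z)) * pd i f z"
  using pd_eq[OF has_derivative_sqrt_comp[OF assms]] two_cases[of i] by auto

lemma Ck_on_sqrt:
  fixes f :: "complex \<Rightarrow> real"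
  assumes "open S" "\<And>z. z \<in> S \<Longrightarrow> f z > 0" "Ck_on k f S"
  shows "Ck_on k (\<lambda>z. sqrt (f z)) S"
  using assms(3)
proof (induction k)
  case 0 then show ?case by (auto intro: continuous_intros)
next
  case (Suc k)
  have ne: "2 * sqrt (f z) \<noteq> 0" if "z \<in> S" for z using assms(2)[OF that] by simp
  have "Ck_on k (\<lambda>z. sqrt (f z)) S" using Suc Ck_on_Suc_D by blast
  then have "Ck_on k (\<lambda>z. inverse (2 * sqrt (f z)) * pd i f z) S" for i
    using Suc.prems
    by (intro Ck_on_bilinear[OF assms(1) bounded_bilinear_mult] Ck_on_inverse[OF assms(1) ne]
        Ck_on_linear[OF assms(1) bounded_linear_mult_right]) auto
  then have "Ck_on k (pd i (\<lambda>z. sqrt (f z))) S" for i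
    by (rule Ck_on_cong[OF assms(1), where f="(\<lambda>z. inverse (2 * sqrt (f z)) * pd i f z)", rotated]) (rule pd_sqrt[symmetric], use Suc.prems assms(2) in auto)
  moreover have "\<forall>z\<in>S. (\<lambda>z. sqrt (f z)) differentiable (at z)"
    using Suc.prems assms(2) has_derivative_sqrt_comp unfolding Ck_on.simps differentiable_def by blast
  ultimately show ?case by simp
qed

lemma has_derivative_pd_compose:
  fixes g :: "complex \<Rightarrow> complex"
  assumes "f differentiable (at (g z))" "(g has_derivative D) (at z)"
  shows "((\<lambda>z. f (g z)) has_derivative (\<lambda>h. Re (D h) *\<^sub>R pd 1 f (g z) + Im (D h) *\<^sub>R pd 2 f (g z))) (at z)"
  by (rule has_derivative_compose[OF assms(2) has_derivative_pd[OF assms(1)]])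

lemma pd_compose:
  fixes g :: "complex \<Rightarrow> complex"
  assumes "f differentiable (at (g z))" "g differentiable (at z)"
  shows "pd i (\<lambda>z. f (g z)) z = Re (pd i g z) *\<^sub>R pd 1 f (g z) + Im (pd i g z) *\<^sub>R pd 2 f (g z)"
  using pd_eq[OF has_derivative_pd_compose[OF assms(1) has_derivative_pd[OF assms(2)]]]
    two_cases[of i] by auto

lemma Ck_on_compose:
  fixes g :: "complex \<Rightarrow> complex"
  assumes "open S" "g ` S \<subseteq> S'" "Ck_on k f S'" "Ck_on k g S"
  shows "Ck_on k (\<lambda>z. f (g z)) S"
  using assms(3,4)
proof (induction k arbitrary: f)
  case 0 then show ?case using continuous_on_compose2[of S' f S g] assms(2) by simp
next
  case (Suc k)
  have g: "Ck_on k g S" using Suc.prems(2) by (rule Ck_on_Suc_D)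
  have "Ck_on k (\<lambda>z. Re (pd i g z) *\<^sub>R pd 1 f (g z) + Im (pd i g z) *\<^sub>R pd 2 f (g z)) S" for i
    using Suc.prems g
    by (intro Ck_on_add[OF assms(1)] Ck_on_bilinear[OF assms(1) bounded_bilinear_scaleR]
        Ck_on_linear[OF assms(1) bounded_linear_Re] Ck_on_linear[OF assms(1) bounded_linear_Im] Suc.IH) auto
  then have "Ck_on k (pd i (\<lambda>z. f (g z))) S" for i
    by (rule Ck_on_cong[OF assms(1), where f="(\<lambda>z. Re (pd i g z) *\<^sub>R pd 1 f (g z) + Im (pd i g z) *\<^sub>R pd 2 f (g z))", rotated]) (use Suc.prems assms(2) in \<open>auto intro!: pd_compose[symmetric]\<close>)
  moreover have "\<forall>z\<in>S. (\<lambda>z. f (g z)) differentiable (at z)"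
    using Suc.prems assms(2) has_derivative_pd_compose[OF _ has_derivative_pd, of f g]
    unfolding Ck_on.simps differentiable_def by blast
  ultimately show ?case by simp
qed

lemma smooth_onD:
  assumes "smooth_on f S"
  shows "\<And>z. z \<in> S \<Longrightarrow> f differentiable (at z)" "smooth_on (pd i f) S" "continuous_on S f"
  using assms[unfolded smooth_on_def, rule_format, of 1] assms[unfolded smooth_on_def, rule_format, of 0]
    assms[unfolded smooth_on_def, rule_format, of "Suc k" for k] by (auto simp: smooth_on_def)

lemma smooth_on_subset: "smooth_on f S \<Longrightarrow> S' \<subseteq> S \<Longrightarrow> smooth_on f S'"
  by (auto simp: smooth_on_def intro: Ck_on_subset)

lemma smooth_on_cong: "open S \<Longrightarrow> (\<And>z. z \<in> S \<Longrightarrow> f z = g z) \<Longrightarrow> smooth_on f S \<Longrightarrow> smooth_on g S"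
  using Ck_on_cong unfolding smooth_on_def by blast

lemma smooth_on_local:
  "(\<And>z. z \<in> S \<Longrightarrow> \<exists>N. open N \<and> z \<in> N \<and> smooth_on f N) \<Longrightarrow> smooth_on f S"
  unfolding smooth_on_def by (auto intro!: Ck_on_local)

lemma smooth_on_add: "open S \<Longrightarrow> smooth_on f S \<Longrightarrow> smooth_on g S \<Longrightarrow> smooth_on (\<lambda>z. f z + g z) S"
  by (simp add: smooth_on_def Ck_on_add)

lemma smooth_on_linear: "open S \<Longrightarrow> bounded_linear L \<Longrightarrow> smooth_on f S \<Longrightarrow> smooth_on (\<lambda>z. L (f z)) S"
  by (simp add: smooth_on_def Ck_on_linear)

lemma smooth_on_bilinear:
  "open S \<Longrightarrow> bounded_bilinear B \<Longrightarrow> smooth_on f S \<Longrightarrow> smooth_on g S \<Longrightarrow> smooth_on (\<lambda>z. B (f z) (g z)) S"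
  by (simp add: smooth_on_def Ck_on_bilinear)

lemma smooth_on_compose:
  fixes g :: "complex \<Rightarrow> complex"
  shows "open S \<Longrightarrow> g ` S \<subseteq> S' \<Longrightarrow> smooth_on f S' \<Longrightarrow> smooth_on g S \<Longrightarrow> smooth_on (\<lambda>z. f (g z)) S"
  by (simp add: smooth_on_def Ck_on_compose)

lemma smooth_on_inverse:
  fixes f :: "complex \<Rightarrow> real"
  shows "open S \<Longrightarrow> (\<And>z. z \<in> S \<Longrightarrow> f z \<noteq> 0) \<Longrightarrow> smooth_on f S \<Longrightarrow> smooth_on (\<lambda>z. inverse (f z)) S"
  by (simp add: smooth_on_def Ck_on_inverse)

lemma smooth_on_sqrt:
  fixes f :: "complex \<Rightarrow> real"
  shows "open S \<Longrightarrow> (\<And>z. z \<in> S \<Longrightarrow> f z > 0) \<Longrightarrow> smooth_on f S \<Longrightarrow> smooth_on (\<lambda>z. sqrt (f z)) S"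
  by (simp add: smooth_on_def Ck_on_sqrt)

lemma smooth_onI:
  assumes "open S" "\<And>z. z \<in> S \<Longrightarrow> f differentiable (at z)" "\<And>i. smooth_on (pd i f) S"
  shows "smooth_on f S"
  unfolding smooth_on_def
proof
  fix k show "Ck_on k f S"
  proof (cases k)
    case 0
    have "\<forall>z\<in>S. isCont f z" using assms(2) by (auto intro: differentiable_imp_continuous_within)
    then show ?thesis using 0 by (simp add: continuous_at_imp_continuous_on)
  next
    case (Suc m) then show ?thesis using assms by (simp add: smooth_on_def)
  qed
qed

section \<open>The Minkowski product as a bounded bilinear form\<close>

lemma mink_add_left: "mink (u + v) w = mink u w + mink v w"
  and mink_add_right: "mink w (u + v) = mink w u + mink w v"
  and mink_scaleR_left: "mink (r *\<^sub>R u) w = r * mink u w"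
  and mink_scaleR_right: "mink w (r *\<^sub>R u) = r * mink w u"
  and mink_diff_left: "mink (u - v) w = mink u w - mink v w"
  and mink_diff_right: "mink w (u - v) = mink w u - mink w v"
  and mink_zero: "mink 0 w = 0" "mink w 0 = 0"
  by (simp_all add: mink_def algebra_simps)

lemma mink_commute: "mink u v = mink v u"
  by (simp add: mink_def algebra_simps)

lemma bounded_bilinear_mink: "bounded_bilinear mink"
proof
  show "\<exists>K. \<forall>a b. norm (mink a b) \<le> norm a * norm b * K"
  proof (intro exI allI)
    fix a b :: "real^4"
    have c: "\<bar>a $ i * b $ i\<bar> \<le> norm a * norm b" for i
      by (simp add: abs_mult component_le_norm_cart mult_mono)
    show "norm (mink a b) \<le> norm a * norm b * 4"
      using c[of 1] c[of 2] c[of 3] c[of 4] unfolding mink_def real_norm_def by linarith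
  qed
qed (simp_all add: mink_add_left mink_add_right mink_scaleR_left mink_scaleR_right)

subsection \<open>Length of curves and completeness\<close>

text \<open>If the integral on the right is infinite, nothing is to be shown. Otherwise the
  derivative is Lebesgue integrable, and by the fundamental theorem for the gauge integral, which
  tolerates finitely many exceptions, its integral is the increment.\<close>

lemma norm_increment_le_nn_integral:
  fixes y y' :: "real \<Rightarrow> complex"
  assumes ab: "a \<le> b" and fin: "finite S" and cont: "continuous_on {a..b} y"
    and der: "\<And>t. t \<in> {a<..<b} - S \<Longrightarrow> (y has_vector_derivative y' t) (at t)"
    and cont': "continuous_on ({a<..<b} - S) y'"
    and le: "\<And>t. t \<in> {a<..<b} - S \<Longrightarrow> ennreal (norm (y' t)) \<le> g t"
  shows "ennreal (norm (y b - y a)) \<le> (\<integral>\<^sup>+ t. g t * indicator {a..b} t \<partial>lborel)"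
proof -
  define D where "D = {a<..<b} - S"
  define h where "h t = indicator D t *\<^sub>R y' t" for t
  have "D \<in> sets borel" using fin by (auto simp: D_def intro!: borel_open open_Diff finite_imp_closed)
  then have hm: "h \<in> borel_measurable borel"
    unfolding h_def[abs_def] using cont' by (intro borel_measurable_continuous_on_indicator) (simp_all add: D_def)
  have "ennreal (norm (h t)) \<le> g t * indicator {a..b} t" for t
    using le[of t] by (auto simp: h_def D_def indicator_def)
  then have le': "(\<integral>\<^sup>+ t. ennreal (norm (h t)) \<partial>lborel) \<le> (\<integral>\<^sup>+ t. g t * indicator {a..b} t \<partial>lborel)"
    by (rule nn_integral_mono)
  show ?thesis
  proof (cases "(\<integral>\<^sup>+ t. ennreal (norm (h t)) \<partial>lborel) < \<infinity>")
    case False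
    then have "(\<integral>\<^sup>+ t. g t * indicator {a..b} t \<partial>lborel) = \<infinity>" using le' by (simp add: top_unique not_less)
    then show ?thesis by simp
  next
    case True
    then have int: "integrable lborel h" using hm by (intro integrableI_bounded) auto
    have "(h has_integral (y b - y a)) {a..b}"
      by (rule fundamental_theorem_of_calculus_interior_strong[OF fin ab _ cont])
         (use der in \<open>auto simp: h_def D_def\<close>)
    then have "(h has_integral (y b - y a)) UNIV"
      by (rule has_integral_on_superset) (auto simp: h_def D_def)
    then have eq: "y b - y a = integral\<^sup>L lborel h"
      using has_integral_integral_lborel[OF int] has_integral_unique by blast
    have "ennreal (norm (y b - y a)) \<le> ennreal (integral\<^sup>L lborel (\<lambda>t. norm (h t)))"
      unfolding eq by (intro ennreal_leI integral_norm_bound)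
    also have "\<dots> = (\<integral>\<^sup>+ t. ennreal (norm (h t)) \<partial>lborel)"
      by (rule nn_integral_eq_integral[symmetric]) (use int in auto)
    finally show ?thesis using le' by simp
  qed
qed

lemma has_vector_derivative_pd_compose:
  assumes "f differentiable (at (y t))" "(y has_vector_derivative d) (at t)"
  shows "((\<lambda>t. f (y t)) has_vector_derivative Re d *\<^sub>R pd 1 f (y t) + Im d *\<^sub>R pd 2 f (y t)) (at t)"
proof -
  have "((\<lambda>t. f (y t)) has_derivative (\<lambda>h. Re (h *\<^sub>R d) *\<^sub>R pd 1 f (y t) + Im (h *\<^sub>R d) *\<^sub>R pd 2 f (y t))) (at t)"
    by (rule has_derivative_compose[OF assms(2)[unfolded has_vector_derivative_def] has_derivative_pd[OF assms(1)]])
  then show ?thesis by (simp add: has_vector_derivative_def scaleR_add_right)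
qed

lemma eventually_nhds_twice: "\<forall>\<^sub>F s in nhds t. P s \<Longrightarrow> \<forall>\<^sub>F s in nhds t. \<forall>\<^sub>F r in nhds s. P r"
  by (simp only: eventually_eventually)

lemma isCont_cong_nhds:
  assumes "isCont f t" "\<forall>\<^sub>F s in nhds t. f s = g s"
  shows "isCont g t"
  using isCont_cong[OF assms(2)] assms(1) by simp

lemma has_vector_derivative_cong_nhds:
  assumes "\<forall>\<^sub>F s in nhds t. f s = g s"
  shows "(f has_vector_derivative d) (at t) \<longleftrightarrow> (g has_vector_derivative d) (at t)"
proof (rule has_vector_derivative_cong_ev)
  show "\<forall>\<^sub>F s in nhds t. s \<in> UNIV \<longrightarrow> f s = g s" using assms by simp
  show "f t = g t" using assms by (rule eventually_nhds_x_imp_x)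
qed

lemma vector_derivative_cong_nhds:
  assumes "\<forall>\<^sub>F s in nhds t. f s = g s"
  shows "vector_derivative f (at t) = vector_derivative g (at t)"
proof -
  have "(f has_vector_derivative d) (at t) \<longleftrightarrow> (g has_vector_derivative d) (at t)" for d
    by (rule has_vector_derivative_cong_nhds[OF assms])
  then show ?thesis by (simp add: vector_derivative_def)
qed

lemma differentiable_cong_nhds:
  assumes "\<forall>\<^sub>F s in nhds t. f s = g s"
  shows "f differentiable (at (t::real)) \<longleftrightarrow> g differentiable (at t)"
proof -
  have "(f has_vector_derivative d) (at t) \<longleftrightarrow> (g has_vector_derivative d) (at t)" for d
    by (rule has_vector_derivative_cong_nhds[OF assms])
  then show ?thesis
    by (metis differentiableI_vector vector_derivative_works)
qed

section \<open>Speed and regularity of curves\<close>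

definition speed :: "('a \<Rightarrow> real^4) \<Rightarrow> (real \<Rightarrow> 'a) \<Rightarrow> real \<Rightarrow> real" where
  "speed x \<gamma> t = sqrt (mink (vector_derivative (x \<circ> \<gamma>) (at t)) (vector_derivative (x \<circ> \<gamma>) (at t)))"

lemma curve_length_eq:
  assumes "D \<subseteq> {0..1}" "finite ({0..1} - D)"
  shows "curve_length x \<gamma> = (\<integral>\<^sup>+ t. ennreal (speed x \<gamma> t) * indicator D t \<partial>lborel)"
  unfolding curve_length_def speed_def
proof (rule nn_integral_cong_AE)
  have "AE t in lborel. t \<notin> {0..1} - D"
    by (rule AE_not_in[OF finite_imp_null_set_lborel[OF assms(2)]])
  then show "AE t in lborel. ennreal (sqrt (mink (vector_derivative (x \<circ> \<gamma>) (at t)) (vector_derivative (x \<circ> \<gamma>) (at t)))) * indicator {0..1} t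
    = ennreal (sqrt (mink (vector_derivative (x \<circ> \<gamma>) (at t)) (vector_derivative (x \<circ> \<gamma>) (at t)))) * indicator D t"
    by eventually_elim (use assms(1) in \<open>auto simp: indicator_def\<close>)
qed

definition metric_norm :: "(complex \<Rightarrow> real^4) \<Rightarrow> complex \<Rightarrow> complex \<Rightarrow> real" where
  "metric_norm X z h = sqrt (mink (Re h *\<^sub>R pd 1 X z + Im h *\<^sub>R pd 2 X z) (Re h *\<^sub>R pd 1 X z + Im h *\<^sub>R pd 2 X z))"

lemma metric_norm_scaleR: "metric_norm X z (r *\<^sub>R h) = \<bar>r\<bar> * metric_norm X z h"
proof -
  have *: "Re (r *\<^sub>R h) *\<^sub>R pd 1 X z + Im (r *\<^sub>R h) *\<^sub>R pd 2 X z = r *\<^sub>R (Re h *\<^sub>R pd 1 X z + Im h *\<^sub>R pd 2 X z)"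
    by (simp add: scaleR_add_right)
  have "sqrt (r * (r * q)) = \<bar>r\<bar> * sqrt q" for q :: real
    by (simp add: real_sqrt_mult mult.assoc[symmetric])
  then show ?thesis unfolding metric_norm_def * by (simp only: mink_scaleR_left mink_scaleR_right)
qed

locale spacelike =
  fixes T :: "'a topology" and \<A> :: "'a chart set" and x :: "'a \<Rightarrow> real^4"
  assumes spacelike: "spacelike_surface T \<A> x"
begin

abbreviation "X c \<equiv> in_chart x c"

lemma surface: "oriented_surface T \<A>"
  and X_smooth: "c \<in> \<A> \<Longrightarrow> smooth_on (X c) (img c)"
  and X_inj: "c \<in> \<A> \<Longrightarrow> z \<in> img c \<Longrightarrow> inj (frechet_derivative (X c) (at z))"
  and X_pos: "c \<in> \<A> \<Longrightarrow> z \<in> img c \<Longrightarrow> \<xi> \<noteq> 0 \<Longrightarrow> \<xi> \<bullet> (first_form (X c) z *v \<xi>) > 0"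
  using spacelike by (auto simp: spacelike_surface_def)

lemma nonempty: "topspace T \<noteq> {}" and T_connected: "connected_space T" and T_hausdorff: "Hausdorff_space T"
  and A_chart: "c \<in> \<A> \<Longrightarrow> is_chart T c"
  and A_cover: "p \<in> topspace T \<Longrightarrow> \<exists>c\<in>\<A>. p \<in> fst c"
  and A_transition: "c \<in> \<A> \<Longrightarrow> c' \<in> \<A> \<Longrightarrow> oriented_transition c c'"
  using surface by (auto simp: oriented_surface_def)

lemma A_smooth_transition:
  "c \<in> \<A> \<Longrightarrow> c' \<in> \<A> \<Longrightarrow> smooth_on (change c c') (snd c ` (fst c \<inter> fst c'))"
  using A_transition[of c c'] by (auto simp: oriented_transition_def split: prod.splits)

lemma metric_pos:
  assumes "c \<in> \<A>" "z \<in> img c" "h \<noteq> 0"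
  shows "mink (Re h *\<^sub>R pd 1 (X c) z + Im h *\<^sub>R pd 2 (X c) z) (Re h *\<^sub>R pd 1 (X c) z + Im h *\<^sub>R pd 2 (X c) z) > 0"
proof -
  define \<xi> :: "real^2" where "\<xi> = (\<chi> i. if i = 1 then Re h else Im h)"
  have "\<xi> \<noteq> 0"
  proof
    assume "\<xi> = 0"
    then have "\<xi> $ 1 = 0" "\<xi> $ 2 = 0" by simp_all
    then show False using assms(3) by (simp add: \<xi>_def complex_eq_iff)
  qed
  then have "\<xi> \<bullet> (first_form (X c) z *v \<xi>) > 0" by (rule X_pos[OF assms(1,2)])
  also have "\<xi> \<bullet> (first_form (X c) z *v \<xi>) = mink (Re h *\<^sub>R pd 1 (X c) z + Im h *\<^sub>R pd 2 (X c) z) (Re h *\<^sub>R pd 1 (X c) z + Im h *\<^sub>R pd 2 (X c) z)"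
    by (simp add: inner_vec_def matrix_vector_mult_def sum_2 first_form_def \<xi>_def mink_add_left
        mink_add_right mink_scaleR_left mink_scaleR_right algebra_simps)
  finally show ?thesis .
qed

text \<open>By homogeneity in \<open>h\<close> it is enough to consider unit vectors over
  \<open>K\<close>; there the norm is a positive continuous function on a compact set.\<close>

lemma metric_norm_bounds:
  assumes c: "c \<in> \<A>" and K: "compact K" "K \<subseteq> img c"
  obtains k B where "k > 0" "\<And>z h. z \<in> K \<Longrightarrow> k * norm h \<le> metric_norm (X c) z h"
    "\<And>z h. z \<in> K \<Longrightarrow> metric_norm (X c) z h \<le> B * norm h"
proof (cases "K = {}")
  case True then show ?thesis using that[of 1] by auto
next
  case False
  let ?S = "K \<times> sphere (0::complex) 1"
  let ?f = "\<lambda>p. metric_norm (X c) (fst p) (snd p)"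
  have cX: "continuous_on K (pd i (X c))" for i
    using smooth_onD(3)[OF smooth_onD(2)[OF X_smooth[OF c]]] K(2) continuous_on_subset by blast
  have "continuous_on ?S (\<lambda>p. pd i (X c) (fst p))" for i
    by (rule continuous_on_compose2[OF cX]) (auto intro: continuous_intros)
  then have cont: "continuous_on ?S ?f" unfolding metric_norm_def
    by (intro continuous_intros bounded_bilinear.continuous_on[OF bounded_bilinear_mink])
  have S: "compact ?S" "?S \<noteq> {}" using K(1) False by (auto intro: compact_Times)
  obtain m where m: "m \<in> ?S" "\<And>p. p \<in> ?S \<Longrightarrow> ?f m \<le> ?f p"
    using continuous_attains_inf[OF S cont] by blast
  obtain M where M: "M \<in> ?S" "\<And>p. p \<in> ?S \<Longrightarrow> ?f p \<le> ?f M"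
    using continuous_attains_sup[OF S cont] by blast
  have sc: "metric_norm (X c) z h = norm h * ?f (z, (1 / norm h) *\<^sub>R h)" if "h \<noteq> 0" for z h
    using metric_norm_scaleR[of "X c" z "norm h" "(1 / norm h) *\<^sub>R h"] that by simp
  have unit: "(z, (1 / norm h) *\<^sub>R h) \<in> ?S" if "z \<in> K" "h \<noteq> 0" for z h using that by simp
  have z: "metric_norm (X c) z 0 = 0" for z by (simp add: metric_norm_def mink_zero)
  show ?thesis
  proof (rule that)
    have "fst m \<in> img c" "snd m \<noteq> 0" using m(1) K(2) by (auto simp: mem_Times_iff)
    then show "?f m > 0" using metric_pos[OF c] by (simp add: metric_norm_def)
    show "?f m * norm h \<le> metric_norm (X c) z h" if "z \<in> K" for z h
    proof (cases "h = 0")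
      case False then show ?thesis
        unfolding sc[OF False] mult.commute[of "?f m"] using m(2)[OF unit[OF that False]] by (intro mult_left_mono) auto
    qed (simp add: z)
    show "metric_norm (X c) z h \<le> ?f M * norm h" if "z \<in> K" for z h
    proof (cases "h = 0")
      case False then show ?thesis
        unfolding sc[OF False] mult.commute[of "?f M"] using M(2)[OF unit[OF that False]] by (intro mult_left_mono) auto
    qed (simp add: z)
  qed
qed

text \<open>The condition of \<open>pw_C1_curve\<close> at a single parameter. In this local form it
  passes easily to other charts, to reparametrizations and to curves glued from pieces; the
  equivalence is \<open>pw_C1_curve_iff\<close>.\<close>

definition regular :: "(real \<Rightarrow> 'a) \<Rightarrow> real \<Rightarrow> bool" where
  "regular \<gamma> t \<longleftrightarrow> \<gamma> t \<in> topspace T \<and> (\<forall>V. openin T V \<and> \<gamma> t \<in> V \<longrightarrow> (\<forall>\<^sub>F s in nhds t. \<gamma> s \<in> V)) \<and>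
     (\<forall>c\<in>\<A>. \<gamma> t \<in> fst c \<longrightarrow> (\<forall>\<^sub>F s in nhds t. (snd c \<circ> \<gamma>) differentiable (at s)) \<and>
        isCont (\<lambda>s. vector_derivative (snd c \<circ> \<gamma>) (at s)) t)"

lemma regularD:
  assumes "regular \<gamma> t"
  shows "\<gamma> t \<in> topspace T" "\<And>V. openin T V \<Longrightarrow> \<gamma> t \<in> V \<Longrightarrow> (\<forall>\<^sub>F s in nhds t. \<gamma> s \<in> V)"
    "\<And>c. c \<in> \<A> \<Longrightarrow> \<gamma> t \<in> fst c \<Longrightarrow> (\<forall>\<^sub>F s in nhds t. \<gamma> s \<in> fst c)"
    "\<And>c. c \<in> \<A> \<Longrightarrow> \<gamma> t \<in> fst c \<Longrightarrow> (\<forall>\<^sub>F s in nhds t. (snd c \<circ> \<gamma>) differentiable (at s))"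
    "\<And>c. c \<in> \<A> \<Longrightarrow> \<gamma> t \<in> fst c \<Longrightarrow> isCont (\<lambda>s. vector_derivative (snd c \<circ> \<gamma>) (at s)) t"
    "\<And>c. c \<in> \<A> \<Longrightarrow> \<gamma> t \<in> fst c \<Longrightarrow> (snd c \<circ> \<gamma> has_vector_derivative vector_derivative (snd c \<circ> \<gamma>) (at t)) (at t)"
  using assms is_chartD(1)[OF A_chart] eventually_nhds_x_imp_x vector_derivative_works
  unfolding regular_def by (blast, blast, blast, blast, blast, metis)

text \<open>Stated for any chart of the surface, since isothermal charts need not lie in the
  atlas.\<close>

lemma speed_in_chart:
  assumes c: "is_chart T c" "\<gamma> t \<in> fst c" "X c differentiable (at (snd c (\<gamma> t)))"
    and ev: "\<forall>\<^sub>F s in nhds t. \<gamma> s \<in> fst c" and d: "(snd c \<circ> \<gamma> has_vector_derivative d) (at t)"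
  shows "speed x \<gamma> t = metric_norm (X c) (snd c (\<gamma> t)) d"
proof -
  have "((\<lambda>t. X c ((snd c \<circ> \<gamma>) t)) has_vector_derivative
     Re d *\<^sub>R pd 1 (X c) (snd c (\<gamma> t)) + Im d *\<^sub>R pd 2 (X c) (snd c (\<gamma> t))) (at t)"
    using has_vector_derivative_pd_compose[of "X c" "snd c \<circ> \<gamma>" t d] c(3) d by simp
  moreover have "\<forall>\<^sub>F s in nhds t. (x \<circ> \<gamma>) s = X c ((snd c \<circ> \<gamma>) s)"
    using ev by eventually_elim (simp add: in_chart_def inv_into_f_f[OF is_chartD(3)[OF c(1)]])
  ultimately have "vector_derivative (x \<circ> \<gamma>) (at t) =
     Re d *\<^sub>R pd 1 (X c) (snd c (\<gamma> t)) + Im d *\<^sub>R pd 2 (X c) (snd c (\<gamma> t))"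
    by (simp add: vector_derivative_cong_nhds vector_derivative_at)
  then show ?thesis by (simp add: speed_def metric_norm_def)
qed

lemma regular_speed:
  assumes "regular \<gamma> t" "c \<in> \<A>" "\<gamma> t \<in> fst c"
  shows "speed x \<gamma> t = metric_norm (X c) (snd c (\<gamma> t)) (vector_derivative (snd c \<circ> \<gamma>) (at t))"
  using speed_in_chart[of c \<gamma> t, OF A_chart[OF assms(2)] assms(3) _ regularD(3)[OF assms] regularD(6)[OF assms]]
    smooth_onD(1)[OF X_smooth[OF assms(2)]] assms(3) by blast

lemma regular_speed_isCont:
  assumes "\<forall>\<^sub>F s in nhds t. regular \<gamma> s"
  shows "isCont (speed x \<gamma>) t"
proof -
  have t: "regular \<gamma> t" using assms by (rule eventually_nhds_x_imp_x)
  obtain c where c: "c \<in> \<A>" "\<gamma> t \<in> fst c" using A_cover regularD(1)[OF t] by blast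
  have oU: "open (img c)" by (rule is_chartD(2)[OF A_chart[OF c(1)]])
  have "isCont (snd c \<circ> \<gamma>) t" using regularD(6)[OF t c] by (rule has_vector_derivative_continuous)
  then have cont: "isCont (\<lambda>s. snd c (\<gamma> s)) t" by (simp add: o_def)
  have "isCont (pd i (X c)) (snd c (\<gamma> t))" for i
    using smooth_onD(3)[OF smooth_onD(2)[OF X_smooth[OF c(1)]]] oU c(2) by (simp add: continuous_on_eq_continuous_at)
  then have "isCont (\<lambda>s. pd i (X c) (snd c (\<gamma> s))) t" for i
    using isCont_o2[OF cont] by blast
  then have "isCont (\<lambda>s. metric_norm (X c) (snd c (\<gamma> s)) (vector_derivative (snd c \<circ> \<gamma>) (at s))) t"
    unfolding metric_norm_def using regularD(5)[OF t c]
    by (intro continuous_intros bounded_bilinear.continuous[OF bounded_bilinear_mink] isCont_Re isCont_Im)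
  moreover have "\<forall>\<^sub>F s in nhds t. metric_norm (X c) (snd c (\<gamma> s)) (vector_derivative (snd c \<circ> \<gamma>) (at s)) = speed x \<gamma> s"
    using assms regularD(3)[OF t c] by eventually_elim (rule regular_speed[OF _ c(1), symmetric])
  ultimately show ?thesis by (rule isCont_cong_nhds)
qed

lemma regular_speed_continuous_on:
  assumes "open D" "\<And>t. t \<in> D \<Longrightarrow> regular \<gamma> t"
  shows "continuous_on D (speed x \<gamma>)"
proof (rule continuous_at_imp_continuous_on, rule ballI)
  fix t assume "t \<in> D"
  from eventually_nhds_in_open[OF assms(1) this]
  have "\<forall>\<^sub>F s in nhds t. regular \<gamma> s" by eventually_elim (rule assms(2))
  then show "isCont (speed x \<gamma>) t" by (rule regular_speed_isCont)
qed

text \<open>By the chain rule one chart with smooth transitions to the atlas suffices. This is how a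
  curve given in isothermal charts becomes admissible for the induced distance.\<close>

lemma regular_one_chart:
  assumes c: "is_chart T c" "\<And>a. a \<in> \<A> \<Longrightarrow> smooth_on (change c a) (snd c ` (fst c \<inter> fst a))"
    and t: "\<gamma> t \<in> fst c" and ev: "\<forall>\<^sub>F s in nhds t. \<gamma> s \<in> fst c"
    and diff: "\<forall>\<^sub>F s in nhds t. (snd c \<circ> \<gamma>) differentiable (at s)"
    and cont: "isCont (\<lambda>s. vector_derivative (snd c \<circ> \<gamma>) (at s)) t"
  shows "regular \<gamma> t"
proof -
  define y where "y = snd c \<circ> \<gamma>"
  have y: "y differentiable (at t)" using diff eventually_nhds_x_imp_x unfolding y_def by blast
  then have yc: "isCont y t" by (rule differentiable_imp_continuous_within)
  have nhd: "\<forall>\<^sub>F s in nhds t. \<gamma> s \<in> V" if V: "openin T V" "\<gamma> t \<in> V" for V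
  proof -
    have "open (snd c ` (fst c \<inter> V))"
      by (rule is_chartD(5)[OF c(1)]) (use V is_chartD(1)[OF c(1)] in auto)
    moreover have "y t \<in> snd c ` (fst c \<inter> V)" using V t by (auto simp: y_def)
    ultimately have "\<forall>\<^sub>F s in nhds t. y s \<in> snd c ` (fst c \<inter> V)"
      using topological_tendstoD[OF isCont_tendsto_nhds[OF yc]] by blast
    then show ?thesis using ev
    proof eventually_elim
      case (elim s)
      then show ?case using is_chartD(3)[OF c(1)] by (auto simp: y_def dest!: inj_onD)
    qed
  qed
  have "(\<forall>\<^sub>F s in nhds t. (snd a \<circ> \<gamma>) differentiable (at s)) \<and>
        isCont (\<lambda>s. vector_derivative (snd a \<circ> \<gamma>) (at s)) t" if a: "a \<in> \<A>" "\<gamma> t \<in> fst a" for a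
  proof -
    define \<tau> where "\<tau> = change c a"
    define O' where "O' = snd c ` (fst c \<inter> fst a)"
    have \<tau>: "smooth_on \<tau> O'" using c(2)[OF a(1)] by (simp add: \<tau>_def O'_def)
    have oO: "open O'" unfolding O'_def
      by (rule is_chartD(5)[OF c(1)]) (use is_chartD(1)[OF c(1)] is_chartD(1)[OF A_chart[OF a(1)]] in auto)
    have ev2: "\<forall>\<^sub>F s in nhds t. \<gamma> s \<in> fst c \<inter> fst a"
      using ev nhd[OF is_chartD(1)[OF A_chart[OF a(1)]] a(2)] by eventually_elim simp
    let ?d = "\<lambda>s. Re (vector_derivative y (at s)) *\<^sub>R pd 1 \<tau> (y s) + Im (vector_derivative y (at s)) *\<^sub>R pd 2 \<tau> (y s)"
    have ev3: "\<forall>\<^sub>F s in nhds t. (snd a \<circ> \<gamma> has_vector_derivative ?d s) (at s)"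
      using eventually_nhds_twice[OF ev2] diff
    proof eventually_elim
      case (elim s)
      have s: "\<gamma> s \<in> fst c \<inter> fst a" using elim(1) by (rule eventually_nhds_x_imp_x)
      then have "y s \<in> O'" by (auto simp: y_def O'_def)
      then have "((\<lambda>t. \<tau> (y t)) has_vector_derivative ?d s) (at s)"
        using elim(2) smooth_onD(1)[OF \<tau>] vector_derivative_works[of y "at s"]
        by (intro has_vector_derivative_pd_compose) (simp_all add: y_def[symmetric])
      moreover have "\<forall>\<^sub>F s in nhds s. \<tau> (y s) = (snd a \<circ> \<gamma>) s"
        using elim(1) by eventually_elim (simp add: \<tau>_def y_def inv_into_f_f[OF is_chartD(3)[OF c(1)]])
      ultimately show ?case
        by (rule iffD1[OF has_vector_derivative_cong_nhds, rotated])
    qed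
    have yO: "y t \<in> O'" using t a by (auto simp: y_def O'_def)
    have "isCont (pd i \<tau>) (y t)" for i
      using smooth_onD(3)[OF smooth_onD(2)[OF \<tau>]] oO yO by (simp add: continuous_on_eq_continuous_at)
    then have "isCont (\<lambda>s. pd i \<tau> (y s)) t" for i using isCont_o2[OF yc] by blast
    then have "isCont ?d t" using cont unfolding y_def[symmetric] by (intro continuous_intros isCont_Re isCont_Im)
    moreover have "\<forall>\<^sub>F s in nhds t. ?d s = vector_derivative (snd a \<circ> \<gamma>) (at s)"
      using ev3 by eventually_elim (simp add: vector_derivative_at)
    ultimately have "isCont (\<lambda>s. vector_derivative (snd a \<circ> \<gamma>) (at s)) t" by (rule isCont_cong_nhds)
    moreover have "\<forall>\<^sub>F s in nhds t. (snd a \<circ> \<gamma>) differentiable (at s)"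
      using ev3 by eventually_elim (rule differentiableI_vector)
    ultimately show ?thesis by blast
  qed
  then show ?thesis using t nhd is_chartD(4)[OF c(1)] unfolding regular_def by blast
qed

lemma regular_cong:
  assumes "regular \<gamma> t" "\<forall>\<^sub>F s in nhds t. \<gamma> s = \<gamma>' s"
  shows "regular \<gamma>' t" "speed x \<gamma>' t = speed x \<gamma> t"
proof -
  have eq: "\<gamma>' t = \<gamma> t" using assms(2) eventually_nhds_x_imp_x by force
  obtain c where c: "c \<in> \<A>" "\<gamma> t \<in> fst c" using A_cover regularD(1)[OF assms(1)] by blast
  have ev2: "\<forall>\<^sub>F s in nhds t. \<forall>\<^sub>F s in nhds s. (snd c \<circ> \<gamma>) s = (snd c \<circ> \<gamma>') s"
    using eventually_nhds_twice[OF assms(2)]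
    by eventually_elim (erule eventually_mono, simp)
  show "regular \<gamma>' t"
  proof (rule regular_one_chart[OF A_chart[OF c(1)] A_smooth_transition[OF c(1)]])
    show "\<gamma>' t \<in> fst c" using c eq by simp
    show "\<forall>\<^sub>F s in nhds t. \<gamma>' s \<in> fst c" using assms(2) regularD(3)[OF assms(1) c] by eventually_elim simp
    show "\<forall>\<^sub>F s in nhds t. (snd c \<circ> \<gamma>') differentiable (at s)"
      using ev2 regularD(4)[OF assms(1) c] by eventually_elim (simp only: differentiable_cong_nhds[symmetric])
    have "\<forall>\<^sub>F s in nhds t. vector_derivative (snd c \<circ> \<gamma>) (at s) = vector_derivative (snd c \<circ> \<gamma>') (at s)"
      using ev2 by eventually_elim (rule vector_derivative_cong_nhds)
    with regularD(5)[OF assms(1) c] show "isCont (\<lambda>s. vector_derivative (snd c \<circ> \<gamma>') (at s)) t"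
      by (rule isCont_cong_nhds)
  qed
  have "\<forall>\<^sub>F s in nhds t. (x \<circ> \<gamma>') s = (x \<circ> \<gamma>) s" using assms(2) by eventually_elim simp
  then have "vector_derivative (x \<circ> \<gamma>') (at t) = vector_derivative (x \<circ> \<gamma>) (at t)"
    by (rule vector_derivative_cong_nhds)
  then show "speed x \<gamma>' t = speed x \<gamma> t" by (simp only: speed_def)
qed

lemma regular_affine:
  assumes "regular \<gamma> (b + m * s)"
  shows "regular (\<lambda>s. \<gamma> (b + m * s)) s" "speed x (\<lambda>s. \<gamma> (b + m * s)) s = \<bar>m\<bar> * speed x \<gamma> (b + m * s)"
proof -
  let ?t = "b + m * s"
  obtain c where c: "c \<in> \<A>" "\<gamma> ?t \<in> fst c" using A_cover regularD(1)[OF assms(1)] by blast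
  have lim: "filterlim (\<lambda>s. b + m * s) (nhds ?t) (nhds s)"
    by (intro tendsto_intros filterlim_ident)
  have ev: "\<forall>\<^sub>F s in nhds s. \<gamma> (b + m * s) \<in> fst c"
    using eventually_compose_filterlim[OF regularD(3)[OF assms c] lim] .
  have chain: "(snd c \<circ> (\<lambda>s. \<gamma> (b + m * s)) has_vector_derivative m *\<^sub>R vector_derivative (snd c \<circ> \<gamma>) (at (b + m * s))) (at s)"
    if "(snd c \<circ> \<gamma>) differentiable (at (b + m * s))" for s
  proof -
    have "((\<lambda>s. b + m * s) has_vector_derivative m) (at s)" by (auto intro!: derivative_eq_intros)
    from vector_diff_chain_at[OF this, of "snd c \<circ> \<gamma>"] that vector_derivative_works
    show ?thesis by (auto simp: o_def)
  qed
  have ev2: "\<forall>\<^sub>F s in nhds s. (snd c \<circ> (\<lambda>s. \<gamma> (b + m * s)) has_vector_derivative m *\<^sub>R vector_derivative (snd c \<circ> \<gamma>) (at (b + m * s))) (at s)"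
    using eventually_compose_filterlim[OF regularD(4)[OF assms c] lim] by eventually_elim (rule chain)
  show "regular (\<lambda>s. \<gamma> (b + m * s)) s"
  proof (rule regular_one_chart[OF A_chart[OF c(1)] A_smooth_transition[OF c(1)] c(2) ev])
    show "\<forall>\<^sub>F s in nhds s. (snd c \<circ> (\<lambda>s. \<gamma> (b + m * s))) differentiable (at s)"
      using ev2 by eventually_elim (rule differentiableI_vector)
    have "isCont (\<lambda>s. vector_derivative (snd c \<circ> \<gamma>) (at (b + m * s))) s"
    proof -
      have "isCont (\<lambda>s. b + m * s) s" by (intro continuous_intros)
      from isCont_o2[OF this regularD(5)[OF assms c]] show ?thesis .
    qed
    then have "isCont (\<lambda>s. m *\<^sub>R vector_derivative (snd c \<circ> \<gamma>) (at (b + m * s))) s" by (intro continuous_intros)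
    moreover have "\<forall>\<^sub>F s in nhds s. m *\<^sub>R vector_derivative (snd c \<circ> \<gamma>) (at (b + m * s)) = vector_derivative (snd c \<circ> (\<lambda>s. \<gamma> (b + m * s))) (at s)"
      using ev2 by eventually_elim (simp add: vector_derivative_at)
    ultimately show "isCont (\<lambda>s. vector_derivative (snd c \<circ> (\<lambda>s. \<gamma> (b + m * s))) (at s)) s"
      by (rule isCont_cong_nhds)
  qed
  have Xd: "X c differentiable (at (snd c (\<gamma> ?t)))" using smooth_onD(1)[OF X_smooth[OF c(1)]] c(2) by blast
  have "speed x (\<lambda>s. \<gamma> (b + m * s)) s = metric_norm (X c) (snd c (\<gamma> ?t)) (m *\<^sub>R vector_derivative (snd c \<circ> \<gamma>) (at ?t))"
    using speed_in_chart[of c "\<lambda>s. \<gamma> (b + m * s)" s, OF A_chart[OF c(1)] c(2) Xd ev eventually_nhds_x_imp_x[OF ev2]] .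
  then show "speed x (\<lambda>s. \<gamma> (b + m * s)) s = \<bar>m\<bar> * speed x \<gamma> ?t"
    using regular_speed[OF assms c] by (simp add: metric_norm_scaleR)
qed

text \<open>Substitution in the integral. Negative \<open>m\<close> is included for the reversal of
  curves.\<close>

lemma length_affine:
  assumes D: "open D" "\<And>t. t \<in> D \<Longrightarrow> regular \<gamma> t" and m: "m \<noteq> 0"
  shows "(\<integral>\<^sup>+ s. ennreal (speed x (\<lambda>s. \<gamma> (b + m * s)) s) * indicator D (b + m * s) \<partial>lborel)
    = (\<integral>\<^sup>+ t. ennreal (speed x \<gamma> t) * indicator D t \<partial>lborel)"
proof -
  have "(\<lambda>t. indicator D t *\<^sub>R speed x \<gamma> t) \<in> borel_measurable borel"
    using D(1) regular_speed_continuous_on[OF D] by (intro borel_measurable_continuous_on_indicator) auto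
  then have "(\<lambda>t. ennreal (indicator D t *\<^sub>R speed x \<gamma> t)) \<in> borel_measurable borel" by measurable
  moreover have "(\<lambda>t. ennreal (indicator D t *\<^sub>R speed x \<gamma> t)) = (\<lambda>t. ennreal (speed x \<gamma> t) * indicator D t)"
    by (auto simp: indicator_def)
  ultimately have meas: "(\<lambda>t. ennreal (speed x \<gamma> t) * indicator D t) \<in> borel_measurable borel" by simp
  have "(\<integral>\<^sup>+ t. ennreal (speed x \<gamma> t) * indicator D t \<partial>lborel)
    = \<bar>m\<bar> * (\<integral>\<^sup>+ s. ennreal (speed x \<gamma> (b + m * s)) * indicator D (b + m * s) \<partial>lborel)"
    by (rule nn_integral_real_affine[OF meas m])
  also have "\<dots> = (\<integral>\<^sup>+ s. \<bar>m\<bar> * (ennreal (speed x \<gamma> (b + m * s)) * indicator D (b + m * s)) \<partial>lborel)"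
    by (rule nn_integral_cmult[symmetric]) (rule measurable_compose[OF _ meas], measurable)
  also have "\<dots> = (\<integral>\<^sup>+ s. ennreal (speed x (\<lambda>s. \<gamma> (b + m * s)) s) * indicator D (b + m * s) \<partial>lborel)"
    by (intro nn_integral_cong) (auto simp: indicator_def regular_affine(2)[OF D(2)] ennreal_mult')
  finally show ?thesis by simp
qed

lemma pathin_nhds:
  assumes "pathin T \<gamma>" "t \<in> {0<..<1}" "openin T V" "\<gamma> t \<in> V"
  shows "\<forall>\<^sub>F s in nhds t. \<gamma> s \<in> V"
proof -
  have "openin (top_of_set {0..1}) {s \<in> topspace (top_of_set {0..1}). \<gamma> s \<in> V}"
    using assms(1,3) unfolding pathin_def by (rule openin_continuous_map_preimage)
  then have "openin (top_of_set {0..1::real}) {s \<in> {0..1}. \<gamma> s \<in> V}" by simp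
  then obtain W where W: "open W" "{s \<in> {0..1}. \<gamma> s \<in> V} = {0..1} \<inter> W" by (metis openin_open)
  have "t \<in> {0..1} \<inter> W" unfolding W(2)[symmetric] using assms(2,4) by simp
  then have t: "t \<in> W \<inter> {0<..<1}" using assms(2) by blast
  have "open (W \<inter> {0<..<1})" using W(1) by (intro open_Int) simp_all
  from eventually_nhds_in_open[OF this t] show ?thesis
  proof eventually_elim
    case (elim s)
    then have "s \<in> {0..1} \<inter> W" by simp
    then show ?case unfolding W(2)[symmetric] by blast
  qed
qed

text \<open>Continuity of the path makes the parameters with values in a chart an open set once the
  exceptional ones are removed, so being C1 on that set and near each of its points is the
  same.\<close>

lemma pw_C1_curve_iff:
  "pw_C1_curve T \<A> p q \<gamma> \<longleftrightarrow> pathin T \<gamma> \<and> \<gamma> 0 = p \<and> \<gamma> 1 = q \<and>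
     (\<exists>S. finite S \<and> (\<forall>t\<in>{0<..<1} - S. regular \<gamma> t))"
proof -
  have "(\<forall>(U, f)\<in>\<A>. (f \<circ> \<gamma>) C1_differentiable_on {t\<in>{0<..<1} - S. \<gamma> t \<in> U}) \<longleftrightarrow> (\<forall>t\<in>{0<..<1} - S. regular \<gamma> t)"
    if path: "pathin T \<gamma>" and S: "finite S" for S
  proof
    have oD: "open ({0<..<1} - S)" using S by (auto intro: finite_imp_closed)
    assume C1: "\<forall>(U, f)\<in>\<A>. (f \<circ> \<gamma>) C1_differentiable_on {t\<in>{0<..<1} - S. \<gamma> t \<in> U}"
    show "\<forall>t\<in>{0<..<1} - S. regular \<gamma> t"
    proof
      fix t assume t: "t \<in> {0<..<1} - S"
      have gt: "\<gamma> t \<in> topspace T"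
        using path t unfolding pathin_def continuous_map_def by auto
      obtain c where c: "c \<in> \<A>" "\<gamma> t \<in> fst c" using A_cover gt by blast
      have C1c: "(snd c \<circ> \<gamma>) C1_differentiable_on {t\<in>{0<..<1} - S. \<gamma> t \<in> fst c}" using C1 c(1) by (cases c) auto
      have ev: "\<forall>\<^sub>F s in nhds t. \<gamma> s \<in> fst c"
        by (rule pathin_nhds[OF path _ is_chartD(1)[OF A_chart[OF c(1)]] c(2)]) (use t in auto)
      have "\<forall>\<^sub>F s in nhds t. s \<in> {t\<in>{0<..<1} - S. \<gamma> t \<in> fst c}"
        using ev eventually_nhds_in_open[OF oD t] by eventually_elim simp
      then obtain N where N: "open N" "t \<in> N" "N \<subseteq> {t\<in>{0<..<1} - S. \<gamma> t \<in> fst c}"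
        unfolding eventually_nhds by blast
      have C1N: "(snd c \<circ> \<gamma>) C1_differentiable_on N" using C1_differentiable_on_subset[OF C1c N(3)] .
      show "regular \<gamma> t"
      proof (rule regular_one_chart[OF A_chart[OF c(1)] A_smooth_transition[OF c(1)] c(2) ev])
        show "\<forall>\<^sub>F s in nhds t. (snd c \<circ> \<gamma>) differentiable (at s)"
          using eventually_nhds_in_open[OF N(1,2)] by eventually_elim (use C1N in \<open>simp add: C1_differentiable_on_eq\<close>)
        show "isCont (\<lambda>s. vector_derivative (snd c \<circ> \<gamma>) (at s)) t"
          using C1N N(1,2) by (simp add: C1_differentiable_on_eq continuous_on_eq_continuous_at)
      qed
    qed
  next
    assume reg: "\<forall>t\<in>{0<..<1} - S. regular \<gamma> t"
    show "\<forall>(U, f)\<in>\<A>. (f \<circ> \<gamma>) C1_differentiable_on {t\<in>{0<..<1} - S. \<gamma> t \<in> U}"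
    proof (intro ballI, clarify)
      fix U f assume c: "(U, f) \<in> \<A>"
      have "(f \<circ> \<gamma>) differentiable (at t)" "isCont (\<lambda>s. vector_derivative (f \<circ> \<gamma>) (at s)) t"
        if "t \<in> {t\<in>{0<..<1} - S. \<gamma> t \<in> U}" for t
        using regularD(4)[of \<gamma> t "(U,f)", OF _ c] regularD(5)[of \<gamma> t "(U,f)", OF _ c] reg that eventually_nhds_x_imp_x by auto
      then show "(f \<circ> \<gamma>) C1_differentiable_on {t\<in>{0<..<1} - S. \<gamma> t \<in> U}"
        unfolding C1_differentiable_on_eq by (auto intro: continuous_at_imp_continuous_on)
    qed
  qed
  then show ?thesis unfolding pw_C1_curve_def by blast
qed

end

subsection \<open>Integration of closed forms\<close>

lemma has_vector_derivative_horizontal: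
  assumes "f differentiable (at (Complex u v))"
  shows "((\<lambda>u. f (Complex u v)) has_vector_derivative pd 1 f (Complex u v)) (at u)"
proof -
  have "((\<lambda>u. Complex u v) has_vector_derivative 1) (at u)"
    by (auto simp: has_vector_derivative_complex_iff intro!: derivative_eq_intros)
  from has_vector_derivative_pd_compose[OF assms this] show ?thesis by simp
qed

lemma has_vector_derivative_vertical:
  assumes "f differentiable (at (Complex u v))"
  shows "((\<lambda>v. f (Complex u v)) has_vector_derivative pd 2 f (Complex u v)) (at v)"
proof -
  have "((\<lambda>v. Complex u v) has_vector_derivative \<i>) (at v)"
    by (auto simp: has_vector_derivative_complex_iff intro!: derivative_eq_intros)
  from has_vector_derivative_pd_compose[OF assms this] show ?thesis by simp
qed

text \<open>The increment of \<open>f\<close> in the second variable is the integral of its second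
  partial. Differentiating this under the integral sign in the first variable and then at the end
  point in the second produces both orders.\<close>

lemma mixed_partials:
  fixes f :: "complex \<Rightarrow> 'b::banach"
  assumes S: "open S" "z0 \<in> S" and f: "smooth_on f S"
  shows "pd 1 (pd 2 f) z0 = pd 2 (pd 1 f) z0"
proof -
  obtain r where r: "r > 0" "ball z0 r \<subseteq> S" using S open_contains_ball by blast
  define e where "e = r / 2"
  define u0 where "u0 = Re z0"
  define v0 where "v0 = Im z0"
  have e: "e > 0" using r by (simp add: e_def)
  have box: "Complex u v \<in> S" if "u \<in> {u0-e<..<u0+e}" "v \<in> {v0..v0+e/2}" for u v
  proof -
    have "norm (Complex u v - z0) \<le> \<bar>u - u0\<bar> + \<bar>v - v0\<bar>"
      using cmod_le[of "Complex u v - z0"] by (simp add: u0_def v0_def)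
    also have "\<dots> < r" using that by (auto simp: e_def abs_if)
    finally show ?thesis using r(2) by (auto simp: dist_norm norm_minus_commute)
  qed
  note D = smooth_onD[OF f] and D2 = smooth_onD[OF smooth_onD(2)[OF f]] and D3 = smooth_onD[OF smooth_onD(2)[OF smooth_onD(2)[OF f]]]
  let ?U = "{u0-e<..<u0+e}"
  have u0: "u0 \<in> ?U" using e by simp
  have cC: "continuous_on A (\<lambda>v. Complex u v)" for A u
    by (auto intro!: continuous_intros simp: complex_eq_iff Complex_eq)
  have int: "f (Complex u0' v) - f (Complex u0' v0) = integral {v0..v} (\<lambda>t. pd 2 f (Complex u0' t))"
    if "u0' \<in> ?U" "v \<in> {v0..v0+e/2}" for u0' v
  proof -
    have "((\<lambda>t. pd 2 f (Complex u0' t)) has_integral f (Complex u0' v) - f (Complex u0' v0)) {v0..v}"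
    proof (rule fundamental_theorem_of_calculus)
      show "v0 \<le> v" using that by simp
      fix t assume "t \<in> {v0..v}"
      then have "Complex u0' t \<in> S" using that by (intro box) auto
      from has_vector_derivative_vertical[OF D(1)[OF this]]
      show "((\<lambda>t. f (Complex u0' t)) has_vector_derivative pd 2 f (Complex u0' t)) (at t within {v0..v})"
        by (rule has_vector_derivative_at_within)
    qed
    then show ?thesis by (simp add: integral_unique)
  qed
  have key: "pd 1 f (Complex u0 v) - pd 1 f (Complex u0 v0) = integral {v0..v} (\<lambda>t. pd 1 (pd 2 f) (Complex u0 t))"
    if v: "v \<in> {v0..v0+e/2}" for v
  proof -
    have sub: "t \<in> {v0..v0+e/2}" if "t \<in> {v0..v}" for t using that v by auto
    have "((\<lambda>u. integral (cbox v0 v) (\<lambda>t. pd 2 f (Complex u t))) has_vector_derivative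
        integral (cbox v0 v) (\<lambda>t. pd 1 (pd 2 f) (Complex u0 t))) (at u0 within ?U)"
    proof (rule leibniz_rule_vector_derivative)
      show "((\<lambda>u. pd 2 f (Complex u t)) has_vector_derivative pd 1 (pd 2 f) (Complex u t)) (at u within ?U)"
        if "u \<in> ?U" "t \<in> cbox v0 v" for u t
        by (rule has_vector_derivative_at_within, rule has_vector_derivative_horizontal, rule D2(1), rule box)
           (use that sub in auto)
      show "(\<lambda>t. pd 2 f (Complex u t)) integrable_on cbox v0 v" if "u \<in> ?U" for u
        by (rule integrable_continuous, rule continuous_on_compose2[OF D2(3) cC]) (use that sub box in auto)
      have "continuous_on (?U \<times> cbox v0 v) (\<lambda>p. pd 1 (pd 2 f) (Complex (fst p) (snd p)))"
        by (rule continuous_on_compose2[OF D3(3)])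
           (use sub box in \<open>auto simp: Complex_eq intro!: continuous_intros\<close>)
      then show "continuous_on (?U \<times> cbox v0 v) (\<lambda>(u, t). pd 1 (pd 2 f) (Complex u t))"
        by (simp add: case_prod_unfold)
    qed (use u0 in auto)
    then have d1: "((\<lambda>u. integral {v0..v} (\<lambda>t. pd 2 f (Complex u t))) has_vector_derivative
        integral {v0..v} (\<lambda>t. pd 1 (pd 2 f) (Complex u0 t))) (at u0)"
      unfolding at_within_open[OF u0 open_greaterThanLessThan] box_real .
    have "((\<lambda>u. f (Complex u v) - f (Complex u v0)) has_vector_derivative
        pd 1 f (Complex u0 v) - pd 1 f (Complex u0 v0)) (at u0)"
      using v e u0 by (intro has_vector_derivative_diff has_vector_derivative_horizontal D(1) box) auto
    then have "((\<lambda>u. integral {v0..v} (\<lambda>t. pd 2 f (Complex u t))) has_vector_derivative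
        pd 1 f (Complex u0 v) - pd 1 f (Complex u0 v0)) (at u0)"
      by (rule iffD1[OF has_vector_derivative_cong_nhds, rotated])
         (rule eventually_mono[OF eventually_nhds_in_open[OF _ u0]], use int v in auto)
    then show ?thesis using d1 vector_derivative_unique_at by blast
  qed
  \<comment> \<open>A one-sided neighbourhood of \<open>v0\<close> suffices, because derivatives
    within it are unique.\<close>
  let ?I = "{v0..v0+e/2}"
  have "((\<lambda>v. integral {v0..v} (\<lambda>t. pd 1 (pd 2 f) (Complex u0 t))) has_vector_derivative pd 1 (pd 2 f) (Complex u0 v0)) (at v0 within ?I)"
    by (rule integral_has_vector_derivative, rule continuous_on_compose2[OF D3(3) cC]) (use box u0 e in auto)
  then have "((\<lambda>v. pd 1 f (Complex u0 v) - pd 1 f (Complex u0 v0)) has_vector_derivative pd 1 (pd 2 f) (Complex u0 v0)) (at v0 within ?I)"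
    by (rule has_vector_derivative_transform[rotated 2]) (use e key in auto)
  moreover have "((\<lambda>v. pd 1 f (Complex u0 v) - pd 1 f (Complex u0 v0)) has_vector_derivative pd 2 (pd 1 f) (Complex u0 v0) - 0) (at v0 within ?I)"
    by (rule has_vector_derivative_at_within, intro has_vector_derivative_diff has_vector_derivative_const
        has_vector_derivative_vertical D2(1) box) (use e u0 in auto)
  ultimately have "pd 1 (pd 2 f) (Complex u0 v0) = pd 2 (pd 1 f) (Complex u0 v0) - 0"
    by (rule vector_derivative_unique_within[rotated]) (use e in \<open>simp add: trivial_limit_within islimpt_Icc\<close>)
  then show ?thesis by (simp add: u0_def v0_def)
qed

text \<open>The real differential with partials \<open>a\<close> and \<open>b\<close> as a bounded
  linear map, the form in which the Leibniz rule and the inverse function theorem take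
  derivatives.\<close>

definition complex_blinfun :: "'b::real_normed_vector \<Rightarrow> 'b \<Rightarrow> complex \<Rightarrow>\<^sub>L 'b" where
  "complex_blinfun a b = (blinfun_scaleR_left a o\<^sub>L Blinfun Re) + (blinfun_scaleR_left b o\<^sub>L Blinfun Im)"

lemma complex_blinfun_apply: "blinfun_apply (complex_blinfun a b) h = Re h *\<^sub>R a + Im h *\<^sub>R b"
  by (simp add: complex_blinfun_def blinfun.add_left bounded_linear_Blinfun_apply bounded_linear_Re bounded_linear_Im)

lemma continuous_on_complex_blinfun:
  "continuous_on A f \<Longrightarrow> continuous_on A g \<Longrightarrow> continuous_on A (\<lambda>z. complex_blinfun (f z) (g z))"
  unfolding complex_blinfun_def by (intro continuous_intros)

lemma poincare_lemma:
  fixes P Q :: "complex \<Rightarrow> 'b::banach"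
  assumes P: "smooth_on P (ball z0 r)" and Q: "smooth_on Q (ball z0 r)"
    and closed: "\<And>z. z \<in> ball z0 r \<Longrightarrow> pd 2 P z = pd 1 Q z"
  obtains Y where "\<And>z. z \<in> ball z0 r \<Longrightarrow> (Y has_derivative (\<lambda>h. Re h *\<^sub>R P z + Im h *\<^sub>R Q z)) (at z)"
proof -
  let ?B = "ball z0 r"
  define \<gamma> where "\<gamma> z t = z0 + of_real t * (z - z0)" for z :: complex and t :: real
  have \<gamma>B: "\<gamma> z t \<in> ?B" if "z \<in> ?B" "t \<in> {0..1}" for z t
  proof -
    have "norm (of_real t * (z - z0)) \<le> 1 * norm (z - z0)" unfolding norm_mult using that by (intro mult_right_mono) auto
    then show ?thesis using that by (simp add: \<gamma>_def dist_norm norm_minus_commute)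
  qed
  note DP = smooth_onD[OF P] and DP2 = smooth_onD[OF smooth_onD(2)[OF P]]
  note DQ = smooth_onD[OF Q] and DQ2 = smooth_onD[OF smooth_onD(2)[OF Q]]
  define f where "f z t = Re (z - z0) *\<^sub>R P (\<gamma> z t) + Im (z - z0) *\<^sub>R Q (\<gamma> z t)" for z t
  \<comment> \<open>The partials of \<open>f\<close> in \<open>z\<close>, with closedness already
    used to write them as the derivatives in \<open>t\<close> of
    \<open>t *\<^sub>R P (\<gamma> z t)\<close> and \<open>t *\<^sub>R Q (\<gamma> z t)\<close>.
    Hence they integrate to the values of P and Q at the end of the segment.\<close>
  define A1 where "A1 z t = P (\<gamma> z t) + t *\<^sub>R (Re (z - z0) *\<^sub>R pd 1 P (\<gamma> z t) + Im (z - z0) *\<^sub>R pd 2 P (\<gamma> z t))" for z t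
  define A2 where "A2 z t = Q (\<gamma> z t) + t *\<^sub>R (Re (z - z0) *\<^sub>R pd 1 Q (\<gamma> z t) + Im (z - z0) *\<^sub>R pd 2 Q (\<gamma> z t))" for z t
  have fder: "((\<lambda>z. f z t) has_derivative complex_blinfun (A1 z t) (A2 z t)) (at z within ?B)"
    if "z \<in> ?B" "t \<in> cbox 0 1" for z t
  proof -
    have g': "((\<lambda>z. \<gamma> z t) has_derivative (\<lambda>h. of_real t * h)) (at z)"
      unfolding \<gamma>_def by (auto intro!: derivative_eq_intros)
    have gB: "\<gamma> z t \<in> ?B" using \<gamma>B that by simp
    have R: "((\<lambda>z. Re (z - z0)) has_derivative Re) (at z)" "((\<lambda>z. Im (z - z0)) has_derivative Im) (at z)"
      by (auto intro!: derivative_eq_intros)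
    have "((\<lambda>z. f z t) has_derivative (\<lambda>h. (Re (z - z0) *\<^sub>R (Re (of_real t * h) *\<^sub>R pd 1 P (\<gamma> z t) + Im (of_real t * h) *\<^sub>R pd 2 P (\<gamma> z t)) + Re h *\<^sub>R P (\<gamma> z t))
       + (Im (z - z0) *\<^sub>R (Re (of_real t * h) *\<^sub>R pd 1 Q (\<gamma> z t) + Im (of_real t * h) *\<^sub>R pd 2 Q (\<gamma> z t)) + Im h *\<^sub>R Q (\<gamma> z t)))) (at z)"
      unfolding f_def
      by (intro has_derivative_add has_derivative_scaleR R has_derivative_pd_compose[OF DP(1)[OF gB] g']
          has_derivative_pd_compose[OF DQ(1)[OF gB] g'])
    moreover have "(Re (z - z0) *\<^sub>R (Re (of_real t * h) *\<^sub>R pd 1 P (\<gamma> z t) + Im (of_real t * h) *\<^sub>R pd 2 P (\<gamma> z t)) + Re h *\<^sub>R P (\<gamma> z t))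
       + (Im (z - z0) *\<^sub>R (Re (of_real t * h) *\<^sub>R pd 1 Q (\<gamma> z t) + Im (of_real t * h) *\<^sub>R pd 2 Q (\<gamma> z t)) + Im h *\<^sub>R Q (\<gamma> z t))
       = blinfun_apply (complex_blinfun (A1 z t) (A2 z t)) h" for h
      unfolding complex_blinfun_apply A1_def A2_def closed[OF gB] by (simp add: algebra_simps)
    ultimately show ?thesis by (simp add: has_derivative_at_withinI)
  qed
  have cg: "continuous_on (?B \<times> {0..1}) (\<lambda>p. \<gamma> (fst p) (snd p))"
    unfolding \<gamma>_def by (intro continuous_intros)
  have cc: "continuous_on (?B \<times> {0..1}) (\<lambda>p. h (\<gamma> (fst p) (snd p)))" if "continuous_on ?B h" for h :: "complex \<Rightarrow> 'b"
    by (rule continuous_on_compose2[OF that cg]) (use \<gamma>B in auto)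
  have "continuous_on (?B \<times> {0..1}) (\<lambda>p. complex_blinfun (A1 (fst p) (snd p)) (A2 (fst p) (snd p)))"
    unfolding A1_def A2_def by (intro continuous_on_complex_blinfun continuous_intros cc DP(3) DQ(3) DP2(3) DQ2(3))
  then have cont: "continuous_on (?B \<times> cbox 0 1) (\<lambda>(z, t). complex_blinfun (A1 z t) (A2 z t))"
    by (simp add: case_prod_unfold)
  have cg1: "continuous_on {0..1} (\<lambda>t. \<gamma> z t)" for z unfolding \<gamma>_def by (intro continuous_intros)
  have c1: "continuous_on {0..1} (\<lambda>t. h (\<gamma> z t))" if "z \<in> ?B" "continuous_on ?B h" for z and h :: "complex \<Rightarrow> 'b"
    by (rule continuous_on_compose2[OF that(2) cg1]) (use \<gamma>B that in auto)
  define Y where "Y z = integral (cbox 0 1) (f z)" for z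
  have "(Y has_derivative (\<lambda>h. Re h *\<^sub>R P z + Im h *\<^sub>R Q z)) (at z)" if z: "z \<in> ?B" for z
  proof -
    have dY: "(Y has_derivative integral (cbox 0 1) (\<lambda>t. complex_blinfun (A1 z t) (A2 z t))) (at z within ?B)"
      unfolding Y_def[abs_def]
    proof (rule leibniz_rule[OF fder _ cont z convex_ball])
      show "f z integrable_on cbox 0 1" if "z \<in> ?B" for z
        unfolding f_def using that
        by (intro integrable_continuous continuous_intros) (auto intro!: c1 DP(3) DQ(3))
    qed
    have eq: "blinfun_apply (integral (cbox 0 1) (\<lambda>t. complex_blinfun (A1 z t) (A2 z t))) h = Re h *\<^sub>R P z + Im h *\<^sub>R Q z" for h
    proof -
      have io: "(\<lambda>t. complex_blinfun (A1 z t) (A2 z t)) integrable_on cbox 0 1"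
        unfolding A1_def A2_def
        by (intro integrable_continuous continuous_on_complex_blinfun continuous_intros)
           (use z in \<open>auto intro!: c1 DP(3) DQ(3) DP2(3) DQ2(3)\<close>)
      have ftc: "((\<lambda>t. K (\<gamma> z t) + t *\<^sub>R (Re (z - z0) *\<^sub>R pd 1 K (\<gamma> z t) + Im (z - z0) *\<^sub>R pd 2 K (\<gamma> z t))) has_integral K z) {0..1}"
        if K: "\<And>w. w \<in> ?B \<Longrightarrow> K differentiable (at w)" for K :: "complex \<Rightarrow> 'b"
      proof -
        have "((\<lambda>t. K (\<gamma> z t) + t *\<^sub>R (Re (z - z0) *\<^sub>R pd 1 K (\<gamma> z t) + Im (z - z0) *\<^sub>R pd 2 K (\<gamma> z t))) has_integral
            1 *\<^sub>R K (\<gamma> z 1) - 0 *\<^sub>R K (\<gamma> z 0)) {0..1}"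
        proof (rule fundamental_theorem_of_calculus)
          fix t :: real assume t: "t \<in> {0..1}"
          have "((\<lambda>t. \<gamma> z t) has_vector_derivative (z - z0)) (at t)"
            unfolding \<gamma>_def by (auto intro!: derivative_eq_intros)
          from has_vector_derivative_pd_compose[OF K[OF \<gamma>B[OF z t]] this]
          have k: "((\<lambda>t. K (\<gamma> z t)) has_vector_derivative Re (z - z0) *\<^sub>R pd 1 K (\<gamma> z t) + Im (z - z0) *\<^sub>R pd 2 K (\<gamma> z t)) (at t)" .
          have "((\<lambda>t. t *\<^sub>R K (\<gamma> z t)) has_vector_derivative t *\<^sub>R (Re (z - z0) *\<^sub>R pd 1 K (\<gamma> z t) + Im (z - z0) *\<^sub>R pd 2 K (\<gamma> z t)) + 1 *\<^sub>R K (\<gamma> z t)) (at t)"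
            by (rule has_vector_derivative_scaleR[OF _ k]) (auto intro!: derivative_eq_intros)
          then show "((\<lambda>t. t *\<^sub>R K (\<gamma> z t)) has_vector_derivative K (\<gamma> z t) + t *\<^sub>R (Re (z - z0) *\<^sub>R pd 1 K (\<gamma> z t) + Im (z - z0) *\<^sub>R pd 2 K (\<gamma> z t))) (at t within {0..1})"
            by (simp add: add.commute has_vector_derivative_at_within)
        qed simp
        then show ?thesis by (simp add: \<gamma>_def)
      qed
      have i1: "((\<lambda>t. blinfun_apply (complex_blinfun (A1 z t) (A2 z t)) h) has_integral Re h *\<^sub>R P z + Im h *\<^sub>R Q z) {0..1}"
        unfolding complex_blinfun_apply A1_def A2_def
        by (intro has_integral_add has_integral_cmul ftc DP(1) DQ(1))
      have i2: "((\<lambda>t. blinfun_apply (complex_blinfun (A1 z t) (A2 z t)) h) has_integral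
          blinfun_apply (integral (cbox 0 1) (\<lambda>t. complex_blinfun (A1 z t) (A2 z t))) h) (cbox 0 1)"
        using has_integral_linear[OF integrable_integral[OF io] blinfun.bounded_linear_left[of h]]
        by (simp add: o_def)
      show ?thesis by (rule has_integral_unique[OF i2 i1[folded box_real(2)]])
    qed
    show ?thesis using dY unfolding at_within_open[OF z open_ball] eq .
  qed
  then show ?thesis by (rule that)
qed

text \<open>Cramer's rule; \<open>matrix_inv\<close> is a choice of a two-sided inverse, which
  uniqueness of inverses identifies with the adjugate over \<open>D\<close>.\<close>

lemma matrix_inv_2:
  fixes A :: "real^2^2"
  assumes "D = A$1$1 * A$2$2 - A$1$2 * A$2$1" "D \<noteq> 0"
  shows "matrix_inv A $ 1 $ 1 = A$2$2 / D" "matrix_inv A $ 2 $ 2 = A$1$1 / D"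
    "matrix_inv A $ 1 $ 2 = - A$1$2 / D" "matrix_inv A $ 2 $ 1 = - A$2$1 / D"
proof -
  define B :: "real^2^2" where "B = (\<chi> i j. if i = 1 then (if j = 1 then A$2$2 / D else - A$1$2 / D)
     else (if j = 1 then - A$2$1 / D else A$1$1 / D))"
  have "A ** B = mat 1" "B ** A = mat 1"
    using assms by (auto simp: vec_eq_iff forall_2 matrix_matrix_mult_def mat_def sum_2 B_def field_simps)
  then have "A ** matrix_inv A = mat 1 \<and> matrix_inv A ** A = mat 1"
    unfolding matrix_inv_def by (intro someI[of "\<lambda>B. A ** B = mat 1 \<and> B ** A = mat 1" B] conjI)
  then have "matrix_inv A = B" using \<open>B ** A = mat 1\<close>
    by (metis matrix_mul_assoc matrix_mul_lid matrix_mul_rid)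
  then show "matrix_inv A $ 1 $ 1 = A$2$2 / D" "matrix_inv A $ 2 $ 2 = A$1$1 / D"
    "matrix_inv A $ 1 $ 2 = - A$1$2 / D" "matrix_inv A $ 2 $ 1 = - A$2$1 / D"
    by (simp_all add: B_def)
qed

subsection \<open>Convergence of curves on complete surfaces\<close>

context spacelike begin

lemma curve_in_topspace: "pathin T \<gamma> \<Longrightarrow> t \<in> {0..1} \<Longrightarrow> \<gamma> t \<in> topspace T"
  unfolding pathin_def continuous_map_def by auto

lemma chart_inv_continuous_map:
  assumes "c \<in> \<A>"
  shows "continuous_map (top_of_set (img c)) T (chart_inv c)"
  unfolding continuous_map_def
proof (intro conjI allI impI)
  note C = is_chartD[OF A_chart[OF assms]]
  show "chart_inv c \<in> topspace (top_of_set (img c)) \<rightarrow> topspace T"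
    using C(4) inv_into_into[of _ "snd c" "fst c"] by (simp add: Pi_iff subset_iff)
  fix V assume V: "openin T V"
  have "open (snd c ` (fst c \<inter> V))" by (rule C(5)) (use V C(1) in auto)
  moreover have "{z \<in> topspace (top_of_set (img c)). chart_inv c z \<in> V} = snd c ` (fst c \<inter> V)"
    using inv_into_f_f[OF C(3)] by auto
  ultimately show "openin (top_of_set (img c)) {z \<in> topspace (top_of_set (img c)). chart_inv c z \<in> V}"
    using openin_open_eq[OF C(2)] by auto
qed

text \<open>As long as the curve stays in the coordinate disc its speed is at least \<open>k\<close>
  times its coordinate speed, and before leaving it has to cover the coordinate distance
  \<rho>.\<close>

lemma curve_length_lower:
  assumes c: "c \<in> \<A>" "p \<in> fst c" and \<rho>: "\<rho> > 0" "cball (snd c p) \<rho> \<subseteq> img c"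
    and k: "k > 0" "\<And>z h. z \<in> cball (snd c p) \<rho> \<Longrightarrow> k * norm h \<le> metric_norm (X c) z h"
    and \<gamma>: "pw_C1_curve T \<A> p q \<gamma>" and q: "\<not> (q \<in> fst c \<and> snd c q \<in> ball (snd c p) \<rho>)"
  shows "ennreal (k * \<rho>) \<le> curve_length x \<gamma>"
proof -
  note C = is_chartD[OF A_chart[OF c(1)]]
  obtain S where path: "pathin T \<gamma>" and pq: "\<gamma> 0 = p" "\<gamma> 1 = q" and S: "finite S"
    and reg: "\<And>t. t \<in> {0<..<1} - S \<Longrightarrow> regular \<gamma> t"
    using \<gamma> unfolding pw_C1_curve_iff by blast
  define V where "V = {p' \<in> fst c. snd c p' \<in> ball (snd c p) \<rho>}"
  define K where "K = chart_inv c ` cball (snd c p) \<rho>"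
  have V: "openin T V" unfolding V_def by (rule C(6)) simp
  \<comment> \<open>The closed coordinate disc is compact, hence closed in the Hausdorff surface. So
    at the first exit time \<open>t1\<close> the curve is still in the chart, namely on the boundary
    circle.\<close>
  have "compactin (top_of_set (img c)) (cball (snd c p) \<rho>)"
    using \<rho>(2) by (simp add: compactin_subtopology)
  then have "compactin T K" unfolding K_def by (rule image_compactin[OF _ chart_inv_continuous_map[OF c(1)]])
  then have K: "closedin T K" by (rule compactin_imp_closedin[OF T_hausdorff])
  have VK: "V \<subseteq> K"
  proof
    fix p' assume "p' \<in> V"
    then have "p' = chart_inv c (snd c p')" "snd c p' \<in> cball (snd c p) \<rho>"
      using inv_into_f_f[OF C(3)] by (auto simp: V_def)
    then show "p' \<in> K" unfolding K_def by blast
  qed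
  have KU: "p' \<in> fst c \<and> snd c p' \<in> cball (snd c p) \<rho>" if p': "p' \<in> K" for p'
  proof -
    obtain z where z: "z \<in> cball (snd c p) \<rho>" "p' = chart_inv c z" using p' unfolding K_def by blast
    then have "z \<in> img c" using \<rho>(2) by blast
    then show ?thesis using z inv_into_into[of z "snd c" "fst c"] f_inv_into_f[of z "snd c" "fst c"] by simp
  qed
  have cm: "continuous_map (top_of_set {0..1}) T \<gamma>" using path by (simp add: pathin_def)
  define B where "B = {t \<in> {0..1}. \<gamma> t \<notin> V}"
  have "closedin (top_of_set {0..1}) {t \<in> topspace (top_of_set {0..1}). \<gamma> t \<in> topspace T - V}"
    by (rule closedin_continuous_map_preimage[OF cm]) (use V in auto)
  moreover have "{t \<in> topspace (top_of_set {0..1}). \<gamma> t \<in> topspace T - V} = B"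
    using curve_in_topspace[OF path] by (auto simp: B_def)
  ultimately have "closedin (top_of_set {0..1}) B" by simp
  then have clB: "closed B" by (rule closedin_closed_trans) simp
  have B1: "1 \<in> B" using q pq by (auto simp: B_def V_def)
  have bB: "bdd_below B" by (rule bdd_belowI[of _ 0]) (auto simp: B_def)
  define t1 where "t1 = Inf B"
  have t1B: "t1 \<in> B" unfolding t1_def using clB B1 bB by (intro closed_contains_Inf) auto
  have p0: "\<gamma> 0 \<in> V" using pq c \<rho> by (simp add: V_def)
  then have t1: "0 < t1" "t1 \<le> 1" using t1B by (auto simp: B_def intro: le_neq_trans)
  have before: "\<gamma> t \<in> V" if "0 \<le> t" "t < t1" for t
  proof (rule ccontr)
    assume "\<gamma> t \<notin> V"
    then have "t \<in> B" using that t1 by (auto simp: B_def)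
    then have "t1 \<le> t" unfolding t1_def by (rule cInf_lower[OF _ bB])
    then show False using that by simp
  qed
  have "\<gamma> t1 \<in> K"
  proof -
    have "closedin (top_of_set {0..1}) {t \<in> topspace (top_of_set {0..1}). \<gamma> t \<in> K}"
      by (rule closedin_continuous_map_preimage[OF cm K])
    then have "closed {t \<in> {0..1}. \<gamma> t \<in> K}" using closedin_closed_trans by fastforce
    moreover have "{0..<t1} \<subseteq> {t \<in> {0..1}. \<gamma> t \<in> K}" using before VK t1 by auto
    ultimately have "closure {0..<t1} \<subseteq> {t \<in> {0..1}. \<gamma> t \<in> K}" by (intro closure_minimal)
    moreover have "t1 \<in> closure {0..<t1}" using t1 by simp
    ultimately show ?thesis by blast
  qed
  then have gK: "\<gamma> t \<in> K" if "t \<in> {0..t1}" for t using before VK that by (cases "t = t1") auto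
  define y where "y t = snd c (\<gamma> t)" for t
  have y1: "dist (snd c p) (y t1) = \<rho>"
    using KU[OF \<open>\<gamma> t1 \<in> K\<close>] t1B by (auto simp: B_def V_def y_def)
  have conty: "continuous_on {0..t1} y"
  proof -
    have "continuous_map (subtopology T (fst c)) euclidean (snd c)"
      unfolding continuous_map_def
    proof (intro conjI allI impI)
      fix W :: "complex set" assume "openin euclidean W"
      then have "openin T {p \<in> fst c. snd c p \<in> W}" using C(6) by simp
      then have "openin (subtopology T (fst c)) {p \<in> fst c. snd c p \<in> W}"
        using C(1) by (simp add: openin_open_subtopology)
      moreover have "{p \<in> topspace (subtopology T (fst c)). snd c p \<in> W} = {p \<in> fst c. snd c p \<in> W}"
        using C(4) by auto
      ultimately show "openin (subtopology T (fst c)) {p \<in> topspace (subtopology T (fst c)). snd c p \<in> W}" by simp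
    qed auto
    moreover have "continuous_map (top_of_set {0..t1}) (subtopology T (fst c)) \<gamma>"
      unfolding continuous_map_in_subtopology
    proof
      have "continuous_map (subtopology (top_of_set {0..1}) {0..t1}) T \<gamma>"
        by (rule continuous_map_from_subtopology[OF cm])
      moreover have "subtopology (top_of_set {0..1}) {0..t1} = top_of_set {0..t1}"
        using t1 by (simp add: subtopology_subtopology Int_absorb1 Int_commute)
      ultimately show "continuous_map (top_of_set {0..t1}) T \<gamma>" by simp
      show "\<gamma> \<in> topspace (top_of_set {0..t1}) \<rightarrow> fst c" using gK KU by auto
    qed
    ultimately have "continuous_map (top_of_set {0..t1}) euclidean (snd c \<circ> \<gamma>)"
      by (rule continuous_map_compose[rotated])
    then show ?thesis by (simp add: y_def[abs_def] o_def)
  qed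
  have inD: "t \<in> {0<..<1} - S" if "t \<in> {0<..<t1} - S" for t using that t1 by auto
  have ygam: "y = snd c \<circ> \<gamma>" by (simp add: y_def[abs_def] o_def)
  have gU: "\<gamma> t \<in> fst c" if "t \<in> {0<..<t1} - S" for t using gK[of t] KU that by auto
  have "ennreal (norm ((\<lambda>t. k *\<^sub>R y t) t1 - (\<lambda>t. k *\<^sub>R y t) 0)) \<le> (\<integral>\<^sup>+ t. ennreal (speed x \<gamma> t) * indicator {0..t1} t \<partial>lborel)"
  proof (rule norm_increment_le_nn_integral[where y'="\<lambda>t. k *\<^sub>R vector_derivative y (at t)"])
    show "continuous_on {0..t1} (\<lambda>t. k *\<^sub>R y t)" by (intro continuous_intros conty)
    show "((\<lambda>t. k *\<^sub>R y t) has_vector_derivative k *\<^sub>R vector_derivative y (at t)) (at t)" if "t \<in> {0<..<t1} - S" for t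
      using regularD(6)[OF reg[OF inD[OF that]] c(1) gU[OF that]] unfolding ygam
      by (intro bounded_linear.has_vector_derivative[OF bounded_linear_scaleR_right])
    show "continuous_on ({0<..<t1} - S) (\<lambda>t. k *\<^sub>R vector_derivative y (at t))"
    proof (rule continuous_at_imp_continuous_on, rule ballI)
      fix t assume t: "t \<in> {0<..<t1} - S"
      show "isCont (\<lambda>t. k *\<^sub>R vector_derivative y (at t)) t"
        using regularD(5)[OF reg[OF inD[OF t]] c(1) gU[OF t]] unfolding ygam by (intro continuous_intros)
    qed
    show "ennreal (norm (k *\<^sub>R vector_derivative y (at t))) \<le> ennreal (speed x \<gamma> t)" if t: "t \<in> {0<..<t1} - S" for t
    proof (rule ennreal_leI)
      have "y t \<in> cball (snd c p) \<rho>" using gK[of t] KU t by (auto simp: y_def)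
      then show "norm (k *\<^sub>R vector_derivative y (at t)) \<le> speed x \<gamma> t"
        using k regular_speed[OF reg[OF inD[OF t]] c(1) gU[OF t]] unfolding ygam by simp
    qed
  qed (use t1 S in auto)
  also have "\<dots> \<le> (\<integral>\<^sup>+ t. ennreal (speed x \<gamma> t) * indicator {0..1} t \<partial>lborel)"
    using t1 by (intro nn_integral_mono) (auto simp: indicator_def)
  also have "\<dots> = curve_length x \<gamma>" by (simp add: curve_length_def speed_def)
  also have "norm ((\<lambda>t. k *\<^sub>R y t) t1 - (\<lambda>t. k *\<^sub>R y t) 0) = k * \<rho>"
    using y1 pq k by (simp add: scaleR_diff_right[symmetric] y_def dist_norm norm_minus_commute)
  finally show ?thesis .
qed

section \<open>The induced distance\<close>

abbreviation "d \<equiv> induced_dist T \<A> x"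

definition curves :: "'a \<Rightarrow> 'a \<Rightarrow> (real \<Rightarrow> 'a) set" where
  "curves p q = {\<gamma>. pw_C1_curve T \<A> p q \<gamma>}"

lemma d_eq: "d p q = enn2real (INF \<gamma>\<in>curves p q. curve_length x \<gamma>)"
  by (simp add: induced_dist_def curves_def)

lemma reverse_curve:
  assumes "\<gamma> \<in> curves p q"
  shows "(\<lambda>t. \<gamma> (1 - t)) \<in> curves q p" "curve_length x (\<lambda>t. \<gamma> (1 - t)) = curve_length x \<gamma>"
proof -
  obtain S where path: "pathin T \<gamma>" and pq: "\<gamma> 0 = p" "\<gamma> 1 = q" and S: "finite S"
    and reg: "\<And>t. t \<in> {0<..<1} - S \<Longrightarrow> regular \<gamma> t"
    using assms unfolding curves_def pw_C1_curve_iff by blast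
  have reg': "regular (\<lambda>t. \<gamma> (1 - t)) t" if "t \<in> {0<..<1} - (\<lambda>t. 1 - t) ` S" for t
  proof -
    have "1 + (-1) * t \<in> {0<..<1} - S" using that by (force simp: image_iff)
    from regular_affine(1)[OF reg[OF this]] show ?thesis by simp
  qed
  have "continuous_map (top_of_set {0..1}) (top_of_set {0..1}) (\<lambda>t::real. 1 - t)"
    by (auto intro!: continuous_intros)
  then have "continuous_map (top_of_set {0..1}) T (\<gamma> \<circ> (\<lambda>t. 1 - t))"
    using path unfolding pathin_def by (rule continuous_map_compose)
  then have "pathin T (\<lambda>t. \<gamma> (1 - t))" by (simp add: pathin_def o_def)
  then show "(\<lambda>t. \<gamma> (1 - t)) \<in> curves q p"
    unfolding curves_def pw_C1_curve_iff using pq S reg'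
    by (intro CollectI conjI exI[of _ "(\<lambda>t. 1 - t) ` S"]) auto
  define D where "D = {0<..<1} - S"
  have oD: "open D" unfolding D_def using S by (intro open_Diff finite_imp_closed) auto
  have "curve_length x (\<lambda>t. \<gamma> (1 - t)) =
     (\<integral>\<^sup>+ t. ennreal (speed x (\<lambda>t. \<gamma> (1 - t)) t) * indicator {t. 1 - t \<in> D} t \<partial>lborel)"
  proof (rule curve_length_eq)
    show "{t. 1 - t \<in> D} \<subseteq> {0..1}" by (auto simp: D_def)
    have "{0..1} - {t. 1 - t \<in> D} \<subseteq> {0, 1} \<union> (\<lambda>t. 1 - t) ` S" by (force simp: D_def image_iff)
    then show "finite ({0..1} - {t. 1 - t \<in> D})" using S finite_subset by blast
  qed
  also have "\<dots> = (\<integral>\<^sup>+ s. ennreal (speed x (\<lambda>s. \<gamma> (1 + (-1) * s)) s) * indicator D (1 + (-1) * s) \<partial>lborel)"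
    by (intro nn_integral_cong) (simp add: indicator_def)
  also have "\<dots> = (\<integral>\<^sup>+ t. ennreal (speed x \<gamma> t) * indicator D t \<partial>lborel)"
    by (rule length_affine[OF oD]) (use reg in \<open>auto simp: D_def\<close>)
  also have "\<dots> = curve_length x \<gamma>"
  proof (rule curve_length_eq[symmetric])
    have "{0..1} - D \<subseteq> {0, 1} \<union> S" by (auto simp: D_def)
    then show "finite ({0..1} - D)" using S finite_subset by blast
  qed (auto simp: D_def)
  finally show "curve_length x (\<lambda>t. \<gamma> (1 - t)) = curve_length x \<gamma>" .
qed

lemma join_curve:
  assumes "\<gamma>1 \<in> curves p q" "\<gamma>2 \<in> curves q r"
  shows "\<exists>\<gamma>\<in>curves p r. curve_length x \<gamma> = curve_length x \<gamma>1 + curve_length x \<gamma>2"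
proof -
  obtain S1 where g1: "pathin T \<gamma>1" "\<gamma>1 0 = p" "\<gamma>1 1 = q" "finite S1" "\<And>t. t \<in> {0<..<1} - S1 \<Longrightarrow> regular \<gamma>1 t"
    using assms(1) unfolding curves_def pw_C1_curve_iff by blast
  obtain S2 where g2: "pathin T \<gamma>2" "\<gamma>2 0 = q" "\<gamma>2 1 = r" "finite S2" "\<And>t. t \<in> {0<..<1} - S2 \<Longrightarrow> regular \<gamma>2 t"
    using assms(2) unfolding curves_def pw_C1_curve_iff by blast
  define \<gamma> where "\<gamma> t = (if t \<le> 1/2 then \<gamma>1 (2 * t) else \<gamma>2 (2 * t - 1))" for t :: real
  let ?T01 = "top_of_set {0..1::real}"
  have path: "pathin T \<gamma>"
    unfolding pathin_def \<gamma>_def[abs_def]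
  proof (rule continuous_map_cases_le[of ?T01 "\<lambda>t. t" "\<lambda>t. 1/2" T "\<lambda>t. \<gamma>1 (2*t)" "\<lambda>t. \<gamma>2 (2*t-1)"])
    have c1: "continuous_map (top_of_set {0..1/2}) ?T01 (\<lambda>t::real. 2 * t)"
      by (auto intro!: continuous_intros)
    have e1: "subtopology ?T01 {t \<in> topspace ?T01. t \<le> 1/2} = top_of_set {0..1/2}"
      by (simp add: subtopology_subtopology) (rule arg_cong[of _ _ "subtopology _"], auto)
    show "continuous_map (subtopology ?T01 {t \<in> topspace ?T01. t \<le> 1/2}) T (\<lambda>t. \<gamma>1 (2*t))"
      unfolding e1 using continuous_map_compose[OF c1 g1(1)[unfolded pathin_def]] by (simp add: o_def)
    have c2: "continuous_map (top_of_set {1/2..1}) ?T01 (\<lambda>t::real. 2 * t - 1)"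
      by (auto intro!: continuous_intros)
    have e2: "subtopology ?T01 {t \<in> topspace ?T01. 1/2 \<le> t} = top_of_set {1/2..1}"
      by (simp add: subtopology_subtopology) (rule arg_cong[of _ _ "subtopology _"], auto)
    show "continuous_map (subtopology ?T01 {t \<in> topspace ?T01. 1/2 \<le> t}) T (\<lambda>t. \<gamma>2 (2*t-1))"
      unfolding e2 using continuous_map_compose[OF c2 g2(1)[unfolded pathin_def]] by (simp add: o_def)
    show "\<gamma>1 (2 * t) = \<gamma>2 (2 * t - 1)" if "t \<in> topspace ?T01" "t = 1/2" for t
      unfolding that(2) using g1 g2 by simp
  qed (auto simp: continuous_map_from_subtopology)
  define D1 where "D1 = {0<..<1} - S1"
  define D2 where "D2 = {0<..<1} - S2"
  have oD: "open D1" "open D2" unfolding D1_def D2_def using g1 g2 by (auto intro!: open_Diff finite_imp_closed)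
  \<comment> \<open>The good parameters of the two halves, written in the shape
    \<open>b + m * s\<close> of \<open>length_affine\<close>.\<close>
  define E1 where "E1 = {s. 0 + 2 * s \<in> D1}"
  define E2 where "E2 = {s. -1 + 2 * s \<in> D2}"
  have E1: "E1 \<subseteq> {0<..<1/2}" and E2: "E2 \<subseteq> {1/2<..<1}" by (auto simp: E1_def E2_def D1_def D2_def)
  have ev1: "\<forall>\<^sub>F s in nhds t. \<gamma>1 (0 + 2 * s) = \<gamma> s" if "t < 1/2" for t
    using eventually_nhds_in_open[of "{..<1/2}" t] that by (auto elim!: eventually_mono simp: \<gamma>_def)
  have ev2: "\<forall>\<^sub>F s in nhds t. \<gamma>2 (-1 + 2 * s) = \<gamma> s" if "t > 1/2" for t
    using eventually_nhds_in_open[of "{1/2<..}" t] that by (auto elim!: eventually_mono simp: \<gamma>_def)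
  have r1: "regular \<gamma> t" "speed x \<gamma> t = speed x (\<lambda>s. \<gamma>1 (0 + 2 * s)) t" if "t \<in> E1" for t
    using regular_cong[OF regular_affine(1)[OF g1(5)] ev1] that E1 by (auto simp: E1_def D1_def)
  have r2: "regular \<gamma> t" "speed x \<gamma> t = speed x (\<lambda>s. \<gamma>2 (-1 + 2 * s)) t" if "t \<in> E2" for t
    using regular_cong[OF regular_affine(1)[OF g2(5)] ev2] that E2 by (auto simp: E2_def D2_def)
  define S where "S = {1/2} \<union> (\<lambda>t. t / 2) ` S1 \<union> (\<lambda>t. (t + 1) / 2) ` S2"
  have S: "finite S" using g1 g2 by (simp add: S_def)
  have cov: "t \<in> E1 \<union> E2" if "t \<in> {0<..<1} - S" for t
  proof -
    have "0 + 2 * t \<notin> S1"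
    proof
      assume "0 + 2 * t \<in> S1"
      then have "(0 + 2 * t) / 2 \<in> S" unfolding S_def by blast
      then show False using that by simp
    qed
    moreover have "-1 + 2 * t \<notin> S2"
    proof
      assume "-1 + 2 * t \<in> S2"
      then have "(-1 + 2 * t + 1) / 2 \<in> S" unfolding S_def by blast
      then show False using that by simp
    qed
    moreover have "t < 1/2 \<or> 1/2 < t" using that by (auto simp: S_def)
    ultimately show ?thesis using that unfolding E1_def E2_def D1_def D2_def by auto
  qed
  have regS: "regular \<gamma> t" if "t \<in> {0<..<1} - S" for t using cov[OF that] r1(1) r2(1) by blast
  have mem: "\<gamma> \<in> curves p r"
    unfolding curves_def pw_C1_curve_iff
    by (intro CollectI conjI exI[of _ S] ballI regS path S) (use g1(2) g2(3) in \<open>simp_all add: \<gamma>_def\<close>)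
  have len1: "curve_length x \<gamma>1 = (\<integral>\<^sup>+ t. ennreal (speed x \<gamma>1 t) * indicator D1 t \<partial>lborel)"
  proof (rule curve_length_eq)
    have "{0..1} - D1 \<subseteq> {0, 1} \<union> S1" by (auto simp: D1_def)
    then show "finite ({0..1} - D1)" using g1 finite_subset by blast
  qed (auto simp: D1_def)
  have len2: "curve_length x \<gamma>2 = (\<integral>\<^sup>+ t. ennreal (speed x \<gamma>2 t) * indicator D2 t \<partial>lborel)"
  proof (rule curve_length_eq)
    have "{0..1} - D2 \<subseteq> {0, 1} \<union> S2" by (auto simp: D2_def)
    then show "finite ({0..1} - D2)" using g2 finite_subset by blast
  qed (auto simp: D2_def)
  have oE: "open E1" "open E2"
  proof -
    have "E1 = (\<lambda>s. 0 + 2 * s) -` D1" "E2 = (\<lambda>s. -1 + 2 * s) -` D2" by (auto simp: E1_def E2_def)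
    then show "open E1" "open E2" using oD by (auto intro!: open_vimage continuous_intros)
  qed
  have meas: "(\<lambda>t. ennreal (speed x \<gamma> t) * indicator E t) \<in> borel_measurable borel"
    if "open E" "\<And>t. t \<in> E \<Longrightarrow> regular \<gamma> t" for E
  proof -
    have "(\<lambda>t. indicator E t *\<^sub>R speed x \<gamma> t) \<in> borel_measurable borel"
      using that regular_speed_continuous_on[OF that] by (intro borel_measurable_continuous_on_indicator) auto
    then have "(\<lambda>t. ennreal (indicator E t *\<^sub>R speed x \<gamma> t)) \<in> borel_measurable borel" by measurable
    moreover have "(\<lambda>t. ennreal (indicator E t *\<^sub>R speed x \<gamma> t)) = (\<lambda>t. ennreal (speed x \<gamma> t) * indicator E t)"
      by (auto simp: indicator_def)
    ultimately show ?thesis by simp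
  qed
  have "curve_length x \<gamma> = (\<integral>\<^sup>+ t. ennreal (speed x \<gamma> t) * indicator (E1 \<union> E2) t \<partial>lborel)"
  proof (rule curve_length_eq)
    show "E1 \<union> E2 \<subseteq> {0..1}" using E1 E2 by force
    have "{0..1} - (E1 \<union> E2) \<subseteq> {0, 1} \<union> S"
    proof
      fix t assume t: "t \<in> {0..1} - (E1 \<union> E2)"
      show "t \<in> {0, 1} \<union> S"
      proof (rule ccontr)
        assume "t \<notin> {0, 1} \<union> S"
        then have "t \<in> {0<..<1} - S" using t by (simp add: less_le)
        then show False using cov[of t] t by blast
      qed
    qed
    then show "finite ({0..1} - (E1 \<union> E2))" using S finite_subset by blast
  qed
  also have "\<dots> = (\<integral>\<^sup>+ t. ennreal (speed x \<gamma> t) * indicator E1 t + ennreal (speed x \<gamma> t) * indicator E2 t \<partial>lborel)"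
    using E1 E2 by (intro nn_integral_cong) (force simp: indicator_def)
  also have "\<dots> = (\<integral>\<^sup>+ t. ennreal (speed x \<gamma> t) * indicator E1 t \<partial>lborel) + (\<integral>\<^sup>+ t. ennreal (speed x \<gamma> t) * indicator E2 t \<partial>lborel)"
    by (rule nn_integral_add) (use meas oE r1 r2 in auto)
  also have "(\<integral>\<^sup>+ t. ennreal (speed x \<gamma> t) * indicator E1 t \<partial>lborel)
    = (\<integral>\<^sup>+ s. ennreal (speed x (\<lambda>s. \<gamma>1 (0 + 2 * s)) s) * indicator D1 (0 + 2 * s) \<partial>lborel)"
    by (intro nn_integral_cong) (use r1 in \<open>auto simp: indicator_def E1_def\<close>)
  also have "\<dots> = curve_length x \<gamma>1"
    unfolding len1 by (rule length_affine[OF oD(1)]) (use g1 in \<open>auto simp: D1_def\<close>)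
  also have "(\<integral>\<^sup>+ t. ennreal (speed x \<gamma> t) * indicator E2 t \<partial>lborel)
    = (\<integral>\<^sup>+ s. ennreal (speed x (\<lambda>s. \<gamma>2 (-1 + 2 * s)) s) * indicator D2 (-1 + 2 * s) \<partial>lborel)"
    by (intro nn_integral_cong) (use r2 in \<open>auto simp: indicator_def E2_def\<close>)
  also have "\<dots> = curve_length x \<gamma>2"
    unfolding len2 by (rule length_affine[OF oD(2)]) (use g2 in \<open>auto simp: D2_def\<close>)
  finally show ?thesis using mem by blast
qed

lemma segment_curve:
  assumes c: "c \<in> \<A>" "p \<in> fst c" and r: "r > 0" "cball (snd c p) r \<subseteq> img c"
    and q: "q \<in> fst c" "snd c q \<in> ball (snd c p) r"
  shows "\<exists>\<gamma>\<in>curves p q. curve_length x \<gamma> < \<infinity>"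
proof -
  note C = is_chartD[OF A_chart[OF c(1)]]
  define h where "h = snd c q - snd c p"
  define l where "l t = snd c p + of_real t * h" for t :: real
  have lB: "l t \<in> cball (snd c p) r" if "t \<in> {0..1}" for t
  proof -
    have "norm (of_real t * h) \<le> 1 * norm h" unfolding norm_mult using that by (intro mult_right_mono) auto
    also have "\<dots> \<le> r" using q by (simp add: h_def dist_norm norm_minus_commute)
    finally show ?thesis by (simp add: l_def dist_norm)
  qed
  define \<gamma> where "\<gamma> t = chart_inv c (l t)" for t
  have \<gamma>c: "\<gamma> t \<in> fst c" "snd c (\<gamma> t) = l t" if "t \<in> {0..1}" for t
    using lB[OF that] r(2) inv_into_into[of "l t" "snd c" "fst c"] f_inv_into_f[of "l t" "snd c" "fst c"]
    by (auto simp: \<gamma>_def)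
  have "continuous_map (top_of_set {0..1}) (top_of_set (img c)) l"
    using lB r(2) by (auto simp: l_def[abs_def] intro!: continuous_intros)
  then have "continuous_map (top_of_set {0..1}) T (chart_inv c \<circ> l)"
    by (rule continuous_map_compose[OF _ chart_inv_continuous_map[OF c(1)]])
  then have path: "pathin T \<gamma>" by (simp add: pathin_def \<gamma>_def[abs_def] o_def)
  have l': "(l has_vector_derivative h) (at t)" for t
    unfolding l_def[abs_def] by (auto intro!: derivative_eq_intros)
  have y': "(snd c \<circ> \<gamma> has_vector_derivative h) (at t)" if "t \<in> {0<..<1}" for t
  proof -
    have "\<forall>\<^sub>F s in nhds t. l s = (snd c \<circ> \<gamma>) s"
      using eventually_nhds_in_open[OF open_greaterThanLessThan that] by eventually_elim (simp add: \<gamma>c)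
    from has_vector_derivative_cong_nhds[OF this] l' show ?thesis by blast
  qed
  have evin: "\<forall>\<^sub>F s in nhds t. \<gamma> s \<in> fst c" if "t \<in> {0<..<1}" for t
    using eventually_nhds_in_open[OF open_greaterThanLessThan that] by eventually_elim (simp add: \<gamma>c)
  have reg: "regular \<gamma> t" if t: "t \<in> {0<..<1}" for t
  proof (rule regular_one_chart[OF A_chart[OF c(1)] A_smooth_transition[OF c(1)] \<gamma>c(1) evin[OF t]])
    show "\<forall>\<^sub>F s in nhds t. (snd c \<circ> \<gamma>) differentiable (at s)"
      using eventually_nhds_in_open[OF open_greaterThanLessThan t] by eventually_elim (rule differentiableI_vector[OF y'])
    have "\<forall>\<^sub>F s in nhds t. h = vector_derivative (snd c \<circ> \<gamma>) (at s)"
      using eventually_nhds_in_open[OF open_greaterThanLessThan t] by eventually_elim (use y' vector_derivative_at in metis)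
    then show "isCont (\<lambda>s. vector_derivative (snd c \<circ> \<gamma>) (at s)) t"
      by (rule isCont_cong_nhds[rotated]) simp
  qed (use t in auto)
  have mem: "\<gamma> \<in> curves p q"
    unfolding curves_def pw_C1_curve_iff
  proof (intro CollectI conjI exI[of _ "{}"])
    show "\<gamma> 0 = p" "\<gamma> 1 = q" using inv_into_f_f[OF C(3)] c q by (auto simp: \<gamma>_def l_def h_def)
  qed (use path reg in auto)
  obtain B where B: "\<And>z h. z \<in> cball (snd c p) r \<Longrightarrow> metric_norm (X c) z h \<le> B * norm h"
    using metric_norm_bounds[OF c(1) compact_cball r(2)] by metis
  have "speed x \<gamma> t \<le> B * norm h" if "t \<in> {0<..<1}" for t
    using regular_speed[OF reg[OF that] c(1)] \<gamma>c[of t] that vector_derivative_at[OF y'[OF that]] B[OF lB[of t]] by simp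
  moreover have fin01: "finite ({0..1} - {0<..<1::real})"
    by (rule finite_subset[of _ "{0,1}"]) auto
  ultimately have "curve_length x \<gamma> \<le> (\<integral>\<^sup>+ t. ennreal (B * norm h) * indicator {0..1::real} t \<partial>lborel)"
    by (subst curve_length_eq[of "{0<..<1}"])
       (use fin01 in \<open>auto intro!: nn_integral_mono ennreal_leI simp: indicator_def\<close>)
  also have "\<dots> < \<infinity>" by (simp add: nn_integral_cmult_indicator ennreal_mult_less_top)
  finally show ?thesis using mem by blast
qed

text \<open>\<open>induced_dist\<close> converts an infimum by \<open>enn2real\<close>, which sends
  \<infinity> to 0, so its value has a meaning only because any two points are joined at finite
  length. They are, since this is an equivalence relation with open classes on a connected
  space.\<close>

lemma finite_curve:
  assumes "p \<in> topspace T" "q \<in> topspace T"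
  shows "\<exists>\<gamma>\<in>curves p q. curve_length x \<gamma> < \<infinity>"
proof -
  define R where "R p q \<longleftrightarrow> (\<exists>\<gamma>\<in>curves p q. curve_length x \<gamma> < \<infinity>)" for p q
  have Rsym: "R p q \<Longrightarrow> R q p" for p q using reverse_curve unfolding R_def by metis
  have Rtrans: "R p q \<Longrightarrow> R q s \<Longrightarrow> R p s" for p q s
    unfolding R_def using join_curve by (metis ennreal_add_less_top infinity_ennreal_def)
  have nb: "\<exists>V. openin T V \<and> q \<in> V \<and> (\<forall>q'\<in>V. R q q')" if q: "q \<in> topspace T" for q
  proof -
    obtain c where c: "c \<in> \<A>" "q \<in> fst c" using A_cover q by blast
    note C = is_chartD[OF A_chart[OF c(1)]]
    obtain r where r: "r > 0" "cball (snd c q) r \<subseteq> img c"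
      using C(2) c(2) open_contains_cball by (metis imageI)
    show ?thesis
    proof (intro exI conjI ballI)
      show "openin T {p \<in> fst c. snd c p \<in> ball (snd c q) r}" by (rule C(6)) simp
      show "R q q'" if "q' \<in> {p \<in> fst c. snd c p \<in> ball (snd c q) r}" for q'
        using segment_curve[OF c r] that unfolding R_def by blast
    qed (use c r in auto)
  qed
  define E where "E = {s \<in> topspace T. R p s}"
  define F where "F = {s \<in> topspace T. \<not> R p s}"
  have "openin T E"
    unfolding openin_subopen[of T E]
  proof
    fix s assume s: "s \<in> E"
    then obtain V where V: "openin T V" "s \<in> V" "\<forall>q'\<in>V. R s q'" using nb by (auto simp: E_def)
    then have "V \<subseteq> E" using s Rtrans openin_subset[OF V(1)] by (auto simp: E_def)
    then show "\<exists>V. openin T V \<and> s \<in> V \<and> V \<subseteq> E" using V by blast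
  qed
  moreover have "openin T F"
    unfolding openin_subopen[of T F]
  proof
    fix s assume s: "s \<in> F"
    then obtain V where V: "openin T V" "s \<in> V" "\<forall>q'\<in>V. R s q'" using nb by (auto simp: F_def)
    then have "V \<subseteq> F" using s Rtrans Rsym openin_subset[OF V(1)] unfolding F_def by blast
    then show "\<exists>V. openin T V \<and> s \<in> V \<and> V \<subseteq> F" using V by blast
  qed
  moreover have "E \<union> F = topspace T" "E \<inter> F = {}" by (auto simp: E_def F_def)
  moreover have "R p p" using nb[OF assms(1)] by blast
  then have "E \<noteq> {}" using assms by (auto simp: E_def)
  ultimately have "F = {}" using T_connected unfolding connected_space_eq by blast
  then show ?thesis using assms by (auto simp: F_def R_def)
qed

lemma d_le: "\<gamma> \<in> curves p q \<Longrightarrow> curve_length x \<gamma> \<le> ennreal l \<Longrightarrow> 0 \<le> l \<Longrightarrow> d p q \<le> l"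
proof -
  assume a: "\<gamma> \<in> curves p q" "curve_length x \<gamma> \<le> ennreal l" "0 \<le> l"
  have "(INF \<gamma>\<in>curves p q. curve_length x \<gamma>) \<le> ennreal l" using a by (meson INF_lower order_trans)
  then have "enn2real (INF \<gamma>\<in>curves p q. curve_length x \<gamma>) \<le> enn2real (ennreal l)"
    by (intro enn2real_mono) auto
  then show ?thesis using a by (simp add: d_eq)
qed

lemma d_less:
  assumes "p \<in> topspace T" "q \<in> topspace T" "d p q < l"
  shows "\<exists>\<gamma>\<in>curves p q. curve_length x \<gamma> < ennreal l"
proof -
  obtain \<gamma> where \<gamma>: "\<gamma> \<in> curves p q" "curve_length x \<gamma> < \<infinity>" using finite_curve[OF assms(1,2)] by blast
  have "(INF \<gamma>\<in>curves p q. curve_length x \<gamma>) \<le> curve_length x \<gamma>" using \<gamma> by (meson INF_lower)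
  then have fin: "(INF \<gamma>\<in>curves p q. curve_length x \<gamma>) < \<infinity>" using \<gamma>(2) by (rule order_le_less_trans)
  have "0 \<le> d p q" by (simp add: d_eq)
  then have "ennreal (d p q) < ennreal l" using assms(3) by (simp add: ennreal_less_iff)
  then have "(INF \<gamma>\<in>curves p q. curve_length x \<gamma>) < ennreal l" using fin by (simp add: d_eq)
  then show ?thesis by (simp add: INF_less_iff)
qed

text \<open>Leaving a coordinate disc costs length at least \<open>k * \<rho>\<close>. This gives
  positivity of the distance and turns metric limits into limits in \<open>T\<close>.\<close>

lemma d_separates:
  assumes p: "p \<in> topspace T" and V: "openin T V" "p \<in> V"
  shows "\<exists>r>0. \<forall>q\<in>topspace T. d p q < r \<longrightarrow> q \<in> V"
proof -
  obtain c where c: "c \<in> \<A>" "p \<in> fst c" using A_cover p by blast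
  note C = is_chartD[OF A_chart[OF c(1)]]
  have "open (snd c ` (fst c \<inter> V))" by (rule C(5)) (use V C(1) in auto)
  then obtain \<rho> where \<rho>: "\<rho> > 0" "cball (snd c p) \<rho> \<subseteq> snd c ` (fst c \<inter> V)"
    using c(2) V(2) open_contains_cball by (metis IntI imageI)
  then have \<rho>': "cball (snd c p) \<rho> \<subseteq> img c" by blast
  obtain k where k: "k > 0" "\<And>z h. z \<in> cball (snd c p) \<rho> \<Longrightarrow> k * norm h \<le> metric_norm (X c) z h"
    using metric_norm_bounds[OF c(1) compact_cball \<rho>'] by metis
  show ?thesis
  proof (intro exI[of _ "k * \<rho>"] conjI ballI impI)
    show "k * \<rho> > 0" using k \<rho> by simp
    fix q assume q: "q \<in> topspace T" "d p q < k * \<rho>"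
    obtain \<gamma> where \<gamma>: "\<gamma> \<in> curves p q" "curve_length x \<gamma> < ennreal (k * \<rho>)" using d_less[OF p q] by blast
    then have "q \<in> fst c \<and> snd c q \<in> ball (snd c p) \<rho>"
      using curve_length_lower[OF c \<rho>(1) \<rho>' k, of q \<gamma>] by (auto simp: curves_def not_le[symmetric])
    then show "q \<in> V" using \<rho>(2) C(3) by (force dest: inj_onD)
  qed
qed

lemma d_metric: "Metric_space (topspace T) d"
proof
  show "0 \<le> d p q" for p q by (simp add: d_eq)
  show sym: "d p q = d q p" for p q
  proof -
    have "curve_length x ` curves p q \<subseteq> curve_length x ` curves q p" for p q
    proof (rule image_subsetI)
      fix \<gamma> assume "\<gamma> \<in> curves p q"
      from reverse_curve[OF this] show "curve_length x \<gamma> \<in> curve_length x ` curves q p" by (metis image_eqI)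
    qed
    then have "curve_length x ` curves p q = curve_length x ` curves q p" by blast
    then show ?thesis by (simp add: d_eq)
  qed
  show "d p s \<le> d p q + d q s" if pts: "p \<in> topspace T" "q \<in> topspace T" "s \<in> topspace T" for p q s
  proof (rule field_le_epsilon)
    fix e :: real assume e: "e > 0"
    have nn: "0 \<le> d p q" "0 \<le> d q s" by (simp_all add: d_eq)
    obtain \<gamma>1 where 1: "\<gamma>1 \<in> curves p q" "curve_length x \<gamma>1 < ennreal (d p q + e/2)"
      using d_less[OF pts(1,2), of "d p q + e/2"] e by auto
    obtain \<gamma>2 where 2: "\<gamma>2 \<in> curves q s" "curve_length x \<gamma>2 < ennreal (d q s + e/2)"
      using d_less[OF pts(2,3), of "d q s + e/2"] e by auto
    obtain \<gamma> where \<gamma>: "\<gamma> \<in> curves p s" "curve_length x \<gamma> = curve_length x \<gamma>1 + curve_length x \<gamma>2"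
      using join_curve[OF 1(1) 2(1)] by blast
    have "curve_length x \<gamma> \<le> ennreal (d p q + e/2) + ennreal (d q s + e/2)"
      unfolding \<gamma>(2) using 1(2) 2(2) by (intro add_mono) auto
    also have "\<dots> = ennreal (d p q + d q s + e)" using nn e by (simp add: ennreal_plus[symmetric] del: ennreal_plus)
    finally show "d p s \<le> d p q + d q s + e" using \<gamma>(1) nn e by (intro d_le) auto
  qed
  show "d p q = 0 \<longleftrightarrow> p = q" if pq: "p \<in> topspace T" "q \<in> topspace T" for p q
  proof
    assume d0: "d p q = 0"
    show "p = q"
    proof (rule ccontr)
      assume "p \<noteq> q"
      then obtain U V where "openin T U" "p \<in> U" "q \<notin> U"
        using T_hausdorff pq unfolding Hausdorff_space_def disjnt_iff by metis
      then show False using d_separates[OF pq(1), of U] pq(2) d0 by auto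
    qed
  next
    assume "p = q"
    have reg: "regular (\<lambda>t. p) t" for t
    proof -
      obtain c where c: "c \<in> \<A>" "p \<in> fst c" using A_cover pq by blast
      have "vector_derivative (snd c \<circ> (\<lambda>t. p)) (at s) = 0" for s :: real
        by (rule vector_derivative_at) (simp add: o_def)
      then show ?thesis
        by (intro regular_one_chart[OF A_chart[OF c(1)] A_smooth_transition[OF c(1)]]) (use c in \<open>auto simp: o_def\<close>)
    qed
    have "(\<lambda>t. p) \<in> curves p p"
      unfolding curves_def pw_C1_curve_iff using reg pq by (auto simp: pathin_def)
    moreover have "vector_derivative (x \<circ> (\<lambda>t. p)) (at s) = 0" for s :: real
      by (rule vector_derivative_at) (simp add: o_def)
    then have "curve_length x (\<lambda>t. p) = 0"
      by (simp add: curve_length_def mink_zero)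
    ultimately have "d p p \<le> 0" by (intro d_le) auto
    then show "d p q = 0" using \<open>p = q\<close> by (simp add: d_eq antisym)
  qed
qed

text \<open>Increments of \<open>B\<close> dominate distances along the curve, and continuity of
  \<open>B\<close> up to 1 makes the curve Cauchy even where \<open>B'\<close> is unbounded.\<close>

theorem curve_converges:
  assumes complete: "complete_surface T \<A> x"
    and reg: "\<And>t. 0 \<le> t \<Longrightarrow> t < 1 \<Longrightarrow> regular \<gamma> t"
    and B: "continuous_on {0..1} B" "\<And>t. 0 \<le> t \<Longrightarrow> t < 1 \<Longrightarrow> (B has_real_derivative B' t) (at t)"
      "\<And>t. 0 \<le> t \<Longrightarrow> t < 1 \<Longrightarrow> speed x \<gamma> t \<le> B' t"
      "continuous_on {0..<1} B'"
  obtains q where "limitin T \<gamma> q (at_left 1)"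
proof -
  interpret M: Metric_space "topspace T" d by (rule d_metric)
  have sp0: "0 \<le> speed x \<gamma> t" if t: "0 \<le> t" "t < 1" for t
  proof -
    obtain c where c: "c \<in> \<A>" "\<gamma> t \<in> fst c" using A_cover regularD(1)[OF reg[OF t]] by blast
    have "0 \<le> mink (Re h *\<^sub>R pd 1 (X c) z + Im h *\<^sub>R pd 2 (X c) z) (Re h *\<^sub>R pd 1 (X c) z + Im h *\<^sub>R pd 2 (X c) z)"
      if "z \<in> img c" for z h
      using metric_pos[OF c(1) that, of h] by (cases "h = 0") (auto simp: mink_zero less_imp_le)
    then show ?thesis using regular_speed[OF reg[OF t] c] c(2) by (simp add: metric_norm_def)
  qed
  have B'0: "0 \<le> B' t" if "0 \<le> t" "t < 1" for t using sp0 B(3) that by (meson order_trans)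
  have mono: "B s \<le> B t" if "0 \<le> s" "s \<le> t" "t < 1" for s t
  proof (rule DERIV_nonneg_imp_nondecreasing[OF that(2)])
    fix r assume "s \<le> r" "r \<le> t"
    then have "0 \<le> r" "r < 1" using that by auto
    then show "\<exists>y. (B has_real_derivative y) (at r) \<and> 0 \<le> y" using B(2) B'0 by blast
  qed
  have gT: "\<gamma> t \<in> topspace T" if "0 \<le> t" "t < 1" for t using regularD(1)[OF reg[OF that]] .
  have dB: "d (\<gamma> s) (\<gamma> t) \<le> B t - B s" if st: "0 \<le> s" "s < t" "t < 1" for s t
  proof -
    define m where "m = t - s"
    have m: "m > 0" using st by (simp add: m_def)
    have in_st: "0 \<le> s + m * \<tau>" "s + m * \<tau> < 1" if "\<tau> \<in> {0..1}" for \<tau>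
    proof -
      have "m * \<tau> \<le> m" using that m by (simp add: mult_left_le)
      moreover have "0 \<le> m * \<tau>" using that m by simp
      ultimately show "0 \<le> s + m * \<tau>" "s + m * \<tau> < 1" using st m_def by linarith+
    qed
    have r: "regular (\<lambda>\<tau>. \<gamma> (s + m * \<tau>)) \<tau>" if "\<tau> \<in> {0..1}" for \<tau>
      using regular_affine(1) reg in_st[OF that] by blast
    have "pathin T (\<lambda>\<tau>. \<gamma> (s + m * \<tau>))"
      unfolding pathin_def continuous_map_def
    proof (intro conjI allI impI)
      show "(\<lambda>\<tau>. \<gamma> (s + m * \<tau>)) \<in> topspace (top_of_set {0..1}) \<rightarrow> topspace T" using regularD(1)[OF r] by auto
      fix V assume V: "openin T V"
      have "openin (top_of_set {0..1}) {\<tau> \<in> {0..1}. \<gamma> (s + m * \<tau>) \<in> V}"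
        unfolding openin_subopen[of "top_of_set {0..1}" "{\<tau> \<in> {0..1}. \<gamma> (s + m * \<tau>) \<in> V}"]
      proof
        fix \<tau> assume \<tau>V: "\<tau> \<in> {\<tau> \<in> {0..1}. \<gamma> (s + m * \<tau>) \<in> V}"
        then have "\<forall>\<^sub>F \<tau>' in nhds \<tau>. \<gamma> (s + m * \<tau>') \<in> V" using regularD(2)[OF r V] by simp
        then obtain N where N: "open N" "\<tau> \<in> N" "\<forall>\<tau>'\<in>N. \<gamma> (s + m * \<tau>') \<in> V" unfolding eventually_nhds by blast
        then show "\<exists>W. openin (top_of_set {0..1}) W \<and> \<tau> \<in> W \<and> W \<subseteq> {\<tau> \<in> {0..1}. \<gamma> (s + m * \<tau>) \<in> V}"
          using \<tau>V by (intro exI[of _ "{0..1} \<inter> N"]) (auto simp: openin_open_Int)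
      qed
      then show "openin (top_of_set {0..1}) {\<tau> \<in> topspace (top_of_set {0..1}). \<gamma> (s + m * \<tau>) \<in> V}" by simp
    qed
    then have mem: "(\<lambda>\<tau>. \<gamma> (s + m * \<tau>)) \<in> curves (\<gamma> s) (\<gamma> t)"
      unfolding curves_def pw_C1_curve_iff using r by (auto simp: m_def intro!: exI[of _ "{}"])
    have "curve_length x (\<lambda>\<tau>. \<gamma> (s + m * \<tau>)) =
       (\<integral>\<^sup>+ \<tau>. ennreal (speed x (\<lambda>\<tau>. \<gamma> (s + m * \<tau>)) \<tau>) * indicator {0<..<1} \<tau> \<partial>lborel)"
    proof (rule curve_length_eq)
      show "finite ({0..1} - {0<..<1::real})" by (rule finite_subset[of _ "{0,1}"]) auto
    qed auto
    also have "\<dots> = (\<integral>\<^sup>+ \<tau>. ennreal (speed x (\<lambda>\<tau>. \<gamma> (s + m * \<tau>)) \<tau>) * indicator {s<..<t} (s + m * \<tau>) \<partial>lborel)"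
    proof (intro nn_integral_cong arg_cong2[of _ _ _ _ "(*)"] refl)
      fix \<tau> :: real
      have "s + m * \<tau> < t \<longleftrightarrow> m * \<tau> < m * 1" by (auto simp: m_def)
      also have "\<dots> \<longleftrightarrow> \<tau> < 1" using m by simp
      finally have "s + m * \<tau> < t \<longleftrightarrow> \<tau> < 1" .
      moreover have "s < s + m * \<tau> \<longleftrightarrow> 0 < \<tau>" using m by (simp add: zero_less_mult_iff)
      ultimately show "(indicator {0<..<1} \<tau> :: ennreal) = indicator {s<..<t} (s + m * \<tau>)"
        by (simp add: indicator_def)
    qed
    also have "\<dots> = (\<integral>\<^sup>+ \<tau>. ennreal (speed x \<gamma> \<tau>) * indicator {s<..<t} \<tau> \<partial>lborel)"
      by (rule length_affine) (use st reg m in auto)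
    finally have len: "curve_length x (\<lambda>\<tau>. \<gamma> (s + m * \<tau>)) = (\<integral>\<^sup>+ \<tau>. ennreal (speed x \<gamma> \<tau>) * indicator {s<..<t} \<tau> \<partial>lborel)" .
    have "(\<integral>\<^sup>+ \<tau>. ennreal (speed x \<gamma> \<tau>) * indicator {s<..<t} \<tau> \<partial>lborel)
      \<le> (\<integral>\<^sup>+ \<tau>. ennreal (indicator {s..t} \<tau> *\<^sub>R B' \<tau>) * indicator {s..t} \<tau> \<partial>lborel)"
      using B(3) st by (intro nn_integral_mono) (auto simp: indicator_def intro!: ennreal_leI)
    also have "\<dots> = ennreal (B t - B s)"
    proof (rule nn_integral_FTC_Icc)
      show "(\<lambda>\<tau>. indicator {s..t} \<tau> *\<^sub>R B' \<tau>) \<in> borel_measurable borel"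
        by (rule borel_measurable_continuous_on_indicator) (use st in \<open>auto intro: continuous_on_subset[OF B(4)]\<close>)
    qed (use st B(2) B'0 in \<open>auto intro: has_field_derivative_at_within\<close>)
    finally show ?thesis using mem mono[of s t] st unfolding len[symmetric] by (intro d_le) auto
  qed
  have key: "\<exists>t0. 0 \<le> t0 \<and> t0 < 1 \<and> (\<forall>s t. t0 < s \<longrightarrow> s < 1 \<longrightarrow> t0 < t \<longrightarrow> t < 1 \<longrightarrow> d (\<gamma> s) (\<gamma> t) < \<epsilon>)"
    if \<epsilon>: "\<epsilon> > 0" for \<epsilon>
  proof -
    obtain \<delta> where \<delta>: "\<delta> > 0" "\<And>t. t \<in> {0..1} \<Longrightarrow> dist t 1 < \<delta> \<Longrightarrow> dist (B t) (B 1) < \<epsilon>/2"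
      using B(1)[unfolded continuous_on_iff, rule_format, of 1 "\<epsilon>/2"] \<epsilon> by auto
    define t0 where "t0 = max 0 (1 - \<delta>)"
    have near: "\<bar>B t - B 1\<bar> < \<epsilon>/2" if "t0 < t" "t < 1" for t
      using \<delta>(2)[of t] that by (auto simp: t0_def dist_real_def)
    have "d (\<gamma> s) (\<gamma> t) < \<epsilon>" if "t0 < s" "s < 1" "t0 < t" "t < 1" for s t
    proof -
      have n: "0 \<le> s" "0 \<le> t" using that by (auto simp: t0_def)
      consider "s < t" | "s = t" | "t < s" by linarith
      then have "d (\<gamma> s) (\<gamma> t) \<le> \<bar>B t - B s\<bar>"
      proof cases
        case 1 then show ?thesis using dB[OF n(1) 1 that(4)] by simp
      next
        case 2 then show ?thesis using M.mdist_zero[OF gT[OF n(1) that(2)]] by simp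
      next
        case 3 then show ?thesis using dB[OF n(2) 3 that(2)] M.commute by simp
      qed
      then show ?thesis using near[OF that(1,2)] near[OF that(3,4)] by linarith
    qed
    then show ?thesis using \<delta>(1) by (intro exI[of _ t0]) (auto simp: t0_def)
  qed
  \<comment> \<open>Completeness is a statement about sequences; these parameters lie in [0, 1) from
    n = 0 on.\<close>
  define \<sigma> where "\<sigma> n = \<gamma> (1 - 1 / (real n + 2))" for n :: nat
  have par: "0 \<le> 1 - 1 / (real n + 2)" "1 - 1 / (real n + 2) < 1" for n by (auto simp: field_simps)
  have tail: "\<exists>N. \<forall>n\<ge>N. t0 < 1 - 1 / (real n + 2)" if "t0 < 1" for t0 :: real
  proof -
    obtain N :: nat where N: "1 / (1 - t0) < real N" using reals_Archimedean2 by blast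
    have "t0 < 1 - 1 / (real n + 2)" if n: "n \<ge> N" for n
    proof -
      have "1 / (1 - t0) < real n + 2" using N n by linarith
      then have "1 < (real n + 2) * (1 - t0)" using \<open>t0 < 1\<close> by (simp add: field_simps)
      then show ?thesis by (simp add: field_simps)
    qed
    then show ?thesis by blast
  qed
  have "M.MCauchy \<sigma>"
    unfolding M.MCauchy_def
  proof (intro conjI allI impI)
    show "range \<sigma> \<subseteq> topspace T" using gT[OF par] by (auto simp: \<sigma>_def)
    fix \<epsilon> :: real assume "\<epsilon> > 0"
    then obtain t0 where t0: "t0 < 1" "\<And>s t. t0 < s \<Longrightarrow> s < 1 \<Longrightarrow> t0 < t \<Longrightarrow> t < 1 \<Longrightarrow> d (\<gamma> s) (\<gamma> t) < \<epsilon>"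
      using key by metis
    obtain N where "\<forall>n\<ge>N. t0 < 1 - 1 / (real n + 2)" using tail[OF t0(1)] by blast
    then show "\<exists>N. \<forall>n n'. N \<le> n \<longrightarrow> N \<le> n' \<longrightarrow> d (\<sigma> n) (\<sigma> n') < \<epsilon>"
      unfolding \<sigma>_def using t0(2) par by blast
  qed
  then obtain q where "limitin M.mtopology \<sigma> q sequentially"
    using complete unfolding complete_surface_def M.mcomplete_def by blast
  then have q: "q \<in> topspace T" "\<And>\<epsilon>. \<epsilon> > 0 \<Longrightarrow> \<forall>\<^sub>F n in sequentially. d (\<sigma> n) q < \<epsilon>"
    unfolding M.limitin_metric by (auto elim: eventually_mono)
  have "limitin T \<gamma> q (at_left 1)"
    unfolding limitin_def
  proof (intro conjI allI impI q(1))
    fix V assume V: "openin T V \<and> q \<in> V"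
    then obtain r where r: "r > 0" "\<And>q'. q' \<in> topspace T \<Longrightarrow> d q q' < r \<Longrightarrow> q' \<in> V"
      using d_separates[OF q(1), of V] by metis
    obtain t0 where t0: "0 \<le> t0" "t0 < 1" "\<And>s t. t0 < s \<Longrightarrow> s < 1 \<Longrightarrow> t0 < t \<Longrightarrow> t < 1 \<Longrightarrow> d (\<gamma> s) (\<gamma> t) < r/2"
      using key[of "r/2"] r(1) by auto
    obtain N where N: "\<forall>n\<ge>N. t0 < 1 - 1 / (real n + 2)" using tail[OF t0(2)] by blast
    obtain N' where N': "\<forall>n\<ge>N'. d (\<sigma> n) q < r/2"
      using q(2)[of "r/2"] r(1) unfolding eventually_sequentially by auto
    define n where "n = max N N'"
    have n: "t0 < 1 - 1 / (real n + 2)" "d (\<sigma> n) q < r/2" using N N' by (auto simp: n_def)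
    show "\<forall>\<^sub>F t in at_left 1. \<gamma> t \<in> V"
      unfolding eventually_at_left_field
    proof (intro exI[of _ t0] conjI allI impI t0(2))
      fix t assume t: "t0 < t" "t < 1"
      have gt: "\<gamma> t \<in> topspace T" "\<sigma> n \<in> topspace T" using gT t t0 par by (auto simp: \<sigma>_def)
      have "d q (\<gamma> t) \<le> d q (\<sigma> n) + d (\<sigma> n) (\<gamma> t)" by (rule M.triangle[OF q(1) gt(2,1)])
      also have "\<dots> < r" using n(2) t0(3)[OF n(1) par(2) t] M.commute[of q "\<sigma> n"] by (simp add: \<sigma>_def)
      finally show "\<gamma> t \<in> V" using r(2) gt by blast
    qed
  qed
  then show ?thesis by (rule that)
qed

end

subsection \<open>The conjugate of a stationary surface\<close>

text \<open>Gauss's coefficients of the first fundamental form and the area density.\<close>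

definition gE :: "(complex \<Rightarrow> real^4) \<Rightarrow> complex \<Rightarrow> real" where "gE X z = mink (pd 1 X z) (pd 1 X z)"
definition gF :: "(complex \<Rightarrow> real^4) \<Rightarrow> complex \<Rightarrow> real" where "gF X z = mink (pd 1 X z) (pd 2 X z)"
definition gG :: "(complex \<Rightarrow> real^4) \<Rightarrow> complex \<Rightarrow> real" where "gG X z = mink (pd 2 X z) (pd 2 X z)"
definition gW :: "(complex \<Rightarrow> real^4) \<Rightarrow> complex \<Rightarrow> real" where "gW X z = sqrt (gE X z * gG X z - (gF X z)\<^sup>2)"

text \<open>\<open>- starQ du + starP dv\<close> is the Hodge star of \<open>dX\<close>.\<close>

definition starP :: "(complex \<Rightarrow> real^4) \<Rightarrow> complex \<Rightarrow> real^4" where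
  "starP X z = (gG X z * inverse (gW X z)) *\<^sub>R pd 1 X z + (- (gF X z * inverse (gW X z))) *\<^sub>R pd 2 X z"
definition starQ :: "(complex \<Rightarrow> real^4) \<Rightarrow> complex \<Rightarrow> real^4" where
  "starQ X z = (gE X z * inverse (gW X z)) *\<^sub>R pd 2 X z + (- (gF X z * inverse (gW X z))) *\<^sub>R pd 1 X z"

lemma pd_mult:
  fixes f g :: "complex \<Rightarrow> real"
  assumes "f differentiable (at z)" "g differentiable (at z)"
  shows "pd i (\<lambda>z. f z * g z) z = f z * pd i g z + pd i f z * g z"
  by (rule pd_bilinear[OF bounded_bilinear_mult assms])

locale regular_patch =
  fixes X :: "complex \<Rightarrow> real^4" and S :: "complex set"
  assumes S: "open S" and smooth: "smooth_on X S"
    and E_pos: "z \<in> S \<Longrightarrow> gE X z > 0" and D_pos: "z \<in> S \<Longrightarrow> gE X z * gG X z - (gF X z)\<^sup>2 > 0"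
begin

lemma W_pos: "z \<in> S \<Longrightarrow> gW X z > 0" using D_pos by (simp add: gW_def)
lemma W_sq: "z \<in> S \<Longrightarrow> gW X z * gW X z = gE X z * gG X z - (gF X z)\<^sup>2"
  using D_pos[of z] by (simp add: gW_def)

lemma smooth_E: "smooth_on (gE X) S" and smooth_F: "smooth_on (gF X) S" and smooth_G: "smooth_on (gG X) S"
  unfolding gE_def[abs_def] gF_def[abs_def] gG_def[abs_def]
  by (intro smooth_on_bilinear[OF S bounded_bilinear_mink] smooth_onD(2)[OF smooth])+

lemma smooth_W: "smooth_on (gW X) S"
proof -
  have "smooth_on (\<lambda>z. gE X z * gG X z + - (gF X z * gF X z)) S"
    by (intro smooth_on_add[OF S] smooth_on_bilinear[OF S bounded_bilinear_mult] smooth_E smooth_F smooth_G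
        smooth_on_linear[OF S bounded_linear_minus[OF bounded_linear_ident]])
  then have "smooth_on (\<lambda>z. gE X z * gG X z - (gF X z)\<^sup>2) S" by (simp add: power2_eq_square)
  then have "smooth_on (\<lambda>z. sqrt (gE X z * gG X z - (gF X z)\<^sup>2)) S"
    by (rule smooth_on_sqrt[OF S, rotated]) (rule D_pos)
  then show ?thesis by (simp add: gW_def[abs_def])
qed

lemma smooth_iW: "smooth_on (\<lambda>z. inverse (gW X z)) S"
  by (rule smooth_on_inverse[OF S _ smooth_W]) (use W_pos in force)

lemma smooth_coeffs: "smooth_on (\<lambda>z. gG X z * inverse (gW X z)) S" "smooth_on (\<lambda>z. gE X z * inverse (gW X z)) S"
  "smooth_on (\<lambda>z. - (gF X z * inverse (gW X z))) S"
  by (intro smooth_on_bilinear[OF S bounded_bilinear_mult] smooth_E smooth_F smooth_G smooth_iW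
        smooth_on_linear[OF S bounded_linear_minus[OF bounded_linear_ident]])+

lemma smooth_P: "smooth_on (starP X) S" and smooth_Q: "smooth_on (starQ X) S"
  unfolding starP_def[abs_def] starQ_def[abs_def]
  by (intro smooth_on_add[OF S] smooth_on_bilinear[OF S bounded_bilinear_scaleR] smooth_coeffs smooth_onD(2)[OF smooth])+

text \<open>The left side is the area density times the Laplacian of \<open>X\<close>, that is,
  twice the density times the mean curvature vector. Its tangential part vanishes by the product
  rule alone, its normal part by stationarity.\<close>

lemma star_closed:
  assumes z: "z \<in> S" and H: "mean_curvature X z = 0"
  shows "pd 1 (starP X) z + pd 2 (starQ X) z = 0"
proof -
  note sm = smooth_onD(1)[OF _ z] and X1 = smooth_onD(1)[OF smooth_onD(2)[OF smooth] z]
  define a where "a = (\<lambda>z. gG X z * inverse (gW X z))"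
  define e where "e = (\<lambda>z. gE X z * inverse (gW X z))"
  define b where "b = (\<lambda>z. - (gF X z * inverse (gW X z)))"
  have da: "a differentiable (at z)" and de: "e differentiable (at z)" and db: "b differentiable (at z)"
    unfolding a_def b_def e_def by (rule sm[OF smooth_coeffs(1)], rule sm[OF smooth_coeffs(2)], rule sm[OF smooth_coeffs(3)])
  have dE: "gE X differentiable (at z)" and dF: "gF X differentiable (at z)" and dG: "gG X differentiable (at z)"
    and dW: "gW X differentiable (at z)"
    using sm[OF smooth_E] sm[OF smooth_F] sm[OF smooth_G] sm[OF smooth_W] by auto
  define x1 x2 x11 x12 x22 where "x1 = pd 1 X z" and "x2 = pd 2 X z" and "x11 = pd 1 (pd 1 X) z"
    and "x12 = pd 1 (pd 2 X) z" and "x22 = pd 2 (pd 2 X) z"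
  have x21: "pd 2 (pd 1 X) z = x12" unfolding x12_def using mixed_partials[OF S z smooth] by simp
  define V where "V = pd 1 (starP X) z + pd 2 (starQ X) z"
  have P1: "pd 1 (starP X) z = (a z *\<^sub>R x11 + pd 1 a z *\<^sub>R x1) + (b z *\<^sub>R x12 + pd 1 b z *\<^sub>R x2)"
  proof -
    have "starP X = (\<lambda>z. a z *\<^sub>R pd 1 X z + b z *\<^sub>R pd 2 X z)" by (simp add: fun_eq_iff starP_def a_def b_def)
    then show ?thesis
      using pd_add[of "\<lambda>z. a z *\<^sub>R pd 1 X z" z "\<lambda>z. b z *\<^sub>R pd 2 X z" 1] da db X1
      by (simp add: pd_bilinear[OF bounded_bilinear_scaleR] x1_def x2_def x11_def x12_def)
  qed
  have Q2: "pd 2 (starQ X) z = (e z *\<^sub>R x22 + pd 2 e z *\<^sub>R x2) + (b z *\<^sub>R x12 + pd 2 b z *\<^sub>R x1)"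
  proof -
    have "starQ X = (\<lambda>z. e z *\<^sub>R pd 2 X z + b z *\<^sub>R pd 1 X z)" by (simp add: fun_eq_iff starQ_def e_def b_def)
    then show ?thesis
      using pd_add[of "\<lambda>z. e z *\<^sub>R pd 2 X z" z "\<lambda>z. b z *\<^sub>R pd 1 X z" 2] de db X1
      by (simp add: pd_bilinear[OF bounded_bilinear_scaleR] x1_def x2_def x22_def x21)
  qed
  define E F G W where "E = gE X z" and "F = gF X z" and "G = gG X z" and "W = gW X z"
  have W: "W > 0" "W * W = E * G - F\<^sup>2" using W_pos[OF z] W_sq[OF z] by (simp_all add: E_def F_def G_def W_def)
  have EFG: "mink x1 x1 = E" "mink x1 x2 = F" "mink x2 x1 = F" "mink x2 x2 = G"
    by (simp_all add: x1_def x2_def E_def F_def G_def gE_def gF_def gG_def mink_commute)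
  have abe: "a z = G / W" "b z = - (F / W)" "e z = E / W"
    by (simp_all add: a_def b_def e_def E_def F_def G_def W_def divide_inverse)
  have pdE: "pd 1 (gE X) z = 2 * mink x11 x1" "pd 2 (gE X) z = 2 * mink x12 x1"
    unfolding gE_def[abs_def] by (simp_all add: pd_bilinear[OF bounded_bilinear_mink X1 X1] x21 x1_def x11_def mink_commute)
  have pdG: "pd 1 (gG X) z = 2 * mink x12 x2" "pd 2 (gG X) z = 2 * mink x22 x2"
    unfolding gG_def[abs_def] by (simp_all add: pd_bilinear[OF bounded_bilinear_mink X1 X1] x2_def x12_def x22_def mink_commute)
  have pdF: "pd 1 (gF X) z = mink x12 x1 + mink x11 x2" "pd 2 (gF X) z = mink x22 x1 + mink x12 x2"
    unfolding gF_def[abs_def] by (simp_all add: pd_bilinear[OF bounded_bilinear_mink X1 X1] x21 x1_def x2_def x11_def x12_def x22_def mink_commute)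
  have pdWW: "2 * W * pd i (gW X) z = E * pd i (gG X) z + pd i (gE X) z * G - 2 * F * pd i (gF X) z" for i
  proof -
    have "pd i (\<lambda>z. gW X z * gW X z) z = pd i (\<lambda>z. gE X z * gG X z + - (gF X z * gF X z)) z"
      by (rule pd_cong[OF S z]) (simp add: W_sq power2_eq_square)
    also have "\<dots> = pd i (\<lambda>z. gE X z * gG X z) z + - pd i (\<lambda>z. gF X z * gF X z) z"
      using dE dF dG pd_linear[OF bounded_linear_minus[OF bounded_linear_ident], of "\<lambda>z. gF X z * gF X z" z i]
      by (subst pd_add) auto
    finally show ?thesis using dE dF dG dW by (simp add: pd_mult E_def F_def G_def W_def algebra_simps)
  qed
  have lin2: "pd i (\<lambda>z. p z * q z + b z * r z) z = p z * pd i q z + pd i p z * q z + b z * pd i r z + pd i b z * r z"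
    if "p differentiable (at z)" "q differentiable (at z)" "r differentiable (at z)" for p q r :: "complex \<Rightarrow> real" and i
    using that db by (subst pd_add) (auto simp: pd_mult)
  \<comment> \<open>The pairings of \<open>starP\<close> and \<open>starQ\<close> with the tangent
    vectors. Their derivatives eliminate the derivatives of \<open>a\<close>, \<open>b\<close>,
    \<open>e\<close> from the tangential components of \<open>V\<close>.\<close>
  have ident: "a w * gE X w + b w * gF X w = gW X w" "e w * gF X w + b w * gE X w = 0"
    "a w * gF X w + b w * gG X w = 0" "e w * gG X w + b w * gF X w = gW X w" if "w \<in> S" for w
    using W_pos[OF that] W_sq[OF that] by (simp_all add: a_def b_def e_def field_simps power2_eq_square)
  have i1: "a z * pd 1 (gE X) z + pd 1 a z * E + b z * pd 1 (gF X) z + pd 1 b z * F = pd 1 (gW X) z"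
    using pd_cong[OF S z ident(1), where i=1] lin2[OF da dE dF, where i=1] by (simp add: E_def F_def)
  have i2: "e z * pd 2 (gF X) z + pd 2 e z * F + b z * pd 2 (gE X) z + pd 2 b z * E = 0"
    using pd_cong[OF S z ident(2), where i=2] lin2[OF de dF dE, where i=2] by (simp add: E_def F_def)
  have i3: "a z * pd 1 (gF X) z + pd 1 a z * F + b z * pd 1 (gG X) z + pd 1 b z * G = 0"
    using pd_cong[OF S z ident(3), where i=1] lin2[OF da dF dG, where i=1] by (simp add: G_def F_def)
  have i4: "e z * pd 2 (gG X) z + pd 2 e z * G + b z * pd 2 (gF X) z + pd 2 b z * F = pd 2 (gW X) z"
    using pd_cong[OF S z ident(4), where i=2] lin2[OF de dG dF, where i=2] by (simp add: G_def F_def)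
  have V: "V = (a z *\<^sub>R x11 + pd 1 a z *\<^sub>R x1) + (b z *\<^sub>R x12 + pd 1 b z *\<^sub>R x2)
      + ((e z *\<^sub>R x22 + pd 2 e z *\<^sub>R x2) + (b z *\<^sub>R x12 + pd 2 b z *\<^sub>R x1))"
    unfolding V_def P1 Q2 ..
  have V1: "mink V x1 = 0"
  proof -
    have "mink V x1 = a z * mink x11 x1 + pd 1 a z * E + b z * mink x12 x1 + pd 1 b z * F
        + e z * mink x22 x1 + pd 2 e z * F + b z * mink x12 x1 + pd 2 b z * E"
      unfolding V by (simp only: mink_add_left mink_scaleR_left EFG)
    also have "\<dots> = pd 1 (gW X) z - (a z * mink x11 x1 + b z * (mink x11 x2 + mink x12 x1) + e z * mink x12 x2)"
      using i1 i2 unfolding pdE pdF by (simp add: algebra_simps)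
    also have "pd 1 (gW X) z = a z * mink x11 x1 + b z * (mink x11 x2 + mink x12 x1) + e z * mink x12 x2"
      using pdWW[of 1] W(1) unfolding pdE pdF pdG abe by (simp add: field_simps)
    finally show ?thesis by simp
  qed
  have V2: "mink V x2 = 0"
  proof -
    have "mink V x2 = a z * mink x11 x2 + pd 1 a z * F + b z * mink x12 x2 + pd 1 b z * G
        + e z * mink x22 x2 + pd 2 e z * G + b z * mink x12 x2 + pd 2 b z * F"
      unfolding V by (simp only: mink_add_left mink_scaleR_left EFG)
    also have "\<dots> = pd 2 (gW X) z - (e z * mink x22 x2 + b z * (mink x22 x1 + mink x12 x2) + a z * mink x12 x1)"
      using i3 i4 unfolding pdG pdF by (simp add: algebra_simps)
    also have "pd 2 (gW X) z = e z * mink x22 x2 + b z * (mink x22 x1 + mink x12 x2) + a z * mink x12 x1"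
      using pdWW[of 2] W(1) unfolding pdE pdF pdG abe by (simp add: field_simps)
    finally show ?thesis by simp
  qed
  define g where "g = first_form X z"
  have g: "g$1$1 = E" "g$1$2 = F" "g$2$1 = F" "g$2$2 = G"
    using EFG by (simp_all add: g_def first_form_def x1_def x2_def mink_commute)
  have D: "W * W = g$1$1 * g$2$2 - g$1$2 * g$2$1" "W * W \<noteq> 0"
    using W(2) by (simp add: g power2_eq_square) (use W(1) in simp)
  note gi = matrix_inv_2[OF D, unfolded g]
  define N where "N w = normal_part X z w" for w
  have N: "N w = w - ((G * mink w x1 - F * mink w x2) / (W*W)) *\<^sub>R x1 - ((E * mink w x2 - F * mink w x1) / (W*W)) *\<^sub>R x2" for w
    unfolding N_def normal_part_def sum_2 g_def[symmetric] gi x1_def[symmetric] x2_def[symmetric]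
    by (simp add: scaleR_add_left[symmetric] algebra_simps diff_divide_distrib)
  have Nadd: "N (v + w) = N v + N w" and Nsc: "N (r *\<^sub>R w) = r *\<^sub>R N w" for v w r
    unfolding N by (simp_all add: mink_add_left mink_scaleR_left algebra_simps add_divide_distrib diff_divide_distrib)
  have N1: "N x1 = 0" "N x2 = 0"
  proof -
    have e: "G * E - F * F = W * W" "E * G - F * F = W * W" "E * F - F * E = 0" "G * F - F * G = 0"
      using W(2) by (simp_all add: power2_eq_square)
    show "N x1 = 0" "N x2 = 0" using D(2) unfolding N EFG e by simp_all
  qed
  have NV: "N V = a z *\<^sub>R N x11 + b z *\<^sub>R N x12 + (e z *\<^sub>R N x22 + b z *\<^sub>R N x12)"
    unfolding V by (simp only: Nadd Nsc N1 scaleR_zero_right add_0_right)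
  have "mean_curvature X z = (1/2) *\<^sub>R ((G/(W*W)) *\<^sub>R N x11 + (- F/(W*W)) *\<^sub>R N x12 + ((- F/(W*W)) *\<^sub>R N x12 + (E/(W*W)) *\<^sub>R N x22))"
    unfolding mean_curvature_def second_form_def sum_2 g_def[symmetric] gi N_def x11_def x12_def x22_def x21[unfolded x12_def, symmetric]
    using x21 by (simp add: x12_def)
  then have MC: "W *\<^sub>R ((G/(W*W)) *\<^sub>R N x11 + (- F/(W*W)) *\<^sub>R N x12 + ((- F/(W*W)) *\<^sub>R N x12 + (E/(W*W)) *\<^sub>R N x22)) = 0"
    using H by simp
  have scal: "W * (r / (W * W)) = r / W" for r using W(1) by simp
  \<comment> \<open>The normal part of \<open>V\<close> is \<open>2 * W\<close> times the mean
    curvature, and \<open>V\<close> equals its normal part because it is orthogonal to both tangent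
    vectors.\<close>
  have "N V = 0"
    using MC unfolding NV abe scaleR_add_right scaleR_scaleR scal minus_divide_left by (simp only: add.commute add.left_commute)
  moreover have "N V = V" unfolding N V1 V2 by simp
  ultimately show ?thesis by (simp add: V_def)
qed

text \<open>Closedness of the star is the integrability condition of the Poincare lemma. The
  differential of \<open>Y\<close> is the Hodge star of that of \<open>X\<close>.\<close>

lemma conjugate_exists:
  assumes H: "\<And>z. z \<in> S \<Longrightarrow> mean_curvature X z = 0" and z0: "z0 \<in> S"
  obtains r Y where "r > 0" "ball z0 r \<subseteq> S"
    "\<And>z. z \<in> ball z0 r \<Longrightarrow> (Y has_derivative (\<lambda>h. Re h *\<^sub>R (- starQ X z) + Im h *\<^sub>R starP X z)) (at z)"
proof -
  obtain r where r: "r > 0" "ball z0 r \<subseteq> S" using S z0 open_contains_ball by blast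
  have Q: "smooth_on (\<lambda>z. - starQ X z) (ball z0 r)"
    by (rule smooth_on_subset[OF smooth_on_linear[OF S bounded_linear_minus[OF bounded_linear_ident] smooth_Q] r(2)])
  have P: "smooth_on (starP X) (ball z0 r)" by (rule smooth_on_subset[OF smooth_P r(2)])
  have "pd 2 (\<lambda>z. - starQ X z) z = pd 1 (starP X) z" if "z \<in> ball z0 r" for z
  proof -
    have z: "z \<in> S" using r(2) that by blast
    have "pd 2 (\<lambda>z. - starQ X z) z = - pd 2 (starQ X) z"
      using pd_linear[OF bounded_linear_minus[OF bounded_linear_ident] smooth_onD(1)[OF smooth_Q z]] by simp
    then show ?thesis using star_closed[OF z H[OF z]] by (simp add: add_eq_0_iff)
  qed
  then obtain Y where Y: "\<And>z. z \<in> ball z0 r \<Longrightarrow> (Y has_derivative (\<lambda>h. Re h *\<^sub>R (- starQ X z) + Im h *\<^sub>R starP X z)) (at z)"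
    using poincare_lemma[OF Q P] by blast
  show ?thesis by (rule that[OF r Y])
qed

end

text \<open>Conformal invariance of the Hodge star: if \<open>a\<close> and \<open>b\<close> are the
  partials of an isothermal coordinate, the differential of \<open>X\<close> and its star are the
  real and the imaginary part of 2 \<phi> times the differential of that coordinate.\<close>

lemma star_conformal:
  fixes \<phi> :: "complex^4" and a b :: complex and l :: real
  assumes l: "l > 0" and J: "Im (cnj a * b) > 0"
    and E: "gE X z = l * (norm a)\<^sup>2" and F: "gF X z = l * Re (a * cnj b)" and G: "gG X z = l * (norm b)\<^sup>2"
    and X1: "\<And>k. pd 1 X z $ k = 2 * Re (\<phi> $ k * a)" and X2: "\<And>k. pd 2 X z $ k = 2 * Re (\<phi> $ k * b)"
  shows "starP X z $ k = 2 * Im (\<phi> $ k * b)" "- starQ X z $ k = 2 * Im (\<phi> $ k * a)" "gW X z = l * Im (cnj a * b)"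
proof -
  have sq: "gE X z * gG X z - (gF X z)\<^sup>2 = (l * Im (cnj a * b))\<^sup>2"
    unfolding E F G cmod_power2 by (simp add: power2_eq_square algebra_simps)
  have W: "gW X z = l * Im (cnj a * b)" unfolding gW_def sq using l J by simp
  then show "gW X z = l * Im (cnj a * b)" .
  define D where "D = Im (cnj a * b)"
  have D: "D > 0" "gW X z = l * D" using J W by (simp_all add: D_def)
  have "D * (starP X z $ k) = (norm b)\<^sup>2 * (2 * Re (\<phi> $ k * a)) - Re (a * cnj b) * (2 * Re (\<phi> $ k * b))"
    using D l unfolding starP_def E F G D(2) by (simp add: X1 X2 field_simps)
  also have "\<dots> = D * (2 * Im (\<phi> $ k * b))"
    unfolding D_def cmod_power2 by (simp add: power2_eq_square algebra_simps)
  finally show "starP X z $ k = 2 * Im (\<phi> $ k * b)" using D(1) by simp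
  have "D * (- starQ X z $ k) = Re (a * cnj b) * (2 * Re (\<phi> $ k * a)) - (norm a)\<^sup>2 * (2 * Re (\<phi> $ k * b))"
    using D l unfolding starQ_def E F G D(2) by (simp add: X1 X2 field_simps)
  also have "\<dots> = D * (2 * Im (\<phi> $ k * a))"
    unfolding D_def cmod_power2 by (simp add: power2_eq_square algebra_simps)
  finally have "D * (- starQ X z $ k) = D * (2 * Im (\<phi> $ k * a))" .
  then show "- starQ X z $ k = 2 * Im (\<phi> $ k * a)" using D(1) mult_left_cancel[of D] by blast
qed

lemma jacobian_eq: "jacobian f z = Im (cnj (pd 1 f z) * pd 2 f z)"
  by (simp add: jacobian_def algebra_simps)

lemma jacobian_compose:
  assumes "f differentiable (at (g z))" "g differentiable (at z)"
  shows "jacobian (\<lambda>z. f (g z)) z = jacobian f (g z) * jacobian g z"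
  unfolding jacobian_def pd_compose[where f=f and g=g, OF assms] by (simp add: algebra_simps)

lemma jacobian_cong: "open S \<Longrightarrow> z \<in> S \<Longrightarrow> (\<And>z. z \<in> S \<Longrightarrow> f z = g z) \<Longrightarrow> jacobian f z = jacobian g z"
  unfolding jacobian_def using pd_cong[of S z f g] by simp

lemma pd_id: "pd i (\<lambda>z. z) z = (if i = 1 then 1 else \<i>)"
  using pd_eq[OF has_derivative_ident] .

text \<open>The chain rule for the identity \<open>\<sigma> (g w) = w\<close>, solved for the
  partials of \<open>g\<close> by Cramer's rule.\<close>

lemma inverse_pd:
  fixes \<sigma> g :: "complex \<Rightarrow> complex"
  assumes V: "open V" "w \<in> V" and inv: "\<And>w. w \<in> V \<Longrightarrow> \<sigma> (g w) = w"
    and d: "g differentiable (at w)" "\<sigma> differentiable (at (g w))" and e: "e = (if i = 1 then 1 else \<i>)"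
  shows "Re (pd i g w) *\<^sub>R pd 1 \<sigma> (g w) + Im (pd i g w) *\<^sub>R pd 2 \<sigma> (g w) = e"
    "jacobian \<sigma> (g w) * Re (pd i g w) = Im (cnj e * pd 2 \<sigma> (g w))"
    "jacobian \<sigma> (g w) * Im (pd i g w) = Im (cnj (pd 1 \<sigma> (g w)) * e)"
    "jacobian \<sigma> (g w) * jacobian g w = 1"
proof -
  have "pd i (\<lambda>w. \<sigma> (g w)) w = e" using pd_cong[OF V, of "\<lambda>w. \<sigma> (g w)" "\<lambda>w. w"] inv pd_id e by simp
  then show s: "Re (pd i g w) *\<^sub>R pd 1 \<sigma> (g w) + Im (pd i g w) *\<^sub>R pd 2 \<sigma> (g w) = e"
    using pd_compose[where f=\<sigma> and g=g, OF d(2,1)] by simp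
  show "jacobian \<sigma> (g w) * Re (pd i g w) = Im (cnj e * pd 2 \<sigma> (g w))"
    "jacobian \<sigma> (g w) * Im (pd i g w) = Im (cnj (pd 1 \<sigma> (g w)) * e)"
    unfolding s[symmetric] jacobian_def by (simp_all add: algebra_simps)
  have "jacobian (\<lambda>w. \<sigma> (g w)) w = jacobian (\<lambda>w. w) w" by (rule jacobian_cong[OF V inv])
  then show "jacobian \<sigma> (g w) * jacobian g w = 1"
    using jacobian_compose[where f=\<sigma> and g=g, OF d(2,1)] by (simp add: jacobian_def pd_id)
qed

text \<open>Bootstrapping: by \<open>inverse_pd\<close> the partials of \<open>g\<close> are smooth
  expressions in the partials of \<sigma> at \<open>g w\<close>, so each order of smoothness of
  \<open>g\<close> yields the next.\<close>

lemma smooth_on_inverse_function: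
  fixes \<sigma> g :: "complex \<Rightarrow> complex"
  assumes V: "open V" and U: "open U" "g ` V \<subseteq> U" and \<sigma>: "smooth_on \<sigma> U"
    and J: "\<And>z. z \<in> U \<Longrightarrow> jacobian \<sigma> z \<noteq> 0"
    and g: "\<And>w. w \<in> V \<Longrightarrow> g differentiable (at w)" and inv: "\<And>w. w \<in> V \<Longrightarrow> \<sigma> (g w) = w"
  shows "smooth_on g V"
  unfolding smooth_on_def
proof
  fix k show "Ck_on k g V"
  proof (induction k)
    case 0
    have "\<forall>w\<in>V. isCont g w" using g by (auto intro: differentiable_imp_continuous_within)
    then show ?case by (simp add: continuous_at_imp_continuous_on)
  next
    case (Suc k)
    have s: "Ck_on k (\<lambda>w. pd i \<sigma> (g w)) V" for i
      by (rule Ck_on_compose[OF V U(2) _ Suc]) (use smooth_onD(2)[OF \<sigma>] in \<open>simp add: smooth_on_def\<close>)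
    have lin: "Ck_on k (\<lambda>w. L (h w)) V" if "bounded_linear L" "Ck_on k h V" for L :: "complex \<Rightarrow> real" and h
      by (rule Ck_on_linear[OF V that])
    have "Ck_on k (\<lambda>w. Re (pd 1 \<sigma> (g w)) * Im (pd 2 \<sigma> (g w)) + - (Re (pd 2 \<sigma> (g w)) * Im (pd 1 \<sigma> (g w)))) V"
      by (intro Ck_on_add[OF V] Ck_on_bilinear[OF V bounded_bilinear_mult]
          Ck_on_linear[OF V bounded_linear_minus[OF bounded_linear_ident]] lin[OF bounded_linear_Re] lin[OF bounded_linear_Im] s)
    then have sJ: "Ck_on k (\<lambda>w. jacobian \<sigma> (g w)) V" by (simp add: jacobian_def)
    have iJ: "Ck_on k (\<lambda>w. inverse (jacobian \<sigma> (g w))) V"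
      by (rule Ck_on_inverse[OF V _ sJ]) (use U(2) J in auto)
    have "Ck_on k (pd i g) V" for i
    proof -
      define e :: complex where "e = (if i = 1 then 1 else \<i>)"
      have "Ck_on k (\<lambda>w. (inverse (jacobian \<sigma> (g w)) * Im (cnj e * pd 2 \<sigma> (g w))) *\<^sub>R (1::complex)
          + (inverse (jacobian \<sigma> (g w)) * Im (cnj (pd 1 \<sigma> (g w)) * e)) *\<^sub>R \<i>) V"
        by (intro Ck_on_add[OF V] Ck_on_bilinear[OF V bounded_bilinear_scaleR] Ck_on_bilinear[OF V bounded_bilinear_mult]
            iJ lin[OF bounded_linear_Im] Ck_on_const s Ck_on_linear[OF V bounded_linear_cnj])
      then show ?thesis
      proof (rule Ck_on_cong[OF V, rotated])
        fix w assume w: "w \<in> V"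
        then have gw: "g w \<in> U" using U(2) by blast
        note i = inverse_pd[OF V w inv g[OF w] smooth_onD(1)[OF \<sigma> gw] e_def]
        have "Re (pd i g w) = inverse (jacobian \<sigma> (g w)) * Im (cnj e * pd 2 \<sigma> (g w))"
          "Im (pd i g w) = inverse (jacobian \<sigma> (g w)) * Im (cnj (pd 1 \<sigma> (g w)) * e)"
          using i(2,3) J[OF gw] by (simp_all add: field_simps)
        then show "(inverse (jacobian \<sigma> (g w)) * Im (cnj e * pd 2 \<sigma> (g w))) *\<^sub>R (1::complex)
          + (inverse (jacobian \<sigma> (g w)) * Im (cnj (pd 1 \<sigma> (g w)) * e)) *\<^sub>R \<i> = pd i g w"
          by (simp add: complex_eq_iff)
      qed
    qed
    then show ?case using g by simp
  qed
qed

lemma is_chartI: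
  assumes "openin T U" "inj_on f U" "\<And>V. openin T V \<Longrightarrow> V \<subseteq> U \<Longrightarrow> open (f ` V)"
    "\<And>W. open W \<Longrightarrow> openin T {p \<in> U. f p \<in> W}"
  shows "is_chart T (U, f)"
proof -
  have UT: "U \<subseteq> topspace T" using assms(1) by (rule openin_subset)
  have "homeomorphic_map (subtopology T U) (top_of_set (f ` U)) f"
  proof (rule bijective_open_imp_homeomorphic_map)
    show "continuous_map (subtopology T U) (top_of_set (f ` U)) f"
      unfolding continuous_map_def
    proof (intro conjI allI impI)
      show "f \<in> topspace (subtopology T U) \<rightarrow> topspace (top_of_set (f ` U))" by auto
      fix W assume "openin (top_of_set (f ` U)) W"
      then obtain O' where O': "open O'" "W = f ` U \<inter> O'" by (auto simp: openin_open)
      have "{p \<in> topspace (subtopology T U). f p \<in> W} = {p \<in> U. f p \<in> O'}" using UT O' by auto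
      then show "openin (subtopology T U) {p \<in> topspace (subtopology T U). f p \<in> W}"
        using assms(4)[OF O'(1)] assms(1) by (simp add: openin_open_subtopology)
    qed
    show "open_map (subtopology T U) (top_of_set (f ` U)) f"
      unfolding open_map_def
    proof (intro allI impI)
      fix V assume "openin (subtopology T U) V"
      then have "openin T V" "V \<subseteq> U" using assms(1) by (auto simp: openin_open_subtopology)
      then show "openin (top_of_set (f ` U)) (f ` V)" using assms(3) by (simp add: open_subset image_mono)
    qed
    show "f ` topspace (subtopology T U) = topspace (top_of_set (f ` U))" using UT by (simp add: Int_absorb1)
    show "inj_on f (topspace (subtopology T U))" using assms(2) UT by (simp add: Int_absorb1)
  qed
  then show ?thesis using assms(1) assms(3)[OF assms(1)] by (simp add: is_chart_def)
qed

subsection \<open>Isothermal coordinates\<close>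

text \<open>Equal lengths, orthogonality and positive orientation amount to the Cauchy-Riemann
  equations; the orientation selects \<open>\<i>\<close> against \<open>- \<i>\<close>.\<close>

lemma orthogonal_rotation:
  fixes a b :: complex
  assumes "norm a = norm b" "Re (a * cnj b) = 0" "Im (cnj a * b) > 0"
  shows "b = \<i> * a" "a \<noteq> 0"
proof -
  show a: "a \<noteq> 0" using assms(3) by auto
  have "Re (cnj a * b) = 0" using assms(2) by (simp add: algebra_simps)
  moreover have "(Re (cnj a * b))\<^sup>2 + (Im (cnj a * b))\<^sup>2 = (norm a * norm a)\<^sup>2"
    using assms(1) by (simp only: cmod_power2[symmetric] norm_mult complex_mod_cnj)
  ultimately have "Im (cnj a * b) = norm a * norm a"
    using assms(3) power2_eq_imp_eq[of "Im (cnj a * b)" "norm a * norm a"] by auto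
  then have "cnj a * b = \<i> * (cnj a * a)"
    using \<open>Re (cnj a * b) = 0\<close> by (simp add: complex_eq_iff complex_mult_cnj cmod_def power2_eq_square[symmetric] del: power2_eq_square)
  then have "cnj a * (b - \<i> * a) = 0" by (simp add: algebra_simps)
  then show "b = \<i> * a" using a by simp
qed

lemma pd_X_dz: "pd 1 X z $ k = 2 * Re (dz X z $ k)" "pd 2 X z $ k = - 2 * Im (dz X z $ k)"
  by (simp_all add: dz_def)

lemma form_pullback:
  fixes s :: "2 \<Rightarrow> complex"
  assumes "gG Y w = gE Y w" "gF Y w = 0"
    and "\<And>i. pd i X z = Re (s i) *\<^sub>R pd 1 Y w + Im (s i) *\<^sub>R pd 2 Y w"
  shows "gE X z = gE Y w * (norm (s 1))\<^sup>2" "gF X z = gE Y w * Re (s 1 * cnj (s 2))" "gG X z = gE Y w * (norm (s 2))\<^sup>2"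
    "pd i X z $ k = 2 * Re (dz Y w $ k * s i)"
proof -
  have m: "mink (pd 1 Y w) (pd 1 Y w) = gE Y w" "mink (pd 2 Y w) (pd 2 Y w) = gE Y w"
    "mink (pd 1 Y w) (pd 2 Y w) = 0" "mink (pd 2 Y w) (pd 1 Y w) = 0"
    using assms(1,2) by (simp_all add: gE_def gF_def gG_def mink_commute)
  show "gE X z = gE Y w * (norm (s 1))\<^sup>2" "gF X z = gE Y w * Re (s 1 * cnj (s 2))" "gG X z = gE Y w * (norm (s 2))\<^sup>2"
    unfolding gE_def[of X] gF_def[of X] gG_def[of X] assms(3) cmod_power2
    by (simp_all add: mink_add_left mink_add_right mink_scaleR_left mink_scaleR_right m power2_eq_square algebra_simps)
  show "pd i X z $ k = 2 * Re (dz Y w $ k * s i)"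
    unfolding assms(3) by (simp add: dz_def algebra_simps)
qed

text \<open>The Hermitian form <z, conj z>. On the derivative of the immersion in an isothermal
  chart it is half the conformal factor.\<close>

definition herm :: "complex^4 \<Rightarrow> real" where
  "herm z = (norm (z$1))\<^sup>2 + (norm (z$2))\<^sup>2 + (norm (z$3))\<^sup>2 - (norm (z$4))\<^sup>2"

locale stationary = spacelike T \<A> x
  for T :: "'a topology" and \<A> :: "'a chart set" and x :: "'a \<Rightarrow> real^4" +
  assumes minimal: "\<And>c z. c \<in> \<A> \<Longrightarrow> z \<in> img c \<Longrightarrow> mean_curvature (in_chart x c) z = 0"
begin

lemma patch:
  assumes c: "c \<in> \<A>"
  shows "regular_patch (X c) (img c)"
proof
  show "open (img c)" by (rule is_chartD(2)[OF A_chart[OF c]])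
  show "smooth_on (X c) (img c)" by (rule X_smooth[OF c])
  fix z assume z: "z \<in> img c"
  show E: "gE (X c) z > 0" using metric_pos[OF c z, of 1] by (simp add: gE_def)
  \<comment> \<open>At the tangent vector (-F, E) the metric takes the value E (E G - F^2), which
    makes the determinant positive.\<close>
  define h where "h = Complex (- gF (X c) z) (gE (X c) z)"
  have "h \<noteq> 0" using E by (simp add: h_def complex_eq_iff)
  from metric_pos[OF c z this]
  have "gE (X c) z * (gE (X c) z * gG (X c) z - (gF (X c) z)\<^sup>2) > 0"
    by (simp add: h_def mink_add_left mink_add_right mink_diff_left mink_diff_right mink_scaleR_left mink_scaleR_right gE_def gF_def gG_def
        mink_commute[of "pd 2 (X c) z" "pd 1 (X c) z"] power2_eq_square algebra_simps)
  then show "gE (X c) z * gG (X c) z - (gF (X c) z)\<^sup>2 > 0" using E zero_less_mult_pos by blast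
qed

definition Iso :: "'a chart set" where "Iso = {c. isothermal_chart T \<A> x c}"

lemma Iso_chart: "c \<in> Iso \<Longrightarrow> is_chart T c"
  and Iso_trans: "c \<in> Iso \<Longrightarrow> a \<in> \<A> \<Longrightarrow> oriented_transition c a" "c \<in> Iso \<Longrightarrow> a \<in> \<A> \<Longrightarrow> oriented_transition a c"
  by (auto simp: Iso_def isothermal_chart_def oriented_chart_def)

lemma oriented_transitionD:
  assumes "oriented_transition c c'"
  shows "smooth_on (change c c') (snd c ` (fst c \<inter> fst c'))"
    "z \<in> snd c ` (fst c \<inter> fst c') \<Longrightarrow> jacobian (change c c') z > 0"
  using assms by (auto simp: oriented_transition_def split: prod.splits)

lemma overlap_open:
  assumes "is_chart T c" "is_chart T c'"
  shows "open (snd c ` (fst c \<inter> fst c'))"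
  by (rule is_chartD(5)[OF assms(1)]) (use is_chartD(1)[OF assms(1)] is_chartD(1)[OF assms(2)] in auto)

lemma transition_apply:
  assumes "is_chart T c" "z \<in> snd c ` (fst c \<inter> fst c')"
  shows "chart_inv c z \<in> fst c \<inter> fst c'" "snd c (chart_inv c z) = z"
    "change c c' z \<in> snd c' ` (fst c' \<inter> fst c)"
  using assms inv_into_f_f[OF is_chartD(3)[OF assms(1)]] by auto

lemma X_transition:
  assumes "is_chart T c" "is_chart T c'" "z \<in> snd c ` (fst c \<inter> fst c')"
  shows "X c z = X c' (change c c' z)"
  using transition_apply[OF assms(1,3)] inv_into_f_f[OF is_chartD(3)[OF assms(2)]] by (simp add: in_chart_def)

lemma Iso_X_smooth:
  assumes c: "c \<in> Iso" shows "smooth_on (X c) (img c)"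
proof (rule smooth_on_local)
  fix z assume z: "z \<in> img c"
  then obtain p where p: "p \<in> fst c" "z = snd c p" by auto
  obtain a where a: "a \<in> \<A>" "p \<in> fst a" using A_cover is_chartD(4)[OF Iso_chart[OF c]] p by blast
  let ?N = "snd c ` (fst c \<inter> fst a)"
  have oN: "open ?N" by (rule overlap_open[OF Iso_chart[OF c] A_chart[OF a(1)]])
  have "smooth_on (\<lambda>z. X a (change c a z)) ?N"
  proof (rule smooth_on_compose[OF oN _ X_smooth[OF a(1)]])
    show "(change c a) ` ?N \<subseteq> img a" using transition_apply[OF Iso_chart[OF c]] by fastforce
    show "smooth_on (change c a) ?N" by (rule oriented_transitionD(1)[OF Iso_trans(1)[OF c a(1)]])
  qed
  then have "smooth_on (X c) ?N"
    by (rule smooth_on_cong[OF oN, rotated]) (rule X_transition[OF Iso_chart[OF c] A_chart[OF a(1)], symmetric])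
  then show "\<exists>N. open N \<and> z \<in> N \<and> smooth_on (X c) N" using oN p a by blast
qed

lemma Iso_form:
  assumes "c \<in> Iso" "z \<in> img c"
  shows "gG (X c) z = gE (X c) z" "gF (X c) z = 0"
proof -
  have "let g = first_form (X c) z in g $ 1 $ 1 = g $ 2 $ 2 \<and> g $ 1 $ 2 = 0"
    using assms by (auto simp: Iso_def isothermal_chart_def)
  then show "gG (X c) z = gE (X c) z" "gF (X c) z = 0"
    by (simp_all add: Let_def first_form_def gE_def gF_def gG_def)
qed

definition \<phi> :: "'a chart \<Rightarrow> 'a \<Rightarrow> complex^4" where "\<phi> c p = dz (X c) (snd c p)"

text \<open>The conjugate surface is constructed in atlas charts, the derivative \<phi> in
  isothermal ones; here the atlas data are expressed by the isothermal data and the transition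
  \<sigma>.\<close>

lemma A_to_Iso:
  assumes a: "a \<in> \<A>" and c: "c \<in> Iso" and z: "z \<in> snd a ` (fst a \<inter> fst c)"
  defines "\<sigma> \<equiv> change a c"
  shows "gE (X c) (\<sigma> z) > 0" "gE (X a) z = gE (X c) (\<sigma> z) * (norm (pd 1 \<sigma> z))\<^sup>2"
    "gF (X a) z = gE (X c) (\<sigma> z) * Re (pd 1 \<sigma> z * cnj (pd 2 \<sigma> z))"
    "gG (X a) z = gE (X c) (\<sigma> z) * (norm (pd 2 \<sigma> z))\<^sup>2"
    "pd i (X a) z $ k = 2 * Re (dz (X c) (\<sigma> z) $ k * pd i \<sigma> z)"
    "starP (X a) z $ k = 2 * Im (dz (X c) (\<sigma> z) $ k * pd 2 \<sigma> z)"
    "- starQ (X a) z $ k = 2 * Im (dz (X c) (\<sigma> z) $ k * pd 1 \<sigma> z)"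
proof -
  note t = transition_apply[OF A_chart[OF a] z]
  have sz: "\<sigma> z \<in> img c" using t by (auto simp: \<sigma>_def)
  have oN: "open (snd a ` (fst a \<inter> fst c))" by (rule overlap_open[OF A_chart[OF a] Iso_chart[OF c]])
  have sm: "smooth_on \<sigma> (snd a ` (fst a \<inter> fst c))" unfolding \<sigma>_def by (rule oriented_transitionD(1)[OF Iso_trans(2)[OF c a]])
  have J: "jacobian \<sigma> z > 0" unfolding \<sigma>_def by (rule oriented_transitionD(2)[OF Iso_trans(2)[OF c a] z])
  have pdX: "pd i (X a) z = Re (pd i \<sigma> z) *\<^sub>R pd 1 (X c) (\<sigma> z) + Im (pd i \<sigma> z) *\<^sub>R pd 2 (X c) (\<sigma> z)" for i
  proof -
    have "pd i (X a) z = pd i (\<lambda>z. X c (\<sigma> z)) z"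
      by (rule pd_cong[OF oN z]) (simp add: \<sigma>_def X_transition[OF A_chart[OF a] Iso_chart[OF c]] del: o_apply)
    also have "\<dots> = Re (pd i \<sigma> z) *\<^sub>R pd 1 (X c) (\<sigma> z) + Im (pd i \<sigma> z) *\<^sub>R pd 2 (X c) (\<sigma> z)"
      by (rule pd_compose[OF smooth_onD(1)[OF Iso_X_smooth[OF c] sz] smooth_onD(1)[OF sm z]])
    finally show ?thesis .
  qed
  note fp = form_pullback[of "X c" "\<sigma> z" "X a" z "\<lambda>i. pd i \<sigma> z", OF Iso_form[OF c sz] pdX]
  show E: "gE (X a) z = gE (X c) (\<sigma> z) * (norm (pd 1 \<sigma> z))\<^sup>2"
    and F: "gF (X a) z = gE (X c) (\<sigma> z) * Re (pd 1 \<sigma> z * cnj (pd 2 \<sigma> z))"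
    and G: "gG (X a) z = gE (X c) (\<sigma> z) * (norm (pd 2 \<sigma> z))\<^sup>2"
    by (rule fp(1), rule fp(2), rule fp(3))
  show X': "pd i (X a) z $ k = 2 * Re (dz (X c) (\<sigma> z) $ k * pd i \<sigma> z)" for i k by (rule fp(4))
  have "z \<in> img a" using z by auto
  then have "gE (X a) z > 0" by (rule regular_patch.E_pos[OF patch[OF a]])
  then show l: "gE (X c) (\<sigma> z) > 0" unfolding E by (simp add: zero_less_mult_iff)
  from star_conformal[OF l J[unfolded jacobian_eq] E F G X' X']
  show "starP (X a) z $ k = 2 * Im (dz (X c) (\<sigma> z) $ k * pd 2 \<sigma> z)"
    "- starQ (X a) z $ k = 2 * Im (dz (X c) (\<sigma> z) $ k * pd 1 \<sigma> z)" by blast+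
qed

text \<open>With \<open>Y\<close> conjugate to \<open>X\<close>, the function X + iY has a complex
  derivative in the isothermal coordinate, namely twice \<open>dz (X c) z\<close>. So it is
  holomorphic, and so is its derivative.\<close>

lemma \<phi>_holomorphic_coord:
  assumes c: "c \<in> Iso"
  shows "(\<lambda>z. dz (X c) z $ k) holomorphic_on img c"
proof -
  have "\<exists>f'. ((\<lambda>z. dz (X c) z $ k) has_field_derivative f') (at z0)" if z0: "z0 \<in> img c" for z0
  proof -
    obtain p where p: "p \<in> fst c" "z0 = snd c p" using z0 by auto
    obtain a where a: "a \<in> \<A>" "p \<in> fst a" using A_cover is_chartD(4)[OF Iso_chart[OF c]] p by blast
    have "snd a p \<in> img a" using a by simp
    then obtain r Y where r: "r > 0" "ball (snd a p) r \<subseteq> img a"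
      and Y: "\<And>z. z \<in> ball (snd a p) r \<Longrightarrow> (Y has_derivative (\<lambda>h. Re h *\<^sub>R (- starQ (X a) z) + Im h *\<^sub>R starP (X a) z)) (at z)"
      using regular_patch.conjugate_exists[OF patch[OF a(1)] minimal[OF a(1)]] by blast
    define \<tau> where "\<tau> = change c a"
    define \<sigma> where "\<sigma> = change a c"
    define M where "M = snd c ` (fst c \<inter> fst a)"
    have oM: "open M" unfolding M_def by (rule overlap_open[OF Iso_chart[OF c] A_chart[OF a(1)]])
    have s\<tau>: "smooth_on \<tau> M" unfolding \<tau>_def M_def by (rule oriented_transitionD(1)[OF Iso_trans(1)[OF c a(1)]])
    have s\<sigma>: "smooth_on \<sigma> (snd a ` (fst a \<inter> fst c))" unfolding \<sigma>_def by (rule oriented_transitionD(1)[OF Iso_trans(2)[OF c a(1)]])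
    define N where "N = M \<inter> \<tau> -` ball (snd a p) r"
    have oN: "open N" unfolding N_def by (rule continuous_open_preimage[OF smooth_onD(3)[OF s\<tau>] oM open_ball])
    have z0M: "z0 \<in> M" using p a by (auto simp: M_def)
    have "\<tau> z0 = snd a p" using p inv_into_f_f[OF is_chartD(3)[OF Iso_chart[OF c]] p(1)] by (simp add: \<tau>_def)
    then have z0N: "z0 \<in> N" using z0M r(1) by (simp add: N_def)
    have \<sigma>\<tau>: "\<sigma> (\<tau> z) = z" if "z \<in> M" for z
      using transition_apply[OF Iso_chart[OF c] that[unfolded M_def]] inv_into_f_f[OF is_chartD(3)[OF A_chart[OF a(1)]]]
      by (simp add: \<sigma>_def \<tau>_def)
    define F where "F w = of_real (X a w $ k) + \<i> * of_real (Y w $ k)" for w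
    have F': "((\<lambda>z. F (\<tau> z)) has_field_derivative 2 * dz (X c) z $ k) (at z)" if z: "z \<in> N" for z
    proof -
      have zM: "z \<in> M" and tb: "\<tau> z \<in> ball (snd a p) r" using z by (auto simp: N_def)
      have tz: "\<tau> z \<in> snd a ` (fst a \<inter> fst c)" using transition_apply(3)[OF Iso_chart[OF c]] zM unfolding \<tau>_def M_def by blast
      have tU: "\<tau> z \<in> img a" using tz by auto
      note AI = A_to_Iso[OF a(1) c tz, folded \<sigma>_def, unfolded \<sigma>\<tau>[OF zM]]
      have dX: "((\<lambda>w. X a w $ k) has_derivative (\<lambda>h. (Re h *\<^sub>R pd 1 (X a) (\<tau> z) + Im h *\<^sub>R pd 2 (X a) (\<tau> z)) $ k)) (at (\<tau> z))"
        by (rule bounded_linear.has_derivative[OF bounded_linear_vec_nth has_derivative_pd[OF smooth_onD(1)[OF X_smooth[OF a(1)] tU]]])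
      have dY: "((\<lambda>w. Y w $ k) has_derivative (\<lambda>h. (Re h *\<^sub>R (- starQ (X a) (\<tau> z)) + Im h *\<^sub>R starP (X a) (\<tau> z)) $ k)) (at (\<tau> z))"
        by (rule bounded_linear.has_derivative[OF bounded_linear_vec_nth Y[OF tb]])
      have "(F has_derivative (\<lambda>h. of_real ((Re h *\<^sub>R pd 1 (X a) (\<tau> z) + Im h *\<^sub>R pd 2 (X a) (\<tau> z)) $ k)
          + \<i> * of_real ((Re h *\<^sub>R (- starQ (X a) (\<tau> z)) + Im h *\<^sub>R starP (X a) (\<tau> z)) $ k))) (at (\<tau> z))"
        unfolding F_def[abs_def]
        by (intro has_derivative_add has_derivative_mult_right bounded_linear.has_derivative[OF bounded_linear_of_real] dX dY)
      moreover have "of_real ((Re h *\<^sub>R pd 1 (X a) (\<tau> z) + Im h *\<^sub>R pd 2 (X a) (\<tau> z)) $ k)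
          + \<i> * of_real ((Re h *\<^sub>R (- starQ (X a) (\<tau> z)) + Im h *\<^sub>R starP (X a) (\<tau> z)) $ k)
          = 2 * dz (X c) z $ k * (Re h *\<^sub>R pd 1 \<sigma> (\<tau> z) + Im h *\<^sub>R pd 2 \<sigma> (\<tau> z))" for h
        by (simp only: vector_add_component vector_scaleR_component vector_uminus_component AI(5-7))
           (simp add: complex_eq_iff algebra_simps)
      ultimately have dF: "(F has_derivative (\<lambda>h. 2 * dz (X c) z $ k * (Re h *\<^sub>R pd 1 \<sigma> (\<tau> z) + Im h *\<^sub>R pd 2 \<sigma> (\<tau> z)))) (at (\<tau> z))"
        by simp
      have d\<tau>: "(\<tau> has_derivative (\<lambda>h. Re h *\<^sub>R pd 1 \<tau> z + Im h *\<^sub>R pd 2 \<tau> z)) (at z)"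
        by (rule has_derivative_pd[OF smooth_onD(1)[OF s\<tau> zM]])
      let ?D = "\<lambda>h. Re h *\<^sub>R pd 1 \<tau> z + Im h *\<^sub>R pd 2 \<tau> z"
      have "((\<lambda>z. \<sigma> (\<tau> z)) has_derivative (\<lambda>h. Re (?D h) *\<^sub>R pd 1 \<sigma> (\<tau> z) + Im (?D h) *\<^sub>R pd 2 \<sigma> (\<tau> z))) (at z)"
        by (rule has_derivative_pd_compose[OF smooth_onD(1)[OF s\<sigma> tz] d\<tau>])
      moreover have "((\<lambda>z. \<sigma> (\<tau> z)) has_derivative (\<lambda>h. h)) (at z)"
        by (rule has_derivative_transform_within_open[OF has_derivative_ident oM zM]) (simp add: \<sigma>\<tau>)
      \<comment> \<open>The differential of \<sigma> undoes that of \<tau>; inserted into the real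
        differential of \<open>F\<close> this leaves multiplication by one complex number.\<close>
      ultimately have id: "(\<lambda>h. Re (?D h) *\<^sub>R pd 1 \<sigma> (\<tau> z) + Im (?D h) *\<^sub>R pd 2 \<sigma> (\<tau> z)) = (\<lambda>h. h)"
        by (rule has_derivative_unique)
      have "((\<lambda>z. F (\<tau> z)) has_derivative (\<lambda>h. 2 * dz (X c) z $ k * (Re (?D h) *\<^sub>R pd 1 \<sigma> (\<tau> z) + Im (?D h) *\<^sub>R pd 2 \<sigma> (\<tau> z)))) (at z)"
        by (rule has_derivative_compose[OF d\<tau> dF])
      then have "((\<lambda>z. F (\<tau> z)) has_derivative (\<lambda>h. 2 * dz (X c) z $ k * h)) (at z)"
        unfolding fun_cong[OF id] .
      then show ?thesis by (simp add: has_field_derivative_def)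
    qed
    then have hol: "(\<lambda>z. F (\<tau> z)) holomorphic_on N" using holomorphic_on_open[OF oN] by blast
    have "(\<lambda>z. deriv (\<lambda>z. F (\<tau> z)) z / 2) holomorphic_on N"
      by (intro holomorphic_intros holomorphic_deriv[OF hol oN]) auto
    then obtain f' where "((\<lambda>z. deriv (\<lambda>z. F (\<tau> z)) z / 2) has_field_derivative f') (at z0)"
      using holomorphic_on_open[OF oN] z0N by blast
    then have "((\<lambda>z. dz (X c) z $ k) has_field_derivative f') (at z0)"
      by (rule has_field_derivative_transform_within_open[OF _ oN z0N]) (simp add: DERIV_imp_deriv[OF F'])
    then show ?thesis by blast
  qed
  then show ?thesis using holomorphic_on_open[OF is_chartD(2)[OF Iso_chart[OF c]]] by blast
qed

lemma Iso_E_pos: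
  assumes "c \<in> Iso" "p \<in> fst c" shows "gE (X c) (snd c p) > 0"
proof -
  obtain a where a: "a \<in> \<A>" "p \<in> fst a" using A_cover is_chartD(4)[OF Iso_chart[OF assms(1)]] assms(2) by blast
  then have "snd a p \<in> snd a ` (fst a \<inter> fst c)" using assms by auto
  from A_to_Iso(1)[OF a(1) assms(1) this] show ?thesis
    using inv_into_f_f[OF is_chartD(3)[OF A_chart[OF a(1)]] a(2)] by simp
qed

text \<open>Compatibility is postulated with the atlas only, so the transition is factored through
  an atlas chart to be differentiable and orientation preserving. Both metrics being conformal, the
  Cauchy-Riemann equations hold, and \<phi> transforms like the coefficient of a 1-form.\<close>

lemma Iso_transition:
  assumes c: "c \<in> Iso" "c' \<in> Iso" and p: "p \<in> fst c" "p \<in> fst c'"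
  obtains d where "d \<noteq> 0" "(change c c' has_field_derivative d) (at (snd c p))" "\<phi> c p = d *s \<phi> c' p"
proof -
  obtain a where a: "a \<in> \<A>" "p \<in> fst a" using A_cover is_chartD(4)[OF Iso_chart[OF c(1)]] p by blast
  note ch = Iso_chart[OF c(1)] Iso_chart[OF c(2)] A_chart[OF a(1)]
  define \<rho> where "\<rho> = change c c'"
  define \<tau> where "\<tau> = change c a"
  define \<sigma> where "\<sigma> = change a c'"
  define z where "z = snd c p"
  have V3: "openin T (fst c \<inter> fst c' \<inter> fst a)" using is_chartD(1)[OF ch(1)] is_chartD(1)[OF ch(2)] is_chartD(1)[OF ch(3)] by (intro openin_Int)
  define N where "N = snd c ` (fst c \<inter> fst c' \<inter> fst a)"
  have oN: "open N" unfolding N_def by (rule is_chartD(5)[OF ch(1) V3]) auto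
  have zN: "z \<in> N" using p a by (auto simp: N_def z_def)
  have inv: "chart_inv c w \<in> fst c \<inter> fst c' \<inter> fst a" if "w \<in> N" for w
    using that inv_into_f_f[OF is_chartD(3)[OF ch(1)]] by (auto simp: N_def)
  have invz: "chart_inv c z = p" using inv_into_f_f[OF is_chartD(3)[OF ch(1)] p(1)] by (simp add: z_def)
  have eq: "\<rho> w = \<sigma> (\<tau> w)" if "w \<in> N" for w
    using inv[OF that] inv_into_f_f[OF is_chartD(3)[OF ch(3)]] by (simp add: \<rho>_def \<sigma>_def \<tau>_def)
  have z1: "z \<in> snd c ` (fst c \<inter> fst a)" and z2: "\<tau> z \<in> snd a ` (fst a \<inter> fst c')" and z3: "\<rho> z = snd c' p"
    using p a invz by (auto simp: z_def \<tau>_def \<rho>_def)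
  have d\<tau>: "\<tau> differentiable (at z)" "jacobian \<tau> z > 0"
    using smooth_onD(1)[OF oriented_transitionD(1)[OF Iso_trans(1)[OF c(1) a(1)]] z1]
      oriented_transitionD(2)[OF Iso_trans(1)[OF c(1) a(1)] z1] by (simp_all add: \<tau>_def)
  have d\<sigma>: "\<sigma> differentiable (at (\<tau> z))" "jacobian \<sigma> (\<tau> z) > 0"
    using smooth_onD(1)[OF oriented_transitionD(1)[OF Iso_trans(2)[OF c(2) a(1)]] z2]
      oriented_transitionD(2)[OF Iso_trans(2)[OF c(2) a(1)] z2] by (simp_all add: \<sigma>_def)
  have "(\<lambda>z. \<sigma> (\<tau> z)) differentiable (at z)"
    using has_derivative_pd_compose[OF d\<sigma>(1) has_derivative_pd[OF d\<tau>(1)]] unfolding differentiable_def by blast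
  then have d\<rho>: "\<rho> differentiable (at z)" by (rule differentiable_cong_open[OF oN zN, rotated]) (simp add: eq)
  have "jacobian \<rho> z = jacobian (\<lambda>z. \<sigma> (\<tau> z)) z" by (rule jacobian_cong[OF oN zN eq])
  then have J: "jacobian \<rho> z > 0" using jacobian_compose[OF d\<sigma>(1) d\<tau>(1)] d\<sigma>(2) d\<tau>(2) by simp
  have pX: "snd c' p \<in> img c'" "z \<in> img c" using p by (auto simp: z_def)
  have oM: "open (snd c ` (fst c \<inter> fst c'))" by (rule overlap_open[OF ch(1,2)])
  have zM: "z \<in> snd c ` (fst c \<inter> fst c')" using p by (auto simp: z_def)
  have pdX: "pd i (X c) z = Re (pd i \<rho> z) *\<^sub>R pd 1 (X c') (snd c' p) + Im (pd i \<rho> z) *\<^sub>R pd 2 (X c') (snd c' p)" for i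
  proof -
    have "pd i (X c) z = pd i (\<lambda>z. X c' (\<rho> z)) z"
      by (rule pd_cong[OF oM zM]) (simp add: \<rho>_def X_transition[OF ch(1,2)] del: o_apply)
    also have "\<dots> = Re (pd i \<rho> z) *\<^sub>R pd 1 (X c') (\<rho> z) + Im (pd i \<rho> z) *\<^sub>R pd 2 (X c') (\<rho> z)"
      by (rule pd_compose[OF _ d\<rho>]) (use smooth_onD(1)[OF Iso_X_smooth[OF c(2)] pX(1)] z3 in simp)
    finally show ?thesis by (simp add: z3)
  qed
  note fp = form_pullback[of "X c'" "snd c' p" "X c" z "\<lambda>i. pd i \<rho> z", OF Iso_form[OF c(2) pX(1)] pdX]
  have l: "gE (X c') (snd c' p) > 0" by (rule Iso_E_pos[OF c(2) p(2)])
  have "(norm (pd 1 \<rho> z))\<^sup>2 = (norm (pd 2 \<rho> z))\<^sup>2" "Re (pd 1 \<rho> z * cnj (pd 2 \<rho> z)) = 0"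
    using Iso_form[OF c(1) pX(2)] l unfolding fp(1-3) by auto
  then have rot: "pd 2 \<rho> z = \<i> * pd 1 \<rho> z" "pd 1 \<rho> z \<noteq> 0"
    using orthogonal_rotation[of "pd 1 \<rho> z" "pd 2 \<rho> z"] J[unfolded jacobian_eq] power2_eq_imp_eq[of "norm (pd 1 \<rho> z)" "norm (pd 2 \<rho> z)"] by auto
  have "(\<lambda>h. Re h *\<^sub>R pd 1 \<rho> z + Im h *\<^sub>R pd 2 \<rho> z) = (*) (pd 1 \<rho> z)"
    unfolding rot(1) by (auto simp: fun_eq_iff complex_eq_iff algebra_simps)
  then have der: "(\<rho> has_field_derivative pd 1 \<rho> z) (at z)"
    using has_derivative_pd[OF d\<rho>] by (simp add: has_field_derivative_def)
  have "\<phi> c p = pd 1 \<rho> z *s \<phi> c' p"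
    unfolding vec_eq_iff
  proof
    fix k
    have "Re (\<phi> c p $ k) = pd 1 (X c) z $ k / 2" "Im (\<phi> c p $ k) = - pd 2 (X c) z $ k / 2"
      by (simp_all add: \<phi>_def z_def pd_X_dz)
    then show "\<phi> c p $ k = (pd 1 \<rho> z *s \<phi> c' p) $ k"
      unfolding fp(4) rot(1) \<phi>_def by (simp add: complex_eq_iff algebra_simps)
  qed
  then show ?thesis using that[OF rot(2)] der by (simp add: \<rho>_def z_def)
qed

lemma \<phi>_null: 
  assumes "c \<in> Iso" "p \<in> fst c"
  shows "cmink (\<phi> c p) (\<phi> c p) = 0" "herm (\<phi> c p) = gE (X c) (snd c p) / 2" "herm (\<phi> c p) > 0"
proof -
  have z: "snd c p \<in> img c" using assms by simp
  note f = Iso_form[OF assms(1) z]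
  show "cmink (\<phi> c p) (\<phi> c p) = 0"
    using f unfolding gE_def gF_def gG_def mink_def
    by (simp add: cmink_def \<phi>_def dz_def complex_eq_iff field_simps)
  show h: "herm (\<phi> c p) = gE (X c) (snd c p) / 2"
  proof -
    have ri: "Re (\<phi> c p $ k) = pd 1 (X c) (snd c p) $ k / 2" "Im (\<phi> c p $ k) = - pd 2 (X c) (snd c p) $ k / 2" for k
      by (simp_all add: \<phi>_def pd_X_dz)
    show ?thesis
      using f unfolding gE_def gF_def gG_def mink_def
      by (simp only: herm_def cmod_power2 ri) (simp add: field_simps power2_eq_square)
  qed
  then show "herm (\<phi> c p) > 0" using Iso_E_pos[OF assms] by simp
qed

lemma metric_norm_Iso:
  assumes "c \<in> Iso" "p \<in> fst c"
  shows "metric_norm (X c) (snd c p) h = sqrt (2 * herm (\<phi> c p)) * norm h"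
proof -
  have z: "snd c p \<in> img c" using assms by simp
  note f = Iso_form[OF assms(1) z]
  have "mink (Re h *\<^sub>R pd 1 (X c) (snd c p) + Im h *\<^sub>R pd 2 (X c) (snd c p)) (Re h *\<^sub>R pd 1 (X c) (snd c p) + Im h *\<^sub>R pd 2 (X c) (snd c p))
     = gE (X c) (snd c p) * (norm h)\<^sup>2"
    using f unfolding gE_def gF_def gG_def cmod_power2
    by (simp add: mink_add_left mink_add_right mink_scaleR_left mink_scaleR_right
        mink_commute[of "pd 2 (X c) (snd c p)" "pd 1 (X c) (snd c p)"] power2_eq_square algebra_simps)
  then show ?thesis unfolding metric_norm_def \<phi>_null(2)[OF assms] by (simp add: real_sqrt_mult)
qed

end

section \<open>Existence of isothermal charts\<close>

context stationary begin

text \<open>As dY is the Hodge star of dX, every component of X + iY is conformal where its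
  differential is nonzero. A component whose differential does not vanish at the given point becomes
  a chart by the inverse function theorem.\<close>

lemma Iso_cover:
  assumes p: "p \<in> topspace T"
  shows "\<exists>c\<in>Iso. p \<in> fst c"
proof -
  obtain a where a: "a \<in> \<A>" "p \<in> fst a" using A_cover p by blast
  note C = is_chartD[OF A_chart[OF a(1)]]
  interpret rp: regular_patch "X a" "img a" by (rule patch[OF a(1)])
  define z0 where "z0 = snd a p"
  have z0: "z0 \<in> img a" using a by (simp add: z0_def)
  obtain r Y where r: "r > 0" "ball z0 r \<subseteq> img a"
    and Y: "\<And>z. z \<in> ball z0 r \<Longrightarrow> (Y has_derivative (\<lambda>h. Re h *\<^sub>R (- starQ (X a) z) + Im h *\<^sub>R starP (X a) z)) (at z)"
    using rp.conjugate_exists[OF minimal[OF a(1)] z0] by blast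
  have "pd 1 (X a) z0 \<noteq> 0" using rp.E_pos[OF z0] by (auto simp: gE_def mink_zero)
  then obtain k where k: "pd 1 (X a) z0 $ k \<noteq> 0" by (auto simp: vec_eq_iff)
  define \<sigma> where "\<sigma> z = of_real (X a z $ k) + \<i> * of_real (Y z $ k)" for z
  have inS: "z \<in> img a" if "z \<in> ball z0 r" for z using that r(2) by blast
  have d\<sigma>: "(\<sigma> has_derivative (\<lambda>h. of_real ((Re h *\<^sub>R pd 1 (X a) z + Im h *\<^sub>R pd 2 (X a) z) $ k)
          + \<i> * of_real ((Re h *\<^sub>R (- starQ (X a) z) + Im h *\<^sub>R starP (X a) z) $ k))) (at z)" if z: "z \<in> ball z0 r" for z
    unfolding \<sigma>_def[abs_def]
    by (intro has_derivative_add has_derivative_mult_right bounded_linear.has_derivative[OF bounded_linear_of_real]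
        bounded_linear.has_derivative[OF bounded_linear_vec_nth] Y[OF z] has_derivative_pd[OF smooth_onD(1)[OF X_smooth[OF a(1)] inS[OF z]]])
  have pd1: "pd 1 \<sigma> z = of_real (pd 1 (X a) z $ k) + \<i> * of_real (- starQ (X a) z $ k)"
    and pd2: "pd 2 \<sigma> z = of_real (pd 2 (X a) z $ k) + \<i> * of_real (starP (X a) z $ k)" if "z \<in> ball z0 r" for z
    using pd_eq[OF d\<sigma>[OF that], of 1] pd_eq[OF d\<sigma>[OF that], of 2] by simp_all
  have smk: "smooth_on (\<lambda>z. (of_real (f z $ k) :: complex)) (ball z0 r)" if "smooth_on f (img a)" for f :: "complex \<Rightarrow> real^4"
    using smooth_on_subset[OF that r(2)]
    by (intro smooth_on_linear[OF open_ball bounded_linear_of_real] smooth_on_linear[OF open_ball bounded_linear_vec_nth])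
  have sm\<sigma>: "smooth_on \<sigma> (ball z0 r)"
  proof (rule smooth_onI[OF open_ball])
    show "\<sigma> differentiable (at z)" if "z \<in> ball z0 r" for z using d\<sigma>[OF that] unfolding differentiable_def by blast
    have m: "smooth_on (\<lambda>z. - starQ (X a) z) (img a)"
      by (rule smooth_on_linear[OF C(2) bounded_linear_minus[OF bounded_linear_ident] rp.smooth_Q])
    have "smooth_on (\<lambda>z. of_real (pd 1 (X a) z $ k) + \<i> * of_real ((- starQ (X a) z) $ k)) (ball z0 r)"
      by (intro smooth_on_add[OF open_ball] smooth_on_linear[OF open_ball bounded_linear_mult_right] smk m smooth_onD(2)[OF X_smooth[OF a(1)]])
    then have 1: "smooth_on (pd 1 \<sigma>) (ball z0 r)" by (rule smooth_on_cong[OF open_ball, rotated]) (simp add: pd1)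
    have "smooth_on (\<lambda>z. of_real (pd 2 (X a) z $ k) + \<i> * of_real (starP (X a) z $ k)) (ball z0 r)"
      by (intro smooth_on_add[OF open_ball] smooth_on_linear[OF open_ball bounded_linear_mult_right] smk rp.smooth_P smooth_onD(2)[OF X_smooth[OF a(1)]])
    then have 2: "smooth_on (pd 2 \<sigma>) (ball z0 r)" by (rule smooth_on_cong[OF open_ball, rotated]) (simp add: pd2)
    show "smooth_on (pd i \<sigma>) (ball z0 r)" for i using 1 2 two_cases[of i] by auto
  qed
  \<comment> \<open>The metric is W/J times the pull-back of the Euclidean metric by \<sigma>, with
    W the area density and J the Jacobian. Division by J is avoided because J > 0 is itself derived
    from the first identity, at \<open>z0\<close>.\<close>
  have ids: "gE (X a) z * jacobian \<sigma> z = gW (X a) z * (norm (pd 1 \<sigma> z))\<^sup>2"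
    "gF (X a) z * jacobian \<sigma> z = gW (X a) z * Re (pd 1 \<sigma> z * cnj (pd 2 \<sigma> z))"
    "gG (X a) z * jacobian \<sigma> z = gW (X a) z * (norm (pd 2 \<sigma> z))\<^sup>2" if z: "z \<in> ball z0 r" for z
  proof -
    define u v E F G W where "u = pd 1 (X a) z $ k" and "v = pd 2 (X a) z $ k" and "E = gE (X a) z"
      and "F = gF (X a) z" and "G = gG (X a) z" and "W = gW (X a) z"
    have W: "W > 0" "W * W = E * G - F * F"
      using rp.W_pos[OF inS[OF z]] rp.W_sq[OF inS[OF z]] by (simp_all add: E_def F_def G_def W_def power2_eq_square)
    define P where "P = starP (X a) z $ k"
    define Q where "Q = starQ (X a) z $ k"
    have WP: "W * P = G * u - F * v" and WQ: "W * Q = E * v - F * u"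
      using W(1) by (simp_all add: P_def Q_def starP_def starQ_def u_def v_def E_def F_def G_def W_def field_simps)
    have J: "jacobian \<sigma> z = u * P + v * Q"
      by (simp add: jacobian_def pd1[OF z] pd2[OF z] u_def v_def P_def Q_def)
    have n: "(norm (pd 1 \<sigma> z))\<^sup>2 = u * u + Q * Q" "Re (pd 1 \<sigma> z * cnj (pd 2 \<sigma> z)) = u * v - Q * P" "(norm (pd 2 \<sigma> z))\<^sup>2 = v * v + P * P"
      unfolding cmod_power2 by (simp_all add: pd1[OF z] pd2[OF z] u_def v_def P_def Q_def power2_eq_square)
    have WJ: "W * (u * P + v * Q) = G * u * u - 2 * F * u * v + E * v * v"
    proof -
      have "W * (u * P + v * Q) = u * (W * P) + v * (W * Q)" by (simp add: algebra_simps)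
      then show ?thesis unfolding WP WQ by (simp add: algebra_simps)
    qed
    have "W * (E * (u * P + v * Q)) = W * (W * (u * u + Q * Q))"
    proof -
      have "W * (W * (u * u + Q * Q)) = (W * W) * (u * u) + (W * Q) * (W * Q)" by (simp add: algebra_simps)
      also have "\<dots> = E * (G * u * u - 2 * F * u * v + E * v * v)" unfolding W(2) WQ by (simp add: algebra_simps)
      finally show ?thesis unfolding WJ[symmetric] by (simp add: algebra_simps)
    qed
    then show "gE (X a) z * jacobian \<sigma> z = gW (X a) z * (norm (pd 1 \<sigma> z))\<^sup>2"
      unfolding J n E_def[symmetric] W_def[symmetric] using W(1) by simp
    have "W * (F * (u * P + v * Q)) = W * (W * (u * v - Q * P))"
    proof -
      have "W * (W * (u * v - Q * P)) = (W * W) * (u * v) - (W * Q) * (W * P)" by (simp add: algebra_simps)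
      also have "\<dots> = F * (G * u * u - 2 * F * u * v + E * v * v)" unfolding W(2) WQ WP by (simp add: algebra_simps)
      finally show ?thesis unfolding WJ[symmetric] by (simp add: algebra_simps)
    qed
    then show "gF (X a) z * jacobian \<sigma> z = gW (X a) z * Re (pd 1 \<sigma> z * cnj (pd 2 \<sigma> z))"
      unfolding J n F_def[symmetric] W_def[symmetric] using W(1) by simp
    have "W * (G * (u * P + v * Q)) = W * (W * (v * v + P * P))"
    proof -
      have "W * (W * (v * v + P * P)) = (W * W) * (v * v) + (W * P) * (W * P)" by (simp add: algebra_simps)
      also have "\<dots> = G * (G * u * u - 2 * F * u * v + E * v * v)" unfolding W(2) WP by (simp add: algebra_simps)
      finally show ?thesis unfolding WJ[symmetric] by (simp add: algebra_simps)
    qed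
    then show "gG (X a) z * jacobian \<sigma> z = gW (X a) z * (norm (pd 2 \<sigma> z))\<^sup>2"
      unfolding J n G_def[symmetric] W_def[symmetric] using W(1) by simp
  qed
  have contJ: "continuous_on (ball z0 r) (jacobian \<sigma>)"
    unfolding jacobian_def[abs_def] using smooth_onD(3)[OF smooth_onD(2)[OF sm\<sigma>]] by (intro continuous_intros)
  have J0: "jacobian \<sigma> z0 > 0"
  proof -
    have z: "z0 \<in> ball z0 r" using r by simp
    have "pd 1 \<sigma> z0 \<noteq> 0" using k by (simp add: pd1[OF z] complex_eq_iff)
    then have "0 < gW (X a) z0 * (norm (pd 1 \<sigma> z0))\<^sup>2" using rp.W_pos[OF z0] by simp
    then show ?thesis unfolding ids(1)[OF z, symmetric] using rp.E_pos[OF z0] zero_less_mult_pos by blast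
  qed
  define B where "B = ball z0 r \<inter> jacobian \<sigma> -` {0<..}"
  have oB: "open B" unfolding B_def by (rule continuous_open_preimage[OF contJ open_ball]) simp
  have z0B: "z0 \<in> B" using r J0 by (simp add: B_def)
  have Bb: "z \<in> ball z0 r" "jacobian \<sigma> z > 0" if "z \<in> B" for z using that by (auto simp: B_def)
  define f' where "f' z = complex_blinfun (pd 1 \<sigma> z) (pd 2 \<sigma> z)" for z
  have f'app: "blinfun_apply (f' z) h = Re h *\<^sub>R pd 1 \<sigma> z + Im h *\<^sub>R pd 2 \<sigma> z" for z h
    by (simp add: f'_def complex_blinfun_apply)
  define J where "J = jacobian \<sigma> z0"
  \<comment> \<open>The inverse of the differential of \<sigma> at \<open>z0\<close>, by Cramer's
    rule.\<close>
  define invf where "invf = complex_blinfun (Complex (Im (pd 2 \<sigma> z0) / J) (- Im (pd 1 \<sigma> z0) / J)) (Complex (- Re (pd 2 \<sigma> z0) / J) (Re (pd 1 \<sigma> z0) / J))"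
  have der: "(\<sigma> has_derivative blinfun_apply (f' z)) (at z)" if "z \<in> B" for z
    using has_derivative_pd[OF smooth_onD(1)[OF sm\<sigma> Bb(1)[OF that]]] by (simp add: f'app[abs_def])
  have contf': "continuous_on B f'"
    unfolding f'_def[abs_def]
    by (rule continuous_on_complex_blinfun; rule continuous_on_subset[OF smooth_onD(3)[OF smooth_onD(2)[OF sm\<sigma>]]]) (use Bb in auto)
  have invf: "invf o\<^sub>L f' z0 = id_blinfun"
  proof (rule blinfun_eqI)
    fix h
    have Jv: "J = Re (pd 1 \<sigma> z0) * Im (pd 2 \<sigma> z0) - Re (pd 2 \<sigma> z0) * Im (pd 1 \<sigma> z0)" "J \<noteq> 0"
      using J0 by (simp_all add: J_def jacobian_def)
    have "blinfun_apply invf (Re h *\<^sub>R pd 1 \<sigma> z0 + Im h *\<^sub>R pd 2 \<sigma> z0) = h"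
    proof (rule complex_eqI)
      have "Re (blinfun_apply invf (Re h *\<^sub>R pd 1 \<sigma> z0 + Im h *\<^sub>R pd 2 \<sigma> z0)) = Re h * (Re (pd 1 \<sigma> z0) * Im (pd 2 \<sigma> z0) - Re (pd 2 \<sigma> z0) * Im (pd 1 \<sigma> z0)) / J"
        unfolding invf_def complex_blinfun_apply using Jv(2) by (simp add: field_simps)
      then show "Re (blinfun_apply invf (Re h *\<^sub>R pd 1 \<sigma> z0 + Im h *\<^sub>R pd 2 \<sigma> z0)) = Re h"
        unfolding Jv(1)[symmetric] using Jv(2) by simp
      have "Im (blinfun_apply invf (Re h *\<^sub>R pd 1 \<sigma> z0 + Im h *\<^sub>R pd 2 \<sigma> z0)) = Im h * (Re (pd 1 \<sigma> z0) * Im (pd 2 \<sigma> z0) - Re (pd 2 \<sigma> z0) * Im (pd 1 \<sigma> z0)) / J"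
        unfolding invf_def complex_blinfun_apply using Jv(2) by (simp add: field_simps)
      then show "Im (blinfun_apply invf (Re h *\<^sub>R pd 1 \<sigma> z0 + Im h *\<^sub>R pd 2 \<sigma> z0)) = Im h"
        unfolding Jv(1)[symmetric] using Jv(2) by simp
    qed
    then show "blinfun_apply (invf o\<^sub>L f' z0) h = blinfun_apply id_blinfun h" by (simp add: f'app)
  qed
  obtain U' V g g' where U': "open U'" "U' \<subseteq> B" "z0 \<in> U'" and V: "open V" "\<sigma> z0 \<in> V"
    and hom: "homeomorphism U' V \<sigma> g" and dg: "\<And>y. y \<in> V \<Longrightarrow> (g has_derivative (g' y)) (at y)"
    using inverse_function_theorem[OF oB der contf' z0B invf] by metis
  have gU: "g y \<in> U'" "\<sigma> (g y) = y" if "y \<in> V" for y using hom that by (auto simp: homeomorphism_def)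
  have \<sigma>V: "\<sigma> z \<in> V" "g (\<sigma> z) = z" if "z \<in> U'" for z using hom that by (auto simp: homeomorphism_def)
  have gd: "g differentiable (at y)" if "y \<in> V" for y using dg[OF that] unfolding differentiable_def by blast
  have U'r: "U' \<subseteq> ball z0 r" using U'(2) by (auto simp: B_def)
  have sm\<sigma>': "smooth_on \<sigma> U'" by (rule smooth_on_subset[OF sm\<sigma> U'r])
  have JU: "jacobian \<sigma> z > 0" if "z \<in> U'" for z using that U'(2) Bb by blast
  have smg: "smooth_on g V"
    by (rule smooth_on_inverse_function[OF V(1) U'(1) _ sm\<sigma>' _ gd gU(2)]) (use gU JU in force)+
  define c where "c = ({q \<in> fst a. snd a q \<in> U'}, \<sigma> \<circ> snd a)"
  have c1: "fst c = {q \<in> fst a. snd a q \<in> U'}" and c2: "snd c q = \<sigma> (snd a q)" for q by (simp_all add: c_def)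
  have U'a: "U' \<subseteq> img a" using U'r r(2) by blast
  have openI: "open (\<sigma> ` O')" if "open O'" "O' \<subseteq> U'" for O'
  proof -
    have "\<sigma> ` O' = V \<inter> g -` O'" using \<sigma>V gU that(2) by force
    then show ?thesis using continuous_open_preimage[OF smooth_onD(3)[OF smg] V(1) that(1)] by simp
  qed
  have chart: "is_chart T c"
    unfolding c_def
  proof (rule is_chartI)
    show "openin T {q \<in> fst a. snd a q \<in> U'}" by (rule C(6)[OF U'(1)])
    show "inj_on (\<sigma> \<circ> snd a) {q \<in> fst a. snd a q \<in> U'}"
    proof (rule inj_onI)
      fix q q' assume q: "q \<in> {q \<in> fst a. snd a q \<in> U'}" "q' \<in> {q \<in> fst a. snd a q \<in> U'}" "(\<sigma> \<circ> snd a) q = (\<sigma> \<circ> snd a) q'"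
      have "snd a q = g (\<sigma> (snd a q))" by (rule \<sigma>V(2)[symmetric]) (use q in simp)
      also have "\<dots> = g (\<sigma> (snd a q'))" using q(3) by simp
      also have "\<dots> = snd a q'" by (rule \<sigma>V(2)) (use q in simp)
      finally have "snd a q = snd a q'" .
      then show "q = q'" using q C(3) by (auto dest: inj_onD)
    qed
    show "open ((\<sigma> \<circ> snd a) ` W)" if "openin T W" "W \<subseteq> {q \<in> fst a. snd a q \<in> U'}" for W
      unfolding image_comp[symmetric] by (rule openI, rule C(5)) (use that in auto)
    show "openin T {q \<in> {q \<in> fst a. snd a q \<in> U'}. (\<sigma> \<circ> snd a) q \<in> W}" if "open W" for W
    proof -
      have "open (U' \<inter> \<sigma> -` W)" by (rule continuous_open_preimage[OF smooth_onD(3)[OF sm\<sigma>'] U'(1) that])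
      from C(6)[OF this] show ?thesis by (rule back_subst[where P="openin T"]) auto
    qed
  qed
  have invc: "chart_inv c y = chart_inv a (g y)" "chart_inv a (g y) \<in> fst c" "snd a (chart_inv a (g y)) = g y" if y: "y \<in> V" for y
  proof -
    have gya: "g y \<in> img a" using gU(1)[OF y] U'a by blast
    show e: "snd a (chart_inv a (g y)) = g y" by (rule f_inv_into_f[OF gya])
    show i: "chart_inv a (g y) \<in> fst c" using inv_into_into[OF gya] e gU(1)[OF y] by (simp add: c1)
    show "chart_inv c y = chart_inv a (g y)"
      by (rule inv_into_f_eq[OF is_chartD(3)[OF chart] i]) (simp add: c2 e gU(2)[OF y])
  qed
  have rng: "img c \<subseteq> V" using \<sigma>V by (auto simp: c1 c2)
  have trans: "oriented_transition c a' \<and> oriented_transition a' c" if a': "a' \<in> \<A>" for a'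
  proof
    define t where "t = change a a'"
    define M where "M = snd a ` (fst a \<inter> fst a')"
    have st: "smooth_on t M" "\<And>z. z \<in> M \<Longrightarrow> jacobian t z > 0"
      unfolding t_def M_def using oriented_transitionD[OF A_transition[OF a(1) a']] by blast+
    let ?N = "snd c ` (fst c \<inter> fst a')"
    have oN: "open ?N" by (rule overlap_open[OF chart A_chart[OF a']])
    have NV: "?N \<subseteq> V" using rng by blast
    have gM: "g ` ?N \<subseteq> M"
    proof
      fix w assume "w \<in> g ` ?N"
      then obtain q where q: "q \<in> fst c" "q \<in> fst a'" "w = g (snd c q)" by auto
      then have "w = snd a q" using \<sigma>V(2) by (simp add: c1 c2)
      then show "w \<in> M" using q by (auto simp: M_def c1)
    qed
    have eq: "t (g y) = change c a' y" if "y \<in> ?N" for y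
      using that NV invc(1)[of y] by (auto simp: t_def)
    have "smooth_on (\<lambda>y. t (g y)) ?N"
      by (rule smooth_on_compose[OF oN gM st(1) smooth_on_subset[OF smg NV]])
    then have s1: "smooth_on (change c a') ?N" by (rule smooth_on_cong[OF oN, rotated]) (rule eq)
    have j1: "jacobian (change c a') y > 0" if y: "y \<in> ?N" for y
    proof -
      have yV: "y \<in> V" and gy: "g y \<in> M" using y NV gM by blast+
      have "jacobian (change c a') y = jacobian (\<lambda>y. t (g y)) y" by (rule jacobian_cong[OF oN y eq[symmetric]])
      also have "\<dots> = jacobian t (g y) * jacobian g y"
        by (rule jacobian_compose[OF smooth_onD(1)[OF st(1) gy] gd[OF yV]])
      finally show ?thesis
        using st(2)[OF gy] JU[OF gU(1)[OF yV]] inverse_pd(4)[OF V(1) yV gU(2) gd[OF yV] smooth_onD(1)[OF sm\<sigma>' gU(1)[OF yV]] refl]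
        by (metis mult_pos_pos zero_less_mult_pos zero_less_one)
    qed
    show "oriented_transition c a'" using s1 j1 by (auto simp: oriented_transition_def split: prod.splits)
    define t' where "t' = change a' a"
    let ?N' = "snd a' ` (fst a' \<inter> fst c)"
    have N'M: "?N' \<subseteq> snd a' ` (fst a' \<inter> fst a)" by (auto simp: c1)
    have st': "smooth_on t' ?N'" "\<And>z. z \<in> ?N' \<Longrightarrow> jacobian t' z > 0"
      using oriented_transitionD[OF A_transition[OF a' a(1)]] smooth_on_subset[OF _ N'M] N'M unfolding t'_def by blast+
    have oN': "open ?N'" by (rule overlap_open[OF A_chart[OF a'] chart])
    have tU: "t' ` ?N' \<subseteq> U'" using inv_into_f_f[OF is_chartD(3)[OF A_chart[OF a']]] by (auto simp: t'_def c1)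
    have eq': "\<sigma> (t' y) = change a' c y" for y by (simp add: t'_def c2)
    have "smooth_on (\<lambda>y. \<sigma> (t' y)) ?N'" by (rule smooth_on_compose[OF oN' tU sm\<sigma>' st'(1)])
    then have s2: "smooth_on (change a' c) ?N'" by (rule smooth_on_cong[OF oN', rotated]) (rule eq')
    have j2: "jacobian (change a' c) y > 0" if y: "y \<in> ?N'" for y
    proof -
      have ty: "t' y \<in> U'" using y tU by blast
      have "jacobian (change a' c) y = jacobian (\<lambda>y. \<sigma> (t' y)) y" by (rule jacobian_cong[OF oN' y eq'[symmetric]])
      also have "\<dots> = jacobian \<sigma> (t' y) * jacobian t' y"
        by (rule jacobian_compose[OF smooth_onD(1)[OF sm\<sigma>' ty] smooth_onD(1)[OF st'(1) y]])
      finally show ?thesis using st'(2)[OF y] JU[OF ty] by simp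
    qed
    show "oriented_transition a' c" using s2 j2 by (auto simp: oriented_transition_def split: prod.splits)
  qed
  have "first_form (X c) y $ 1 $ 1 = first_form (X c) y $ 2 $ 2 \<and> first_form (X c) y $ 1 $ 2 = 0" if y: "y \<in> img c" for y
  proof -
    have yV: "y \<in> V" using y rng by blast
    note gy = gU(1)[OF yV]
    have gya: "g y \<in> img a" and gyr: "g y \<in> ball z0 r" using gy U'a U'r by blast+
    have eq: "X c w = X a (g w)" if "w \<in> V" for w using invc(1)[OF that] by (simp add: in_chart_def)
    have pdX: "pd i (X c) y = Re (pd i g y) *\<^sub>R pd 1 (X a) (g y) + Im (pd i g y) *\<^sub>R pd 2 (X a) (g y)" for i
    proof -
      have "pd i (X c) y = pd i (\<lambda>w. X a (g w)) y" by (rule pd_cong[OF V(1) yV eq])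
      also have "\<dots> = Re (pd i g y) *\<^sub>R pd 1 (X a) (g y) + Im (pd i g y) *\<^sub>R pd 2 (X a) (g y)"
        by (rule pd_compose[OF smooth_onD(1)[OF X_smooth[OF a(1)] gya] gd[OF yV]])
      finally show ?thesis .
    qed
    define s1 s2 where "s1 = pd 1 \<sigma> (g y)" and "s2 = pd 2 \<sigma> (g y)"
    note id = ids[OF gyr, folded s1_def s2_def]
    \<comment> \<open>\<open>ids\<close> extended bilinearly to arbitrary tangent vectors. It is
      applied to the partials of \<open>g\<close>, which the differential of \<sigma> maps to 1 and
      \<open>\<i>\<close>.\<close>
    have bil: "jacobian \<sigma> (g y) * mink (\<alpha> *\<^sub>R pd 1 (X a) (g y) + \<beta> *\<^sub>R pd 2 (X a) (g y)) (\<gamma> *\<^sub>R pd 1 (X a) (g y) + \<delta> *\<^sub>R pd 2 (X a) (g y))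
        = gW (X a) (g y) * Re ((\<alpha> *\<^sub>R s1 + \<beta> *\<^sub>R s2) * cnj (\<gamma> *\<^sub>R s1 + \<delta> *\<^sub>R s2))" for \<alpha> \<beta> \<gamma> \<delta>
    proof -
      have "jacobian \<sigma> (g y) * mink (\<alpha> *\<^sub>R pd 1 (X a) (g y) + \<beta> *\<^sub>R pd 2 (X a) (g y)) (\<gamma> *\<^sub>R pd 1 (X a) (g y) + \<delta> *\<^sub>R pd 2 (X a) (g y))
        = \<alpha> * \<gamma> * (gE (X a) (g y) * jacobian \<sigma> (g y)) + (\<alpha> * \<delta> + \<beta> * \<gamma>) * (gF (X a) (g y) * jacobian \<sigma> (g y)) + \<beta> * \<delta> * (gG (X a) (g y) * jacobian \<sigma> (g y))"
        by (simp add: mink_add_left mink_add_right mink_scaleR_left mink_scaleR_right gE_def gF_def gG_def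
            mink_commute[of "pd 2 (X a) (g y)" "pd 1 (X a) (g y)"] algebra_simps)
      then show ?thesis unfolding id cmod_power2 by (simp add: power2_eq_square algebra_simps)
    qed
    have inv1: "Re (pd 1 g y) *\<^sub>R s1 + Im (pd 1 g y) *\<^sub>R s2 = 1" "Re (pd 2 g y) *\<^sub>R s1 + Im (pd 2 g y) *\<^sub>R s2 = \<i>"
      using inverse_pd(1)[OF V(1) yV gU(2) gd[OF yV] smooth_onD(1)[OF sm\<sigma>' gy] refl, of 1]
        inverse_pd(1)[OF V(1) yV gU(2) gd[OF yV] smooth_onD(1)[OF sm\<sigma>' gy] refl, of 2] by (simp_all add: s1_def s2_def)
    have "jacobian \<sigma> (g y) * mink (pd 1 (X c) y) (pd 1 (X c) y) = jacobian \<sigma> (g y) * mink (pd 2 (X c) y) (pd 2 (X c) y)"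
      "jacobian \<sigma> (g y) * mink (pd 1 (X c) y) (pd 2 (X c) y) = 0"
      unfolding pdX bil inv1 by simp_all
    then show ?thesis using JU[OF gy] by (simp add: first_form_def)
  qed
  then have "c \<in> Iso"
    using chart trans by (simp add: Iso_def isothermal_chart_def oriented_chart_def Let_def)
  moreover have "p \<in> fst c" using a U'(3) by (simp add: c1 z0_def)
  ultimately show ?thesis by blast
qed

sublocale riemann_surface T Iso
proof
  show "Hausdorff_space T" "connected_space T" by (rule T_hausdorff, rule T_connected)
  show "\<And>c. c \<in> Iso \<Longrightarrow> is_chart T c" by (rule Iso_chart)
  show "\<And>p. p \<in> topspace T \<Longrightarrow> \<exists>c\<in>Iso. p \<in> fst c" by (rule Iso_cover)
  show "\<And>c c' p. \<lbrakk>c \<in> Iso; c' \<in> Iso; p \<in> fst c; p \<in> fst c'\<rbrakk>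
      \<Longrightarrow> \<exists>d. d \<noteq> 0 \<and> (change c c' has_field_derivative d) (at (snd c p))"
    using Iso_transition by metis
qed

lemma gauss_map_eq:
  assumes "c \<in> Iso" "p \<in> fst c"
  shows "gauss_map T \<A> x p = proj_pt (\<phi> c p)"
  unfolding gauss_map_def
proof (rule the_equality)
  show "\<exists>c'. isothermal_chart T \<A> x c' \<and> p \<in> fst c' \<and> proj_pt (\<phi> c p) = proj_pt (dz (X c') (snd c' p))"
    by (rule exI[of _ c]) (use assms in \<open>simp add: Iso_def \<phi>_def\<close>)
  fix L assume "\<exists>c. isothermal_chart T \<A> x c \<and> p \<in> fst c \<and> L = proj_pt (dz (X c) (snd c p))"
  then obtain c' where c': "c' \<in> Iso" "p \<in> fst c'" "L = proj_pt (\<phi> c' p)" by (auto simp: Iso_def \<phi>_def)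
  obtain d where "d \<noteq> 0" "\<phi> c' p = d *s \<phi> c p" by (rule Iso_transition[OF c'(1) assms(1) c'(2) assms(2)])
  then show "L = proj_pt (\<phi> c p)" unfolding c'(3) proj_pt_eq_iff by blast
qed

end

subsection \<open>Fujimoto's argument\<close>

context riemann_surface begin

lemma locally_constant_imp_constant:
  assumes loc: "\<And>p. p \<in> topspace T \<Longrightarrow> \<exists>V. openin T V \<and> p \<in> V \<and> (\<forall>q\<in>V. f q = f p)"
    and p: "p \<in> topspace T" and q: "q \<in> topspace T"
  shows "f q = f p"
proof -
  have op: "openin T {s \<in> topspace T. P (f s)}" for P
    unfolding openin_subopen[of T "Collect _"]
  proof
    fix s assume s: "s \<in> {s \<in> topspace T. P (f s)}"
    then obtain V where V: "openin T V" "s \<in> V" "\<forall>q\<in>V. f q = f s" using loc by blast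
    have "V \<subseteq> {s \<in> topspace T. P (f s)}" using V(3) s openin_subset[OF V(1)] by auto
    then show "\<exists>W. openin T W \<and> s \<in> W \<and> W \<subseteq> {s \<in> topspace T. P (f s)}" using V by blast
  qed
  define E where "E = {s \<in> topspace T. f s = f p}"
  define F where "F = {s \<in> topspace T. f s \<noteq> f p}"
  have "openin T E" "openin T F" unfolding E_def F_def by (rule op)+
  moreover have "E \<union> F = topspace T" "E \<inter> F = {}" by (auto simp: E_def F_def)
  moreover have "E \<noteq> {}" using p by (auto simp: E_def)
  ultimately have "F = {}" using connected unfolding connected_space_eq by blast
  then show ?thesis using q by (auto simp: F_def)
qed

text \<open>The coefficient of the 1-form dg in the chart \<open>c\<close>.\<close>

definition cderiv :: "('a \<Rightarrow> complex) \<Rightarrow> 'a chart \<Rightarrow> 'a \<Rightarrow> complex" where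
  "cderiv g c p = deriv (\<lambda>z. g (chart_inv c z)) (snd c p)"

lemma cderiv_has_derivative:
  assumes "c \<in> Ch" "p \<in> fst c" "(\<lambda>z. g (chart_inv c z)) holomorphic_on img c"
  shows "((\<lambda>z. g (chart_inv c z)) has_field_derivative cderiv g c p) (at (snd c p))"
  unfolding cderiv_def using assms chart_open_range by (intro holomorphic_derivI) auto

lemma chart_inv_eventually:
  assumes "c \<in> Ch" "p \<in> fst c" "openin T V" "p \<in> V"
  shows "\<forall>\<^sub>F z in nhds (snd c p). chart_inv c z \<in> fst c \<inter> V \<and> snd c (chart_inv c z) = z"
proof -
  obtain r where r: "r > 0" "\<And>z. z \<in> ball (snd c p) r \<Longrightarrow> chart_inv c z \<in> fst c \<inter> V"
    using chart_nhd[OF assms] by metis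
  have 1: "\<forall>\<^sub>F z in nhds (snd c p). z \<in> ball (snd c p) r" using r(1) by (intro eventually_nhds_in_open) auto
  have 2: "\<forall>\<^sub>F z in nhds (snd c p). z \<in> img c"
    using chart_open_range[OF assms(1)] assms(2) by (intro eventually_nhds_in_open) auto
  show ?thesis
    using 1 2
  proof eventually_elim
    case (elim z)
    then show ?case using r(2)[OF elim(1)] chart_chart_inv[OF elim(2)] by auto
  qed
qed

lemma cderiv_transition:
  assumes c: "c \<in> Ch" "c' \<in> Ch" and p: "p \<in> fst c" "p \<in> fst c'"
    and hol: "\<And>c. c \<in> Ch \<Longrightarrow> (\<lambda>z. g (chart_inv c z)) holomorphic_on img c"
    and d: "(change c c' has_field_derivative d) (at (snd c p))"
  shows "cderiv g c p = cderiv g c' p * d"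
proof -
  have "((\<lambda>z. g (chart_inv c' z)) has_field_derivative cderiv g c' p) (at ((change c c') (snd c p)))"
    using cderiv_has_derivative[OF c(2) p(2) hol[OF c(2)]] chart_inv_chart[OF c(1) p(1)] by simp
  from DERIV_chain2[OF this d]
  have "((\<lambda>z. g (chart_inv c' (change c c' z))) has_field_derivative cderiv g c' p * d) (at (snd c p))" .
  moreover have "\<forall>\<^sub>F z in nhds (snd c p). g (chart_inv c' (change c c' z)) = g (chart_inv c z)"
    using chart_inv_eventually[OF c(1) p(1) chart_open[OF c(2)] p(2)]
    by eventually_elim (simp add: chart_inv_chart[OF c(2)])
  ultimately have "((\<lambda>z. g (chart_inv c z)) has_field_derivative cderiv g c' p * d) (at (snd c p))"
    by (rule has_field_derivative_cong_eventually)
  then show ?thesis unfolding cderiv_def by (rule DERIV_imp_deriv)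
qed

lemma cderiv_zero_imp_constant:
  assumes hol: "\<And>c. c \<in> Ch \<Longrightarrow> (\<lambda>z. g (chart_inv c z)) holomorphic_on img c"
    and zero: "\<And>c p. c \<in> Ch \<Longrightarrow> p \<in> fst c \<Longrightarrow> cderiv g c p = 0"
    and p: "p \<in> topspace T" and q: "q \<in> topspace T"
  shows "g q = g p"
proof (rule locally_constant_imp_constant[OF _ p q])
  fix p assume "p \<in> topspace T"
  then obtain c where c: "c \<in> Ch" "p \<in> fst c" using cover by blast
  obtain r where r: "r > 0" "\<And>z. z \<in> ball (snd c p) r \<Longrightarrow> chart_inv c z \<in> fst c \<inter> fst c"
    using chart_nhd[OF c chart_open[OF c(1)] c(2)] by metis
  have oU: "open (img c)" by (rule chart_open_range[OF c(1)])
  obtain r where r: "r > 0" "ball (snd c p) r \<subseteq> img c" using oU c(2) open_contains_ball by (metis imageI)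
  have "\<exists>k. \<forall>z\<in>ball (snd c p) r. g (chart_inv c z) = k"
  proof (rule has_field_derivative_zero_constant[OF convex_ball])
    fix z assume "z \<in> ball (snd c p) r"
    then have z: "z \<in> img c" using r by blast
    have "((\<lambda>z. g (chart_inv c z)) has_field_derivative 0) (at z)"
      using cderiv_has_derivative[OF c(1) chart_inv_in[OF z] hol[OF c(1)]] zero[OF c(1) chart_inv_in[OF z]] chart_chart_inv[OF z] by simp
    then show "((\<lambda>z. g (chart_inv c z)) has_field_derivative 0) (at z within ball (snd c p) r)"
      by (rule has_field_derivative_at_within)
  qed
  then obtain k where k: "\<And>z. z \<in> ball (snd c p) r \<Longrightarrow> g (chart_inv c z) = k" by blast
  have gk: "g q = k" if "q \<in> fst c" "snd c q \<in> ball (snd c p) r" for q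
    using k[OF that(2)] chart_inv_chart[OF c(1) that(1)] by simp
  show "\<exists>V. openin T V \<and> p \<in> V \<and> (\<forall>q\<in>V. g q = g p)"
  proof (intro exI conjI ballI)
    show "openin T {q \<in> fst c. snd c q \<in> ball (snd c p) r}" by (rule chart_open_vimage[OF c(1) open_ball])
    show "p \<in> {q \<in> fst c. snd c q \<in> ball (snd c p) r}" using c r by simp
    then have "g p = k" by (intro gk) auto
    then show "g q = g p" if "q \<in> {q \<in> fst c. snd c q \<in> ball (snd c p) r}" for q using gk[of q] that by simp
  qed
qed

end

context holomorphic_vector_field begin

lemma sol_compose_derivative:
  assumes sol: "sol \<Phi> \<Omega>" "w \<in> \<Omega>" and c: "c \<in> Ch" "\<Phi> w \<in> fst c"
    and hol: "(\<lambda>z. g (chart_inv c z)) holomorphic_on img c"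
  shows "((\<lambda>w. g (\<Phi> w)) has_field_derivative cderiv g c (\<Phi> w) * v c (\<Phi> w)) (at w)"
proof -
  have "((\<lambda>z. g (chart_inv c z)) has_field_derivative cderiv g c (\<Phi> w)) (at ((snd c \<circ> \<Phi>) w))"
    using cderiv_has_derivative[OF c hol] by simp
  from DERIV_chain2[OF this solD(3)[OF sol c]]
  have "((\<lambda>w. g (chart_inv c ((snd c \<circ> \<Phi>) w))) has_field_derivative cderiv g c (\<Phi> w) * v c (\<Phi> w)) (at w)" .
  moreover have "\<forall>\<^sub>F w in nhds w. g (chart_inv c ((snd c \<circ> \<Phi>) w)) = g (\<Phi> w)"
    using solD(2)[OF sol c] by eventually_elim (simp add: chart_inv_chart[OF c(1)])
  ultimately show ?thesis by (rule has_field_derivative_cong_eventually)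
qed

end

context stationary begin

lemma ray_regular:
  assumes vf: "holomorphic_vector_field T Iso v"
    and sol: "holomorphic_vector_field.sol T Iso v \<Phi> (ball 0 R)"
    and a: "norm a = R" and R: "R > 0" and t: "\<bar>t\<bar> < 1" and c: "c \<in> Iso" "\<Phi> (of_real t * a) \<in> fst c"
  shows "regular (\<lambda>t. \<Phi> (of_real t * a)) t"
    "speed x (\<lambda>t. \<Phi> (of_real t * a)) t = R * (sqrt (2 * herm (\<phi> c (\<Phi> (of_real t * a)))) * norm (v c (\<Phi> (of_real t * a))))"
proof -
  interpret holomorphic_vector_field T Iso v by (rule vf)
  define \<gamma> where "\<gamma> t = \<Phi> (of_real t * a)" for t :: real
  \<comment> \<open>Regularity is a two-sided condition, so the ray is followed for parameters in
    (-1, 1) in order to include t = 0.\<close>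
  have inB: "of_real t * a \<in> ball 0 R" if "t \<in> {-1<..<1}" for t using that a R by (simp add: norm_mult abs_if)
  have gc: "\<gamma> t \<in> fst c" using c by (simp add: \<gamma>_def)
  have lim: "filterlim (\<lambda>s. of_real s * a) (nhds (of_real t * a)) (nhds t)"
    by (intro tendsto_intros filterlim_ident)
  have tI: "t \<in> {-1<..<1}" using t by auto
  have ev: "\<forall>\<^sub>F s in nhds t. \<gamma> s \<in> fst c"
    using eventually_compose_filterlim[OF solD(2)[OF sol inB[OF tI] c] lim] by (simp add: \<gamma>_def)
  have ev2: "\<forall>\<^sub>F s in nhds t. s \<in> {-1<..<1}" by (rule eventually_nhds_in_open[OF open_greaterThanLessThan tI])
  have der: "(snd c \<circ> \<gamma> has_vector_derivative a * v c (\<gamma> s)) (at s)" if "s \<in> {-1<..<1}" "\<gamma> s \<in> fst c" for s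
  proof -
    have "(snd c \<circ> \<Phi> has_field_derivative v c (\<Phi> (of_real s * a))) (at (of_real s * a))"
      using solD(3)[OF sol inB[OF that(1)] c(1)] that(2) by (simp add: \<gamma>_def)
    moreover have "((\<lambda>t. of_real t * a) has_vector_derivative a) (at s)"
      by (auto intro!: derivative_eq_intros)
    ultimately have "(snd c \<circ> \<Phi> \<circ> (\<lambda>t. of_real t * a) has_vector_derivative a * v c (\<Phi> (of_real s * a))) (at s)"
      by (intro field_vector_diff_chain_at)
    then show ?thesis by (simp add: \<gamma>_def[abs_def] o_def)
  qed
  have dt: "(snd c \<circ> \<gamma> has_vector_derivative a * v c (\<gamma> t)) (at t)" by (rule der[OF tI gc])
  have "regular \<gamma> t"
  proof (rule regular_one_chart[OF Iso_chart[OF c(1)] oriented_transitionD(1)[OF Iso_trans(1)[OF c(1)]] gc ev])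
    show "\<forall>\<^sub>F s in nhds t. (snd c \<circ> \<gamma>) differentiable (at s)"
      using ev ev2 by eventually_elim (rule differentiableI_vector[OF der])
    have "isCont (\<lambda>z. v c (chart_inv c z)) (snd c (\<gamma> t))"
      using holomorphic_on_imp_continuous_on[OF v_holomorphic[OF c(1)]] chart_open_range[OF c(1)] gc
      by (simp add: continuous_on_eq_continuous_at)
    moreover have "isCont (\<lambda>s. snd c (\<gamma> s)) t" using has_vector_derivative_continuous[OF dt] by (simp add: o_def)
    ultimately have "isCont (\<lambda>s. a * v c (chart_inv c (snd c (\<gamma> s)))) t"
      using isCont_o2[of t "\<lambda>s. snd c (\<gamma> s)" "\<lambda>z. v c (chart_inv c z)"] by (intro continuous_intros) auto
    moreover have "\<forall>\<^sub>F s in nhds t. a * v c (chart_inv c (snd c (\<gamma> s))) = vector_derivative (snd c \<circ> \<gamma>) (at s)"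
      using ev ev2
    proof eventually_elim
      case (elim s)
      then show ?case using vector_derivative_at[OF der[OF elim(2,1)]] chart_inv_chart[OF c(1) elim(1)] by simp
    qed
    ultimately show "isCont (\<lambda>s. vector_derivative (snd c \<circ> \<gamma>) (at s)) t" by (rule isCont_cong_nhds)
  qed
  then show "regular (\<lambda>t. \<Phi> (of_real t * a)) t" by (simp add: \<gamma>_def[abs_def])
  have "speed x \<gamma> t = metric_norm (X c) (snd c (\<gamma> t)) (a * v c (\<gamma> t))"
    using speed_in_chart[OF Iso_chart[OF c(1)] gc _ ev dt] smooth_onD(1)[OF Iso_X_smooth[OF c(1)]] gc by blast
  then show "speed x (\<lambda>t. \<Phi> (of_real t * a)) t = R * (sqrt (2 * herm (\<phi> c (\<Phi> (of_real t * a)))) * norm (v c (\<Phi> (of_real t * a))))"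
    unfolding metric_norm_Iso[OF c(1) gc] norm_mult a by (simp add: \<gamma>_def[abs_def])
qed

text \<open>Since \<kappa> < 1, the bound on the speed has a convergent integral along each radius;
  by completeness the curve has a limit at every boundary point, which is the hypothesis of
  \<open>entire_sol\<close>.\<close>

theorem complete_imp_entire_sol:
  assumes complete: "complete_surface T \<A> x" and vf: "holomorphic_vector_field T Iso v"
    and p: "c0 \<in> Iso" "p \<in> fst c0" "v c0 p \<noteq> 0" and \<kappa>: "0 \<le> \<kappa>" "\<kappa> < 1"
    and bound: "\<And>R \<Phi>. R > 0 \<Longrightarrow> holomorphic_vector_field.sol T Iso v \<Phi> (ball 0 R) \<Longrightarrow> \<exists>C. \<forall>w\<in>ball 0 R. \<forall>c\<in>Iso.
      \<Phi> w \<in> fst c \<longrightarrow> sqrt (2 * herm (\<phi> c (\<Phi> w))) * norm (v c (\<Phi> w)) \<le> C * (R - norm w) powr (- \<kappa>)"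
  obtains \<Phi> where "holomorphic_vector_field.sol T Iso v \<Phi> UNIV" "\<Phi> 0 = p"
proof -
  interpret holomorphic_vector_field T Iso v by (rule vf)
  have pT: "p \<in> topspace T" using p is_chartD(4)[OF Iso_chart] by blast
  show ?thesis
  proof (rule entire_sol[OF pT p])
    fix R :: real and \<Phi> and a :: complex
    assume R: "R > 0" and sol: "sol \<Phi> (ball 0 R)" and "\<Phi> 0 = p" and a: "norm a = R"
    obtain C where C: "\<And>w c. w \<in> ball 0 R \<Longrightarrow> c \<in> Iso \<Longrightarrow> \<Phi> w \<in> fst c \<Longrightarrow>
        sqrt (2 * herm (\<phi> c (\<Phi> w))) * norm (v c (\<Phi> w)) \<le> C * (R - norm w) powr (- \<kappa>)"
      using bound[OF R sol] by blast
    define K where "K = R * (C * R powr (- \<kappa>))"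
    \<comment> \<open>An antiderivative of \<open>B'\<close>, continuous also at 1 because
      \<open>0 powr (1 - \<kappa>)\<close> is 0.\<close>
    define B where "B t = - (K / (1 - \<kappa>)) * (1 - t) powr (1 - \<kappa>)" for t :: real
    define B' where "B' t = K * (1 - t) powr (- \<kappa>)" for t :: real
    show "\<exists>q. limitin T (\<lambda>t. \<Phi> (of_real t * a)) q (at_left 1)"
    proof (rule curve_converges[OF complete, of "\<lambda>t. \<Phi> (of_real t * a)" B B'])
      show "continuous_on {0..1} B"
        unfolding B_def using \<kappa> by (intro continuous_intros continuous_on_powr') auto
      show "continuous_on {0..<1} B'"
        unfolding B'_def by (intro continuous_intros continuous_on_powr') auto
      fix t :: real assume t: "0 \<le> t" "t < 1"
      have w: "of_real t * a \<in> ball 0 R" using t a R by (simp add: norm_mult)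
      obtain c where c: "c \<in> Iso" "\<Phi> (of_real t * a) \<in> fst c" using Iso_cover solD(1)[OF sol w] by blast
      have t': "\<bar>t\<bar> < 1" using t by simp
      show "regular (\<lambda>t. \<Phi> (of_real t * a)) t" by (rule ray_regular(1)[OF vf sol a R t' c])
      have "speed x (\<lambda>t. \<Phi> (of_real t * a)) t \<le> R * (C * (R - norm (of_real t * a)) powr (- \<kappa>))"
        unfolding ray_regular(2)[OF vf sol a R t' c] using C[OF w c] R by (intro mult_left_mono) auto
      also have "R - norm (of_real t * a) = R * (1 - t)" using t a by (simp add: norm_mult algebra_simps)
      also have "R * (C * (R * (1 - t)) powr (- \<kappa>)) = B' t"
        using R t by (simp add: B'_def K_def powr_mult)
      finally show "speed x (\<lambda>t. \<Phi> (of_real t * a)) t \<le> B' t" .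
      have "((\<lambda>t. 1 - t) has_real_derivative - 1) (at t)" by (auto intro!: derivative_eq_intros)
      from DERIV_fun_powr[OF this, of "1 - \<kappa>"]
      have "((\<lambda>t. (1 - t) powr (1 - \<kappa>)) has_real_derivative (1 - \<kappa>) * (1 - t) powr (1 - \<kappa> - 1) * (- 1)) (at t)"
        using t by simp
      then have "(B has_real_derivative - (K / (1 - \<kappa>)) * ((1 - \<kappa>) * (1 - t) powr (1 - \<kappa> - 1) * (- 1))) (at t)"
        unfolding B_def[abs_def] by (rule DERIV_cmult)
      then show "(B has_real_derivative B' t) (at t)" using \<kappa> by (simp add: B'_def)
    qed blast
  qed (use that in blast)
qed

lemma cmink_\<phi>_holomorphic:
  assumes c: "c \<in> Iso"
  shows "(\<lambda>z. cmink u (\<phi> c (chart_inv c z))) holomorphic_on img c"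
proof -
  have "(\<lambda>z. cmink u (dz (X c) z)) holomorphic_on img c"
    unfolding cmink_def by (intro holomorphic_intros \<phi>_holomorphic_coord[OF c])
  then show ?thesis
    by (rule holomorphic_transform) (simp add: \<phi>_def chart_chart_inv)
qed

text \<open>The vector field \<open>v\<close> is dual to Fujimoto's flat metric; the relations between the exponents make it
  single valued.\<close>

theorem fujimoto:
  fixes A :: "complex set" and m s N k :: nat
  assumes complete: "complete_surface T \<A> x"
    and h: "\<And>c p. c \<in> Iso \<Longrightarrow> p \<in> fst c \<Longrightarrow> cmink u0 (\<phi> c p) \<noteq> 0"
    and g: "\<And>c p. c \<in> Iso \<Longrightarrow> p \<in> fst c \<Longrightarrow> g p = cmink u1 (\<phi> c p) / cmink u0 (\<phi> c p)"
    and bound: "\<And>c p. c \<in> Iso \<Longrightarrow> p \<in> fst c \<Longrightarrow> sqrt (2 * herm (\<phi> c p)) \<le> C0 * norm (cmink u0 (\<phi> c p)) * (1 + norm (g p)) ^ m"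
    and A: "finite A" "card A \<ge> 2" "\<And>p. p \<in> topspace T \<Longrightarrow> g p \<notin> A"
    and N: "N \<ge> 2" "card A * (N - 1) = N + 1 + k" "m * (s * N + 1) = s * k"
    and pq: "p \<in> topspace T" "q \<in> topspace T"
  shows "g q = g p"
proof (rule ccontr)
  assume "g q \<noteq> g p"
  define H where "H c p = cmink u0 (\<phi> c p)" for c p
  note hol\<phi> = cmink_\<phi>_holomorphic
  have holg: "(\<lambda>z. g (chart_inv c z)) holomorphic_on img c" if c: "c \<in> Iso" for c
  proof -
    have "(\<lambda>z. cmink u1 (\<phi> c (chart_inv c z)) / cmink u0 (\<phi> c (chart_inv c z))) holomorphic_on img c"
      by (intro holomorphic_intros hol\<phi>[OF c]) (rule h[OF c chart_inv_in])
    then show ?thesis by (rule holomorphic_transform) (simp add: g[OF c] chart_inv_in)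
  qed
  have gA: "g p \<notin> A" if "c \<in> Iso" "p \<in> fst c" for c p using A(3) that chart_subset by blast
  obtain c0 p0 where c0: "c0 \<in> Iso" "p0 \<in> fst c0" "cderiv g c0 p0 \<noteq> 0"
    using cderiv_zero_imp_constant[of g, OF holg _ pq] \<open>g q \<noteq> g p\<close> by blast
  define \<gamma> where "\<gamma> = s * N"
  define P where "P p = (\<Prod>a\<in>A. g p - a)" for p
  have P0: "P p \<noteq> 0" if "c \<in> Iso" "p \<in> fst c" for c p using gA[OF that] A(1) by (auto simp: P_def)
  \<comment> \<open>\<open>cderiv g\<close> and \<open>H\<close> are coefficients of 1-forms and
    \<open>P\<close> is a function, so exponents \<gamma> above and \<gamma> + 1 below give the
    coefficient of a vector field. It can vanish only at critical points of
    \<open>g\<close>.\<close>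
  define v where "v c p = cderiv g c p ^ \<gamma> / (H c p ^ Suc \<gamma> * P p ^ (s * (N - 1)))" for c p
  have vf: "holomorphic_vector_field T Iso v"
  proof
    fix c assume c: "c \<in> Iso"
    have dcong: "cderiv g c (chart_inv c z) = deriv (\<lambda>z. g (chart_inv c z)) z" if "z \<in> img c" for z
      by (simp add: cderiv_def chart_chart_inv[OF that])
    have "(\<lambda>z. deriv (\<lambda>z. g (chart_inv c z)) z ^ \<gamma> / (cmink u0 (\<phi> c (chart_inv c z)) ^ Suc \<gamma> * (\<Prod>a\<in>A. g (chart_inv c z) - a) ^ (s * (N - 1)))) holomorphic_on img c"
      using h[OF c] P0[OF c] chart_inv_in[of _ c]
      by (intro holomorphic_intros hol\<phi>[OF c] holg[OF c] holomorphic_deriv chart_open_range[OF c]) (auto simp: P_def)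
    then show "(\<lambda>z. v c (chart_inv c z)) holomorphic_on img c"
      by (rule holomorphic_transform) (simp add: v_def dcong H_def P_def)
  next
    fix c c' p d assume c: "c \<in> Iso" "c' \<in> Iso" and p: "p \<in> fst c" "p \<in> fst c'"
      and d: "(change c c' has_field_derivative d) (at (snd c p))"
    obtain d' where d': "d' \<noteq> 0" "(change c c' has_field_derivative d') (at (snd c p))" "\<phi> c p = d' *s \<phi> c' p"
      by (rule Iso_transition[OF c p])
    have "d' = d" using d d'(2) DERIV_unique by blast
    then have "H c p = d * H c' p" "d \<noteq> 0" unfolding H_def using d'(1,3) by (simp_all add: cmink_def algebra_simps)
    moreover have "cderiv g c p = cderiv g c' p * d" by (rule cderiv_transition[OF c p holg d])
    moreover have "H c' p \<noteq> 0" using h[OF c(2) p(2)] by (simp add: H_def)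
    ultimately show "v c' p = d * v c p"
      using P0[OF c(1) p(1)] by (simp add: v_def power_mult_distrib field_simps)
  qed
  interpret holomorphic_vector_field T Iso v by (rule vf)
  obtain K where K: "K > 0" "\<And>f w \<rho>. \<lbrakk>\<rho> > 0; f holomorphic_on ball w \<rho>; \<And>z. z \<in> ball w \<rho> \<Longrightarrow> f z \<notin> A\<rbrakk>
       \<Longrightarrow> (norm (deriv f w) * \<rho>) ^ N * (1 + norm (f w)) ^ k \<le> K * (\<Prod>a\<in>A. norm (f w - a)) ^ (N - 1)"
    using punctured_plane_bound[OF A(1,2) N(1,2)] by blast
  have comp: "((\<lambda>w. g (\<Phi> w)) has_field_derivative cderiv g c (\<Phi> w) * v c (\<Phi> w)) (at w)"
    if "sol \<Phi> \<Omega>" "w \<in> \<Omega>" "c \<in> Iso" "\<Phi> w \<in> fst c" for \<Phi> \<Omega> w c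
    by (rule sol_compose_derivative[OF that holg[OF that(3)]])
  have hol\<Phi>: "(\<lambda>w. g (\<Phi> w)) holomorphic_on \<Omega>" if sol: "sol \<Phi> \<Omega>" and "open \<Omega>" for \<Phi> \<Omega>
    unfolding holomorphic_on_open[OF \<open>open \<Omega>\<close>]
    using comp[OF sol] solD(1)[OF sol] Iso_cover by blast
  \<comment> \<open>\<open>bound\<close> says nothing about the sign of \<open>C0\<close>;
    positivity of the metric at one point determines it.\<close>
  have C0: "C0 \<ge> 0"
  proof -
    have "0 < sqrt (2 * herm (\<phi> c0 p0))" using \<phi>_null(3)[OF c0(1,2)] by simp
    also have "\<dots> \<le> C0 * (norm (cmink u0 (\<phi> c0 p0)) * (1 + norm (g p0)) ^ m)" using bound[OF c0(1,2)] by (simp add: mult.assoc)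
    finally have "0 < C0 * (norm (cmink u0 (\<phi> c0 p0)) * (1 + norm (g p0)) ^ m)" .
    moreover have "0 \<le> norm (cmink u0 (\<phi> c0 p0)) * (1 + norm (g p0)) ^ m"
      by (intro mult_nonneg_nonneg zero_le_power add_nonneg_nonneg) auto
    ultimately show ?thesis by (auto simp: zero_less_mult_iff)
  qed
  \<comment> \<open>The power of the radius that is left after taking the root of order \<gamma> + 1
    in the estimate below.\<close>
  define \<kappa> where "\<kappa> = real \<gamma> / real (Suc \<gamma>)"
  have \<kappa>: "0 \<le> \<kappa>" "\<kappa> < 1" by (simp_all add: \<kappa>_def)
  have v0: "v c0 p0 \<noteq> 0"
    using c0 h[OF c0(1,2)] P0[OF c0(1,2)] by (simp add: v_def H_def)
  obtain \<Phi> where \<Phi>: "sol \<Phi> UNIV" "\<Phi> 0 = p0"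
  proof (rule complete_imp_entire_sol[OF complete vf c0(1,2) v0 \<kappa>])
    fix R :: real and \<Phi> assume R: "R > 0" and sol: "sol \<Phi> (ball 0 R)"
    show "\<exists>C. \<forall>w\<in>ball 0 R. \<forall>c\<in>Iso. \<Phi> w \<in> fst c \<longrightarrow>
        sqrt (2 * herm (\<phi> c (\<Phi> w))) * norm (v c (\<Phi> w)) \<le> C * (R - norm w) powr (- \<kappa>)"
    proof (intro exI ballI impI)
      fix w c assume w: "w \<in> ball 0 R" and c: "c \<in> Iso" "\<Phi> w \<in> fst c"
      \<comment> \<open>The largest radius around \<open>w\<close> on which the Landau-type estimate
        can be applied to \<open>g\<close> along the curve.\<close>
      define \<rho> where "\<rho> = R - norm w"
      have \<rho>: "\<rho> > 0" using w by (simp add: \<rho>_def)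
      have sub: "ball w \<rho> \<subseteq> ball 0 R"
      proof
        fix z assume "z \<in> ball w \<rho>"
        then show "z \<in> ball 0 R" using norm_triangle_ineq2[of z w] by (simp add: \<rho>_def dist_norm norm_minus_commute)
      qed
      define D where "D = cderiv g c (\<Phi> w) * v c (\<Phi> w)"
      have dG: "deriv (\<lambda>w. g (\<Phi> w)) w = D" unfolding D_def by (rule DERIV_imp_deriv[OF comp[OF sol w c]])
      define PP where "PP = (\<Prod>a\<in>A. norm (g (\<Phi> w) - a))"
      have PP: "PP = norm (P (\<Phi> w))" by (simp add: PP_def P_def prod_norm)
      have PP0: "PP > 0" using P0[OF c] by (simp add: PP)
      have est: "(norm D * \<rho>) ^ N * (1 + norm (g (\<Phi> w))) ^ k \<le> K * PP ^ (N - 1)"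
        using K(2)[OF \<rho> holomorphic_on_subset[OF hol\<Phi>[OF sol open_ball] sub]] A(3) solD(1)[OF sol] sub
        unfolding dG PP_def by blast
      \<comment> \<open>\<open>z\<close> bounds the speed up to the factor \<open>C0\<close>.
        Replacing \<open>cderiv g\<close> by the derivative \<open>D\<close> of \<open>g\<close>
        along the curve gives \<open>yD\<close>; by the relation between \<open>m\<close>,
        \<open>s\<close>, \<open>N\<close> and \<open>k\<close> the power of \<open>z\<close> of
        order \<gamma> + 1 is then controlled by the \<open>s\<close>-th power of
        \<open>est\<close>.\<close>
      define y where "y = norm (H c (\<Phi> w)) * norm (v c (\<Phi> w))"
      define z where "z = y * (1 + norm (g (\<Phi> w))) ^ m"
      have z0: "z \<ge> 0" by (simp add: z_def y_def)
      have Hn: "H c (\<Phi> w) \<noteq> 0" using h[OF c] by (simp add: H_def)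
      have "norm (H c (\<Phi> w)) ^ Suc \<gamma> * norm (v c (\<Phi> w)) * PP ^ (s * (N - 1)) = norm (cderiv g c (\<Phi> w)) ^ \<gamma>"
        using Hn PP0 unfolding v_def PP by (simp add: norm_mult norm_divide norm_power)
      then have "y ^ Suc \<gamma> * PP ^ (s * (N - 1)) = norm (v c (\<Phi> w)) ^ \<gamma> * norm (cderiv g c (\<Phi> w)) ^ \<gamma>"
        unfolding y_def power_mult_distrib by (simp add: algebra_simps)
      also have "\<dots> = norm D ^ \<gamma>" unfolding D_def by (simp add: norm_mult power_mult_distrib mult.commute)
      finally have yD: "y ^ Suc \<gamma> * PP ^ (s * (N - 1)) = norm D ^ \<gamma>" .
      have "(z ^ Suc \<gamma> * \<rho> ^ \<gamma>) * PP ^ (s * (N - 1))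
          = (y ^ Suc \<gamma> * PP ^ (s * (N - 1))) * (1 + norm (g (\<Phi> w))) ^ (m * Suc \<gamma>) * \<rho> ^ \<gamma>"
        unfolding z_def power_mult_distrib power_mult[symmetric] by (simp only: ac_simps)
      also have "m * Suc \<gamma> = k * s" using N(3) by (simp add: \<gamma>_def mult.commute)
      also have "(y ^ Suc \<gamma> * PP ^ (s * (N - 1))) * (1 + norm (g (\<Phi> w))) ^ (k * s) * \<rho> ^ \<gamma>
          = ((norm D * \<rho>) ^ N * (1 + norm (g (\<Phi> w))) ^ k) ^ s"
        unfolding yD unfolding \<gamma>_def power_mult_distrib power_mult[symmetric] by (simp only: ac_simps)
      also have "\<dots> \<le> (K * PP ^ (N - 1)) ^ s"
        using \<rho> est by (intro power_mono) auto
      also have "\<dots> = K ^ s * PP ^ (s * (N - 1))" by (simp add: power_mult_distrib power_mult[symmetric] mult.commute)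
      finally have zb: "z ^ Suc \<gamma> * \<rho> ^ \<gamma> \<le> K ^ s" using PP0 by simp
      have "z ^ Suc \<gamma> \<le> K ^ s / \<rho> ^ \<gamma>" using zb \<rho> by (simp add: field_simps)
      also have "\<dots> = ((K ^ s) powr (1 / Suc \<gamma>) * \<rho> powr (- \<kappa>)) ^ Suc \<gamma>"
      proof -
        have "((K ^ s) powr (1 / Suc \<gamma>)) ^ Suc \<gamma> = K ^ s"
          using K(1) by (simp only: powr_realpow[symmetric] powr_powr powr_gt_zero zero_less_power) (simp add: powr_realpow)
        moreover have "(\<rho> powr (- \<kappa>)) ^ Suc \<gamma> = \<rho> powr (- real \<gamma>)"
        proof -
          have "(\<rho> powr (- \<kappa>)) ^ Suc \<gamma> = (\<rho> powr (- \<kappa>)) powr (real (Suc \<gamma>))"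
            using \<rho> by (subst powr_realpow) auto
          also have "\<dots> = \<rho> powr (- real \<gamma>)" by (simp add: powr_powr \<kappa>_def)
          finally show ?thesis .
        qed
        moreover have "\<rho> powr (- real \<gamma>) = 1 / \<rho> ^ \<gamma>" using \<rho> by (simp add: powr_minus powr_realpow divide_inverse)
        ultimately show ?thesis by (simp only: power_mult_distrib) simp
      qed
      finally have "z \<le> (K ^ s) powr (1 / Suc \<gamma>) * \<rho> powr (- \<kappa>)"
        by (rule power_le_imp_le_base) (use \<rho> in auto)
      moreover have "sqrt (2 * herm (\<phi> c (\<Phi> w))) * norm (v c (\<Phi> w)) \<le> C0 * z"
        using mult_right_mono[OF bound[OF c], of "norm (v c (\<Phi> w))"] by (simp add: z_def y_def H_def algebra_simps)
      ultimately show "sqrt (2 * herm (\<phi> c (\<Phi> w))) * norm (v c (\<Phi> w)) \<le> (C0 * (K ^ s) powr (1 / Suc \<gamma>)) * (R - norm w) powr (- \<kappa>)"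
        using mult_left_mono[OF _ C0] by (fastforce simp: \<rho>_def mult.assoc)
    qed
  qed blast
  obtain a b where ab: "a \<in> A" "b \<in> A" "a \<noteq> b"
  proof -
    have "A \<noteq> {}" using A(2) by auto
    then obtain a where a: "a \<in> A" by blast
    have "\<not> A \<subseteq> {a}" using A(2) card_mono[of "{a}" A] by auto
    then show ?thesis using a that by blast
  qed
  have "range (\<lambda>w. g (\<Phi> w)) \<inter> {a, b} = {}" using A(3) solD(1)[OF \<Phi>(1)] ab by blast
  then obtain e where "(\<lambda>w. g (\<Phi> w)) = (\<lambda>w. e)"
    using little_Picard[OF hol\<Phi>[OF \<Phi>(1) open_UNIV] ab(3)] by blast
  then have "((\<lambda>w. g (\<Phi> w)) has_field_derivative 0) (at 0)" by simp
  moreover have "((\<lambda>w. g (\<Phi> w)) has_field_derivative cderiv g c0 (\<Phi> 0) * v c0 (\<Phi> 0)) (at 0)"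
    by (rule comp[OF \<Phi>(1)]) (use c0 \<Phi>(2) in auto)
  ultimately have "cderiv g c0 p0 * v c0 p0 = 0" using DERIV_unique \<Phi>(2) by blast
  then show False using c0 v0 by simp
qed

end

subsection \<open>The complexified inner product\<close>

lemma cmink_commute: "cmink u v = cmink v u"
  by (simp add: cmink_def mult.commute)

lemma cmink_linear:
  "cmink u (v + w) = cmink u v + cmink u w" "cmink (u + v) w = cmink u w + cmink v w"
  "cmink u (v - w) = cmink u v - cmink u w" "cmink (u - v) w = cmink u w - cmink v w"
  "cmink u (a *s v) = a * cmink u v" "cmink (a *s u) v = a * cmink u v"
  "cmink u 0 = 0" "cmink 0 u = 0"
  by (simp_all add: cmink_def algebra_simps)

definition cnjv :: "complex^4 \<Rightarrow> complex^4" where "cnjv z = (\<chi> k. cnj (z$k))"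

lemma cnjv_nth [simp]: "cnjv z $ k = cnj (z $ k)"
  by (simp add: cnjv_def)

lemma cnjv_linear: "cnjv (u + v) = cnjv u + cnjv v" "cnjv (u - v) = cnjv u - cnjv v"
  "cnjv (a *s u) = cnj a *s cnjv u" "cnjv (cnjv u) = u"
  by (simp_all add: vec_eq_iff)

lemma cnjv_cvec [simp]: "cnjv (cvec u) = cvec u"
  by (simp add: vec_eq_iff cvec_def)

lemma cmink_cnjv: "cmink (cnjv u) (cnjv v) = cnj (cmink u v)"
  by (simp add: cmink_def)

lemma herm_eq: "complex_of_real (herm z) = cmink z (cnjv z)"
  by (simp add: herm_def cmink_def complex_mult_cnj cmod_power2)

lemma herm_scale: "herm (a *s z) = (norm a)\<^sup>2 * herm z"
  by (simp add: herm_def norm_mult power_mult_distrib algebra_simps)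

lemma cmink_cvec: "cmink (cvec u) (cvec v) = of_real (mink u v)"
  by (simp add: cmink_def cvec_def mink_def)

lemma vec_smult_rules: "(a::complex) *s (b *s z) = (a * b) *s (z::complex^4)" "1 *s z = z" "0 *s z = 0" "a *s (u + v) = a *s u + a *s v"
  by (simp_all add: vec_eq_iff algebra_simps)

lemma proj_pt_scale: "a \<noteq> 0 \<Longrightarrow> proj_pt (a *s z) = proj_pt z"
  unfolding proj_pt_eq_iff by blast

lemma Psi_proj_pt: "z \<noteq> 0 \<Longrightarrow> cmink z z = 0 \<Longrightarrow> Psi (proj_pt z) = Psi_coord z"
  unfolding Psi_def Psi_inv_coord[symmetric] by (rule inv_f_f[OF inj_Psi_inv])

subsection \<open>Spinor coordinates on the quadric\<close>

text \<open>Homogeneous coordinates on the extended plane. They merge the four cases of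
  \<open>Psi_rep\<close> into one bilinear formula.\<close>

fun rep0 :: "csphere \<Rightarrow> complex" where "rep0 (Some w) = 1" | "rep0 None = 0"
fun rep1 :: "csphere \<Rightarrow> complex" where "rep1 (Some w) = w" | "rep1 None = 1"

lemma rep_det_eq_0: "rep0 w * rep1 w' - rep1 w * rep0 w' = 0 \<longleftrightarrow> w = w'"
  by (cases w; cases w') auto

lemma rep_unique_zero:
  assumes "a \<noteq> 0 \<or> b \<noteq> 0"
  shows "\<exists>!w. a * rep0 w + b * rep1 w = 0"
proof (cases "b = 0")
  case True
  then show ?thesis using assms by (intro ex1I[of _ None]) (auto elim: rep0.elims)
next
  case False
  show ?thesis
  proof (rule ex1I[of _ "Some (- a / b)"])
    show "a * rep0 (Some (- a / b)) + b * rep1 (Some (- a / b)) = 0" using False by simp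
    fix w assume "a * rep0 w + b * rep1 w = 0"
    then show "w = Some (- a / b)" using False by (cases w) (auto simp: field_simps eq_neg_iff_add_eq_0)
  qed
qed

lemma Psi_rep_nth:
  "Psi_rep (w1, w2) $ 1 = rep1 w1 * rep0 w2 + rep0 w1 * rep1 w2"
  "Psi_rep (w1, w2) $ 2 = - \<i> * (rep1 w1 * rep0 w2 - rep0 w1 * rep1 w2)"
  "Psi_rep (w1, w2) $ 3 = rep0 w1 * rep0 w2 - rep1 w1 * rep1 w2"
  "Psi_rep (w1, w2) $ 4 = rep0 w1 * rep0 w2 + rep1 w1 * rep1 w2"
  by (cases w1; cases w2; simp)+

lemma cmink_Psi_rep:
  "cmink A (Psi_rep (w1, w2)) = (rep0 w1 * (A$3 - A$4) + rep1 w1 * (A$1 - \<i> * A$2)) * rep0 w2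
     + (rep0 w1 * (A$1 + \<i> * A$2) + rep1 w1 * (- A$3 - A$4)) * rep1 w2"
  by (simp add: cmink_def Psi_rep_nth algebra_simps)

lemma cmink_Psi_rep2:
  "cmink A (Psi_rep (w1, w2)) = (rep0 w2 * (A$3 - A$4) + rep1 w2 * (A$1 + \<i> * A$2)) * rep0 w1
     + (rep0 w2 * (A$1 - \<i> * A$2) + rep1 w2 * (- A$3 - A$4)) * rep1 w1"
  by (simp add: cmink_def Psi_rep_nth algebra_simps)

text \<open>The quadric is a product of two projective lines, and its bilinear form is a product of
  two determinants. Orthogonal points are therefore those on a common line of one of the two
  rulings.\<close>

lemma cmink_Psi_rep_Psi_rep:
  "cmink (Psi_rep (w1, w2)) (Psi_rep (w1', w2'))
     = - 2 * (rep0 w1 * rep1 w1' - rep1 w1 * rep0 w1') * (rep0 w2 * rep1 w2' - rep1 w2 * rep0 w2')"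
proof -
  have "\<i> * (\<i> * z) = - z" for z by (simp add: mult.assoc[symmetric])
  then show ?thesis by (simp add: cmink_def Psi_rep_nth algebra_simps)
qed

lemma cmink_Psi_rep_eq_0:
  "cmink (Psi_rep w) (Psi_rep w') = 0 \<longleftrightarrow> fst w = fst w' \<or> snd w = snd w'"
  by (cases w; cases w') (simp only: cmink_Psi_rep_Psi_rep mult_eq_0_iff rep_det_eq_0 fst_conv snd_conv, simp)

lemma Psi_rep_null: "cmink (Psi_rep w) (Psi_rep w) = 0"
  by (simp add: cmink_Psi_rep_eq_0)

lemma Psi_rep_nonzero: "Psi_rep w \<noteq> 0"
proof
  assume "Psi_rep w = 0"
  then have "Psi_rep w = 0 *s Psi_rep (None, None)" "Psi_rep w = 0 *s Psi_rep (Some 0, Some 0)" by (simp_all add: vec_eq_iff del: Psi_rep.simps)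
  obtain w' where "fst w \<noteq> fst w'" "snd w \<noteq> snd w'"
    by (metis fst_conv snd_conv option.distinct(1) prod.collapse)
  then have "cmink (Psi_rep w) (Psi_rep w') \<noteq> 0" by (simp add: cmink_Psi_rep_eq_0)
  then show False using \<open>Psi_rep w = 0\<close> by (simp add: cmink_linear del: Psi_rep.simps)
qed

lemma Psi_proj_pt_Psi_rep [simp]: "Psi (proj_pt (Psi_rep w)) = w"
  unfolding Psi_def Psi_inv_def[symmetric] by (rule inv_f_f[OF inj_Psi_inv])

lemma null_eq_Psi_rep:
  assumes "z \<noteq> 0" "cmink z z = 0"
  obtains a where "a \<noteq> 0" "z = a *s Psi_rep (Psi (proj_pt z))"
proof -
  have "proj_pt z = proj_pt (Psi_rep (Psi (proj_pt z)))"
    using Psi_inv_coord[OF assms] unfolding Psi_proj_pt[OF assms] Psi_inv_def by simp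
  then show ?thesis using that unfolding proj_pt_eq_iff by blast
qed

lemma null_orthogonal_iff:
  assumes "z \<noteq> 0" "cmink z z = 0" "z' \<noteq> 0" "cmink z' z' = 0"
  shows "cmink z z' = 0 \<longleftrightarrow> fst (Psi (proj_pt z)) = fst (Psi (proj_pt z')) \<or> snd (Psi (proj_pt z)) = snd (Psi (proj_pt z'))"
proof -
  obtain a where a: "a \<noteq> 0" "z = a *s Psi_rep (Psi (proj_pt z))" by (rule null_eq_Psi_rep[OF assms(1,2)])
  obtain b where b: "b \<noteq> 0" "z' = b *s Psi_rep (Psi (proj_pt z'))" by (rule null_eq_Psi_rep[OF assms(3,4)])
  have "cmink z z' = a * (b * cmink (Psi_rep (Psi (proj_pt z))) (Psi_rep (Psi (proj_pt z'))))"
    by (subst a(2), subst b(2)) (simp add: cmink_linear)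
  then show ?thesis using a(1) b(1) by (simp add: cmink_Psi_rep_eq_0)
qed

lemma proj_pt_in_hyperplane:
  "proj_pt z \<in> hyperplane A \<longleftrightarrow> proj_pt z \<in> quadric \<and> cmink A z = 0"
proof -
  have "z \<in> proj_pt z" unfolding proj_pt_def by (rule CollectI, rule exI[of _ 1]) (simp add: vec_eq_iff)
  then show ?thesis by (auto simp: hyperplane_def proj_pt_def cmink_linear)
qed

lemma hyperplane_eq: "hyperplane A = (\<lambda>w. proj_pt (Psi_rep w)) ` {w. cmink A (Psi_rep w) = 0}"
proof -
  have "hyperplane A = {L \<in> range Psi_inv. \<forall>z\<in>L. cmink A z = 0}"
    using bij_betw_Psi_inv unfolding hyperplane_def bij_betw_def by simp
  also have "\<dots> = Psi_inv ` {w. cmink A (Psi_rep w) = 0}"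
  proof -
    have "(\<forall>z\<in>Psi_inv w. cmink A z = 0) \<longleftrightarrow> cmink A (Psi_rep w) = 0" for w
      using proj_pt_in_hyperplane[of "Psi_rep w" A] Psi_inv_in_quadric[of w] by (simp add: hyperplane_def Psi_inv_def)
    then show ?thesis by auto
  qed
  finally show ?thesis by (simp add: Psi_inv_def[abs_def])
qed

lemma hyperplaneE:
  assumes "L \<in> hyperplane A"
  obtains w where "L = proj_pt (Psi_rep w)" "Psi L = w" "cmink A (Psi_rep w) = 0"
  using assms unfolding hyperplane_eq by auto

text \<open>\<open>A\<close> can be read as a 2 by 2 matrix of determinant
  \<open>- cmink A A\<close>; the two equations say that (s, t) is in its kernel.\<close>

lemma cmink_det_identity:
  fixes A :: "complex^4"
  assumes "s * (A$3 - A$4) + t * (A$1 - \<i> * A$2) = 0" "s * (A$1 + \<i> * A$2) + t * (- A$3 - A$4) = 0" "s \<noteq> 0 \<or> t \<noteq> 0"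
  shows "cmink A A = 0"
proof -
  define a b c d where "a = A$3 - A$4" and "b = A$1 - \<i> * A$2" and "c = A$1 + \<i> * A$2" and "d = - A$3 - A$4"
  have "\<i> * (\<i> * z) = - z" for z by (simp add: mult.assoc[symmetric])
  then have "cmink A A = b * c - a * d" by (simp add: cmink_def a_def b_def c_def d_def algebra_simps)
  moreover have "s * (b * c - a * d) = 0"
  proof -
    have "s * (b * c - a * d) = b * (s * c + t * d) - d * (s * a + t * b)" by (simp add: algebra_simps)
    then show ?thesis using assms(1,2) by (simp add: a_def b_def c_def d_def)
  qed
  moreover have "t * (b * c - a * d) = 0"
  proof -
    have "t * (b * c - a * d) = c * (s * a + t * b) - a * (s * c + t * d)" by (simp add: algebra_simps)
    then show ?thesis using assms(1,2) by (simp add: a_def b_def c_def d_def)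
  qed
  ultimately show ?thesis using assms(3) by auto
qed

lemma rep_nonzero: "rep0 w \<noteq> 0 \<or> rep1 w \<noteq> 0"
  by (cases w) auto

text \<open>For nonisotropic \<open>A\<close> the equation is a nonzero linear form in the
  homogeneous coordinates of \<open>w2\<close>: the conic meets each line of the ruling exactly
  once.\<close>

lemma hyperplane_section1:
  assumes "cmink A A \<noteq> 0" shows "\<exists>!w2. cmink A (Psi_rep (w1, w2)) = 0"
  unfolding cmink_Psi_rep
  by (rule rep_unique_zero) (use cmink_det_identity[of "rep0 w1" A "rep1 w1"] rep_nonzero[of w1] assms in blast)

lemma hyperplane_section2:
  assumes "cmink A A \<noteq> 0" shows "\<exists>!w1. cmink A (Psi_rep (w1, w2)) = 0"
proof -
  \<comment> \<open>Reflection in the second coordinate exchanges the two rulings.\<close>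
  define A' where "A' = vec4 (A$1) (- A$2) (A$3) (A$4)"
  have "cmink A' A' \<noteq> 0" using assms by (simp add: A'_def cmink_def)
  then show ?thesis unfolding cmink_Psi_rep2
    by (intro rep_unique_zero) (use cmink_det_identity[of "rep0 w2" A' "rep1 w2"] rep_nonzero[of w2] in \<open>auto simp: A'_def\<close>)
qed

lemma bij_betw_Psi:
  assumes "\<And>a. \<exists>!w. F w = a \<and> cmink A (Psi_rep w) = 0"
  shows "bij_betw (F \<circ> Psi) (hyperplane A) UNIV"
proof (rule bij_betwI')
  show "\<And>L. L \<in> hyperplane A \<Longrightarrow> (F \<circ> Psi) L \<in> UNIV" by simp
  show "((F \<circ> Psi) L = (F \<circ> Psi) L') = (L = L')" if L: "L \<in> hyperplane A" "L' \<in> hyperplane A" for L L'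
  proof -
    obtain w where w: "L = proj_pt (Psi_rep w)" "Psi L = w" "cmink A (Psi_rep w) = 0" by (rule hyperplaneE[OF L(1)])
    obtain w' where w': "L' = proj_pt (Psi_rep w')" "Psi L' = w'" "cmink A (Psi_rep w') = 0" by (rule hyperplaneE[OF L(2)])
    show ?thesis using w w' assms[of "F w"] by (metis comp_apply)
  qed
  show "\<exists>L\<in>hyperplane A. a = (F \<circ> Psi) L" for a
  proof -
    obtain w where "F w = a" "cmink A (Psi_rep w) = 0" using assms[of a] by blast
    then show ?thesis unfolding hyperplane_eq by (intro bexI[of _ "proj_pt (Psi_rep w)"]) (auto simp del: Psi_rep.simps)
  qed
qed

lemma bij_betw_fst_Psi: "cmink A A \<noteq> 0 \<Longrightarrow> bij_betw (fst \<circ> Psi) (hyperplane A) UNIV"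
  using hyperplane_section1[of A] by (intro bij_betw_Psi) (metis fst_conv prod.collapse)

lemma bij_betw_snd_Psi: "cmink A A \<noteq> 0 \<Longrightarrow> bij_betw (snd \<circ> Psi) (hyperplane A) UNIV"
  using hyperplane_section2[of A] by (intro bij_betw_Psi) (metis snd_conv prod.collapse)

lemma omitted_count_bij:
  assumes "bij_betw F H UNIV" "G \<subseteq> H"
  shows "- F ` G = F ` (H - G)" "finite (- F ` G) \<longleftrightarrow> finite (H - G)" "card (- F ` G) = card (H - G)"
proof -
  have inj: "inj_on F H" and sur: "F ` H = UNIV" using assms(1) by (auto simp: bij_betw_def)
  have "UNIV - F ` G = F ` (H - G)" unfolding sur[symmetric] by (rule inj_on_image_set_diff[OF inj _ assms(2), symmetric]) simp
  then show e: "- F ` G = F ` (H - G)" by (simp add: Compl_eq_Diff_UNIV)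
  have i: "inj_on F (H - G)" by (rule inj_on_subset[OF inj]) blast
  show "finite (- F ` G) \<longleftrightarrow> finite (H - G)" unfolding e by (rule finite_image_iff[OF i])
  show "card (- F ` G) = card (H - G)" unfolding e by (rule card_image[OF i])
qed

subsection \<open>Null frames of the hyperplane\<close>

text \<open>Orthogonal null vectors lie on a common line of the quadric, and such a line meets the
  conic only once. In other words, the orthogonal complement of \<open>A\<close> contains no
  isotropic plane.\<close>

lemma null_in_hyperplane_parallel:
  assumes A: "cmink A A \<noteq> 0" and z: "cmink z z = 0" "cmink A z = 0" and z': "z' \<noteq> 0" "cmink z' z' = 0" "cmink A z' = 0"
    and "cmink z z' = 0"
  obtains a where "z = a *s z'"
proof (cases "z = 0")
  case True
  then show ?thesis using that[of 0] by simp
next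
  case False
  have h: "proj_pt z \<in> hyperplane A" "proj_pt z' \<in> hyperplane A"
    using False z z' by (auto simp: proj_pt_in_hyperplane quadric_def)
  have inj: "inj_on (fst \<circ> Psi) (hyperplane A)" "inj_on (snd \<circ> Psi) (hyperplane A)"
    using bij_betw_fst_Psi[OF A] bij_betw_snd_Psi[OF A] by (auto simp: bij_betw_def)
  have "proj_pt z = proj_pt z'"
    using null_orthogonal_iff[OF False z(1) z'(1,2)] assms(7) inj_onD[OF inj(1) _ h] inj_onD[OF inj(2) _ h]
    by (metis comp_apply)
  then show ?thesis using that unfolding proj_pt_eq_iff by blast
qed

lemma orthogonal_vector_exists:
  fixes a b c :: "'k::field^4"
  obtains n :: "'k^4" where "n \<noteq> 0" "a$1 * n$1 + a$2 * n$2 + a$3 * n$3 + a$4 * n$4 = 0"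
    "b$1 * n$1 + b$2 * n$2 + b$3 * n$3 + b$4 * n$4 = 0" "c$1 * n$1 + c$2 * n$2 + c$3 * n$3 + c$4 * n$4 = 0"
proof -
  \<comment> \<open>Three equations in four unknowns, written as a square matrix with a zero
    row.\<close>
  define M :: "'k^4^4" where "M = (\<chi> i. if i = 1 then a else if i = 2 then b else if i = 3 then c else 0)"
  have "det M = 0" by (rule det_zero_row(2)[of 4]) (simp add: M_def row_def vec_eq_iff)
  then have "\<not> invertible M" by (simp add: invertible_det_nz)
  then obtain n where n: "n \<noteq> 0" "M *v n = 0"
    using matrix_left_invertible_ker[of M] invertible_left_inverse[of M] by blast
  have "(M *v n) $ 1 = 0" "(M *v n) $ 2 = 0" "(M *v n) $ 3 = 0" by (simp_all add: n(2))
  then show ?thesis using that[OF n(1)] by (simp add: matrix_vector_mult_def M_def sum_4)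
qed

lemma cmink_orthogonal_vector_exists:
  obtains n where "n \<noteq> 0" "cmink a n = 0" "cmink b n = 0" "cmink c n = 0"
proof -
  define J where "J z = vec4 (z$1) (z$2) (z$3) (- (z$4))" for z :: "complex^4"
  obtain n :: "complex^4" where "n \<noteq> 0" "J a$1 * n$1 + J a$2 * n$2 + J a$3 * n$3 + J a$4 * n$4 = 0"
    "J b$1 * n$1 + J b$2 * n$2 + J b$3 * n$3 + J b$4 * n$4 = 0" "J c$1 * n$1 + J c$2 * n$2 + J c$3 * n$3 + J c$4 * n$4 = 0"
    by (rule orthogonal_vector_exists)
  then show ?thesis by (intro that[of n]) (auto simp: J_def cmink_def)
qed

lemma mink_orthogonal_vector_exists:
  obtains n where "n \<noteq> 0" "mink a n = 0" "mink b n = 0" "mink c n = 0"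
proof -
  define J :: "real^4 \<Rightarrow> real^4" where "J z = (\<chi> k. if k = 4 then - z$k else z$k)" for z
  obtain n :: "real^4" where "n \<noteq> 0" "J a$1 * n$1 + J a$2 * n$2 + J a$3 * n$3 + J a$4 * n$4 = 0"
    "J b$1 * n$1 + J b$2 * n$2 + J b$3 * n$3 + J b$4 * n$4 = 0" "J c$1 * n$1 + J c$2 * n$2 + J c$3 * n$3 + J c$4 * n$4 = 0"
    by (rule orthogonal_vector_exists)
  then show ?thesis by (intro that[of n]) (auto simp: J_def mink_def)
qed

definition null_frame :: "complex^4 \<Rightarrow> complex^4 \<Rightarrow> complex^4 \<Rightarrow> complex^4 \<Rightarrow> bool" where
  "null_frame A l l' n \<longleftrightarrow> cmink A A \<noteq> 0 \<and> cmink A l = 0 \<and> cmink A l' = 0 \<and> cmink A n = 0 \<and>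
     cmink l l = 0 \<and> cmink l' l' = 0 \<and> cmink l l' = 1 \<and> cmink l n = 0 \<and> cmink l' n = 0 \<and> cmink n n = 1"

text \<open>A null vector orthogonal to \<open>A\<close> and \<open>l\<close> is a multiple of
  \<open>l\<close>, and orthogonality to \<open>l'\<close> forces the factor 0. So a nonzero vector
  orthogonal to all three is not null and can be normalized with a complex square root.\<close>

lemma null_frame_exists:
  assumes A: "cmink A A \<noteq> 0" and l: "cmink A l = 0" "cmink l l = 0" and l': "cmink A l' = 0" "cmink l' l' = 0" "cmink l l' = 1"
  obtains n where "null_frame A l l' n"
proof -
  obtain n where n: "n \<noteq> 0" "cmink A n = 0" "cmink l n = 0" "cmink l' n = 0"
    by (rule cmink_orthogonal_vector_exists[of A l l'])
  have l0: "l \<noteq> 0" using l'(3) by (auto simp: cmink_linear)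
  have nn: "cmink n n \<noteq> 0"
  proof
    assume "cmink n n = 0"
    then obtain a where a: "n = a *s l"
      using null_in_hyperplane_parallel[OF A _ n(2) l0 l(2,1)] n(3) by (metis cmink_commute)
    then have "a = 0" using n(4) l'(3) by (simp add: cmink_linear cmink_commute[of l'])
    then show False using n(1) a by simp
  qed
  define r where "r = 1 / csqrt (cmink n n)"
  have "r * (r * cmink n n) = 1" using nn by (simp add: r_def field_simps power2_eq_square[symmetric])
  then have "null_frame A l l' (r *s n)"
    using A l l' n by (simp add: null_frame_def cmink_linear)
  then show ?thesis by (rule that)
qed

text \<open>In place of a dimension count: a nonzero remainder r would not be null, and with m^2 <r,
  r> = -1 the vector n + m r would be null and orthogonal to l and l', hence zero, contrary to <n, n
  + m r> = 1.\<close>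

lemma null_frame_expand:
  assumes F: "null_frame A l l' n" and z: "cmink A z = 0"
  shows "z = cmink l z *s l' + cmink l' z *s l + cmink n z *s n"
proof (rule ccontr)
  assume ne: "\<not> ?thesis"
  define r where "r = z - (cmink l z *s l' + cmink l' z *s l + cmink n z *s n)"
  have r0: "r \<noteq> 0" using ne by (simp add: r_def)
  have F': "cmink A A \<noteq> 0" "cmink A l = 0" "cmink A l' = 0" "cmink A n = 0" "cmink l l = 0" "cmink l' l' = 0" "cmink l l' = 1"
    "cmink l n = 0" "cmink l' n = 0" "cmink n n = 1" "cmink l' l = 1" "cmink n l = 0" "cmink n l' = 0"
    using F by (auto simp: null_frame_def cmink_commute)
  have r: "cmink A r = 0" "cmink l r = 0" "cmink l' r = 0" "cmink n r = 0"
    by (simp_all add: r_def cmink_linear F' z)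
  have l0: "l \<noteq> 0" using F'(7) by (auto simp: cmink_linear)
  have key: "y = 0" if y: "cmink A y = 0" "cmink l y = 0" "cmink l' y = 0" "cmink y y = 0" for y
  proof -
    obtain a where a: "y = a *s l"
      using null_in_hyperplane_parallel[OF F'(1) y(4,1) l0 F'(5,2)] y(2) by (metis cmink_commute)
    then have "a = 0" using y(3) F'(11) by (simp add: cmink_linear)
    then show ?thesis using a by simp
  qed
  have rr: "cmink r r \<noteq> 0" using key[OF r(1-3)] r0 by blast
  define m where "m = csqrt (- 1 / cmink r r)"
  have m: "m * (m * cmink r r) = - 1" using rr by (simp add: m_def mult.assoc[symmetric] power2_eq_square[symmetric])
  have "n + m *s r = 0"
    by (rule key) (simp_all add: cmink_linear F' r m cmink_commute[of r n])
  then have "cmink n (n + m *s r) = 0" by (simp add: cmink_linear)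
  then show False by (simp add: cmink_linear F' r)
qed

text \<open>The null vectors of \<open>A\<^sup>\<bottom>\<close> not proportional to \<open>l\<close>, up to scaling.\<close>

abbreviation conic :: "complex^4 \<Rightarrow> complex^4 \<Rightarrow> complex^4 \<Rightarrow> complex \<Rightarrow> complex^4" where
  "conic l l' n g \<equiv> l' + g *s n + (- g\<^sup>2 / 2) *s l"

text \<open>In frame coordinates nullity reads 2 h k + g^2 = 0. In the affine chart h = 1 this is a
  parabola, and \<open>l\<close> is its point at infinity.\<close>

lemma null_frame_null_vector:
  assumes F: "null_frame A l l' n" and z: "cmink A z = 0" "cmink z z = 0"
  shows "2 * cmink l z * cmink l' z = - (cmink n z)\<^sup>2"
    "cmink l z \<noteq> 0 \<Longrightarrow> z = cmink l z *s conic l l' n (cmink n z / cmink l z)"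
    "cmink l z = 0 \<Longrightarrow> z \<noteq> 0 \<Longrightarrow> proj_pt z = proj_pt l"
proof -
  have F': "cmink l l = 0" "cmink l' l' = 0" "cmink l l' = 1"
    "cmink l n = 0" "cmink l' n = 0" "cmink n n = 1" "cmink l' l = 1" "cmink n l = 0" "cmink n l' = 0"
    using F by (auto simp: null_frame_def cmink_commute)
  note e = null_frame_expand[OF F z(1)]
  obtain h k g where hkg: "h = cmink l z" "k = cmink l' z" "g = cmink n z" by blast
  have e': "z = h *s l' + k *s l + g *s n" using e unfolding hkg .
  have "cmink z z = 2 * h * k + g\<^sup>2"
    by (simp only: e') (simp add: cmink_linear F' algebra_simps power2_eq_square)
  then have *: "2 * h * k = - g\<^sup>2" using z(2) by (simp add: eq_neg_iff_add_eq_0)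
  then show "2 * cmink l z * cmink l' z = - (cmink n z)\<^sup>2" by (simp add: hkg)
  show "z = cmink l z *s conic l l' n (cmink n z / cmink l z)" if "cmink l z \<noteq> 0"
  proof -
    have h: "h \<noteq> 0" using that hkg by simp
    have k: "h * (- (g / h)\<^sup>2 / 2) = k" using h * by (simp add: field_simps power2_eq_square)
    have e2: "h *s (l' + (g / h) *s n + y *s l) = h *s l' + (h * y) *s l + g *s n" for y
      using h by (simp add: vec_eq_iff algebra_simps)
    have "z = h *s (l' + (g / h) *s n + (- (g / h)\<^sup>2 / 2) *s l)" unfolding e2 k by (rule e')
    then show ?thesis by (simp add: hkg)
  qed
  show "proj_pt z = proj_pt l" if h: "cmink l z = 0" and "z \<noteq> 0"
  proof -
    have "g = 0" using * h by (simp add: hkg)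
    moreover have "h = 0" using h hkg(1) by simp
    ultimately have "z = k *s l" using e' by (simp add: vec_smult_rules)
    moreover from this have "k \<noteq> 0" using \<open>z \<noteq> 0\<close> by auto
    ultimately show ?thesis by (metis proj_pt_scale)
  qed
qed

text \<open>A second point of the conic is found on any line of the first ruling that does not pass
  through \<open>l\<close>.\<close>

lemma null_frame_extend:
  assumes A: "cmink A A \<noteq> 0" and l: "cmink A l = 0" "cmink l l = 0" "l \<noteq> 0"
  obtains l' n where "null_frame A l l' n"
proof -
  obtain w where w: "w \<noteq> fst (Psi (proj_pt l))" by (metis option.distinct(1))
  obtain w2 where w2: "cmink A (Psi_rep (w, w2)) = 0" using hyperplane_section1[OF A, of w] by blast
  define y where "y = Psi_rep (w, w2)"
  have y: "y \<noteq> 0" "cmink y y = 0" "cmink A y = 0" using w2 by (simp_all add: y_def Psi_rep_nonzero Psi_rep_null)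
  have "cmink l y \<noteq> 0"
  proof
    assume "cmink l y = 0"
    then obtain a where "l = a *s y" using null_in_hyperplane_parallel[OF A l(2,1) y] by blast
    moreover from this have "a \<noteq> 0" using l(3) by auto
    ultimately have "proj_pt l = proj_pt y" by (metis proj_pt_scale)
    then show False using w by (simp add: y_def del: Psi_rep.simps)
  qed
  then have "cmink A ((1 / cmink l y) *s y) = 0" "cmink ((1 / cmink l y) *s y) ((1 / cmink l y) *s y) = 0"
    "cmink l ((1 / cmink l y) *s y) = 1" using y by (simp_all add: cmink_linear)
  then show ?thesis using null_frame_exists[OF A l(1,2)] that by metis
qed

text \<open>Complex conjugation swaps the two factors of the quadric and conjugates each, so a point
  is orthogonal to its conjugate exactly if it is its own conjugate.\<close>

lemma herm_Psi_rep_eq_0: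
  "herm (Psi_rep (w1, w2)) = 0 \<longleftrightarrow> w2 = map_option cnj w1"
proof -
  have "cnjv (Psi_rep (w1, w2)) = Psi_rep (map_option cnj w2, map_option cnj w1)"
    by (cases w1; cases w2) (simp_all add: vec_eq_iff forall_4 algebra_simps)
  then have "herm (Psi_rep (w1, w2)) = 0 \<longleftrightarrow> cmink (Psi_rep (w1, w2)) (Psi_rep (map_option cnj w2, map_option cnj w1)) = 0"
    using herm_eq[of "Psi_rep (w1, w2)"] by (metis of_real_0 of_real_eq_iff)
  also have "\<dots> \<longleftrightarrow> w1 = map_option cnj w2 \<or> w2 = map_option cnj w1" by (simp add: cmink_Psi_rep_eq_0)
  also have "\<dots> \<longleftrightarrow> w2 = map_option cnj w1" by (cases w1; cases w2) auto
  finally show ?thesis .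
qed

lemma cnjv_Psi_rep_diagonal: "cnjv (Psi_rep (w, map_option cnj w)) = Psi_rep (w, map_option cnj w)"
  by (cases w) (simp_all add: vec_eq_iff forall_4 algebra_simps)

lemma cmink_self_re_im:
  "Re (cmink z z) = mink (re_vec z) (re_vec z) - mink (im_vec z) (im_vec z)"
  "Im (cmink z z) = 2 * mink (re_vec z) (im_vec z)"
  "herm z = mink (re_vec z) (re_vec z) + mink (im_vec z) (im_vec z)"
  unfolding herm_def cmod_power2
  by (simp_all add: cmink_def mink_def re_vec_def im_vec_def power2_eq_square algebra_simps)

lemma norm_vec_smult: "norm (a *s z) = norm a * norm (z :: complex^4)"
  by (simp add: norm_vec_def L2_set_def norm_mult power_mult_distrib sum_distrib_left[symmetric] real_sqrt_mult)

lemma herm_le_norm: "herm z \<le> (norm z)\<^sup>2"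
proof -
  have "(norm z)\<^sup>2 = (norm (z$1))\<^sup>2 + (norm (z$2))\<^sup>2 + (norm (z$3))\<^sup>2 + (norm (z$4))\<^sup>2"
    by (simp add: norm_vec_def L2_set_def sum_4)
  then show ?thesis by (simp add: herm_def)
qed

text \<open>The negated bound includes infinite sets, for which \<open>card\<close> is 0.\<close>

lemma subset_card_minus:
  assumes "L \<in> X" "\<not> (finite X \<and> card X \<le> n)" "n \<ge> 1"
  obtains S where "S \<subseteq> X - {L}" "finite S" "card S = n"
proof (cases "finite X")
  case True
  then have "n \<le> card (X - {L})" using assms by (simp add: card_Diff_singleton)
  then show ?thesis by (rule obtain_subset_with_card_n) (use that in blast)
next
  case False
  then have "infinite (X - {L})" by simp
  from infinite_arbitrarily_large[OF this, of n] show ?thesis using that by blast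
qed

section \<open>The Gauss image in the quadric\<close>

context stationary begin

lemma \<phi>_nonzero: "c \<in> Iso \<Longrightarrow> p \<in> fst c \<Longrightarrow> \<phi> c p \<noteq> 0"
  using \<phi>_null(3)[of c p] by (auto simp: herm_def)

abbreviation "G \<equiv> gauss_image T \<A> x"
abbreviation "\<psi>1 \<equiv> psi1 T \<A> x"
abbreviation "\<psi>2 \<equiv> psi2 T \<A> x"

lemma gauss_image_eq: "G = {proj_pt (\<phi> c p) |c p. c \<in> Iso \<and> p \<in> fst c}"
proof -
  have "gauss_map T \<A> x p \<in> {proj_pt (\<phi> c p) |c p. c \<in> Iso \<and> p \<in> fst c}" if "p \<in> topspace T" for p
    using Iso_cover[OF that] gauss_map_eq by blast
  moreover have "proj_pt (\<phi> c p) \<in> gauss_map T \<A> x ` topspace T" if "c \<in> Iso" "p \<in> fst c" for c p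
    using gauss_map_eq[OF that] chart_subset[OF that(1)] that(2) by (metis image_eqI subsetD)
  ultimately show ?thesis unfolding gauss_image_def by blast
qed

lemma gauss_image_subset_quadric: "c \<in> Iso \<Longrightarrow> p \<in> fst c \<Longrightarrow> proj_pt (\<phi> c p) \<in> quadric"
  unfolding quadric_def using \<phi>_null(1)[of c p] \<phi>_nonzero[of c p] by blast

lemma gauss_image_subset_hyperplane:
  "G \<subseteq> hyperplane A \<longleftrightarrow> (\<forall>c\<in>Iso. \<forall>p\<in>fst c. cmink A (\<phi> c p) = 0)"
proof -
  have "proj_pt (\<phi> c p) \<in> hyperplane A \<longleftrightarrow> cmink A (\<phi> c p) = 0" if "c \<in> Iso" "p \<in> fst c" for c p
    using gauss_image_subset_quadric[OF that] by (simp add: proj_pt_in_hyperplane)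
  then show ?thesis unfolding gauss_image_eq by blast
qed

lemma real_point_omitted:
  assumes "herm l = 0" shows "proj_pt l \<notin> G"
proof
  assume "proj_pt l \<in> G"
  then obtain c p where c: "c \<in> Iso" "p \<in> fst c" "proj_pt (\<phi> c p) = proj_pt l" unfolding gauss_image_eq by auto
  then obtain a where "\<phi> c p = a *s l" unfolding proj_pt_eq_iff by blast
  then have "herm (\<phi> c p) = 0" by (simp add: herm_scale assms)
  then show False using \<phi>_null(3)[OF c(1,2)] by simp
qed

subsection \<open>Identity theorem\<close>

lemma functional_transition:
  assumes "c \<in> Iso" "c' \<in> Iso" "p \<in> fst c" "p \<in> fst c'"
  shows "cmink u (\<phi> c p) = 0 \<longleftrightarrow> cmink u (\<phi> c' p) = 0"
    "cmink u (\<phi> c p) / cmink u' (\<phi> c p) = cmink u (\<phi> c' p) / cmink u' (\<phi> c' p)"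
proof -
  obtain d where "d \<noteq> 0" "\<phi> c p = d *s \<phi> c' p" by (rule Iso_transition[OF assms])
  then show "cmink u (\<phi> c p) = 0 \<longleftrightarrow> cmink u (\<phi> c' p) = 0"
    "cmink u (\<phi> c p) / cmink u' (\<phi> c p) = cmink u (\<phi> c' p) / cmink u' (\<phi> c' p)" by (simp_all add: cmink_linear)
qed

text \<open>The property \<open>Z\<close> of vanishing identically near a point is locally constant
  by analytic continuation on a coordinate disc, hence constant on the connected surface.\<close>

lemma functional_identity:
  assumes V: "openin T V" "p0 \<in> V" "\<And>c q. c \<in> Iso \<Longrightarrow> q \<in> V \<Longrightarrow> q \<in> fst c \<Longrightarrow> cmink u (\<phi> c q) = 0"
    and c: "c \<in> Iso" "q \<in> fst c"
  shows "cmink u (\<phi> c q) = 0"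
proof -
  define Z where "Z p \<longleftrightarrow> (\<exists>V. openin T V \<and> p \<in> V \<and> (\<forall>c\<in>Iso. \<forall>q\<in>V. q \<in> fst c \<longrightarrow> cmink u (\<phi> c q) = 0))" for p
  have "Z q = Z p0"
  proof (rule locally_constant_imp_constant)
    show "p0 \<in> topspace T" "q \<in> topspace T" using V openin_subset chart_subset c by blast+
    fix p assume "p \<in> topspace T"
    then obtain c where c: "c \<in> Iso" "p \<in> fst c" using Iso_cover by blast
    obtain r where r: "r > 0" "ball (snd c p) r \<subseteq> img c"
      using chart_open_range[OF c(1)] c(2) open_contains_ball by (metis imageI)
    define W where "W = {q \<in> fst c. snd c q \<in> ball (snd c p) r}"
    have W: "openin T W" "p \<in> W" using chart_open_vimage[OF c(1) open_ball] c r(1) by (auto simp: W_def)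
    have zero: "cmink u (\<phi> c' q') = 0" if H: "q \<in> W" "Z q" "q' \<in> W" "c' \<in> Iso" "q' \<in> fst c'" for q q' c'
    proof -
      obtain V0 where V0: "openin T V0" "q \<in> V0" "\<And>c q. c \<in> Iso \<Longrightarrow> q \<in> V0 \<Longrightarrow> q \<in> fst c \<Longrightarrow> cmink u (\<phi> c q) = 0"
        using H(2) unfolding Z_def by blast
      let ?U = "snd c ` (W \<inter> V0)"
      have "open ?U" by (rule chart_open_image[OF c(1)]) (use W V0 in \<open>auto simp: W_def\<close>)
      have U: "?U \<noteq> {}" "?U \<subseteq> ball (snd c p) r" using H(1) V0(2) by (auto simp: W_def)
      have hol: "(\<lambda>z. cmink u (\<phi> c (chart_inv c z))) holomorphic_on ball (snd c p) r"
        by (rule holomorphic_on_subset[OF cmink_\<phi>_holomorphic[OF c(1)] r(2)])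
      have "cmink u (\<phi> c (chart_inv c (snd c q'))) = 0"
      proof (rule analytic_continuation_open[OF \<open>open ?U\<close> open_ball U(1) connected_ball U(2) hol])
        show "(\<lambda>_. 0) holomorphic_on ball (snd c p) r" by simp
        show "snd c q' \<in> ball (snd c p) r" using H(3) by (simp add: W_def)
        fix z assume "z \<in> ?U"
        then obtain s where s: "s \<in> fst c" "s \<in> V0" "z = snd c s" by (auto simp: W_def)
        then show "cmink u (\<phi> c (chart_inv c z)) = 0" using V0(3)[OF c(1)] chart_inv_chart[OF c(1)] by simp
      qed
      moreover have "q' \<in> fst c" using H(3) by (simp add: W_def)
      ultimately show ?thesis
        using functional_transition(1)[OF c(1) H(4) _ H(5)] chart_inv_chart[OF c(1)] by simp
    qed
    then have "Z q' = Z p" if "q' \<in> W" for q' using W that unfolding Z_def by blast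
    then show "\<exists>V. openin T V \<and> p \<in> V \<and> (\<forall>q\<in>V. Z q = Z p)" using W by blast
  qed
  moreover have "Z p0" unfolding Z_def using V by blast
  ultimately show ?thesis using c unfolding Z_def by blast
qed

text \<open>On the open set where the first functional does not vanish the second one does, and the
  identity theorem spreads this to the whole surface.\<close>

lemma functional_product_zero:
  assumes "\<And>c p. c \<in> Iso \<Longrightarrow> p \<in> fst c \<Longrightarrow> cmink u (\<phi> c p) = 0 \<or> cmink u' (\<phi> c p) = 0"
    and c: "c \<in> Iso" "p \<in> fst c" "cmink u (\<phi> c p) \<noteq> 0" and c': "c' \<in> Iso" "q \<in> fst c'"
  shows "cmink u' (\<phi> c' q) = 0"
proof -
  let ?f = "\<lambda>z. cmink u (\<phi> c (chart_inv c z))"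
  have "open (img c \<inter> ?f -` (- {0}))"
    by (rule continuous_open_preimage[OF holomorphic_on_imp_continuous_on[OF cmink_\<phi>_holomorphic[OF c(1)]] chart_open_range[OF c(1)]]) auto
  from chart_open_vimage[OF c(1) this]
  have V: "openin T {q \<in> fst c. snd c q \<in> img c \<inter> ?f -` (- {0})}" (is "openin T ?V") .
  have eq: "cmink u (\<phi> c q) \<noteq> 0 \<and> q \<in> fst c" if "q \<in> ?V" for q using that chart_inv_chart[OF c(1), of q] by simp
  show ?thesis
  proof (rule functional_identity[OF V _ _ c'])
    show "p \<in> ?V" using c chart_inv_chart[OF c(1)] by auto
    show "cmink u' (\<phi> c'' q) = 0" if "c'' \<in> Iso" "q \<in> ?V" "q \<in> fst c''" for c'' q
      using eq[OF that(2)] functional_transition(1)[OF c(1) that(1) _ that(3)] assms(1)[OF that(1,3)] by blast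
  qed
qed

subsection \<open>Surfaces with constant Gauss map\<close>

lemma in_chart_derivative:
  assumes c: "c \<in> Iso" "p \<in> fst c"
  shows "((\<lambda>z. X c z $ k) has_derivative (\<lambda>h. 2 * Re (\<phi> c p $ k * h))) (at (snd c p))"
proof -
  have "(X c has_derivative (\<lambda>h. Re h *\<^sub>R pd 1 (X c) (snd c p) + Im h *\<^sub>R pd 2 (X c) (snd c p))) (at (snd c p))"
    by (rule has_derivative_pd[OF smooth_onD(1)[OF Iso_X_smooth[OF c(1)]]]) (use c in auto)
  from bounded_linear.has_derivative[OF bounded_linear_vec_nth this, of k]
  have "((\<lambda>z. X c z $ k) has_derivative (\<lambda>h. Re h * (2 * Re (\<phi> c p $ k)) + Im h * (- 2 * Im (\<phi> c p $ k)))) (at (snd c p))"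
    by (simp add: \<phi>_def pd_X_dz)
  then show ?thesis by (rule back_subst[where P = "\<lambda>f'. (_ has_derivative f') _"]) (simp add: fun_eq_iff algebra_simps)
qed

text \<open>The field normalizes \<phi> to the constant vector \<open>b\<close>, so along its
  integral curve the immersion is affine in the complex time.\<close>

lemma sol_derivative:
  assumes vf: "holomorphic_vector_field T Iso v" and sol: "holomorphic_vector_field.sol T Iso v \<Phi> UNIV"
    and v: "\<And>c p. c \<in> Iso \<Longrightarrow> p \<in> fst c \<Longrightarrow> v c p *s \<phi> c p = b"
  shows "x (\<Phi> w) $ k = x (\<Phi> 0) $ k + 2 * Re (b $ k * w)"
proof -
  interpret holomorphic_vector_field T Iso v by (rule vf)
  have "((\<lambda>w. x (\<Phi> w) $ k - 2 * Re (b $ k * w)) has_derivative (\<lambda>h. 0)) (at w within UNIV)" for w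
  proof -
    have "\<Phi> w \<in> topspace T" using solD(1)[OF sol] by blast
    then obtain c where c: "c \<in> Iso" "\<Phi> w \<in> fst c" using Iso_cover by blast
    have "((snd c \<circ> \<Phi>) has_derivative (*) (v c (\<Phi> w))) (at w)"
      using solD(3)[OF sol _ c] by (simp add: has_field_derivative_def)
    moreover have "((\<lambda>z. X c z $ k) has_derivative (\<lambda>h. 2 * Re (\<phi> c (\<Phi> w) $ k * h))) (at ((snd c \<circ> \<Phi>) w))"
      using in_chart_derivative[OF c, of k] by simp
    ultimately have "((\<lambda>w. X c ((snd c \<circ> \<Phi>) w) $ k) has_derivative (\<lambda>h. 2 * Re (\<phi> c (\<Phi> w) $ k * (v c (\<Phi> w) * h)))) (at w)"
      by (rule has_derivative_compose)
    moreover have "\<phi> c (\<Phi> w) $ k * (v c (\<Phi> w) * h) = b $ k * h" for h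
    proof -
      have "b $ k = v c (\<Phi> w) * \<phi> c (\<Phi> w) $ k" using v[OF c] by (metis vector_smult_component)
      then show ?thesis by simp
    qed
    ultimately have "((\<lambda>w. X c ((snd c \<circ> \<Phi>) w) $ k) has_derivative (\<lambda>h. 2 * Re (b $ k * h))) (at w)" by simp
    moreover have "\<forall>\<^sub>F w in nhds w. X c ((snd c \<circ> \<Phi>) w) $ k = x (\<Phi> w) $ k"
      using solD(2)[OF sol _ c] chart_inv_chart[OF c(1)] by (auto elim!: eventually_mono simp: in_chart_def)
    ultimately have "((\<lambda>w. x (\<Phi> w) $ k) has_derivative (\<lambda>h. 2 * Re (b $ k * h))) (at w)"
      using has_derivative_transform_eventually[of "\<lambda>w. X c ((snd c \<circ> \<Phi>) w) $ k" _ w UNIV "\<lambda>w. x (\<Phi> w) $ k"]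
      by (simp add: eventually_nhds_conv_at)
    moreover have "((\<lambda>w. 2 * Re (b $ k * w)) has_derivative (\<lambda>h. 2 * Re (b $ k * h))) (at w)"
      by (rule bounded_linear_imp_has_derivative[OF bounded_linear_const_mult[OF bounded_linear_compose[OF bounded_linear_Re bounded_linear_mult_right]]])
    ultimately have "((\<lambda>w. x (\<Phi> w) $ k - 2 * Re (b $ k * w)) has_derivative (\<lambda>h. 2 * Re (b $ k * h) - 2 * Re (b $ k * h))) (at w)"
      by (rule has_derivative_diff)
    then show ?thesis by simp
  qed
  from has_derivative_zero_unique[OF convex_UNIV this, of w 0] show ?thesis by simp
qed

text \<open>The tangent planes are all spanned by the real and imaginary part of \<open>b\<close>,
  so a functional annihilating both has zero differential on the surface.\<close>

lemma constant_functional: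
  assumes b: "\<And>c p. c \<in> Iso \<Longrightarrow> p \<in> fst c \<Longrightarrow> \<exists>a. \<phi> c p = a *s b"
    and y: "y \<bullet> re_vec b = 0" "y \<bullet> im_vec b = 0" and pq: "p \<in> topspace T" "q \<in> topspace T"
  shows "y \<bullet> x q = y \<bullet> x p"
proof (rule locally_constant_imp_constant[OF _ pq])
  fix p assume "p \<in> topspace T"
  then obtain c where c: "c \<in> Iso" "p \<in> fst c" using Iso_cover by blast
  obtain r where r: "r > 0" "ball (snd c p) r \<subseteq> img c"
    using chart_open_range[OF c(1)] c(2) open_contains_ball by (metis imageI)
  have "((\<lambda>z. y \<bullet> X c z) has_derivative (\<lambda>h. 0)) (at z within ball (snd c p) r)" if z: "z \<in> ball (snd c p) r" for z
  proof -
    obtain s where s: "s \<in> fst c" "z = snd c s" using z r(2) by auto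
    obtain a where a: "\<phi> c s = a *s b" using b[OF c(1) s(1)] by blast
    have "((\<lambda>z. \<Sum>k\<in>UNIV. y $ k * X c z $ k) has_derivative (\<lambda>h. \<Sum>k\<in>UNIV. y $ k * (2 * Re (\<phi> c s $ k * h)))) (at z)"
      unfolding s(2) by (intro has_derivative_sum has_derivative_mult_right in_chart_derivative[OF c(1) s(1)])
    moreover have "(\<Sum>k\<in>UNIV. y $ k * (2 * Re (\<phi> c s $ k * h))) = 0" for h
    proof -
      have "(\<Sum>k\<in>UNIV. y $ k * (2 * Re (\<phi> c s $ k * h))) = 2 * Re (a * h) * (y \<bullet> re_vec b) - 2 * Im (a * h) * (y \<bullet> im_vec b)"
        unfolding inner_vec_def sum_distrib_left sum_subtractf[symmetric]
        by (rule sum.cong) (simp_all add: a re_vec_def im_vec_def algebra_simps)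
      then show ?thesis using y by simp
    qed
    ultimately show ?thesis by (simp add: inner_vec_def has_derivative_at_withinI)
  qed
  then have const: "y \<bullet> X c z = y \<bullet> X c (snd c p)" if "z \<in> ball (snd c p) r" for z
    using has_derivative_zero_unique[OF convex_ball, of "snd c p" r "\<lambda>z. y \<bullet> X c z" z "snd c p"] that r(1) by auto
  show "\<exists>V. openin T V \<and> p \<in> V \<and> (\<forall>q\<in>V. y \<bullet> x q = y \<bullet> x p)"
  proof (intro exI conjI ballI)
    show "openin T {q \<in> fst c. snd c q \<in> ball (snd c p) r}" by (rule chart_open_vimage[OF c(1) open_ball])
    show "p \<in> {q \<in> fst c. snd c q \<in> ball (snd c p) r}" using c r by simp
    fix q assume "q \<in> {q \<in> fst c. snd c q \<in> ball (snd c p) r}"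
    then show "y \<bullet> x q = y \<bullet> x p"
      using const[of "snd c q"] chart_inv_chart[OF c(1)] c(2) by (simp add: in_chart_def)
  qed
qed

text \<open>The field normalizing \<phi> to \<open>b\<close> has constant length, so by completeness
  it flows for all complex times, and the flow already covers an affine plane. Functionals that
  annihilate the direction of this plane show that the surface does not leave it.\<close>

lemma constant_gauss_map_imp_plane:
  assumes complete: "complete_surface T \<A> x"
    and b: "\<And>c p. c \<in> Iso \<Longrightarrow> p \<in> fst c \<Longrightarrow> \<exists>a. \<phi> c p = a *s b"
  shows "affine_plane T x"
proof -
  obtain p0 where p0: "p0 \<in> topspace T" using nonempty by blast
  obtain c0 where c0: "c0 \<in> Iso" "p0 \<in> fst c0" using Iso_cover[OF p0] by blast
  obtain a0 where a0: "\<phi> c0 p0 = a0 *s b" using b[OF c0] by blast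
  have hb: "herm b > 0" using \<phi>_null(3)[OF c0] unfolding a0 herm_scale by (simp add: zero_less_mult_iff)
  have nb: "cmink b b = 0" using \<phi>_null(1)[OF c0] \<phi>_nonzero[OF c0] unfolding a0 by (auto simp: cmink_linear)
  \<comment> \<open>Pairing with the conjugate of \<open>b\<close> recovers the factor of
    \<open>b\<close>, because <b, conj b> > 0.\<close>
  define u where "u = (1 / of_real (herm b)) *s cnjv b"
  have ub: "cmink u b = 1" using hb by (simp add: u_def cmink_linear cmink_commute[of "cnjv b"] herm_eq[symmetric])
  define H where "H c p = cmink u (\<phi> c p)" for c p
  have H: "\<phi> c p = H c p *s b" "H c p \<noteq> 0" if c: "c \<in> Iso" "p \<in> fst c" for c p
  proof -
    obtain a where a: "\<phi> c p = a *s b" using b[OF c] by blast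
    then have "H c p = a" by (simp add: H_def cmink_linear ub)
    then show "\<phi> c p = H c p *s b" using a by simp
    then show "H c p \<noteq> 0" using \<phi>_nonzero[OF c] by auto
  qed
  define v where "v c p = 1 / H c p" for c p
  have vf: "holomorphic_vector_field T Iso v"
  proof
    fix c assume c: "c \<in> Iso"
    show "(\<lambda>z. v c (chart_inv c z)) holomorphic_on img c"
      unfolding v_def H_def by (intro holomorphic_intros cmink_\<phi>_holomorphic[OF c]) (use H(2)[OF c chart_inv_in] in \<open>simp add: H_def\<close>)
  next
    fix c c' p d assume c: "c \<in> Iso" "c' \<in> Iso" and p: "p \<in> fst c" "p \<in> fst c'"
      and d: "(change c c' has_field_derivative d) (at (snd c p))"
    obtain d' where d': "d' \<noteq> 0" "(change c c' has_field_derivative d') (at (snd c p))" "\<phi> c p = d' *s \<phi> c' p"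
      by (rule Iso_transition[OF c p])
    have "d' = d" using d d'(2) DERIV_unique by blast
    then show "v c' p = d * v c p" unfolding v_def H_def d'(3) using d'(1) by (simp add: cmink_linear)
  qed
  have v0: "v c0 p0 \<noteq> 0" using H(2)[OF c0] by (simp add: v_def)
  obtain \<Phi> where \<Phi>: "holomorphic_vector_field.sol T Iso v \<Phi> UNIV" "\<Phi> 0 = p0"
  proof (rule complete_imp_entire_sol[OF complete vf c0 v0, of 0])
    fix R :: real and \<Phi> assume R: "R > 0"
    have "sqrt (2 * herm (\<phi> c (\<Phi> w))) * norm (v c (\<Phi> w)) \<le> sqrt (2 * herm b) * (R - norm w) powr - 0"
      if "w \<in> ball 0 R" "c \<in> Iso" "\<Phi> w \<in> fst c" for w c
    proof -
      have "sqrt (2 * herm (\<phi> c (\<Phi> w))) = norm (H c (\<Phi> w)) * sqrt (2 * herm b)"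
        by (subst H(1)[OF that(2,3)]) (simp add: herm_scale real_sqrt_mult)
      then show ?thesis using H(2)[OF that(2,3)] that(1) by (simp add: v_def norm_divide)
    qed
    then show "\<exists>C. \<forall>w\<in>ball 0 R. \<forall>c\<in>Iso. \<Phi> w \<in> fst c \<longrightarrow>
        sqrt (2 * herm (\<phi> c (\<Phi> w))) * norm (v c (\<Phi> w)) \<le> C * (R - norm w) powr (- 0)" by blast
  qed auto
  have "v c p *s \<phi> c p = b" if "c \<in> Iso" "p \<in> fst c" for c p
    using H(2)[OF that] by (subst H(1)[OF that]) (simp add: v_def vec_smult_rules)
  from sol_derivative[OF vf \<Phi>(1) this]
  have x\<Phi>: "x (\<Phi> w) = x p0 + (2 * Re w) *\<^sub>R re_vec b + (- 2 * Im w) *\<^sub>R im_vec b" for w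
    by (simp add: vec_eq_iff \<Phi>(2) re_vec_def im_vec_def algebra_simps)
  let ?S = "span {re_vec b, im_vec b}"
  have "x ` topspace T = (+) (x p0) ` ?S"
  proof
    show "x ` topspace T \<subseteq> (+) (x p0) ` ?S"
    proof (rule image_subsetI)
      fix q assume q: "q \<in> topspace T"
      \<comment> \<open>Euclidean orthogonality serves only to produce a functional that annihilates
        the plane.\<close>
      obtain y z where yz: "y \<in> ?S" "\<And>w. w \<in> ?S \<Longrightarrow> orthogonal z w" "x q - x p0 = y + z"
        using orthogonal_subspace_decomp_exists[of "{re_vec b, im_vec b}" "x q - x p0"] by metis
      have "re_vec b \<in> ?S" "im_vec b \<in> ?S" by (simp_all add: span_base)
      then have "z \<bullet> x q = z \<bullet> x p0"
        by (intro constant_functional[OF b _ _ p0 q]) (use yz(2) in \<open>auto simp: orthogonal_def\<close>)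
      then have "z \<bullet> (y + z) = 0" unfolding yz(3)[symmetric] by (simp add: inner_diff_right)
      then have "z = 0" using yz(2)[OF yz(1)] by (simp add: inner_add_right orthogonal_def)
      then have "x q = x p0 + y" using yz(3) by (simp add: algebra_simps)
      then show "x q \<in> (+) (x p0) ` ?S" using yz(1) by blast
    qed
    show "(+) (x p0) ` ?S \<subseteq> x ` topspace T"
    proof (rule image_subsetI)
      fix y assume "y \<in> ?S"
      then obtain \<alpha> where "y - \<alpha> *\<^sub>R re_vec b \<in> span {im_vec b}" by (auto simp: span_breakdown_eq)
      then obtain \<beta> where "y - \<alpha> *\<^sub>R re_vec b = \<beta> *\<^sub>R im_vec b" by (auto simp: span_singleton)
      then have "x p0 + y = x (\<Phi> (Complex (\<alpha> / 2) (- \<beta> / 2)))" by (simp add: x\<Phi> algebra_simps)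
      moreover have "\<Phi> w \<in> topspace T" for w using holomorphic_vector_field.solD(1)[OF vf \<Phi>(1)] by blast
      ultimately show "x p0 + y \<in> x ` topspace T" by auto
    qed
  qed
  moreover have "dim {re_vec b, im_vec b} = 2"
  proof -
    have m: "mink (re_vec b) (im_vec b) = 0" "mink (re_vec b) (re_vec b) > 0" "mink (im_vec b) (im_vec b) > 0"
      using cmink_self_re_im[of b] nb hb by auto
    have i0: "im_vec b \<noteq> 0" using m(3) by (auto simp: mink_zero)
    have ns: "re_vec b \<notin> span {im_vec b}"
    proof
      assume "re_vec b \<in> span {im_vec b}"
      then obtain k where "re_vec b = k *\<^sub>R im_vec b" by (auto simp: span_singleton)
      then have "mink (re_vec b) (re_vec b) = k * mink (re_vec b) (im_vec b)"
        by (metis mink_scaleR_right)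
      then show False using m by simp
    qed
    then have "re_vec b \<noteq> im_vec b" using span_base[of "im_vec b" "{im_vec b}"] by auto
    moreover have "independent {re_vec b, im_vec b}" using ns i0 by (auto simp: independent_insert)
    ultimately show ?thesis by (simp add: dim_eq_card_independent)
  qed
  ultimately show ?thesis
    unfolding affine_plane_def
    by (simp add: affine_translation[symmetric] subspace_imp_affine aff_dim_translation_eq aff_dim_subspace)
qed

end

subsection \<open>Points omitted by the Gauss map\<close>

text \<open>For real \<open>l\<close> the products of \<open>l\<close> with its own conjugate and
  with that of \<open>n\<close> vanish, so the coefficient of \<open>l\<close> enters only linearly.
  On the conic the form thus grows like |g|^2 and not like |g|^4, which lowers \<open>m\<close> from
  2 to 1.\<close>

lemma herm_frame:
  assumes F: "null_frame A l l' n" and l: "cnjv l = l"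
  shows "herm (l' + g *s n + q *s l) = herm l' + (norm g)\<^sup>2 * herm n + 2 * Re (g * cmink n (cnjv l')) + 2 * Re q"
proof -
  have F': "cmink l l = 0" "cmink l l' = 1" "cmink l' l = 1" "cmink l n = 0" "cmink n l = 0"
    using F by (auto simp: null_frame_def cmink_commute)
  have c1: "cmink l (cnjv l') = 1" using cmink_cnjv[of l l'] F' l by simp
  have c2: "cmink l (cnjv n) = 0" using cmink_cnjv[of l n] F' l by simp
  have c3: "cmink l' (cnjv n) = cnj (cmink n (cnjv l'))"
    using cmink_cnjv[of n "cnjv l'"] by (simp add: cnjv_linear cmink_commute)
  have "complex_of_real (herm (l' + g *s n + q *s l)) = of_real (herm l') + g * cnj g * of_real (herm n)
      + (g * cmink n (cnjv l') + cnj (g * cmink n (cnjv l'))) + (q + cnj q)"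
    unfolding herm_eq cnjv_linear cmink_linear l c1 c2 c3 F' by (simp add: algebra_simps)
  from arg_cong[OF this, of Re] show ?thesis by (simp add: complex_mult_cnj cmod_power2)
qed

lemma sqrt_herm_frame_bound:
  assumes F: "null_frame A l l' n"
  obtains C where "\<And>g. sqrt (2 * herm (conic l l' n g)) \<le> C * (1 + norm g) ^ 2"
proof
  fix g :: complex
  define K where "K = norm l' + norm n + norm l"
  have n1: "1 \<le> (1 + norm g)\<^sup>2" "norm g \<le> (1 + norm g)\<^sup>2" "(norm g)\<^sup>2 / 2 \<le> (1 + norm g)\<^sup>2"
    by (simp_all add: power2_eq_square algebra_simps)
  have "norm (conic l l' n g) \<le> norm l' + norm (g *s n) + norm ((- g\<^sup>2 / 2) *s l)"
    by (rule order_trans[OF norm_triangle_ineq]) (simp add: norm_triangle_ineq)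
  also have "\<dots> = 1 * norm l' + norm g * norm n + (norm g)\<^sup>2 / 2 * norm l"
    unfolding norm_vec_smult by (simp add: norm_divide norm_power)
  also have "\<dots> \<le> (1 + norm g)\<^sup>2 * norm l' + (1 + norm g)\<^sup>2 * norm n + (1 + norm g)\<^sup>2 * norm l"
    by (intro add_mono mult_right_mono n1) auto
  finally have b: "norm (conic l l' n g) \<le> K * (1 + norm g)\<^sup>2" by (simp add: K_def algebra_simps)
  have "sqrt (2 * herm z) \<le> sqrt 2 * norm z" for z
    using real_sqrt_le_mono[OF mult_left_mono[OF herm_le_norm[of z], of 2]] by (simp add: real_sqrt_mult)
  then have "sqrt (2 * herm (conic l l' n g)) \<le> sqrt 2 * norm (conic l l' n g)" .
  also have "\<dots> \<le> sqrt 2 * (K * (1 + norm g)\<^sup>2)" by (rule mult_left_mono[OF b]) simp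
  finally show "sqrt (2 * herm (conic l l' n g)) \<le> (sqrt 2 * K) * (1 + norm g) ^ 2" by (simp only: mult.assoc)
qed

lemma sqrt_herm_real_frame_bound:
  assumes F: "null_frame A l l' n" and l: "cnjv l = l"
  obtains C where "\<And>g. sqrt (2 * herm (conic l l' n g)) \<le> C * (1 + norm g) ^ 1"
proof
  fix g :: complex
  define K where "K = \<bar>herm l'\<bar> + \<bar>herm n\<bar> + 2 * norm (cmink n (cnjv l')) + 1"
  have n1: "1 \<le> (1 + norm g)\<^sup>2" "norm g \<le> (1 + norm g)\<^sup>2" "(norm g)\<^sup>2 \<le> (1 + norm g)\<^sup>2"
    by (simp_all add: power2_eq_square algebra_simps)
  have "herm (conic l l' n g) = herm l' + (norm g)\<^sup>2 * herm n + 2 * Re (g * cmink n (cnjv l')) + 2 * Re (- g\<^sup>2 / 2)"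
    by (rule herm_frame[OF F l])
  also have "\<dots> \<le> 1 * \<bar>herm l'\<bar> + (norm g)\<^sup>2 * \<bar>herm n\<bar> + norm g * (2 * norm (cmink n (cnjv l'))) + (norm g)\<^sup>2 * 1"
    using complex_Re_le_cmod[of "g * cmink n (cnjv l')"] complex_Re_le_cmod[of "- g\<^sup>2 / 2"]
    by (intro add_mono mult_left_mono) (auto simp: norm_mult norm_divide norm_power)
  also have "\<dots> \<le> (1 + norm g)\<^sup>2 * \<bar>herm l'\<bar> + (1 + norm g)\<^sup>2 * \<bar>herm n\<bar> + (1 + norm g)\<^sup>2 * (2 * norm (cmink n (cnjv l'))) + (1 + norm g)\<^sup>2 * 1"
    by (intro add_mono mult_right_mono n1) auto
  also have "\<dots> = K * (1 + norm g)\<^sup>2" by (simp add: K_def algebra_simps)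
  finally have "sqrt (2 * herm (conic l l' n g)) \<le> sqrt (2 * (K * (1 + norm g)\<^sup>2))" by simp
  also have "\<dots> = sqrt (2 * K) * (1 + norm g)" by (simp only: real_sqrt_mult real_sqrt_abs) simp
  finally show "sqrt (2 * herm (conic l l' n g)) \<le> sqrt (2 * K) * (1 + norm g) ^ 1" by simp
qed

text \<open>If \<open>l'\<close> is real too, the constant and the linear term of
  \<open>herm_frame\<close> disappear, and only terms of order |g|^2 are left.\<close>

lemma sqrt_herm_double_real_frame_bound:
  assumes F: "null_frame A l l' n" and l: "cnjv l = l" "cnjv l' = l'"
  obtains C where "\<And>g. sqrt (2 * herm (conic l l' n g)) \<le> C * norm g"
proof
  fix g :: complex
  have "complex_of_real (herm l') = 0" "cmink n (cnjv l') = 0"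
    using F l by (simp_all add: herm_eq null_frame_def cmink_commute)
  then have "herm (conic l l' n g) = (norm g)\<^sup>2 * herm n + 2 * Re (- g\<^sup>2 / 2)"
    unfolding herm_frame[OF F l(1)] by simp
  also have "\<dots> \<le> (norm g)\<^sup>2 * \<bar>herm n\<bar> + (norm g)\<^sup>2"
    using complex_Re_le_cmod[of "- g\<^sup>2 / 2"]
    by (intro add_mono mult_left_mono) (auto simp: norm_divide norm_power)
  also have "\<dots> = (norm g)\<^sup>2 * (\<bar>herm n\<bar> + 1)" by (simp add: algebra_simps)
  finally have "sqrt (2 * herm (conic l l' n g)) \<le> sqrt (2 * ((norm g)\<^sup>2 * (\<bar>herm n\<bar> + 1)))" by simp
  also have "\<dots> = sqrt (2 * (\<bar>herm n\<bar> + 1)) * norm g"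
    by (simp only: real_sqrt_mult real_sqrt_abs abs_norm_cancel mult_ac)
  finally show "sqrt (2 * herm (conic l l' n g)) \<le> sqrt (2 * (\<bar>herm n\<bar> + 1)) * norm g" .
qed

text \<open>A real null vector \<open>l\<close> orthogonal to \<open>m\<close> is orthogonal to the
  conjugate of \<open>m\<close> as well, so the Hermitian form sees only the component along
  \<open>m\<close>.\<close>

lemma herm_pencil:
  assumes l: "cnjv l = l" "cmink l l = 0" "cmink l m = 0"
  shows "herm (a *s m + b *s l) = (norm a)\<^sup>2 * herm m"
proof -
  have lc: "cmink l (cnjv m) = 0" using cmink_cnjv[of l m] l by simp
  have "complex_of_real (herm (a *s m + b *s l)) = a * cnj a * of_real (herm m)"
    unfolding herm_eq cnjv_linear cmink_linear using l lc by (simp add: cmink_commute[of m l] algebra_simps)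
  from arg_cong[OF this, of Re] show ?thesis by (simp add: complex_mult_cnj cmod_power2)
qed

text \<open>The affine coordinate of the conic that has \<open>l\<close> at infinity. Going through
  \<open>Psi_rep\<close> makes it a function of points and not of representing vectors.\<close>

definition frame_value :: "complex^4 \<Rightarrow> complex^4 \<Rightarrow> cp3 \<Rightarrow> complex" where
  "frame_value l n L = cmink n (Psi_rep (Psi L)) / cmink l (Psi_rep (Psi L))"

lemma frame_value_proj_pt:
  assumes "z \<noteq> 0" "cmink z z = 0"
  shows "frame_value l n (proj_pt z) = cmink n z / cmink l z"
proof -
  obtain a where a: "a \<noteq> 0" "z = a *s Psi_rep (Psi (proj_pt z))" by (rule null_eq_Psi_rep[OF assms])
  have "cmink n z = a * cmink n (Psi_rep (Psi (proj_pt z)))" "cmink l z = a * cmink l (Psi_rep (Psi (proj_pt z)))"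
    by (subst a(2), simp only: cmink_linear)+
  then show ?thesis using a(1) by (simp add: frame_value_def)
qed

lemma frame_value_inj:
  assumes F: "null_frame A l l' n" and z: "z \<noteq> 0" "cmink z z = 0" "cmink A z = 0" "proj_pt z \<noteq> proj_pt l"
    and z': "z' \<noteq> 0" "cmink z' z' = 0" "cmink A z' = 0" "proj_pt z' \<noteq> proj_pt l"
    and eq: "cmink n z / cmink l z = cmink n z' / cmink l z'"
  shows "proj_pt z = proj_pt z'"
proof -
  have h: "cmink l z \<noteq> 0" "cmink l z' \<noteq> 0"
    using null_frame_null_vector(3)[OF F z(3,2) _ z(1)] null_frame_null_vector(3)[OF F z'(3,2) _ z'(1)] z(4) z'(4) by blast+
  define b where "b = conic l l' n (cmink n z / cmink l z)"
  have "z = cmink l z *s b" "z' = cmink l z' *s b"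
    using null_frame_null_vector(2)[OF F z(3,2) h(1)] null_frame_null_vector(2)[OF F z'(3,2) h(2)] by (simp_all add: b_def eq)
  then show ?thesis using proj_pt_scale h by metis
qed

section \<open>Bounds for the number of omitted points\<close>

context stationary begin

text \<open>A quotient of two coefficients of 1-forms is a function on the surface; it is defined
  through an arbitrary isothermal chart at each point, and \<open>functional_transition\<close>
  removes the dependence.\<close>

lemma fujimoto_functional:
  fixes A :: "complex set" and m s N k :: nat
  assumes complete: "complete_surface T \<A> x"
    and h: "\<And>c p. c \<in> Iso \<Longrightarrow> p \<in> fst c \<Longrightarrow> cmink u0 (\<phi> c p) \<noteq> 0"
    and bound: "\<And>c p. c \<in> Iso \<Longrightarrow> p \<in> fst c \<Longrightarrow>
      sqrt (2 * herm (\<phi> c p)) \<le> C0 * norm (cmink u0 (\<phi> c p)) * (1 + norm (cmink u1 (\<phi> c p) / cmink u0 (\<phi> c p))) ^ m"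
    and A: "finite A" "card A \<ge> 2" "\<And>c p. c \<in> Iso \<Longrightarrow> p \<in> fst c \<Longrightarrow> cmink u1 (\<phi> c p) / cmink u0 (\<phi> c p) \<notin> A"
    and N: "N \<ge> 2" "card A * (N - 1) = N + 1 + k" "m * (s * N + 1) = s * k"
  obtains e where "\<And>c p. c \<in> Iso \<Longrightarrow> p \<in> fst c \<Longrightarrow> cmink u1 (\<phi> c p) = e * cmink u0 (\<phi> c p)"
proof -
  define g where "g p = (let c = (SOME c. c \<in> Iso \<and> p \<in> fst c) in cmink u1 (\<phi> c p) / cmink u0 (\<phi> c p))" for p
  have g: "g p = cmink u1 (\<phi> c p) / cmink u0 (\<phi> c p)" if c: "c \<in> Iso" "p \<in> fst c" for c p
  proof -
    have "(SOME c. c \<in> Iso \<and> p \<in> fst c) \<in> Iso \<and> p \<in> fst (SOME c. c \<in> Iso \<and> p \<in> fst c)"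
      by (rule someI_ex) (use c in blast)
    then show ?thesis using functional_transition(2)[OF _ c(1) _ c(2)] by (simp add: g_def Let_def)
  qed
  obtain p0 where p0: "p0 \<in> topspace T" using nonempty by blast
  show ?thesis
  proof (rule that[of "g p0"])
    fix c p assume c: "c \<in> Iso" "p \<in> fst c"
    have "g p = g p0"
    proof (rule fujimoto[OF complete h g _ A(1,2) _ N p0])
      show "p \<in> topspace T" using c chart_subset by blast
      show "g q \<notin> A" if "q \<in> topspace T" for q
        using Iso_cover[OF that] g A(3) by auto
      show "sqrt (2 * herm (\<phi> c p)) \<le> C0 * norm (cmink u0 (\<phi> c p)) * (1 + norm (g p)) ^ m" if "c \<in> Iso" "p \<in> fst c" for c p
        using bound[OF that] g[OF that] by simp
    qed
    then show "cmink u1 (\<phi> c p) = g p0 * cmink u0 (\<phi> c p)" using g[OF c] h[OF c] by (metis nonzero_divide_eq_eq)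
  qed
qed

text \<open>With the omitted point \<open>l\<close> at infinity the coordinate of the Gauss map is a
  finite function that omits the values at the points of \<open>S\<close>. \<open>fujimoto\<close>
  makes it constant, and then the surface is a plane.\<close>

lemma frame_omitted_bound:
  fixes m s N k :: nat
  assumes complete: "complete_surface T \<A> x" and np: "\<not> affine_plane T x"
    and F: "null_frame A l l' n" and sub: "G \<subseteq> hyperplane A" and l: "proj_pt l \<notin> G"
    and bound: "\<And>g. sqrt (2 * herm (conic l l' n g)) \<le> C0 * (1 + norm g) ^ m"
    and S: "S \<subseteq> hyperplane A - G - {proj_pt l}" "finite S" "card S \<ge> 2"
    and N: "N \<ge> 2" "card S * (N - 1) = N + 1 + k" "m * (s * N + 1) = s * k"
  shows False
proof -
  have A\<phi>: "cmink A (\<phi> c p) = 0" if "c \<in> Iso" "p \<in> fst c" for c p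
    using sub that unfolding gauss_image_subset_hyperplane by blast
  have inG: "proj_pt (\<phi> c p) \<in> G" if "c \<in> Iso" "p \<in> fst c" for c p
    unfolding gauss_image_eq using that by blast
  have h: "cmink l (\<phi> c p) \<noteq> 0" if c: "c \<in> Iso" "p \<in> fst c" for c p
    using null_frame_null_vector(3)[OF F A\<phi>[OF c] \<phi>_null(1)[OF c] _ \<phi>_nonzero[OF c]] inG[OF c] l by metis
  note rep = null_frame_null_vector(2)[OF F A\<phi> \<phi>_null(1) h]
  have inj: "inj_on (frame_value l n) S"
  proof (rule inj_onI)
    fix L L' assume L: "L \<in> S" "L' \<in> S" "frame_value l n L = frame_value l n L'"
    then have H: "L \<in> hyperplane A" "L' \<in> hyperplane A" "L \<noteq> proj_pt l" "L' \<noteq> proj_pt l" using S(1) by auto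
    obtain w where w: "L = proj_pt (Psi_rep w)" "Psi L = w" "cmink A (Psi_rep w) = 0" by (rule hyperplaneE[OF H(1)])
    obtain w' where w': "L' = proj_pt (Psi_rep w')" "Psi L' = w'" "cmink A (Psi_rep w') = 0" by (rule hyperplaneE[OF H(2)])
    show "L = L'"
      using frame_value_inj[OF F Psi_rep_nonzero Psi_rep_null w(3) _ Psi_rep_nonzero Psi_rep_null w'(3)] H(3,4) L(3)
      unfolding w(1) w'(1) frame_value_proj_pt[OF Psi_rep_nonzero Psi_rep_null] by blast
  qed
  obtain e where e: "\<And>c p. c \<in> Iso \<Longrightarrow> p \<in> fst c \<Longrightarrow> cmink n (\<phi> c p) = e * cmink l (\<phi> c p)"
  proof (rule fujimoto_functional[OF complete h, of C0 n m "frame_value l n ` S" N k s])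
    show "finite (frame_value l n ` S)" "card (frame_value l n ` S) \<ge> 2"
      "card (frame_value l n ` S) * (N - 1) = N + 1 + k" using S(2,3) N(2) card_image[OF inj] by simp_all
    show "N \<ge> 2" "m * (s * N + 1) = s * k" by fact+
  next
    fix c p assume c: "c \<in> Iso" "p \<in> fst c"
    define g where "g = cmink n (\<phi> c p) / cmink l (\<phi> c p)"
    have "herm (\<phi> c p) = (norm (cmink l (\<phi> c p)))\<^sup>2 * herm (conic l l' n g)"
      using arg_cong[OF rep[OF c c c], of herm] unfolding herm_scale g_def .
    then have "sqrt (2 * herm (\<phi> c p)) = norm (cmink l (\<phi> c p)) * sqrt (2 * herm (conic l l' n g))"
      by (simp add: real_sqrt_mult)
    also have "\<dots> \<le> norm (cmink l (\<phi> c p)) * (C0 * (1 + norm g) ^ m)" by (rule mult_left_mono[OF bound]) simp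
    finally show "sqrt (2 * herm (\<phi> c p)) \<le> C0 * norm (cmink l (\<phi> c p)) * (1 + norm (cmink n (\<phi> c p) / cmink l (\<phi> c p))) ^ m"
      unfolding g_def[symmetric] by (simp add: mult_ac)
    show "cmink n (\<phi> c p) / cmink l (\<phi> c p) \<notin> frame_value l n ` S"
    proof
      assume "cmink n (\<phi> c p) / cmink l (\<phi> c p) \<in> frame_value l n ` S"
      then obtain L where L: "L \<in> S" "cmink n (\<phi> c p) / cmink l (\<phi> c p) = frame_value l n L" by blast
      then have H: "L \<in> hyperplane A" "L \<noteq> proj_pt l" "L \<notin> G" using S(1) by auto
      obtain w where w: "L = proj_pt (Psi_rep w)" "Psi L = w" "cmink A (Psi_rep w) = 0" by (rule hyperplaneE[OF H(1)])
      have "proj_pt (\<phi> c p) \<noteq> proj_pt l" using inG[OF c] l by metis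
      then have "proj_pt (\<phi> c p) = L"
        using frame_value_inj[OF F \<phi>_nonzero[OF c] \<phi>_null(1)[OF c] A\<phi>[OF c] _ Psi_rep_nonzero Psi_rep_null w(3)] H(2) L(2)
        unfolding w(1) frame_value_proj_pt[OF Psi_rep_nonzero Psi_rep_null] by blast
      then show False using H(3) inG[OF c] by simp
    qed
  qed blast+
  have "affine_plane T x"
  proof (rule constant_gauss_map_imp_plane[OF complete])
    fix c p assume c: "c \<in> Iso" "p \<in> fst c"
    have "cmink n (\<phi> c p) / cmink l (\<phi> c p) = e" using e[OF c] h[OF c] by simp
    then show "\<exists>a. \<phi> c p = a *s conic l l' n e" using rep[OF c c c] by metis
  qed
  then show False using np by blast
qed

theorem nondegenerate_omitted_le_4:
  assumes complete: "complete_surface T \<A> x" and np: "\<not> affine_plane T x"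
    and A: "cmink A A \<noteq> 0" and sub: "G \<subseteq> hyperplane A"
  shows "finite (hyperplane A - G)" "card (hyperplane A - G) \<le> 4"
proof -
  let ?X = "hyperplane A - G"
  have "finite ?X \<and> card ?X \<le> 4"
  proof (rule ccontr)
    assume n: "\<not> (finite ?X \<and> card ?X \<le> 4)"
    then have "?X \<noteq> {}" by (metis card.empty finite.emptyI zero_le)
    then obtain L where L: "L \<in> ?X" by blast
    obtain S where S: "S \<subseteq> ?X - {L}" "finite S" "card S = 4"
      by (rule subset_card_minus[OF L n]) auto
    have LA: "L \<in> hyperplane A" using L by simp
    obtain w where w: "L = proj_pt (Psi_rep w)" "cmink A (Psi_rep w) = 0" by (rule hyperplaneE[OF LA])
    obtain l' f where F: "null_frame A (Psi_rep w) l' f"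
      by (rule null_frame_extend[OF A w(2) Psi_rep_null Psi_rep_nonzero])
    obtain C where C: "\<And>g. sqrt (2 * herm (conic (Psi_rep w) l' f g)) \<le> C * (1 + norm g) ^ 2"
      using sqrt_herm_frame_bound[OF F] by metis
    \<comment> \<open>For m = 2 and four values the balance of exponents is N = 5 + 2/s. The choice
      N = 6, s = 2 gives k = 4 * 5 - 7 = 13.\<close>
    show False
      by (rule frame_omitted_bound[OF complete np F sub _ C, of S 6 13 2]) (use L S w in auto)
  qed
  then show "finite ?X" "card ?X \<le> 4" by auto
qed

theorem real_null_omitted_le_3:
  assumes complete: "complete_surface T \<A> x" and np: "\<not> affine_plane T x"
    and A: "cmink A A \<noteq> 0" and sub: "G \<subseteq> hyperplane A"
    and l: "cmink A l = 0" "cmink l l = 0" "l \<noteq> 0" "cnjv l = l"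
  shows "proj_pt l \<in> hyperplane A - G" "finite (hyperplane A - G)"
    "card (hyperplane A - G) \<le> 3"
proof -
  let ?X = "hyperplane A - G"
  have "complex_of_real (herm l) = 0" unfolding herm_eq l(4) by (rule l(2))
  then have h: "herm l = 0" by simp
  have q: "proj_pt l \<in> quadric" unfolding quadric_def using l by blast
  show L: "proj_pt l \<in> ?X"
    using real_point_omitted[OF h] l(1) q by (simp add: proj_pt_in_hyperplane)
  have "finite ?X \<and> card ?X \<le> 3"
  proof (rule ccontr)
    assume n: "\<not> (finite ?X \<and> card ?X \<le> 3)"
    obtain S where S: "S \<subseteq> ?X - {proj_pt l}" "finite S" "card S = 3"
      by (rule subset_card_minus[OF L n]) auto
    obtain l' f where F: "null_frame A l l' f" by (rule null_frame_extend[OF A l(1-3)])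
    obtain C where C: "\<And>g. sqrt (2 * herm (conic l l' f g)) \<le> C * (1 + norm g) ^ 1"
      using sqrt_herm_real_frame_bound[OF F l(4)] by metis
    \<comment> \<open>For m = 1 and three values the balance of exponents is N = 4 + 1/s. The choice
      N = 5, s = 1 gives k = 3 * 4 - 6 = 6.\<close>
    show False
      by (rule frame_omitted_bound[OF complete np F sub _ C, of S 5 6 1]) (use L S in auto)
  qed
  then show "finite ?X" "card ?X \<le> 3" by auto
qed

text \<open>As both real points are omitted, neither <l, \<phi>> nor <n, \<phi>> has a zero, and the
  metric is bounded by |<n, \<phi>>| alone. A third omitted point would give 1/g a second omitted
  value besides 0, which is too many for m = 0.\<close>

theorem two_real_null_omitted:
  assumes complete: "complete_surface T \<A> x" and np: "\<not> affine_plane T x"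
    and F: "null_frame A l l' n" and sub: "G \<subseteq> hyperplane A"
    and l: "cnjv l = l" "cnjv l' = l'"
  shows "hyperplane A - G = {proj_pt l, proj_pt l'}" "proj_pt l \<noteq> proj_pt l'"
proof -
  have F': "cmink A A \<noteq> 0" "cmink A l = 0" "cmink A l' = 0" "cmink l l = 0" "cmink l' l' = 0" "cmink l l' = 1" "cmink l' l = 1"
    "cmink l' n = 0" "cmink l n = 0" "cmink n n = 1"
    using F by (auto simp: null_frame_def cmink_commute)
  have l0: "l \<noteq> 0" "l' \<noteq> 0" using F'(6) by (auto simp: cmink_linear)
  show "proj_pt l \<noteq> proj_pt l'"
  proof
    assume "proj_pt l = proj_pt l'"
    then obtain a where "l = a *s l'" unfolding proj_pt_eq_iff by blast
    then have "cmink l l' = a * cmink l' l'" by (simp add: cmink_linear)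
    then show False using F' by simp
  qed
  have om: "proj_pt l \<in> hyperplane A - G" "proj_pt l' \<in> hyperplane A - G"
    using real_null_omitted_le_3(1)[OF complete np F'(1) sub] F' l0 l by blast+
  have A\<phi>: "cmink A (\<phi> c p) = 0" if "c \<in> Iso" "p \<in> fst c" for c p
    using sub that unfolding gauss_image_subset_hyperplane by blast
  have inG: "proj_pt (\<phi> c p) \<in> G" if "c \<in> Iso" "p \<in> fst c" for c p
    unfolding gauss_image_eq using that by blast
  have ne: "proj_pt (\<phi> c p) \<noteq> proj_pt l" "proj_pt (\<phi> c p) \<noteq> proj_pt l'" if c: "c \<in> Iso" "p \<in> fst c" for c p
    using inG[OF c] om by force+
  have h: "cmink l (\<phi> c p) \<noteq> 0" if c: "c \<in> Iso" "p \<in> fst c" for c p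
    using null_frame_null_vector(3)[OF F A\<phi>[OF c] \<phi>_null(1)[OF c] _ \<phi>_nonzero[OF c]] ne[OF c] by metis
  have zero_value: "proj_pt z = proj_pt l'" if "cmink A z = 0" "cmink z z = 0" "cmink l z \<noteq> 0" "cmink n z = 0" for z
    using null_frame_null_vector(2)[OF F that(1-3)] that(3,4) proj_pt_scale[OF that(3), of l'] by simp
  have hn: "cmink n (\<phi> c p) \<noteq> 0" if c: "c \<in> Iso" "p \<in> fst c" for c p
    using zero_value[OF A\<phi>[OF c] \<phi>_null(1)[OF c] h[OF c]] ne[OF c] by metis
  note rep = null_frame_null_vector(2)[OF F A\<phi> \<phi>_null(1) h]
  obtain C where C: "\<And>g. sqrt (2 * herm (conic l l' n g)) \<le> C * norm g"
    using sqrt_herm_double_real_frame_bound[OF F l] by metis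
  have "L = proj_pt l \<or> L = proj_pt l'" if L: "L \<in> hyperplane A - G" for L
  proof (rule ccontr)
    assume nL: "\<not> (L = proj_pt l \<or> L = proj_pt l')"
    have LA: "L \<in> hyperplane A" using L by simp
    obtain w where w: "L = proj_pt (Psi_rep w)" "cmink A (Psi_rep w) = 0" by (rule hyperplaneE[OF LA])
    define z where "z = Psi_rep w"
    have z: "z \<noteq> 0" "cmink z z = 0" "cmink A z = 0" "proj_pt z \<noteq> proj_pt l" "proj_pt z \<noteq> proj_pt l'" "proj_pt z \<notin> G"
      using w nL L by (auto simp: z_def Psi_rep_nonzero Psi_rep_null simp del: Psi_rep.simps)
    have lz: "cmink l z \<noteq> 0" using null_frame_null_vector(3)[OF F z(3,2) _ z(1)] z(4) by metis
    have nz: "cmink n z \<noteq> 0" using zero_value[OF z(3,2) lz] z(5) by metis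
    \<comment> \<open>With N = 3 and k = s = 0 the field of \<open>fujimoto\<close> is simply the
      reciprocal of <n, \<phi>>.\<close>
    obtain e where e: "\<And>c p. c \<in> Iso \<Longrightarrow> p \<in> fst c \<Longrightarrow> cmink l (\<phi> c p) = e * cmink n (\<phi> c p)"
    proof (rule fujimoto_functional[OF complete hn, of C l 0 "{0, cmink l z / cmink n z}" 3 0 0])
      show "finite {0, cmink l z / cmink n z}" "2 \<le> card {0, cmink l z / cmink n z}"
        "card {0, cmink l z / cmink n z} * (3 - 1) = 3 + 1 + 0" using lz nz by auto
      show "(2::nat) \<le> 3" "(0::nat) * (0 * 3 + 1) = 0 * 0" by simp_all
    next
      fix c p assume c: "c \<in> Iso" "p \<in> fst c"
      define g where "g = cmink n (\<phi> c p) / cmink l (\<phi> c p)"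
      have "herm (\<phi> c p) = (norm (cmink l (\<phi> c p)))\<^sup>2 * herm (conic l l' n g)"
        using arg_cong[OF rep[OF c c c], of herm] unfolding herm_scale g_def .
      then have "sqrt (2 * herm (\<phi> c p)) = norm (cmink l (\<phi> c p)) * sqrt (2 * herm (conic l l' n g))"
        by (simp add: real_sqrt_mult)
      also have "\<dots> \<le> norm (cmink l (\<phi> c p)) * (C * norm g)" by (rule mult_left_mono[OF C]) simp
      also have "\<dots> = C * norm (cmink n (\<phi> c p))" using h[OF c] by (simp add: g_def norm_divide)
      finally show "sqrt (2 * herm (\<phi> c p)) \<le> C * norm (cmink n (\<phi> c p)) * (1 + norm (cmink l (\<phi> c p) / cmink n (\<phi> c p))) ^ 0" by simp
      show "cmink l (\<phi> c p) / cmink n (\<phi> c p) \<notin> {0, cmink l z / cmink n z}"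
      proof
        assume "cmink l (\<phi> c p) / cmink n (\<phi> c p) \<in> {0, cmink l z / cmink n z}"
        then have "cmink l (\<phi> c p) / cmink n (\<phi> c p) = cmink l z / cmink n z" using h[OF c] hn[OF c] by simp
        then have "cmink n (\<phi> c p) / cmink l (\<phi> c p) = cmink n z / cmink l z" by (metis inverse_divide)
        then have "proj_pt (\<phi> c p) = proj_pt z"
          by (rule frame_value_inj[OF F \<phi>_nonzero[OF c] \<phi>_null(1)[OF c] A\<phi>[OF c] ne(1)[OF c] z(1-4)])
        then show False using inG[OF c] z(6) by simp
      qed
    qed blast+
    have "affine_plane T x"
    proof (rule constant_gauss_map_imp_plane[OF complete])
      fix c p assume c: "c \<in> Iso" "p \<in> fst c"
      have "cmink n (\<phi> c p) / cmink l (\<phi> c p) = 1 / e" using e[OF c] hn[OF c] by simp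
      then show "\<exists>a. \<phi> c p = a *s conic l l' n (1 / e)" using rep[OF c c c] by metis
    qed
    then show False using np by blast
  qed
  then show "hyperplane A - G = {proj_pt l, proj_pt l'}" using om by blast
qed

text \<open>The real null vector \<open>l\<close> does not contribute to the metric, which is a
  constant times |<u0, \<phi>>|^2. So the ratio of the two coordinates falls under m = 0, where two
  finite omitted values force constancy.\<close>

theorem null_pencil_constant:
  assumes complete: "complete_surface T \<A> x"
    and l: "cnjv l = l" "cmink l l = 0" "cmink l m = 0"
    and rep: "\<And>c p. c \<in> Iso \<Longrightarrow> p \<in> fst c \<Longrightarrow> \<phi> c p = cmink u0 (\<phi> c p) *s m + cmink u1 (\<phi> c p) *s l"
    and z: "z = cmink u0 z *s m + cmink u1 z *s l" "cmink u0 z \<noteq> 0" "proj_pt z \<notin> G"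
    and z': "z' = cmink u0 z' *s m + cmink u1 z' *s l" "cmink u0 z' \<noteq> 0" "proj_pt z' \<notin> G"
    and ne: "proj_pt z \<noteq> proj_pt z'"
  obtains L where "\<And>p. p \<in> topspace T \<Longrightarrow> gauss_map T \<A> x p = L"
proof -
  have h\<phi>: "herm (\<phi> c p) = (norm (cmink u0 (\<phi> c p)))\<^sup>2 * herm m" if c: "c \<in> Iso" "p \<in> fst c" for c p
    using arg_cong[OF rep[OF c], of herm] unfolding herm_pencil[OF l] .
  have h: "cmink u0 (\<phi> c p) \<noteq> 0" if c: "c \<in> Iso" "p \<in> fst c" for c p
    using h\<phi>[OF c] \<phi>_null(3)[OF c] by auto
  have same: "proj_pt y = proj_pt y'" if "y = cmink u0 y *s m + cmink u1 y *s l" "cmink u0 y \<noteq> 0"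
    "y' = cmink u0 y' *s m + cmink u1 y' *s l" "cmink u0 y' \<noteq> 0" "cmink u1 y / cmink u0 y = cmink u1 y' / cmink u0 y'" for y y'
  proof -
    have R: "proj_pt y = proj_pt (m + (cmink u1 y / cmink u0 y) *s l)" if "y = cmink u0 y *s m + cmink u1 y *s l" "cmink u0 y \<noteq> 0" for y
    proof -
      have "cmink u0 y *s (m + (cmink u1 y / cmink u0 y) *s l) = cmink u0 y *s m + cmink u1 y *s l"
        using that(2) by (simp add: vec_smult_rules)
      then show ?thesis using proj_pt_scale[OF that(2), of "m + (cmink u1 y / cmink u0 y) *s l"] that(1) by metis
    qed
    show ?thesis using R[OF that(1,2)] R[OF that(3,4)] that(5) by simp
  qed
  let ?A = "{cmink u1 z / cmink u0 z, cmink u1 z' / cmink u0 z'}"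
  obtain e where e: "\<And>c p. c \<in> Iso \<Longrightarrow> p \<in> fst c \<Longrightarrow> cmink u1 (\<phi> c p) = e * cmink u0 (\<phi> c p)"
  proof (rule fujimoto_functional[OF complete h, of "sqrt (2 * herm m)" u1 0 ?A 3 0 0])
    have "cmink u1 z / cmink u0 z \<noteq> cmink u1 z' / cmink u0 z'" using same[OF z(1,2) z'(1,2)] ne by blast
    then show "finite ?A" "2 \<le> card ?A" "card ?A * (3 - 1) = 3 + 1 + 0" by simp_all
    show "(2::nat) \<le> 3" "(0::nat) * (0 * 3 + 1) = 0 * 0" by simp_all
  next
    fix c p assume c: "c \<in> Iso" "p \<in> fst c"
    show "sqrt (2 * herm (\<phi> c p)) \<le> sqrt (2 * herm m) * norm (cmink u0 (\<phi> c p)) * (1 + norm (cmink u1 (\<phi> c p) / cmink u0 (\<phi> c p))) ^ 0"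
      unfolding h\<phi>[OF c] by (simp add: real_sqrt_mult)
    have G: "proj_pt (\<phi> c p) \<in> G" unfolding gauss_image_eq using c by blast
    then show "cmink u1 (\<phi> c p) / cmink u0 (\<phi> c p) \<notin> ?A"
      using same[OF rep[OF c] h[OF c] z(1,2)] same[OF rep[OF c] h[OF c] z'(1,2)] z(3) z'(3) by auto
  qed blast+
  show ?thesis
  proof (rule that[of "proj_pt (m + e *s l)"])
    fix p assume "p \<in> topspace T"
    then obtain c where c: "c \<in> Iso" "p \<in> fst c" using Iso_cover by blast
    have "\<phi> c p = cmink u0 (\<phi> c p) *s m + (e * cmink u0 (\<phi> c p)) *s l" using rep[OF c] e[OF c] by simp
    also have "\<dots> = cmink u0 (\<phi> c p) *s (m + e *s l)" by (simp add: vec_smult_rules mult.commute)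
    finally have "proj_pt (\<phi> c p) = proj_pt (m + e *s l)" using proj_pt_scale[OF h[OF c]] by metis
    then show "gauss_map T \<A> x p = proj_pt (m + e *s l)" using gauss_map_eq[OF c] by simp
  qed
qed

end

subsection \<open>Flat metrics\<close>

text \<open>\<open>(\<i> * a) \<bullet> b\<close> is the determinant of the pair \<open>a\<close>,
  \<open>b\<close>, and the coefficients are those of Cramer's rule.\<close>

lemma complex_basis_expand:
  fixes a b v :: complex
  assumes "(\<i> * a) \<bullet> b \<noteq> 0"
  shows "v = (- ((\<i> * b) \<bullet> v) / ((\<i> * a) \<bullet> b)) *\<^sub>R a + (((\<i> * a) \<bullet> v) / ((\<i> * a) \<bullet> b)) *\<^sub>R b"
proof -
  have "((\<i> * a) \<bullet> b) *\<^sub>R v = (- ((\<i> * b) \<bullet> v)) *\<^sub>R a + ((\<i> * a) \<bullet> v) *\<^sub>R b"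
    by (simp add: complex_eq_iff inner_complex_def algebra_simps)
  then have "(inverse ((\<i> * a) \<bullet> b) * ((\<i> * a) \<bullet> b)) *\<^sub>R v
      = inverse ((\<i> * a) \<bullet> b) *\<^sub>R ((- ((\<i> * b) \<bullet> v)) *\<^sub>R a + ((\<i> * a) \<bullet> v) *\<^sub>R b)"
    unfolding scaleR_scaleR[symmetric] by (rule arg_cong)
  then show ?thesis using assms by (simp add: scaleR_diff_right divide_inverse mult.commute)
qed

lemma complex_basis_independent:
  fixes a b :: complex
  assumes "(\<i> * a) \<bullet> b \<noteq> 0" "r *\<^sub>R a + s *\<^sub>R b = 0"
  shows "r = 0" "s = 0"
proof -
  have "(\<i> * a) \<bullet> (r *\<^sub>R a + s *\<^sub>R b) = s * ((\<i> * a) \<bullet> b)" "(\<i> * b) \<bullet> (r *\<^sub>R a + s *\<^sub>R b) = - r * ((\<i> * a) \<bullet> b)"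
    by (simp_all add: inner_complex_def algebra_simps)
  then show "r = 0" "s = 0" unfolding assms(2) using assms(1) by simp_all
qed

text \<open>\<open>g\<close> is a multiple of the pull-back of the Euclidean metric under \<open>W\<close>, whose Christoffel symbols
  are the coefficients of the second derivatives of \<open>W\<close> in the basis of its first derivatives.\<close>

lemma flat_metric:
  fixes W :: "complex \<Rightarrow> complex"
  assumes S: "open S" and z: "z \<in> S" and W: "smooth_on W S" and k: "k \<noteq> 0"
    and g: "\<And>z i j. z \<in> S \<Longrightarrow> g z $ i $ j = k * (pd i W z \<bullet> pd j W z)"
    and J: "\<And>z. z \<in> S \<Longrightarrow> (\<i> * pd 1 W z) \<bullet> pd 2 W z \<noteq> 0"
  shows "gauss_curvature g z = 0"
proof -
  define C where "C l i j z = (if l = 1 then - ((\<i> * pd 2 W z) \<bullet> pd i (pd j W) z) else (\<i> * pd 1 W z) \<bullet> pd i (pd j W) z) / ((\<i> * pd 1 W z) \<bullet> pd 2 W z)" for l i j :: 2 and z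
  have sm1: "smooth_on (pd i W) S" for i by (rule smooth_onD(2)[OF W])
  have sm2: "smooth_on (pd i (pd j W)) S" for i j by (rule smooth_onD(2)[OF sm1])
  have d1: "pd i W differentiable (at z)" if "z \<in> S" for i z by (rule smooth_onD(1)[OF sm1 that])
  have d2: "pd i (pd j W) differentiable (at z)" if "z \<in> S" for i j z by (rule smooth_onD(1)[OF sm2 that])
  have sym: "pd i (pd j f) z = pd j (pd i f) z" if "z \<in> S" "smooth_on f S" for i j z and f :: "complex \<Rightarrow> complex"
    using mixed_partials[OF S that] two_cases[of i] two_cases[of j] by auto
  have expand: "pd i (pd j W) z = C 1 i j z *\<^sub>R pd 1 W z + C 2 i j z *\<^sub>R pd 2 W z" if "z \<in> S" for i j z
    using complex_basis_expand[OF J[OF that], of "pd i (pd j W) z"] by (simp add: C_def)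
  have dg: "pd i (\<lambda>w. g w $ j $ l) z = k * (pd j W z \<bullet> pd i (pd l W) z + pd i (pd j W) z \<bullet> pd l W z)" if z: "z \<in> S" for i j l z
  proof -
    have "pd i (\<lambda>w. g w $ j $ l) z = pd i (\<lambda>w. k * (pd j W w \<bullet> pd l W w)) z"
      by (rule pd_cong[OF S z]) (rule g)
    also have "\<dots> = k * pd i (\<lambda>w. pd j W w \<bullet> pd l W w) z"
      by (rule pd_linear[OF bounded_linear_mult_right]) (intro differentiable_inner d1[OF z])
    also have "pd i (\<lambda>w. pd j W w \<bullet> pd l W w) z = pd j W z \<bullet> pd i (pd l W) z + pd i (pd j W) z \<bullet> pd l W z"
      by (rule pd_bilinear[OF bounded_bilinear_inner d1[OF z] d1[OF z]])
    finally show ?thesis .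
  qed
  have chr: "christoffel g l i j z = C l i j z" if z: "z \<in> S" for l i j z
  proof -
    \<comment> \<open>By symmetry of the second derivatives of \<open>W\<close> the six terms of the
      Christoffel combination cancel except for one that occurs twice.\<close>
    have lower: "pd i (\<lambda>w. g w $ j $ m) z + pd j (\<lambda>w. g w $ i $ m) z - pd m (\<lambda>w. g w $ i $ j) z
        = 2 * (k * (pd i (pd j W) z \<bullet> pd m W z))" for m
      unfolding dg[OF z] sym[OF z W, of j i] sym[OF z W, of m i] sym[OF z W, of m j]
      by (simp add: inner_commute algebra_simps)
    define a b v where "a = pd 1 W z" and "b = pd 2 W z" and "v = pd i (pd j W) z"
    define D where "D = g z $ 1 $ 1 * g z $ 2 $ 2 - g z $ 1 $ 2 * g z $ 2 $ 1"
    have D: "D = (k * k) * (((\<i> * a) \<bullet> b) * ((\<i> * a) \<bullet> b))"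
      by (simp add: D_def g[OF z] a_def b_def inner_complex_def algebra_simps)
    have J0: "(\<i> * a) \<bullet> b \<noteq> 0" using J[OF z] by (simp add: a_def b_def)
    have D0: "D \<noteq> 0" unfolding D using k J0 by simp
    have id: "(b \<bullet> b) * (v \<bullet> a) - (a \<bullet> b) * (v \<bullet> b) = (- ((\<i> * b) \<bullet> v)) * ((\<i> * a) \<bullet> b)"
      "(a \<bullet> a) * (v \<bullet> b) - (b \<bullet> a) * (v \<bullet> a) = ((\<i> * a) \<bullet> v) * ((\<i> * a) \<bullet> b)"
      by (simp_all add: inner_complex_def algebra_simps)
    have chr': "christoffel g l i j z = matrix_inv (g z) $ l $ 1 * (k * (v \<bullet> a)) + matrix_inv (g z) $ l $ 2 * (k * (v \<bullet> b))" for l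
      unfolding christoffel_def lower by (simp add: sum_2 a_def b_def v_def algebra_simps)
    have gz: "g z $ 1 $ 1 = k * (a \<bullet> a)" "g z $ 1 $ 2 = k * (a \<bullet> b)" "g z $ 2 $ 1 = k * (b \<bullet> a)" "g z $ 2 $ 2 = k * (b \<bullet> b)"
      by (simp_all add: g[OF z] a_def b_def)
    have "christoffel g 1 i j z = (k * k) * ((b \<bullet> b) * (v \<bullet> a) - (a \<bullet> b) * (v \<bullet> b)) / D"
      unfolding chr' matrix_inv_2[OF D_def D0] gz by (simp add: diff_divide_distrib algebra_simps)
    then have 1: "christoffel g 1 i j z = C 1 i j z"
      unfolding id D using k J0 by (simp add: C_def a_def b_def v_def)
    have "christoffel g 2 i j z = (k * k) * ((a \<bullet> a) * (v \<bullet> b) - (b \<bullet> a) * (v \<bullet> a)) / D"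
      unfolding chr' matrix_inv_2[OF D_def D0] gz by (simp add: diff_divide_distrib algebra_simps)
    then have 2: "christoffel g 2 i j z = C 2 i j z"
      unfolding id D using k J0 by (simp add: C_def a_def b_def v_def)
    show ?thesis using 1 2 two_cases[of l] by auto
  qed
  have dC: "C l i j differentiable (at z)" if z: "z \<in> S" for l i j z
  proof -
    have "(\<lambda>z. \<i> * pd m W z) differentiable (at z)" for m by (intro differentiable_mult differentiable_const d1[OF z])
    then have "(\<lambda>z. (\<i> * pd m W z) \<bullet> pd i (pd j W) z) differentiable (at z)" "(\<lambda>z. (\<i> * pd m W z) \<bullet> pd m' W z) differentiable (at z)" for m m'
      using d1[OF z] d2[OF z] by (intro differentiable_inner; blast)+
    then show ?thesis unfolding C_def[abs_def] using J[OF z]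
      by (cases "l = 1") (auto intro!: differentiable_divide differentiable_minus)
  qed
  \<comment> \<open>The coefficients are one half of the curvature tensor. Antisymmetrized they give
    the tensor itself, and third derivatives of \<open>W\<close> commute.\<close>
  have third: "pd i (pd j (pd q W)) z = (pd i (C 1 j q) z + (\<Sum>m\<in>UNIV. C 1 i m z * C m j q z)) *\<^sub>R pd 1 W z
      + (pd i (C 2 j q) z + (\<Sum>m\<in>UNIV. C 2 i m z * C m j q z)) *\<^sub>R pd 2 W z" for i j q
  proof -
    have t: "pd i (\<lambda>z. C l j q z *\<^sub>R pd l W z) z = C l j q z *\<^sub>R pd i (pd l W) z + pd i (C l j q) z *\<^sub>R pd l W z"
      "(\<lambda>z. C l j q z *\<^sub>R pd l W z) differentiable (at z)" for l
      using pd_bilinear[OF bounded_bilinear_scaleR dC[OF z] d1[OF z]] differentiable_scaleR[OF dC[OF z] d1[OF z]] by blast+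
    have "pd i (pd j (pd q W)) z = pd i (\<lambda>z. C 1 j q z *\<^sub>R pd 1 W z + C 2 j q z *\<^sub>R pd 2 W z) z"
      by (rule pd_cong[OF S z]) (rule expand)
    also have "\<dots> = (C 1 j q z *\<^sub>R pd i (pd 1 W) z + pd i (C 1 j q) z *\<^sub>R pd 1 W z) + (C 2 j q z *\<^sub>R pd i (pd 2 W) z + pd i (C 2 j q) z *\<^sub>R pd 2 W z)"
      unfolding pd_add[OF t(2) t(2)] t(1) by (rule refl)
    finally show ?thesis
      unfolding expand[OF z, of i 1] expand[OF z, of i 2] by (simp add: sum_2 algebra_simps)
  qed
  have "riemann g l q i j z = 0" for l q i j
  proof -
    have pc: "pd i (christoffel g l j q) z = pd i (C l j q) z" for i l j by (rule pd_cong[OF S z]) (rule chr)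
    have R: "riemann g l q i j z = (pd i (C l j q) z + (\<Sum>m\<in>UNIV. C l i m z * C m j q z)) - (pd j (C l i q) z + (\<Sum>m\<in>UNIV. C l j m z * C m i q z))" for l
      unfolding riemann_def chr[OF z] pc by (simp add: sum_subtractf algebra_simps)
    have "riemann g 1 q i j z *\<^sub>R pd 1 W z + riemann g 2 q i j z *\<^sub>R pd 2 W z = pd i (pd j (pd q W)) z - pd j (pd i (pd q W)) z"
      unfolding R third by (simp add: scaleR_diff_left)
    also have "\<dots> = 0" using sym[OF z sm1] by simp
    finally show ?thesis using complex_basis_independent[OF J[OF z]] two_cases[of l] by auto
  qed
  then show ?thesis by (simp add: gauss_curvature_def)
qed

lemma bounded_linear_cmink_cvec: "bounded_linear (\<lambda>y. cmink u (cvec y))"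
proof -
  have "linear (\<lambda>y. cmink u (cvec y))"
    by (rule linearI) (simp_all add: cmink_def cvec_def scaleR_conv_of_real[where 'a = complex] algebra_simps)
  then show ?thesis by (simp add: linear_conv_bounded_linear)
qed

context stationary begin

text \<open>In the situation below the metric is a constant multiple of the pull-back of the Euclidean metric
  under the holomorphic function \<open>\<langle>u0, X + iY\<rangle>\<close>, where \<open>Y\<close> is the conjugate of \<open>X\<close>.\<close>

theorem null_pencil_flat:
  assumes herm: "\<And>c p. c \<in> Iso \<Longrightarrow> p \<in> fst c \<Longrightarrow> herm (\<phi> c p) = (norm (cmink u0 (\<phi> c p)))\<^sup>2 * K"
  shows "\<not> nonflat \<A> x"
proof -
  have "gauss_curvature (first_form (X a)) z0 = 0" if a: "a \<in> \<A>" and z0: "z0 \<in> img a" for a z0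
  proof -
    interpret rp: regular_patch "X a" "img a" by (rule patch[OF a])
    have oU: "open (img a)" by (rule is_chartD(2)[OF A_chart[OF a]])
    obtain r Y where r: "r > 0" "ball z0 r \<subseteq> img a"
      and Y: "\<And>z. z \<in> ball z0 r \<Longrightarrow> (Y has_derivative (\<lambda>h. Re h *\<^sub>R (- starQ (X a) z) + Im h *\<^sub>R starP (X a) z)) (at z)"
      using rp.conjugate_exists[OF minimal[OF a] z0] by blast
    define L where "L y = cmink u0 (cvec y)" for y
    have L: "bounded_linear L" unfolding L_def by (rule bounded_linear_cmink_cvec)
    have iL: "bounded_linear (\<lambda>y. \<i> * L y)" by (rule bounded_linear_compose[OF bounded_linear_mult_right L])
    define W where "W z = L (X a z) + \<i> * L (Y z)" for z
    have pdY: "pd 1 Y z = - starQ (X a) z" "pd 2 Y z = starP (X a) z" and dY: "Y differentiable (at z)" if "z \<in> ball z0 r" for z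
      using pd_eq[OF Y[OF that], of 1] pd_eq[OF Y[OF that], of 2] Y[OF that] by (auto simp: differentiable_def)
    have dX: "X a differentiable (at z)" if "z \<in> ball z0 r" for z
      using smooth_onD(1)[OF X_smooth[OF a]] r(2) that by blast
    have smX: "smooth_on (X a) (ball z0 r)" by (rule smooth_on_subset[OF X_smooth[OF a] r(2)])
    have smY: "smooth_on Y (ball z0 r)"
    proof (rule smooth_onI[OF open_ball dY])
      have m: "smooth_on (\<lambda>z. - starQ (X a) z) (img a)"
        by (rule smooth_on_linear[OF oU bounded_linear_minus[OF bounded_linear_ident] rp.smooth_Q])
      have 1: "smooth_on (pd 1 Y) (ball z0 r)"
        by (rule smooth_on_cong[OF open_ball, rotated, OF smooth_on_subset[OF m r(2)]]) (simp add: pdY)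
      have 2: "smooth_on (pd 2 Y) (ball z0 r)"
        by (rule smooth_on_cong[OF open_ball, rotated, OF smooth_on_subset[OF rp.smooth_P r(2)]]) (simp add: pdY)
      show "smooth_on (pd i Y) (ball z0 r)" for i using 1 2 two_cases[of i] by auto
    qed
    have smW: "smooth_on W (ball z0 r)"
      unfolding W_def by (intro smooth_on_add[OF open_ball] smooth_on_linear[OF open_ball L smX] smooth_on_linear[OF open_ball iL smY])
    have main: "K > 0 \<and> gE (X a) z = K / 2 * (pd 1 W z \<bullet> pd 1 W z) \<and> gF (X a) z = K / 2 * (pd 1 W z \<bullet> pd 2 W z)
        \<and> gG (X a) z = K / 2 * (pd 2 W z \<bullet> pd 2 W z)" if z: "z \<in> ball z0 r" for z
    proof -
      have za: "z \<in> img a" using z r(2) by blast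
      then obtain p where p: "p \<in> fst a" "z = snd a p" by auto
      have "p \<in> topspace T" using p(1) is_chartD(4)[OF A_chart[OF a]] by blast
      then obtain c where c: "c \<in> Iso" "p \<in> fst c" using Iso_cover by blast
      define \<sigma> where "\<sigma> = change a c"
      have zi: "z \<in> snd a ` (fst a \<inter> fst c)" using p c by auto
      have \<sigma>z: "\<sigma> z = snd c p" using inv_into_f_f[OF is_chartD(3)[OF A_chart[OF a]] p(1)] by (simp add: \<sigma>_def p(2))
      note AI = A_to_Iso[OF a c(1) zi, folded \<sigma>_def, unfolded \<sigma>z]
      define h where "h = cmink u0 (\<phi> c p)"
      have E: "gE (X c) (snd c p) = 2 * ((norm h)\<^sup>2 * K)"
        using \<phi>_null(2)[OF c] herm[OF c] by (simp add: h_def)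
      have K: "K > 0" using AI(1) unfolding E by (auto simp: zero_less_mult_iff)
      \<comment> \<open>By \<open>A_to_Iso\<close> the differential of X + iY is 2 \<phi> times that
        of \<sigma>; the functional \<open>u0\<close> is then applied.\<close>
      have pdW: "pd i W z = 2 * pd i \<sigma> z * h" for i
      proof -
        have dL: "(\<lambda>z. L (X a z)) differentiable (at z)" "(\<lambda>z. \<i> * L (Y z)) differentiable (at z)"
          using smooth_onD(1)[OF smooth_on_linear[OF open_ball L smX] z] smooth_onD(1)[OF smooth_on_linear[OF open_ball iL smY] z] by blast+
        have "pd i W z = L (pd i (X a) z) + \<i> * L (pd i Y z)"
          unfolding W_def[abs_def] pd_add[OF dL] pd_linear[OF L dX[OF z]] pd_linear[OF iL dY[OF z]] by (rule refl)
        also have "\<dots> = cmink u0 (cvec (pd i (X a) z) + \<i> *s cvec (pd i Y z))" by (simp add: L_def cmink_linear)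
        also have "cvec (pd i (X a) z) + \<i> *s cvec (pd i Y z) = (2 * pd i \<sigma> z) *s \<phi> c p"
          unfolding vec_eq_iff
        proof
          fix k
          have "pd i Y z $ k = 2 * Im (\<phi> c p $ k * pd i \<sigma> z)"
            using AI(6,7)[of k] pdY[OF z] two_cases[of i] by (auto simp: \<phi>_def)
          then show "(cvec (pd i (X a) z) + \<i> *s cvec (pd i Y z)) $ k = ((2 * pd i \<sigma> z) *s \<phi> c p) $ k"
            using AI(5)[of i k] by (simp add: cvec_def complex_eq_iff \<phi>_def algebra_simps)
        qed
        also have "cmink u0 ((2 * pd i \<sigma> z) *s \<phi> c p) = 2 * pd i \<sigma> z * h" by (simp add: cmink_linear h_def)
        finally show ?thesis .
      qed
      have "pd i W z \<bullet> pd j W z = 4 * (norm h)\<^sup>2 * Re (pd i \<sigma> z * cnj (pd j \<sigma> z))" for i j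
        unfolding pdW cmod_power2 by (simp add: inner_complex_def power2_eq_square algebra_simps)
      then show ?thesis
        unfolding AI(2-4) E cmod_power2 using K by (simp add: power2_eq_square algebra_simps)
    qed
    have "gauss_curvature (first_form (X a)) z0 = 0"
    proof (rule flat_metric[OF open_ball _ smW])
      show zb: "z0 \<in> ball z0 r" using r(1) by simp
      show "K / 2 \<noteq> 0" using main[OF zb] by simp
      fix z assume z: "z \<in> ball z0 r"
      show "first_form (X a) z $ i $ j = K / 2 * (pd i W z \<bullet> pd j W z)" for i j
        using main[OF z] two_cases[of i] two_cases[of j]
        by (auto simp: first_form_def gE_def gF_def gG_def mink_commute inner_commute)
      \<comment> \<open>The determinant of the metric is (K/2)^2 times the square of the determinant
        of the partials of \<open>W\<close>, so these partials form a basis.\<close>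
      have "gE (X a) z * gG (X a) z - (gF (X a) z)\<^sup>2 > 0" using rp.D_pos z r(2) by blast
      then have "(K / 2)\<^sup>2 * ((\<i> * pd 1 W z) \<bullet> pd 2 W z)\<^sup>2 > 0"
        using main[OF z] by (simp add: inner_complex_def power2_eq_square algebra_simps)
      then show "(\<i> * pd 1 W z) \<bullet> pd 2 W z \<noteq> 0" by auto
    qed
    then show ?thesis .
  qed
  then show ?thesis by (auto simp: nonflat_def)
qed

end

subsection \<open>Types of hyperplanes\<close>

lemma totally_realI:
  assumes "A \<noteq> 0" "A = a *s cvec u" shows "totally_real A"
proof -
  have "a \<noteq> 0" "u \<noteq> 0" using assms by (auto simp: cvec_def vec_eq_iff)
  then show ?thesis unfolding totally_real_def using assms(2) proj_pt_scale by blast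
qed

lemma re_im_decomp: "A = cvec (re_vec A) + \<i> *s cvec (im_vec A)"
  by (simp add: vec_eq_iff cvec_def re_vec_def im_vec_def complex_eq_iff)

lemma cvec_linear: "cvec (u + v) = cvec u + cvec v" "cvec (u - v) = cvec u - cvec v" "cvec (r *\<^sub>R u) = of_real r *s cvec u"
  by (simp_all add: vec_eq_iff cvec_def)

lemma cmink_re_im: "cmink A (cvec u) = of_real (mink (re_vec A) u) + \<i> * of_real (mink (im_vec A) u)"
  by (subst re_im_decomp[of A]) (simp add: cmink_linear cmink_cvec)

text \<open>The combination \<open>w\<close> of the two vectors is null and has no time component,
  so it is zero.\<close>

lemma mink_null_parallel:
  assumes "mink u u = 0" "mink v v = 0" "mink u v = 0" "v \<noteq> 0"
  obtains t where "u = t *\<^sub>R v"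
proof -
  define w where "w = u$4 *\<^sub>R v - v$4 *\<^sub>R u"
  have "mink w w = 0"
    by (simp add: w_def mink_diff_left mink_diff_right mink_scaleR_left mink_scaleR_right assms mink_commute[of v u])
  moreover have w4: "w $ 4 = 0" by (simp add: w_def)
  ultimately have "w $ 1 * w $ 1 + w $ 2 * w $ 2 + w $ 3 * w $ 3 = 0" by (simp add: mink_def)
  then have "w $ 1 = 0 \<and> w $ 2 = 0 \<and> w $ 3 = 0"
    using zero_le_square[of "w $ 1"] zero_le_square[of "w $ 2"] zero_le_square[of "w $ 3"]
    by (smt (verit) mult_eq_0_iff)
  then have w: "w = 0" using w4 by (simp add: vec_eq_iff forall_4)
  have v4: "v $ 4 \<noteq> 0"
  proof
    assume "v $ 4 = 0"
    then have "v $ 1 * v $ 1 + v $ 2 * v $ 2 + v $ 3 * v $ 3 = 0" using assms(2) by (simp add: mink_def)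
    then have "v $ 1 = 0 \<and> v $ 2 = 0 \<and> v $ 3 = 0"
      using zero_le_square[of "v $ 1"] zero_le_square[of "v $ 2"] zero_le_square[of "v $ 3"]
      by (smt (verit) mult_eq_0_iff)
    then show False using assms(4) \<open>v $ 4 = 0\<close> by (simp add: vec_eq_iff forall_4)
  qed
  have "v$4 *\<^sub>R u = u$4 *\<^sub>R v" using w by (simp add: w_def)
  then have "inverse (v$4) *\<^sub>R (v$4 *\<^sub>R u) = inverse (v$4) *\<^sub>R (u$4 *\<^sub>R v)" by simp
  then have "u = (u$4 / v$4) *\<^sub>R v" using v4 by (simp add: divide_inverse mult.commute)
  then show ?thesis by (rule that)
qed

text \<open>Orthogonality expresses the product of the time components by the space components,
  which Cauchy-Schwarz bounds; the time component of \<open>t\<close> exceeds the length of its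
  space part.\<close>

lemma timelike_orthogonal:
  assumes "mink t t < 0" "mink t n = 0" "n \<noteq> 0"
  shows "mink n n > 0"
proof -
  define s where "s = n$1 * n$1 + n$2 * n$2 + n$3 * n$3"
  define r where "r = t$1 * t$1 + t$2 * t$2 + t$3 * t$3"
  have t4: "r < t$4 * t$4" using assms(1) by (simp add: mink_def r_def)
  have nt: "t$4 * n$4 = t$1 * n$1 + t$2 * n$2 + t$3 * n$3" using assms(2) by (simp add: mink_def)
  have r0: "0 \<le> r" "0 \<le> s" by (simp_all add: r_def s_def)
  have "(t$1 * n$1 + t$2 * n$2 + t$3 * n$3)\<^sup>2 \<le> r * s"
  proof -
    have "r * s - (t$1 * n$1 + t$2 * n$2 + t$3 * n$3)\<^sup>2
        = (t$1 * n$2 - t$2 * n$1)\<^sup>2 + (t$1 * n$3 - t$3 * n$1)\<^sup>2 + (t$2 * n$3 - t$3 * n$2)\<^sup>2"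
      by (simp add: r_def s_def power2_eq_square algebra_simps)
    also have "\<dots> \<ge> 0" by simp
    finally show ?thesis by simp
  qed
  then have le: "(t$4 * t$4) * (n$4 * n$4) \<le> r * s" unfolding nt[symmetric] by (simp add: power2_eq_square mult_ac)
  have s0: "s > 0"
  proof (rule ccontr)
    assume "\<not> s > 0"
    then have s: "s = 0" using r0 by simp
    then have "n$1 = 0 \<and> n$2 = 0 \<and> n$3 = 0"
      using zero_le_square[of "n $ 1"] zero_le_square[of "n $ 2"] zero_le_square[of "n $ 3"]
      unfolding s_def by (smt (verit) mult_eq_0_iff)
    moreover have "n$4 = 0"
    proof (rule ccontr)
      assume "n$4 \<noteq> 0"
      then have "n$4 * n$4 > 0" by (auto simp: zero_less_mult_iff)
      moreover have "t$4 * t$4 > 0" using t4 r0 by linarith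
      ultimately have "(t$4 * t$4) * (n$4 * n$4) > 0" by (metis mult_pos_pos)
      then show False using le s by simp
    qed
    ultimately show False using assms(3) by (simp add: vec_eq_iff forall_4)
  qed
  have "r * s < (t$4 * t$4) * s" using t4 s0 by simp
  then have "(t$4 * t$4) * (n$4 * n$4) < (t$4 * t$4) * s" using le by linarith
  then have "n$4 * n$4 < s" using t4 r0 by (simp add: mult_less_cancel_left)
  then show ?thesis by (simp add: mink_def s_def)
qed

lemma isotropic_re_im:
  assumes "cmink A A = 0"
  shows "mink (re_vec A) (re_vec A) = mink (im_vec A) (im_vec A)" "mink (re_vec A) (im_vec A) = 0"
  using cmink_self_re_im[of A] assms by auto

lemma span_pairE:
  assumes "v \<in> span {a, b}" obtains \<alpha> \<beta> where "v = \<alpha> *\<^sub>R a + \<beta> *\<^sub>R (b :: real^4)"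
proof -
  obtain \<alpha> where "v - \<alpha> *\<^sub>R a \<in> span {b}" using assms by (auto simp: span_breakdown_eq)
  then obtain \<beta> where "v - \<alpha> *\<^sub>R a = \<beta> *\<^sub>R b" by (auto simp: span_singleton)
  then have "v = \<alpha> *\<^sub>R a + \<beta> *\<^sub>R b" by (simp add: algebra_simps)
  then show ?thesis by (rule that)
qed

lemma in_plane_of: "re_vec A \<in> plane_of A" "im_vec A \<in> plane_of A"
  by (simp_all add: plane_of_def span_base)

text \<open>In an orthonormal basis e, f of the plane, A = z e + w f has <A, A> = z^2 - w^2. If this
  is 0, then w is z or -z, and A is a multiple of a real vector e + f or e - f.\<close>

lemma elliptic_nonisotropic:
  assumes "elliptic_type A" shows "cmink A A \<noteq> 0"
proof
  assume iso: "cmink A A = 0"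
  obtain e f where ef: "plane_of A = span {e, f}" "mink e e = 1" "mink f f = -1" "mink e f = 0"
    and A: "A \<noteq> 0" "\<not> totally_real A"
    using assms by (auto simp: elliptic_type_def)
  obtain a1 a2 where a: "re_vec A = a1 *\<^sub>R e + a2 *\<^sub>R f" using in_plane_of(1)[of A] unfolding ef(1) by (rule span_pairE)
  obtain b1 b2 where b: "im_vec A = b1 *\<^sub>R e + b2 *\<^sub>R f" using in_plane_of(2)[of A] unfolding ef(1) by (rule span_pairE)
  define z w where "z = of_real a1 + \<i> * of_real b1" and "w = of_real a2 + \<i> * of_real b2"
  have Aeq: "A = z *s cvec e + w *s cvec f"
    by (subst re_im_decomp[of A]) (simp add: a b cvec_linear z_def w_def vec_eq_iff algebra_simps)
  have "cmink A A = z * z - w * w"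
    unfolding Aeq by (simp add: cmink_linear cmink_cvec ef mink_commute[of f e])
  then have "(z - w) * (z + w) = 0" using iso by (simp add: algebra_simps)
  then have "w = z \<or> w = - z" by (auto simp: eq_neg_iff_add_eq_0 add.commute)
  then have "A = z *s cvec (e + f) \<or> A = z *s cvec (e - f)"
    unfolding Aeq by (auto simp: cvec_linear vec_eq_iff algebra_simps)
  then show False using A totally_realI by blast
qed

text \<open>The radical of the plane supplies a real null vector on the conic. If \<open>A\<close>
  were isotropic, its real and imaginary part would be null and orthogonal, hence parallel, and
  \<open>A\<close> would be totally real.\<close>

lemma parabolicE:
  assumes "parabolic_type A"
  obtains v where "v \<noteq> 0" "mink v v = 0" "cmink A (cvec v) = 0" "cmink A A \<noteq> 0"
proof -
  obtain v where v: "v \<in> plane_of A" "v \<noteq> 0" "\<And>w. w \<in> plane_of A \<Longrightarrow> mink v w = 0"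
    and A: "A \<noteq> 0" "\<not> totally_real A"
    using assms by (auto simp: parabolic_type_def)
  have va: "mink v (re_vec A) = 0" "mink v (im_vec A) = 0" using v(3) in_plane_of by blast+
  have "cmink A A \<noteq> 0"
  proof
    assume iso: "cmink A A = 0"
    note i = isotropic_re_im[OF iso]
    obtain \<alpha> \<beta> where ab: "v = \<alpha> *\<^sub>R re_vec A + \<beta> *\<^sub>R im_vec A" using v(1) unfolding plane_of_def by (rule span_pairE)
    have "\<alpha> * mink (re_vec A) (re_vec A) = 0" "\<beta> * mink (re_vec A) (re_vec A) = 0"
      using va unfolding ab by (simp_all add: mink_add_left mink_scaleR_left i mink_commute[of "im_vec A" "re_vec A"])
    then have c: "mink (re_vec A) (re_vec A) = 0" using v(2) ab by auto
    show False
    proof (cases "im_vec A = 0")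
      case True
      then have "A = 1 *s cvec (re_vec A)" using re_im_decomp[of A] by (simp add: cvec_def vec_eq_iff)
      then show False using totally_realI A by blast
    next
      case False
      obtain t where "re_vec A = t *\<^sub>R im_vec A" by (rule mink_null_parallel[OF c _ i(2) False]) (use c i in simp)
      then have "cvec (re_vec A) = of_real t *s cvec (im_vec A)" using cvec_linear(3)[of t "im_vec A"] by simp
      then have "A = of_real t *s cvec (im_vec A) + \<i> *s cvec (im_vec A)" using re_im_decomp[of A] by simp
      also have "\<dots> = (of_real t + \<i>) *s cvec (im_vec A)" by (simp add: vec_eq_iff algebra_simps)
      finally have "A = (of_real t + \<i>) *s cvec (im_vec A)" .
      then show False using totally_realI A by blast
    qed
  qed
  moreover have "cmink A (cvec v) = 0" using va by (simp add: cmink_re_im mink_commute[of _ v])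
  ultimately show ?thesis using that v in_plane_of by blast
qed

text \<open>The orthogonal complement of a space-like plane is Lorentzian and has two real null
  directions, the sum and the difference of a space-like and a time-like unit vector.\<close>

lemma hyperbolic_frame:
  assumes h: "hyperbolic_type A" and A: "cmink A A \<noteq> 0"
  obtains l l' n where "null_frame A l l' n" "cnjv l = l" "cnjv l' = l'"
proof -
  have A0: "A \<noteq> 0" "\<not> totally_real A" and pos: "\<And>v. v \<in> plane_of A \<Longrightarrow> v \<noteq> 0 \<Longrightarrow> mink v v > 0"
    using h by (auto simp: hyperbolic_type_def)
  let ?a = "re_vec A" and ?b = "im_vec A"
  have a0: "?a \<noteq> 0"
  proof
    assume "?a = 0"
    then have "A = \<i> *s cvec ?b" using re_im_decomp[of A] by (simp add: cvec_def vec_eq_iff)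
    then show False using totally_realI A0 by blast
  qed
  have aa: "mink ?a ?a > 0" by (rule pos[OF in_plane_of(1) a0])
  define k where "k = mink ?b ?a / mink ?a ?a"
  define b' where "b' = ?b - k *\<^sub>R ?a"
  have ba: "mink b' ?a = 0" using aa by (simp add: b'_def mink_diff_left mink_scaleR_left k_def)
  have b0: "b' \<noteq> 0"
  proof
    assume "b' = 0"
    then have "?b = k *\<^sub>R ?a" by (simp add: b'_def)
    then have "cvec ?b = of_real k *s cvec ?a" using cvec_linear(3)[of k ?a] by simp
    then have "A = cvec ?a + \<i> *s (of_real k *s cvec ?a)" using re_im_decomp[of A] by simp
    also have "\<dots> = (1 + \<i> * of_real k) *s cvec ?a" by (simp add: vec_eq_iff algebra_simps)
    finally have "A = (1 + \<i> * of_real k) *s cvec ?a" .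
    then show False using totally_realI A0 by blast
  qed
  have "b' \<in> plane_of A"
    unfolding b'_def using in_plane_of[of A] unfolding plane_of_def by (intro span_diff span_scale)
  then have bb: "mink b' b' > 0" using pos b0 by blast
  define e4 :: "real^4" where "e4 = axis 4 1"
  \<comment> \<open>Gram-Schmidt applied to the time axis. Removing space-like components keeps the
    vector time-like.\<close>
  define t where "t = e4 - (mink e4 ?a / mink ?a ?a) *\<^sub>R ?a - (mink e4 b' / mink b' b') *\<^sub>R b'"
  have ta: "mink t ?a = 0" "mink t b' = 0"
    using aa bb by (simp_all add: t_def mink_diff_left mink_scaleR_left ba mink_commute[of ?a b'])
  then have tb: "mink t ?b = 0" by (simp add: b'_def mink_diff_right mink_scaleR_right)
  have "mink t t = mink t e4" by (subst (2) t_def) (simp add: mink_diff_right mink_scaleR_right ta)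
  also have "\<dots> = mink e4 e4 - (mink e4 ?a)\<^sup>2 / mink ?a ?a - (mink e4 b')\<^sup>2 / mink b' b'"
    by (simp add: t_def mink_diff_left mink_scaleR_left mink_commute[of ?a e4] mink_commute[of b' e4] power2_eq_square)
  also have "mink e4 e4 = - 1" by (simp add: mink_def e4_def axis_def)
  also have "- 1 - (mink e4 ?a)\<^sup>2 / mink ?a ?a - (mink e4 b')\<^sup>2 / mink b' b' < 0"
  proof -
    have "(mink e4 ?a)\<^sup>2 / mink ?a ?a \<ge> 0" "(mink e4 b')\<^sup>2 / mink b' b' \<ge> 0" using aa bb by simp_all
    then show ?thesis by linarith
  qed
  finally have tt: "mink t t < 0" .
  obtain s where s: "s \<noteq> 0" "mink ?a s = 0" "mink ?b s = 0" "mink t s = 0" by (rule mink_orthogonal_vector_exists)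
  have ss: "mink s s > 0" by (rule timelike_orthogonal[OF tt s(4,1)])
  define t' where "t' = (1 / sqrt (- mink t t)) *\<^sub>R t"
  define s' where "s' = (1 / sqrt (mink s s)) *\<^sub>R s"
  have m: "mink t' t' = - 1" "mink s' s' = 1" "mink t' s' = 0" "mink s' t' = 0"
    using tt ss s(4) by (simp_all add: t'_def s'_def mink_scaleR_left mink_scaleR_right mink_commute[of s t])
  have o: "mink ?a t' = 0" "mink ?b t' = 0" "mink ?a s' = 0" "mink ?b s' = 0"
    using ta(1) tb s by (simp_all add: t'_def s'_def mink_scaleR_right mink_commute[of ?a t] mink_commute[of ?b t])
  define l where "l = cvec (s' + t')"
  define l' where "l' = cvec ((1/2) *\<^sub>R (s' - t'))"
  have "cmink A l = 0" "cmink A l' = 0" "cmink l l = 0" "cmink l' l' = 0" "cmink l l' = 1"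
    unfolding l_def l'_def cmink_re_im[of A] cmink_cvec
    by (simp_all add: mink_add_right mink_add_left mink_diff_right mink_diff_left mink_scaleR_left mink_scaleR_right m o)
  then obtain n where "null_frame A l l' n" using null_frame_exists[OF A] by metis
  then show ?thesis by (rule that) (simp_all add: l_def l'_def)
qed

text \<open>The square of A + \<mu> B is a polynomial in \<mu>, quadratic unless B itself is
  isotropic, and has a complex root. Distinctness of the hyperplanes ensures that the resulting
  vector is not zero.\<close>

lemma isotropic_in_pencil:
  assumes A: "A \<noteq> 0" "B \<noteq> 0" "hyperplane A \<noteq> hyperplane B"
  obtains C where "C \<noteq> 0" "cmink C C = 0" "hyperplane A \<inter> hyperplane B \<subseteq> hyperplane C"
proof (cases "cmink B B = 0")
  case True
  then show ?thesis using that A by blast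
next
  case False
  define d where "d = csqrt ((cmink A B)\<^sup>2 - cmink A A * cmink B B)"
  have d: "d * d = cmink A B * cmink A B - cmink A A * cmink B B" by (simp add: d_def power2_eq_square[symmetric])
  define \<mu> where "\<mu> = (d - cmink A B) / cmink B B"
  have \<mu>: "\<mu> * cmink B B = d - cmink A B" using False by (simp add: \<mu>_def)
  define C where "C = A + \<mu> *s B"
  have "cmink C C = cmink A A + 2 * \<mu> * cmink A B + \<mu> * (\<mu> * cmink B B)"
    by (simp add: C_def cmink_linear cmink_commute[of B A] algebra_simps)
  also have "\<dots> = cmink A A + \<mu> * (d + cmink A B)" unfolding \<mu> by (simp add: algebra_simps)
  finally have "cmink B B * cmink C C = cmink A A * cmink B B + (\<mu> * cmink B B) * (d + cmink A B)" by (simp add: algebra_simps)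
  also have "\<dots> = 0" unfolding \<mu> using d by (simp add: algebra_simps)
  finally have CC: "cmink C C = 0" using False by simp
  have "C \<noteq> 0"
  proof
    assume "C = 0"
    then have Aeq: "A = (- \<mu>) *s B" by (simp add: C_def vec_eq_iff eq_neg_iff_add_eq_0)
    then have "\<mu> \<noteq> 0" using A(1) by auto
    then have "hyperplane A = hyperplane B" unfolding Aeq hyperplane_def cmink_linear by simp
    then show False using A(3) by simp
  qed
  moreover have "hyperplane A \<inter> hyperplane B \<subseteq> hyperplane C" by (auto simp: hyperplane_def C_def cmink_linear)
  ultimately show ?thesis using that CC by blast
qed

subsection \<open>Rulings of the quadric\<close>

lemma pencil_dual:
  assumes "cmink p m \<noteq> 0" "cmink p l = 0" "cmink q m = 0" "cmink q l \<noteq> 0"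
  obtains u0 u1 where "\<And>\<alpha> \<beta>. cmink u0 (\<alpha> *s m + \<beta> *s l) = \<alpha>" "\<And>\<alpha> \<beta>. cmink u1 (\<alpha> *s m + \<beta> *s l) = \<beta>"
  by (rule that[of "(1 / cmink p m) *s p" "(1 / cmink q l) *s q"]) (use assms in \<open>simp_all add: cmink_linear\<close>)

lemma rep_span:
  assumes "b0 \<noteq> b1"
  obtains \<alpha> \<beta> where "rep0 w = \<alpha> * rep0 b0 + \<beta> * rep0 b1" "rep1 w = \<alpha> * rep1 b0 + \<beta> * rep1 b1"
proof -
  define D where "D = rep0 b0 * rep1 b1 - rep1 b0 * rep0 b1"
  have D: "D \<noteq> 0" using assms rep_det_eq_0 by (simp add: D_def)
  show ?thesis
  proof (rule that)
    have "rep0 w * D = (rep0 w * rep1 b1 - rep1 w * rep0 b1) * rep0 b0 + (rep0 b0 * rep1 w - rep1 b0 * rep0 w) * rep0 b1"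
      "rep1 w * D = (rep0 w * rep1 b1 - rep1 w * rep0 b1) * rep1 b0 + (rep0 b0 * rep1 w - rep1 b0 * rep0 w) * rep1 b1"
      by (simp_all add: D_def algebra_simps)
    then show "rep0 w = (rep0 w * rep1 b1 - rep1 w * rep0 b1) / D * rep0 b0 + (rep0 b0 * rep1 w - rep1 b0 * rep0 w) / D * rep0 b1"
      "rep1 w = (rep0 w * rep1 b1 - rep1 w * rep0 b1) / D * rep1 b0 + (rep0 b0 * rep1 w - rep1 b0 * rep0 w) / D * rep1 b1"
      by (simp_all only: times_divide_eq_left add_divide_distrib[symmetric] nonzero_eq_divide_eq[OF D])
  qed
qed

text \<open>A line on the quadric, parametrized by the coordinate that varies along it.\<close>

definition ruling :: "(csphere \<Rightarrow> complex^4) \<Rightarrow> bool" where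
  "ruling R \<longleftrightarrow> (\<exists>a. R = (\<lambda>w. Psi_rep (a, w))) \<or> (\<exists>b. R = (\<lambda>w. Psi_rep (w, b)))"

lemma ruling_facts:
  assumes "ruling R"
  shows "R w \<noteq> 0" "cmink (R w) (R w') = 0" "proj_pt (R w) = proj_pt (R w') \<longleftrightarrow> w = w'"
proof -
  have P: "proj_pt (Psi_rep y) = proj_pt (Psi_rep y') \<longleftrightarrow> y = y'" for y y' by (metis Psi_proj_pt_Psi_rep)
  show "R w \<noteq> 0" "cmink (R w) (R w') = 0" "proj_pt (R w) = proj_pt (R w') \<longleftrightarrow> w = w'"
    using assms by (auto simp: ruling_def Psi_rep_nonzero cmink_Psi_rep_eq_0 P simp del: Psi_rep.simps)
qed

text \<open>\<open>Psi_rep\<close> is linear in the homogeneous coordinates of each factor, so two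
  points span the line; \<open>u0\<close> and \<open>u1\<close> read off the coefficients.\<close>

lemma ruling_dual:
  assumes R: "ruling R" and b: "b0 \<noteq> b1"
  obtains u0 u1 where "\<And>w. R w = cmink u0 (R w) *s R b0 + cmink u1 (R w) *s R b1" "\<And>w. w \<noteq> b1 \<Longrightarrow> cmink u0 (R w) \<noteq> 0"
proof -
  have sp: "\<exists>\<alpha> \<beta>. R w = \<alpha> *s R b0 + \<beta> *s R b1" for w
  proof -
    obtain \<alpha> \<beta> where "rep0 w = \<alpha> * rep0 b0 + \<beta> * rep0 b1" "rep1 w = \<alpha> * rep1 b0 + \<beta> * rep1 b1" by (rule rep_span[OF b])
    then have "R w = \<alpha> *s R b0 + \<beta> *s R b1"
      using R by (auto simp: ruling_def vec_eq_iff forall_4 Psi_rep_nth algebra_simps simp del: Psi_rep.simps)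
    then show ?thesis by blast
  qed
  \<comment> \<open>A point sharing with \<open>R b1\<close> the varying coordinate but not the
    fixed one is orthogonal to \<open>R b1\<close> and not to \<open>R b0\<close>; likewise with the
    roles exchanged.\<close>
  have "\<exists>p q. cmink p (R b0) \<noteq> 0 \<and> cmink p (R b1) = 0 \<and> cmink q (R b0) = 0 \<and> cmink q (R b1) \<noteq> 0"
  proof -
    have "\<forall>a :: csphere. \<exists>b. b \<noteq> a" by (metis option.distinct(1))
    from choice[OF this] obtain a' :: "csphere \<Rightarrow> csphere" where a': "\<And>a. a' a \<noteq> a" by blast
    consider a where "R = (\<lambda>w. Psi_rep (a, w))" | a where "R = (\<lambda>w. Psi_rep (w, a))" using R by (auto simp: ruling_def)
    then show ?thesis
    proof cases
      case (1 a)
      then show ?thesis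
        by (intro exI[of _ "Psi_rep (a' a, b1)"] exI[of _ "Psi_rep (a' a, b0)"]) (use a' b in \<open>simp add: cmink_Psi_rep_eq_0 del: Psi_rep.simps\<close>)
    next
      case (2 a)
      then show ?thesis
        by (intro exI[of _ "Psi_rep (b1, a' a)"] exI[of _ "Psi_rep (b0, a' a)"]) (use a' b in \<open>simp add: cmink_Psi_rep_eq_0 del: Psi_rep.simps\<close>)
    qed
  qed
  then obtain p q where pq: "cmink p (R b0) \<noteq> 0" "cmink p (R b1) = 0" "cmink q (R b0) = 0" "cmink q (R b1) \<noteq> 0" by blast
  obtain u0 u1 where u: "\<And>\<alpha> \<beta>. cmink u0 (\<alpha> *s R b0 + \<beta> *s R b1) = \<alpha>" "\<And>\<alpha> \<beta>. cmink u1 (\<alpha> *s R b0 + \<beta> *s R b1) = \<beta>"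
    using pencil_dual[OF pq] by metis
  have e: "R w = cmink u0 (R w) *s R b0 + cmink u1 (R w) *s R b1" for w using sp[of w] u by metis
  show ?thesis
  proof (rule that[OF e])
    fix w assume "w \<noteq> b1"
    show "cmink u0 (R w) \<noteq> 0"
    proof
      assume "cmink u0 (R w) = 0"
      then have "R w = cmink u1 (R w) *s R b1" using e[of w] by (simp add: vec_smult_rules)
      moreover from this have "cmink u1 (R w) \<noteq> 0" using ruling_facts(1)[OF R, of w] by auto
      ultimately have "proj_pt (R w) = proj_pt (R b1)" using proj_pt_scale by metis
      then show False using ruling_facts(3)[OF R] \<open>w \<noteq> b1\<close> by blast
    qed
  qed
qed

section \<open>The two components of the Gauss map\<close>

context stationary begin

lemma psi_eq:
  assumes "c \<in> Iso" "p \<in> fst c"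
  shows "\<psi>1 p = fst (Psi (proj_pt (\<phi> c p)))" "\<psi>2 p = snd (Psi (proj_pt (\<phi> c p)))"
    "\<exists>k. k \<noteq> 0 \<and> \<phi> c p = k *s Psi_rep (\<psi>1 p, \<psi>2 p)"
proof -
  show e: "\<psi>1 p = fst (Psi (proj_pt (\<phi> c p)))" "\<psi>2 p = snd (Psi (proj_pt (\<phi> c p)))"
    by (simp_all add: psi1_def psi2_def gauss_map_eq[OF assms])
  show "\<exists>k. k \<noteq> 0 \<and> \<phi> c p = k *s Psi_rep (\<psi>1 p, \<psi>2 p)"
    unfolding e prod.collapse using null_eq_Psi_rep[OF \<phi>_nonzero[OF assms] \<phi>_null(1)[OF assms]] by metis
qed

lemma psi_conjugate_ne:
  assumes "p \<in> topspace T" shows "\<psi>2 p \<noteq> map_option cnj (\<psi>1 p)"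
proof
  assume e: "\<psi>2 p = map_option cnj (\<psi>1 p)"
  obtain c where c: "c \<in> Iso" "p \<in> fst c" using Iso_cover[OF assms] by blast
  obtain k where "\<phi> c p = k *s Psi_rep (\<psi>1 p, \<psi>2 p)" using psi_eq(3)[OF c] by blast
  then have "herm (\<phi> c p) = 0" using e herm_Psi_rep_eq_0 by (simp add: herm_scale del: Psi_rep.simps)
  then show False using \<phi>_null(3)[OF c] by simp
qed

text \<open>With the real point of the line as one of two spanning points, only one term of the
  Hermitian form survives, and \<open>null_pencil_flat\<close> applies.\<close>

lemma ruling_flat:
  assumes R: "ruling R" and rep: "\<And>c p. c \<in> Iso \<Longrightarrow> p \<in> fst c \<Longrightarrow> \<exists>k. k \<noteq> 0 \<and> \<phi> c p = k *s R (\<psi> p)"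
    and real: "cnjv (R w0) = R w0"
  shows "\<not> nonflat \<A> x"
proof -
  obtain b where "b \<noteq> w0" by (metis option.distinct(1))
  then obtain u0 u1 where u: "\<And>w. R w = cmink u0 (R w) *s R b + cmink u1 (R w) *s R w0" using ruling_dual[OF R] by metis
  show ?thesis
  proof (rule null_pencil_flat)
    fix c p assume c: "c \<in> Iso" "p \<in> fst c"
    obtain k where k: "\<phi> c p = k *s R (\<psi> p)" using rep[OF c] by blast
    have "herm (R (\<psi> p)) = (norm (cmink u0 (R (\<psi> p))))\<^sup>2 * herm (R b)"
      using arg_cong[OF u[of "\<psi> p"], of herm] unfolding herm_pencil[OF real ruling_facts(2,2)[OF R]] .
    then show "herm (\<phi> c p) = (norm (cmink u0 (\<phi> c p)))\<^sup>2 * herm (R b)"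
      unfolding k herm_scale cmink_linear by (simp add: norm_mult power_mult_distrib)
  qed
qed

text \<open>The real point of the line is omitted, which gives the lower bound. Two further omitted
  points would be two finite omitted values in the coordinate that has the real point at
  infinity.\<close>

lemma ruling_omitted:
  assumes complete: "complete_surface T \<A> x"
    and R: "ruling R" and rep: "\<And>c p. c \<in> Iso \<Longrightarrow> p \<in> fst c \<Longrightarrow> \<exists>k. k \<noteq> 0 \<and> \<phi> c p = k *s R (\<psi> p)"
    and real: "cnjv (R w0) = R w0" "\<And>p. p \<in> topspace T \<Longrightarrow> \<psi> p \<noteq> w0"
    and nc: "\<not> \<psi> constant_on topspace T"
  shows "omitted_count \<psi> (topspace T) \<in> {1, 2}"
proof -
  let ?X = "- \<psi> ` topspace T"
  have proj: "gauss_map T \<A> x p = proj_pt (R (\<psi> p))" if p: "p \<in> topspace T" for p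
  proof -
    obtain c where c: "c \<in> Iso" "p \<in> fst c" using Iso_cover[OF p] by blast
    then show ?thesis using rep[OF c] gauss_map_eq[OF c] proj_pt_scale by metis
  qed
  have omit: "proj_pt (R w) \<notin> G" if "w \<in> ?X" for w
    using that ruling_facts(3)[OF R] proj by (auto simp: gauss_image_def)
  have dX: "w0 \<in> ?X" using real(2) by blast
  have fin: "finite ?X \<and> card ?X \<le> 2"
  proof (rule ccontr)
    assume n: "\<not> (finite ?X \<and> card ?X \<le> 2)"
    obtain S where S: "S \<subseteq> ?X - {w0}" "finite S" "card S = 2" by (rule subset_card_minus[OF dX n]) auto
    obtain b b' where b: "S = {b, b'}" "b \<noteq> b'" using S(3) by (auto simp: card_2_iff)
    have b': "b \<in> ?X" "b' \<in> ?X" "b \<noteq> w0" "b' \<noteq> w0" using S(1) b by auto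
    obtain u0 u1 where u: "\<And>w. R w = cmink u0 (R w) *s R b + cmink u1 (R w) *s R w0" "\<And>w. w \<noteq> w0 \<Longrightarrow> cmink u0 (R w) \<noteq> 0"
      using ruling_dual[OF R b'(3)] by metis
    obtain L where L: "\<And>p. p \<in> topspace T \<Longrightarrow> gauss_map T \<A> x p = L"
    proof (rule null_pencil_constant[OF complete real(1) ruling_facts(2,2)[OF R] _ u(1) u(2)[OF b'(3)] omit[OF b'(1)] u(1) u(2)[OF b'(4)] omit[OF b'(2)]])
      show "\<phi> c p = cmink u0 (\<phi> c p) *s R b + cmink u1 (\<phi> c p) *s R w0" if c: "c \<in> Iso" "p \<in> fst c" for c p
      proof -
        obtain k where k: "\<phi> c p = k *s R (\<psi> p)" using rep[OF c] by blast
        have "k *s R (\<psi> p) = k *s (cmink u0 (R (\<psi> p)) *s R b + cmink u1 (R (\<psi> p)) *s R w0)" by (rule arg_cong[OF u(1)])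
        then show ?thesis unfolding k cmink_linear vec_smult_rules .
      qed
      show "proj_pt (R b) \<noteq> proj_pt (R b')" using b(2) ruling_facts(3)[OF R] by blast
    qed blast
    have "\<psi> p = \<psi> q" if "p \<in> topspace T" "q \<in> topspace T" for p q
      using L that proj ruling_facts(3)[OF R] by metis
    then have "\<psi> constant_on topspace T" using nonempty unfolding constant_on_def by (metis ex_in_conv)
    then show False using nc by blast
  qed
  moreover have "card ?X > 0" using dX fin by (auto simp: card_gt_0_iff)
  ultimately have "card ?X = 1 \<or> card ?X = 2" by linarith
  then show ?thesis using fin by (auto simp: omitted_count_def one_enat_def numeral_eq_enat)
qed

text \<open>An isotropic \<open>C\<close> is itself a point (a, b) of the quadric, so orthogonality
  to it means \<psi>1 = a or \<psi>2 = b at each point. The identity theorem makes one alternative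
  hold everywhere.\<close>

lemma isotropic_dichotomy:
  assumes C: "C \<noteq> 0" "cmink C C = 0" and sub: "G \<subseteq> hyperplane C"
  shows "(\<exists>a. \<forall>p\<in>topspace T. \<psi>1 p = a) \<or> (\<exists>b. \<forall>p\<in>topspace T. \<psi>2 p = b)"
proof -
  obtain a b where ab: "Psi (proj_pt C) = (a, b)" by (metis prod.collapse)
  have orth: "cmink (Psi_rep (w1, w2)) (\<phi> c p) = 0 \<longleftrightarrow> w1 = \<psi>1 p \<or> w2 = \<psi>2 p"
    if c: "c \<in> Iso" "p \<in> fst c" for c p w1 w2
    using null_orthogonal_iff[OF Psi_rep_nonzero Psi_rep_null \<phi>_nonzero[OF c] \<phi>_null(1)[OF c], of "(w1, w2)"]
    unfolding psi_eq(1,2)[OF c] by simp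
  have alt: "\<psi>1 p = a \<or> \<psi>2 p = b" if c: "c \<in> Iso" "p \<in> fst c" for c p
  proof -
    have "cmink C (\<phi> c p) = 0" using sub c unfolding gauss_image_subset_hyperplane by blast
    then show ?thesis
      using null_orthogonal_iff[OF C \<phi>_nonzero[OF c] \<phi>_null(1)[OF c]] unfolding psi_eq(1,2)[OF c] by (auto simp: ab)
  qed
  show ?thesis
  proof (cases "\<forall>p\<in>topspace T. \<psi>1 p = a")
    case True
    then show ?thesis by blast
  next
    case False
    then obtain p0 where p0: "p0 \<in> topspace T" "\<psi>1 p0 \<noteq> a" by blast
    obtain c0 where c0: "c0 \<in> Iso" "p0 \<in> fst c0" using Iso_cover[OF p0(1)] by blast
    \<comment> \<open>The condition \<psi>1 = a is not linear, for \<open>Psi_rep (a, w)\<close>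
      also annihilates the points with \<psi>2 = w. Hence \<open>w\<close> is taken different from
      \<psi>2 at \<open>p0\<close>, and \<open>w'\<close> is kept free to be chosen at the
      end.\<close>
    obtain w where w: "w \<noteq> \<psi>2 p0" by (metis option.distinct(1))
    have z: "cmink (Psi_rep (w', b)) (\<phi> c p) = 0" if c: "c \<in> Iso" "p \<in> fst c" for c p w'
    proof (rule functional_product_zero[OF _ c0 _ c])
      show "cmink (Psi_rep (a, w)) (\<phi> c0 p0) \<noteq> 0" using orth[OF c0] p0(2) w by auto
      show "cmink (Psi_rep (a, w)) (\<phi> c p) = 0 \<or> cmink (Psi_rep (w', b)) (\<phi> c p) = 0" if "c \<in> Iso" "p \<in> fst c" for c p
        using orth[OF that] alt[OF that] by auto
    qed
    have "\<psi>2 p = b" if p: "p \<in> topspace T" for p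
    proof -
      obtain c where c: "c \<in> Iso" "p \<in> fst c" using Iso_cover[OF p] by blast
      obtain w' where "w' \<noteq> \<psi>1 p" by (metis option.distinct(1))
      then show ?thesis using z[OF c, of w'] orth[OF c] by auto
    qed
    then show ?thesis by blast
  qed
qed

lemma omitted_count_nondegenerate:
  assumes A: "cmink A A \<noteq> 0" and sub: "G \<subseteq> hyperplane A" and fin: "finite (hyperplane A - G)"
  shows "omitted_count (\<psi>1) (topspace T) = enat (card (hyperplane A - G))"
    "omitted_count (\<psi>2) (topspace T) = enat (card (hyperplane A - G))"
proof -
  have im: "\<psi>1 ` topspace T = (fst \<circ> Psi) ` G" "\<psi>2 ` topspace T = (snd \<circ> Psi) ` G"
    by (simp_all add: gauss_image_def image_image psi1_def psi2_def)
  show "omitted_count (\<psi>1) (topspace T) = enat (card (hyperplane A - G))"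
    "omitted_count (\<psi>2) (topspace T) = enat (card (hyperplane A - G))"
    unfolding omitted_count_def im
    using omitted_count_bij[OF bij_betw_fst_Psi[OF A] sub] omitted_count_bij[OF bij_betw_snd_Psi[OF A] sub] fin by simp_all
qed

text \<open>The fourth coordinate after the congruence is, up to sign and a constant, the product
  with the vector \<open>a\<close> that \<open>L\<close> maps to the time axis. So \<open>a\<close>
  is orthogonal to all tangent vectors and has square -1.\<close>

lemma minimal_in_hyperplane:
  assumes "in_euclidean_3space T x"
  obtains A where "cmink A A \<noteq> 0" "G \<subseteq> hyperplane A"
proof -
  obtain F where F: "mink_congruence F" "\<forall>p\<in>topspace T. F (x p) $ 4 = 0" using assms unfolding in_euclidean_3space_def by blast
  obtain L b where L: "linear L" "\<And>u v. mink (L u) (L v) = mink u v" and Feq: "F = (\<lambda>v. L v + b)"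
    using F(1) unfolding mink_congruence_def by blast
  have x4: "(L (x p) + b) $ 4 = 0" if "p \<in> topspace T" for p using F(2) that by (simp add: Feq)
  have "inj L"
  proof (subst linear_injective_0[OF L(1)], intro allI impI)
    fix v assume "L v = 0"
    then have m: "mink v w = 0" for w using L(2)[of v w] by (simp add: mink_zero)
    have "v $ 1 = 0" "v $ 2 = 0" "v $ 3 = 0" "v $ 4 = 0"
      using m[of "axis 1 1"] m[of "axis 2 1"] m[of "axis 3 1"] m[of "axis 4 1"] by (simp_all add: mink_def axis_def)
    then show "v = 0" by (simp add: vec_eq_iff forall_4)
  qed
  then have "surj L" by (rule linear_inj_imp_surj[OF L(1)])
  then obtain a where a: "L a = axis 4 1" by (metis surjD)
  have ma: "mink v a = - L v $ 4" for v using L(2)[of v a] by (simp add: a mink_def axis_def)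
  have "mink a a = - 1" by (simp add: ma a axis_def)
  then have "cmink (cvec a) (cvec a) \<noteq> 0" by (simp add: cmink_cvec)
  moreover have "G \<subseteq> hyperplane (cvec a)"
    unfolding gauss_image_subset_hyperplane
  proof (intro ballI)
    fix c p assume c: "c \<in> Iso" "p \<in> fst c"
    have z: "snd c p \<in> img c" using c by simp
    have const: "mink (X c z) a = b $ 4" if "z \<in> img c" for z
    proof -
      have "chart_inv c z \<in> topspace T" using chart_inv_in[OF that] chart_subset[OF c(1)] by blast
      then show ?thesis using x4[of "chart_inv c z"] by (simp add: ma in_chart_def)
    qed
    have "mink (pd i (X c) (snd c p)) a = 0" for i
    proof -
      have "mink (pd i (X c) (snd c p)) a = pd i (\<lambda>z. mink (X c z) a) (snd c p)"
        by (rule pd_linear[OF bounded_bilinear.bounded_linear_left[OF bounded_bilinear_mink] smooth_onD(1)[OF Iso_X_smooth[OF c(1)] z], symmetric])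
      also have "\<dots> = pd i (\<lambda>z. b $ 4) (snd c p)"
        by (rule pd_cong[OF chart_open_range[OF c(1)] z const])
      finally show ?thesis by simp
    qed
    from this[of 1] this[of 2] show "cmink (cvec a) (\<phi> c p) = 0"
      by (simp add: cmink_def mink_def \<phi>_def dz_def cvec_def complex_eq_iff field_simps)
  qed
  ultimately show ?thesis by (rule that)
qed

end

theorem theorem1p3:
  fixes T :: "'a topology" and \<A> :: "'a chart set" and x :: "'a \<Rightarrow> real^4"
    and q1 q2 :: enat
  assumes stationary: "stationary_surface T \<A> x"
    and complete: "complete_surface T \<A> x"
    and degenerate: "degenerate T \<A> x"
    and not_plane: "\<not> affine_plane T x"
    and q1: "q1 = omitted_count (psi1 T \<A> x) (topspace T)"
    and q2: "q2 = omitted_count (psi2 T \<A> x) (topspace T)"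
  shows "(two_degenerate T \<A> x \<longrightarrow>
            (\<not> psi1 T \<A> x constant_on topspace T \<longrightarrow> q1 \<in> {1, 2}) \<and>
            (\<not> psi2 T \<A> x constant_on topspace T \<longrightarrow> q2 \<in> {1, 2}))
       \<and> (nonflat \<A> x \<and> degenerate_of_type hyperbolic_type T \<A> x \<longrightarrow> q1 = 2 \<and> q2 = 2)
       \<and> (minimal_surface_in_R3 T \<A> x \<or> degenerate_of_type elliptic_type T \<A> x \<longrightarrow>
            q1 = q2 \<and> q1 \<in> {0, 1, 2, 3, 4})
       \<and> (degenerate_of_type parabolic_type T \<A> x \<longrightarrow> q1 = q2 \<and> q1 \<in> {1, 2, 3})"
proof -
  interpret stationary T \<A> x
    using stationary by unfold_locales (auto simp: stationary_surface_def)
  have rep1: "\<exists>k. k \<noteq> 0 \<and> \<phi> c p = k *s Psi_rep (a, \<psi>2 p)" if "\<forall>p\<in>topspace T. \<psi>1 p = a" "c \<in> Iso" "p \<in> fst c" for a c p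
    using psi_eq(3)[OF that(2,3)] that chart_subset by (metis subsetD)
  have rep2: "\<exists>k. k \<noteq> 0 \<and> \<phi> c p = k *s Psi_rep (\<psi>1 p, b)" if "\<forall>p\<in>topspace T. \<psi>2 p = b" "c \<in> Iso" "p \<in> fst c" for b c p
    using psi_eq(3)[OF that(2,3)] that chart_subset by (metis subsetD)
  have rul: "ruling (\<lambda>w. Psi_rep (a, w))" "ruling (\<lambda>w. Psi_rep (w, a))" for a by (auto simp: ruling_def)
  \<comment> \<open>Each line of either ruling contains exactly one real point, the one with
    conjugate coordinates.\<close>
  have real1: "cnjv (Psi_rep (a, map_option cnj a)) = Psi_rep (a, map_option cnj a)"
    and real2: "cnjv (Psi_rep (map_option cnj a, a)) = Psi_rep (map_option cnj a, a)" for a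
    using cnjv_Psi_rep_diagonal[of a] cnjv_Psi_rep_diagonal[of "map_option cnj a"]
    by (simp_all add: option.map_comp comp_def option.map_ident del: Psi_rep.simps)
  have "(\<not> \<psi>1 constant_on topspace T \<longrightarrow> q1 \<in> {1, 2}) \<and> (\<not> \<psi>2 constant_on topspace T \<longrightarrow> q2 \<in> {1, 2})"
    if two: "two_degenerate T \<A> x"
  proof -
    obtain A B where AB: "A \<noteq> 0" "B \<noteq> 0" "hyperplane A \<noteq> hyperplane B" "G \<subseteq> hyperplane A \<inter> hyperplane B"
      using two by (auto simp: two_degenerate_def)
    obtain C where C: "C \<noteq> 0" "cmink C C = 0" "hyperplane A \<inter> hyperplane B \<subseteq> hyperplane C"
      by (rule isotropic_in_pencil[OF AB(1-3)])
    have "G \<subseteq> hyperplane C" using AB(4) C(3) by blast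
    from isotropic_dichotomy[OF C(1,2) this] show ?thesis
    proof
      assume "\<exists>a. \<forall>p\<in>topspace T. \<psi>1 p = a"
      then obtain a where a: "\<forall>p\<in>topspace T. \<psi>1 p = a" by blast
      then have "\<psi>1 constant_on topspace T" by (auto simp: constant_on_def)
      moreover have "q2 \<in> {1, 2}" if "\<not> \<psi>2 constant_on topspace T"
        unfolding q2 by (rule ruling_omitted[OF complete rul(1) rep1[OF a] real1 _ that]) (use psi_conjugate_ne a in auto)
      ultimately show ?thesis by blast
    next
      assume "\<exists>b. \<forall>p\<in>topspace T. \<psi>2 p = b"
      then obtain b where b: "\<forall>p\<in>topspace T. \<psi>2 p = b" by blast
      then have "\<psi>2 constant_on topspace T" by (auto simp: constant_on_def)
      moreover have "\<psi>1 p \<noteq> map_option cnj b" if "p \<in> topspace T" for p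
        using psi_conjugate_ne[OF that] b that by (auto simp: option.map_comp comp_def option.map_ident)
      then have "q1 \<in> {1, 2}" if "\<not> \<psi>1 constant_on topspace T"
        unfolding q1 by (intro ruling_omitted[OF complete rul(2) rep2[OF b] real2 _ that])
      ultimately show ?thesis by blast
    qed
  qed
  moreover have "q1 = 2 \<and> q2 = 2" if nf: "nonflat \<A> x" and hyp: "degenerate_of_type hyperbolic_type T \<A> x"
  proof -
    obtain A where A: "hyperbolic_type A" "G \<subseteq> hyperplane A" using hyp by (auto simp: degenerate_of_type_def)
    have A0: "A \<noteq> 0" using A(1) by (simp add: hyperbolic_type_def)
    \<comment> \<open>A vector of hyperbolic type may be isotropic; then one component of the Gauss
      map is constant and the surface is flat.\<close>
    have nA: "cmink A A \<noteq> 0"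
    proof
      assume "cmink A A = 0"
      from isotropic_dichotomy[OF A0 this A(2)] show False
      proof
        assume "\<exists>a. \<forall>p\<in>topspace T. \<psi>1 p = a"
        then obtain a where a: "\<forall>p\<in>topspace T. \<psi>1 p = a" by blast
        show False using ruling_flat[OF rul(1) rep1[OF a] real1] nf by blast
      next
        assume "\<exists>b. \<forall>p\<in>topspace T. \<psi>2 p = b"
        then obtain b where b: "\<forall>p\<in>topspace T. \<psi>2 p = b" by blast
        show False using ruling_flat[OF rul(2) rep2[OF b] real2] nf by blast
      qed
    qed
    obtain l l' n where F: "null_frame A l l' n" "cnjv l = l" "cnjv l' = l'" by (rule hyperbolic_frame[OF A(1) nA])
    have X: "hyperplane A - G = {proj_pt l, proj_pt l'}" "proj_pt l \<noteq> proj_pt l'"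
      by (rule two_real_null_omitted[OF complete not_plane F(1) A(2) F(2,3)])+
    then show ?thesis
      using omitted_count_nondegenerate[OF nA A(2)] unfolding q1 q2 by (simp add: numeral_eq_enat)
  qed
  moreover have "q1 = q2 \<and> q1 \<in> {0, 1, 2, 3, 4}" if type: "minimal_surface_in_R3 T \<A> x \<or> degenerate_of_type elliptic_type T \<A> x"
  proof -
    obtain A where A: "cmink A A \<noteq> 0" "G \<subseteq> hyperplane A"
      using type
    proof
      assume "minimal_surface_in_R3 T \<A> x"
      then have "in_euclidean_3space T x" by (simp add: minimal_surface_in_R3_def)
      from minimal_in_hyperplane[OF this that] show thesis .
    next
      assume "degenerate_of_type elliptic_type T \<A> x"
      then show thesis using that elliptic_nonisotropic unfolding degenerate_of_type_def by blast
    qed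
    note b = nondegenerate_omitted_le_4[OF complete not_plane A]
    have "card (hyperplane A - G) \<in> {0, 1, 2, 3, 4}" using b(2) by auto
    then show ?thesis
      unfolding q1 q2 omitted_count_nondegenerate[OF A b(1)] by (auto simp: zero_enat_def one_enat_def numeral_eq_enat)
  qed
  moreover have "q1 = q2 \<and> q1 \<in> {1, 2, 3}" if par: "degenerate_of_type parabolic_type T \<A> x"
  proof -
    obtain A where A: "parabolic_type A" "G \<subseteq> hyperplane A" using par by (auto simp: degenerate_of_type_def)
    obtain v where v: "v \<noteq> 0" "mink v v = 0" "cmink A (cvec v) = 0" "cmink A A \<noteq> 0" by (rule parabolicE[OF A(1)])
    have cv: "cvec v \<noteq> 0" using v(1) by (auto simp: cvec_def vec_eq_iff)
    have cvn: "cmink (cvec v) (cvec v) = 0" by (simp add: cmink_cvec v(2))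
    note b = real_null_omitted_le_3[OF complete not_plane v(4) A(2) v(3) cvn cv cnjv_cvec]
    \<comment> \<open>The real null point of the conic is omitted and provides the lower bound
      1.\<close>
    have "card (hyperplane A - G) > 0" using b(1,2) by (auto simp: card_gt_0_iff)
    then have "card (hyperplane A - G) \<in> {1, 2, 3}" using b(3) by auto
    then show ?thesis
      unfolding q1 q2 omitted_count_nondegenerate[OF v(4) A(2) b(2)] by (auto simp: one_enat_def numeral_eq_enat)
  qed
  ultimately show ?thesis by blast
qed

end
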